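(* Let $f$ be a smooth diffeomorphism of a compact $d$-dimensional Riemannian manifold $M$ preserving a smooth probability measure $\mu$, and suppose that $f$ is $r$-fold exponentially mixing for Lipschitz observables for all $r\ge2$. Let $\gamma(x)=\lim_{\rho\to0}\rho^{-d}\mu(B(x,\rho))$ and let $\tau>0$. (a) For $\mu$-almost all $x$ the following holds. Let $y$ be distributed according to $\mu$. Then the number of visits of $\{f^k(y)\}_{k\in[1,\tau\rho^{-d}]}$ to $B(x,\rho)$ converges in law, as $\rho\to0$, to a Poisson distribution with parameter $\tau\gamma(x)$. Moreover, with $n=\tau\rho^{-d}$, the sequence $$\frac{d_n^{(1)}(x,y)}\rho,\ \frac{d_n^{(2)}(x,y)}\rho,\ \dots,\ \frac{d_n^{(r)}(x,y)}\rho,\ \dots$$ converges as $\rho\to0$ to the Poisson process on $\mathbb R^+$ with intensity measure $\gamma(x)\,\tau\, d\,t^{d-1}dt$. (b) Let $x$ be distributed according to $\mu$. Then the number of visits of $\{f^k(x)\}_{k\in[1,\tau\rho^{-d}]}$ to $B\big(x,\rho/\gamma(x)^{1/d}\big)$ converges in law, as $\rho\to0$, to a Poisson distribution with parameter $\tau$.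
   Context: Smooth measure: a measure with smooth positive density with respect to Riemannian volume. For $p\ge1$, $(f,M,\mu)$ is $(p+1)$-fold exponentially mixing for Lipschitz observables if there are $C>0$ and $\theta<1$ such that for every Lipschitz $A:M^{p+1}\to\mathbb R$ and all integers $0=k_0\le k_1\le\dots\le k_p$ with $k_{j+1}-k_j\ge m$ for all $0\le j\le p-1$, $$\Big|\int_MA(x,f^{k_1}x,\dots,f^{k_p}x)\,d\mu(x)-\int_{M^{p+1}}A(x_0,\dots,x_p)\,d\mu(x_0)\cdots d\mu(x_p)\Big|\le C\theta^m\|A\|_{\mathrm{Lip}}.$$ $d_n^{(r)}(x,y)$ is the $r$-th smallest among $d(x,f^ky)$, $1\le k\le n$ ($k$ integer). $B(x,\rho)$ is the Riemannian ball. *)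

theory Defs
  imports "HOL-Probability.Probability"
begin

text \<open>Meaningful for open \<open>S\<close> only, the derivatives being two-sided.\<close>

primrec Ck_on :: "nat \<Rightarrow> 'a::real_normed_vector set \<Rightarrow> ('a \<Rightarrow> 'b::real_normed_vector) \<Rightarrow> bool" where
  "Ck_on 0 S F = continuous_on S F"
| "Ck_on (Suc k) S F =
     ((\<forall>x\<in>S. F differentiable (at x)) \<and> (\<forall>v. Ck_on k S (\<lambda>x. frechet_derivative F (at x) v)))"

definition smooth_on :: "'a::real_normed_vector set \<Rightarrow> ('a \<Rightarrow> 'b::real_normed_vector) \<Rightarrow> bool" where
  "smooth_on S F \<longleftrightarrow> (\<forall>k. Ck_on k S F)"

text \<open>A chart consists of its domain and of the coordinate map; the values of the map outside the
  domain are irrelevant. The dimension of the manifold is \<open>CARD('n)\<close>.\<close>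

type_synonym ('a, 'n) chart = "'a set \<times> ('a \<Rightarrow> real ^ 'n)"

abbreviation chart_inv :: "('a, 'n) chart \<Rightarrow> real ^ 'n \<Rightarrow> 'a" where
  "chart_inv c \<equiv> inv_into (fst c) (snd c)"

definition smooth_atlas :: "('a::{t2_space, second_countable_topology}, 'n::finite) chart set \<Rightarrow> bool" where
  "smooth_atlas \<A> \<longleftrightarrow>
     (\<Union>c\<in>\<A>. fst c) = UNIV \<and>
     (\<forall>c\<in>\<A>. open (fst c) \<and> open (snd c ` fst c) \<and>
        homeomorphism (fst c) (snd c ` fst c) (snd c) (chart_inv c)) \<and>
     (\<forall>c\<in>\<A>. \<forall>c'\<in>\<A>. smooth_on (snd c ` (fst c \<inter> fst c')) (snd c' \<circ> chart_inv c))"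

definition smooth_map :: "('a::topological_space, 'n::finite) chart set \<Rightarrow> ('a \<Rightarrow> 'a) \<Rightarrow> bool" where
  "smooth_map \<A> f \<longleftrightarrow> continuous_on UNIV f \<and>
     (\<forall>c\<in>\<A>. \<forall>c'\<in>\<A>. smooth_on (snd c ` (fst c \<inter> f -` fst c')) (snd c' \<circ> f \<circ> chart_inv c))"

definition smooth_fun :: "('a, 'n::finite) chart set \<Rightarrow> ('a \<Rightarrow> real) \<Rightarrow> bool" where
  "smooth_fun \<A> h \<longleftrightarrow> (\<forall>c\<in>\<A>. smooth_on (snd c ` fst c) (h \<circ> chart_inv c))"

definition smooth_diffeo :: "('a::topological_space, 'n::finite) chart set \<Rightarrow> ('a \<Rightarrow> 'a) \<Rightarrow> bool" where
  "smooth_diffeo \<A> f \<longleftrightarrow> bij f \<and> smooth_map \<A> f \<and> smooth_map \<A> (inv f)"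

text \<open>\<open>g c p v w\<close> is the inner product of the two tangent vectors at \<open>p\<close> that are represented
  in the chart \<open>c\<close> by the coordinate vectors \<open>v\<close> and \<open>w\<close>. The last condition below is the
  transformation law of a covariant 2-tensor.\<close>

type_synonym ('a, 'n) metric = "('a, 'n) chart \<Rightarrow> 'a \<Rightarrow> real ^ 'n \<Rightarrow> real ^ 'n \<Rightarrow> real"

definition riemannian_metric ::
    "('a, 'n::finite) chart set \<Rightarrow> ('a, 'n) metric \<Rightarrow> bool" where
  "riemannian_metric \<A> g \<longleftrightarrow>
     (\<forall>c\<in>\<A>. \<forall>p\<in>fst c. bilinear (g c p) \<and> (\<forall>v w. g c p v w = g c p w v) \<and>
        (\<forall>v. v \<noteq> 0 \<longrightarrow> 0 < g c p v v)) \<and>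
     (\<forall>c\<in>\<A>. \<forall>v w. smooth_on (snd c ` fst c) (\<lambda>z. g c (chart_inv c z) v w)) \<and>
     (\<forall>c\<in>\<A>. \<forall>c'\<in>\<A>. \<forall>p\<in>fst c \<inter> fst c'. \<forall>v w.
        (let D = frechet_derivative (snd c' \<circ> chart_inv c) (at (snd c p))
         in g c p v w = g c' p (D v) (D w)))"

text \<open>The defining property of the Riemannian volume, which determines it uniquely:
  in every chart it is \<open>sqrt (det (g\<^sub>i\<^sub>j))\<close> times Lebesgue measure.\<close>

definition gram_det :: "('a, 'n::finite) metric \<Rightarrow> ('a, 'n) chart \<Rightarrow> 'a \<Rightarrow> real" where
  "gram_det g c p = det ((\<chi> i j. g c p (axis i 1) (axis j 1)) :: real ^ 'n ^ 'n)"

definition is_riemannian_volume ::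
    "('a::topological_space, 'n::finite) chart set \<Rightarrow> ('a, 'n) metric \<Rightarrow> 'a measure \<Rightarrow> bool" where
  "is_riemannian_volume \<A> g V \<longleftrightarrow> sets V = sets borel \<and>
     (\<forall>c\<in>\<A>. \<forall>B\<in>sets borel. B \<subseteq> fst c \<longrightarrow>
        emeasure V B =
          (\<integral>\<^sup>+ z \<in> snd c ` B. ennreal (sqrt (gram_det g c (chart_inv c z))) \<partial>lborel))"

definition smooth_measure ::
    "('a::topological_space, 'n::finite) chart set \<Rightarrow> ('a, 'n) metric \<Rightarrow> 'a measure \<Rightarrow> bool" where
  "smooth_measure \<A> g \<mu> \<longleftrightarrow>
     (\<exists>V h. is_riemannian_volume \<A> g V \<and> smooth_fun \<A> h \<and> (\<forall>x. 0 < h x) \<and>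
        \<mu> = density V (\<lambda>x. ennreal (h x)))"

text \<open>As in the library notion \<^const>\<open>piecewise_C1_differentiable_on\<close>, one-sided derivatives at
  the exceptional points are not required to exist; since the curve is continuous there, this
  does not change the infimum of the lengths.\<close>

definition piecewise_C1_curve ::
    "('a::topological_space, 'n::finite) chart set \<Rightarrow> (real \<Rightarrow> 'a) \<Rightarrow> bool" where
  "piecewise_C1_curve \<A> \<sigma> \<longleftrightarrow> continuous_on {0..1} \<sigma> \<and>
     (\<exists>S. finite S \<and>
        (\<forall>c\<in>\<A>. (snd c \<circ> \<sigma>) C1_differentiable_on {t \<in> {0<..<1} - S. \<sigma> t \<in> fst c}))"

text \<open>By the transformation law, the speed does not depend on the choice of the chart.\<close>

definition speed ::
    "('a, 'n::finite) chart set \<Rightarrow> ('a, 'n) metric \<Rightarrow> (real \<Rightarrow> 'a) \<Rightarrow> real \<Rightarrow> real" where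
  "speed \<A> g \<sigma> t =
     (let c = (SOME c. c \<in> \<A> \<and> \<sigma> t \<in> fst c); v = vector_derivative (snd c \<circ> \<sigma>) (at t)
      in sqrt (g c (\<sigma> t) v v))"

definition curve_length ::
    "('a, 'n::finite) chart set \<Rightarrow> ('a, 'n) metric \<Rightarrow> (real \<Rightarrow> 'a) \<Rightarrow> ennreal" where
  "curve_length \<A> g \<sigma> = (\<integral>\<^sup>+ t \<in> {0<..<1}. ennreal (speed \<A> g \<sigma> t) \<partial>lborel)"

text \<open>The manifold is not required to be connected: points in different components are at
  distance \<open>\<infinity>\<close>.\<close>

definition rdist ::
    "('a::topological_space, 'n::finite) chart set \<Rightarrow> ('a, 'n) metric \<Rightarrow> 'a \<Rightarrow> 'a \<Rightarrow> ennreal" where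
  "rdist \<A> g x y =
     (INF \<sigma> \<in> {\<sigma>. piecewise_C1_curve \<A> \<sigma> \<and> \<sigma> 0 = x \<and> \<sigma> 1 = y}. curve_length \<A> g \<sigma>)"

definition rball ::
    "('a::topological_space, 'n::finite) chart set \<Rightarrow> ('a, 'n) metric \<Rightarrow> 'a \<Rightarrow> real \<Rightarrow> 'a set" where
  "rball \<A> g x \<rho> = {y. rdist \<A> g x y < ennreal \<rho>}"

text \<open>The product \<open>M\<^sup>r\<close> is modelled by the functions in \<open>{..<r} \<rightarrow>\<^sub>E UNIV\<close>, with the maximum
  distance (any other usual product distance gives an equivalent Lipschitz norm). The Lipschitz
  norm is the sum of the supremum norm and of the best Lipschitz constant.\<close>

definition lipschitz_const ::
    "('a \<Rightarrow> 'a \<Rightarrow> ennreal) \<Rightarrow> nat \<Rightarrow> ((nat \<Rightarrow> 'a) \<Rightarrow> real) \<Rightarrow> real \<Rightarrow> bool" where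
  "lipschitz_const D r A L \<longleftrightarrow> 0 \<le> L \<and>
     (\<forall>X \<in> {..<r} \<rightarrow>\<^sub>E UNIV. \<forall>Y \<in> {..<r} \<rightarrow>\<^sub>E UNIV.
        ennreal \<bar>A X - A Y\<bar> \<le> ennreal L * (SUP j\<in>{..<r}. D (X j) (Y j)))"

definition lipschitz_norm ::
    "('a \<Rightarrow> 'a \<Rightarrow> ennreal) \<Rightarrow> nat \<Rightarrow> ((nat \<Rightarrow> 'a) \<Rightarrow> real) \<Rightarrow> real" where
  "lipschitz_norm D r A =
     (SUP X \<in> {..<r} \<rightarrow>\<^sub>E UNIV. \<bar>A X\<bar>) + Inf {L. lipschitz_const D r A L}"

text \<open>Here \<open>r = p + 1\<close>, so that the times are \<open>0 = k 0 \<le> \<dots> \<le> k (r - 1)\<close>.\<close>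

definition exponentially_mixing ::
    "('a \<Rightarrow> 'a \<Rightarrow> ennreal) \<Rightarrow> 'a measure \<Rightarrow> ('a \<Rightarrow> 'a) \<Rightarrow> nat \<Rightarrow> bool" where
  "exponentially_mixing D \<mu> f r \<longleftrightarrow>
     (\<exists>C>0. \<exists>\<theta>::real. 0 \<le> \<theta> \<and> \<theta> < 1 \<and>
        (\<forall>A. (\<exists>L. lipschitz_const D r A L) \<longrightarrow>
          (\<forall>m k. k 0 = 0 \<and> (\<forall>j. Suc j < r \<longrightarrow> k j + m \<le> k (Suc j)) \<longrightarrow>
            \<bar>(\<integral>x. A (\<lambda>j\<in>{..<r}. (f ^^ k j) x) \<partial>\<mu>) - (\<integral>X. A X \<partial>(\<Pi>\<^sub>M j\<in>{..<r}. \<mu>))\<bar>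
              \<le> C * \<theta> ^ m * lipschitz_norm D r A)))"

definition visits :: "('a \<Rightarrow> 'a) \<Rightarrow> nat \<Rightarrow> 'a set \<Rightarrow> 'a \<Rightarrow> nat" where
  "visits f n B y = card {k \<in> {1..n}. (f ^^ k) y \<in> B}"

text \<open>The \<open>r\<close>-th smallest distance (\<open>r \<ge> 1\<close>), counted with multiplicity; it is \<open>\<infinity>\<close> if there are
  fewer than \<open>r\<close> distances.\<close>

definition nth_closest ::
    "('a \<Rightarrow> 'a \<Rightarrow> ennreal) \<Rightarrow> ('a \<Rightarrow> 'a) \<Rightarrow> nat \<Rightarrow> nat \<Rightarrow> 'a \<Rightarrow> 'a \<Rightarrow> ennreal" where
  "nth_closest D f n r x y =
     (if r \<le> n then sort (map (\<lambda>k. D x ((f ^^ k) y)) [1..<Suc n]) ! (r - 1) else \<infinity>)"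

definition local_density ::
    "('a::topological_space, 'n::finite) chart set \<Rightarrow> ('a, 'n) metric \<Rightarrow> 'a measure \<Rightarrow> 'a \<Rightarrow> real" where
  "local_density \<A> g \<mu> x =
     Lim (at_right 0) (\<lambda>\<rho>. measure \<mu> (rball \<A> g x \<rho>) / \<rho> ^ CARD('n))"

text \<open>Weak convergence of the laws of \<open>X \<rho>\<close> to the Borel (or discrete) probability measure \<open>Q\<close>.\<close>

definition converges_in_law ::
    "'w measure \<Rightarrow> ('i \<Rightarrow> 'w \<Rightarrow> 'b::topological_space) \<Rightarrow> 'b measure \<Rightarrow> 'i filter \<Rightarrow> bool" where
  "converges_in_law P X Q F \<longleftrightarrow>
     (\<forall>h :: 'b \<Rightarrow> real. continuous_on UNIV h \<and> bounded (range h) \<longrightarrow>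
        ((\<lambda>\<rho>. \<integral>\<omega>. h (X \<rho> \<omega>) \<partial>P) \<longlongrightarrow> (\<integral>b. h b \<partial>Q)) F)"

text \<open>\<open>T 0 \<le> T 1 \<le> \<dots>\<close> are the points, in increasing order, of a Poisson process on the half-line
  whose intensity measure \<open>\<Lambda>\<close> is infinite but finite on bounded sets.\<close>

definition poisson_process :: "'w measure \<Rightarrow> (nat \<Rightarrow> 'w \<Rightarrow> real) \<Rightarrow> real measure \<Rightarrow> bool" where
  "poisson_process P T \<Lambda> \<longleftrightarrow> prob_space P \<and> (\<forall>i. T i \<in> borel_measurable P) \<and>
     (AE \<omega> in P. (\<forall>i. 0 \<le> T i \<omega> \<and> T i \<omega> \<le> T (Suc i) \<omega>) \<and>
        filterlim (\<lambda>i. T i \<omega>) at_top sequentially) \<and>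
     (\<forall>B\<in>sets borel. bounded B \<longrightarrow>
        (\<forall>k. measure P {\<omega> \<in> space P. card {i. T i \<omega> \<in> B} = k} =
           exp (- measure \<Lambda> B) * measure \<Lambda> B ^ k / fact k)) \<and>
     (\<forall>m. \<forall>B :: nat \<Rightarrow> real set. (\<forall>j<m. B j \<in> sets borel \<and> bounded (B j)) \<and>
          disjoint_family_on B {..<m} \<longrightarrow>
        prob_space.indep_vars P (\<lambda>_. count_space UNIV) (\<lambda>j \<omega>. card {i. T i \<omega> \<in> B j}) {..<m})"

end

theory Submission
 imports Defs "HOL-Real_Asymp.Real_Asymp" "HOL-Computational_Algebra.Primes"
begin

text \<open>
  The proof is the method of factorial moments for the number of visits of an orbit to a small
  ball. The mathematical core takes place in a bounded metric space with a Lipschitz map, a measure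
  whose balls satisfy \<open>\<mu>(B(x,\<rho>)) \<sim> \<gamma>(x) \<rho>\<^sup>d\<close> uniformly, and multiple mixing for Lipschitz observables.

  If the visit times \<open>k\<^sub>1 < \<dots> < k\<^sub>r\<close> have gaps of order at least \<open>log\<^sup>2 \<rho>\<close>, mixing of order \<open>r + 1\<close>
  makes the \<open>r\<close> visits asymptotically independent, so such tuples contribute
  \<open>(\<tau> \<gamma>(x))\<^sup>r / r!\<close> to the \<open>r\<close>-th factorial moment. Tuples with a short gap must be negligible, which
  is a statement on recurrence. A point is unlikely to return close to itself at any time: for long
  times by mixing, and for short times because a close return at time \<open>n\<close> is repeated at the multiples
  of \<open>n\<close> until mixing takes over (\<open>short_returns\<close>). By a Borel-Cantelli argument, for almost every
  centre \<open>x\<close> few points of \<open>B(x,\<rho>)\<close> come back soon (\<open>slow_recurrence\<close>); for the returns of a random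
  point to its own neighbourhood the average over the centre is enough. Technically, visits that are
  followed by another visit within the short gap are discarded, at the level of Lipschitz weights,
  before moments are computed (\<open>isolated\<close>); the Bonferroni inequalities then give the limit of the
  generating function (\<open>poisson_limit\<close>).

  The process of rescaled distances is reduced to generating functions as well. For radii
  \<open>a\<^sub>1 < \<dots> < a\<^sub>q\<close> the weights \<open>\<Prod>\<sigma>\<^sub>j\<close>, over all \<open>j\<close> such that the distance is below \<open>\<rho> a\<^sub>j\<close>, carry
  the joint generating function of the counts in all the balls (\<open>hitting_pgf\<close>). Taking for \<open>\<sigma>\<^sub>j\<close> powers
  of reciprocal primes, the generating functions become the moments of the reciprocal of one natural
  number that encodes all the counts, and these moments determine the law
  (\<open>law_from_reciprocal_moments\<close>). The counts determine the order statistics up to any given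
  precision, whence convergence in law of the whole sequence (\<open>sequence_law_from_thresholds\<close>).

  On the manifold it remains to verify the hypotheses. In a chart the metric near a point \<open>p\<close> is
  within a factor \<open>1 \<plusminus> \<epsilon>\<close> of its value at \<open>p\<close>, so the Riemannian distance is within such a factor of
  a norm (\<open>rdist_lower\<close>, \<open>rdist_upper\<close>). This gives at once the topology, the Lipschitz property of
  smooth maps, and the asymptotics of volumes of small balls, all uniform by compactness.
\<close>

section \<open>Alternating sums of factorial moments\<close>

text \<open>The elementary symmetric polynomial of degree \<open>r\<close>. For indicators of events it is the number of \<open>r\<close>-subsets of events that all occur, so that its expectation is a factorial moment divided by \<open>r!\<close>.\<close>

definition esym :: "nat => 'i set => ('i => real) => real" where
 "esym r K a = (\<Sum>S | S \<subseteq> K & card S = r. \<Prod>k\<in>S. a k)"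

lemma esym_0: "finite K ==> esym 0 K a = 1"
proof -
 assume "finite K"
 then have "{S. S \<subseteq> K & card S = 0} = {{}}" by (auto dest: finite_subset)
 then show ?thesis by (simp add: esym_def)
qed

lemma esym_insert:
 assumes K: "finite K" "k \<notin> K"
 shows "esym (Suc r) (insert k K) a = esym (Suc r) K a + a k * esym r K a"
proof -
 have eq: "{S. S \<subseteq> insert k K & card S = Suc r} =
   {S. S \<subseteq> K & card S = Suc r} \<union> insert k ` {S. S \<subseteq> K & card S = r}" (is "?A = ?B \<union> ?C")
 proof (intro equalityI subsetI)
  fix S assume S: "S \<in> ?A"
  show "S \<in> ?B \<union> ?C"
  proof (cases "k \<in> S")
   case True
   then have "S = insert k (S - {k})" "S - {k} \<subseteq> K" "card (S - {k}) = r" using S by auto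
   then show ?thesis by blast
  qed (use S in auto)
 next
  fix S assume "S \<in> ?B \<union> ?C"
  then show "S \<in> ?A"
  proof
   assume "S \<in> ?C"
   then obtain T where T: "S = insert k T" "T \<subseteq> K" "card T = r" by auto
   then have "finite T" "k \<notin> T" using K finite_subset by auto
   then show ?thesis using T by auto
  qed auto
 qed
 have fin: "finite ?B" "finite {S. S \<subseteq> K & card S = r}" using K by auto
 have disj: "?B \<inter> ?C = {}" using K by auto
 have inj: "inj_on (insert k) {S. S \<subseteq> K & card S = r}"
  using K by (auto simp: inj_on_def insert_ident)
 have "(\<Sum>S\<in>?C. \<Prod>k\<in>S. a k) = (\<Sum>S | S \<subseteq> K & card S = r. a k * (\<Prod>k\<in>S. a k))"
  using inj by (subst sum.reindex)
   (auto intro!: sum.cong prod.insert simp: K dest: finite_subset[OF _ K(1)])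
 then show ?thesis unfolding esym_def eq
  using fin disj by (subst sum.union_disjoint) (auto simp: sum_distrib_left)
qed

text \<open>The Bonferroni inequalities for weights in \<open>[0,1]\<close>: expanding \<open>\<Prod>(1 - a\<^sub>k)\<close>, the error of a truncated alternating sum is at most the first omitted term. Weights instead of events make it possible to work with Lipschitz functions throughout.\<close>

lemma bonferroni_esym:
 assumes "finite K" "\<And>k. k \<in> K ==> 0 <= a k" "\<And>k. k \<in> K ==> a k <= 1"
 shows "\<bar>(\<Prod>k\<in>K. 1 - a k) - (\<Sum>r<R. (-1) ^ r * esym r K a)\<bar> <= esym R K a"
 using assms
proof (induction K arbitrary: R rule: finite_induct)
 case empty
 have e: "esym r {} a = (if r = 0 then 1 else 0)" for r
  using esym_0[of "{}" a] by (cases r) (auto simp: esym_def intro!: sum.neutral)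
 show ?case
 proof (cases R)
  case (Suc R')
  then show ?thesis unfolding e by (simp add: lessThan_Suc_eq_insert_0 sum.reindex)
 qed (simp add: e)
next
 case (insert k K)
 show ?case
 proof (cases R)
  case 0
  have "0 <= (\<Prod>k\<in>insert k K. 1 - a k)" "(\<Prod>k\<in>insert k K. 1 - a k) <= 1"
   using insert.prems by (auto intro!: prod_nonneg prod_le_1 simp del: prod.insert)
  then show ?thesis using 0 insert.hyps by (simp add: esym_0 del: prod.insert)
 next
  case (Suc R')
  define rem where "rem R = (\<Prod>k\<in>K. 1 - a k) - (\<Sum>r<R. (-1) ^ r * esym r K a)" for R
  have IH: "\<bar>rem R\<bar> <= esym R K a" for R unfolding rem_def using insert by auto
  have s: "(\<Sum>r<Suc R'. (-1) ^ r * esym r (insert k K) a) =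
    (\<Sum>r<Suc R'. (-1) ^ r * esym r K a) - a k * (\<Sum>r<R'. (-1) ^ r * esym r K a)"
   unfolding lessThan_Suc_eq_insert_0 using insert.hyps
   by (simp add: sum.reindex esym_0 esym_insert sum_distrib_left algebra_simps sum.distrib
      sum_negf sum_subtractf)
  have "(\<Prod>k\<in>insert k K. 1 - a k) - (\<Sum>r<R. (-1) ^ r * esym r (insert k K) a)
    = rem R - a k * rem R'"
   unfolding Suc s using insert.hyps by (simp add: rem_def algebra_simps)
  also have "\<bar>...\<bar> <= \<bar>rem R\<bar> + a k * \<bar>rem R'\<bar>"
   using insert.prems(1)[of k] abs_triangle_ineq4[of "rem R" "a k * rem R'"] by (simp add: abs_mult)
  also have "... <= esym R K a + a k * esym R' K a"
   using insert.prems(1)[of k] by (intro add_mono mult_left_mono IH) auto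
  also have "... = esym R (insert k K) a"
   using insert.hyps Suc by (simp add: esym_insert)
  finally show ?thesis .
 qed
qed

text \<open>If the factorial moments are squeezed between those of Poisson laws of parameters \<open>lo\<close> and \<open>hi\<close>, then the alternating series determines the expectation of the product up to the distance between \<open>exp lo\<close> and \<open>exp hi\<close>. The truncation order is chosen first, because the terms \<open>hi ^ R / R!\<close> tend to zero; only then does the parameter tend to its limit.\<close>

lemma poisson_limit_from_factorial_moments:
 fixes V :: "'r => real" and E :: "nat => 'r => real" and lo lam hi :: real
 assumes lam: "0 <= lo" "lo <= lam" "lam <= hi"
  and bonf: "\<And>R. \<forall>\<^sub>F rho in F. \<bar>V rho - (\<Sum>r<R. (-1) ^ r * E r rho)\<bar> <= E R rho"
  and up: "\<And>r eps. eps > 0 ==> \<forall>\<^sub>F rho in F. E r rho <= hi ^ r / fact r + eps"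
  and low: "\<And>r eps. eps > 0 ==> \<forall>\<^sub>F rho in F. lo ^ r / fact r - eps <= E r rho"
  and eps: "eps > 0"
 shows "\<forall>\<^sub>F rho in F. \<bar>V rho - exp (- lam)\<bar> < exp hi - exp lo + eps"
proof -
 have sm: "summable (%r. x ^ r / fact r)" for x :: real
  using summable_exp[of x] by (simp add: divide_inverse mult.commute)
 have se: "(\<Sum>r. x ^ r / fact r) = exp x" for x :: real
  by (simp add: exp_def divide_inverse mult.commute scaleR_conv_of_real)
 have "\<forall>\<^sub>F R in sequentially. hi ^ R / fact R < eps / 4"
  using summable_LIMSEQ_zero[OF sm[of hi]] eps by (auto dest: order_tendstoD(2)[of _ _ _ "eps/4"])
 moreover have "(%R. \<Sum>r<R. (- lam) ^ r / fact r) \<longlonglongrightarrow> exp (- lam)"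
  using summable_LIMSEQ[OF sm[of "-lam"]] se by simp
 then have "\<forall>\<^sub>F R in sequentially. dist (\<Sum>r<R. (- lam) ^ r / fact r) (exp (- lam)) < eps / 4"
  using eps by (intro tendstoD) auto
 ultimately have "\<forall>\<^sub>F R in sequentially. hi ^ R / fact R < eps / 4 &
   dist (\<Sum>r<R. (- lam) ^ r / fact r) (exp (- lam)) < eps / 4" by eventually_elim auto
 then obtain R where R: "hi ^ R / fact R < eps / 4"
   "\<bar>(\<Sum>r<R. (- lam) ^ r / fact r) - exp (- lam)\<bar> < eps / 4"
  by (auto simp: eventually_sequentially dist_real_def)
 define e where "e = eps / (4 * (real R + 1))"
 have e: "e > 0" "real R * e <= eps / 4" "e <= eps / 4" using eps by (auto simp: e_def field_simps)
 have "\<forall>\<^sub>F rho in F. \<forall>r\<in>{..R}. E r rho <= hi ^ r / fact r + e & lo ^ r / fact r - e <= E r rho"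
  by (intro eventually_ball_finite ballI eventually_conj up low e) auto
 then show ?thesis using bonf[of R]
 proof eventually_elim
  case (elim rho)
  have pw: "lo ^ r / fact r <= lam ^ r / fact r" "lam ^ r / fact r <= hi ^ r / fact r" for r
   using lam by (auto intro!: divide_right_mono power_mono)
  have "\<bar>(\<Sum>r<R. (-1) ^ r * E r rho) - (\<Sum>r<R. (- lam) ^ r / fact r)\<bar>
    = \<bar>\<Sum>r<R. (-1) ^ r * (E r rho - lam ^ r / fact r)\<bar>"
   by (simp add: sum_subtractf right_diff_distrib power_minus[of lam])
  also have "... <= (\<Sum>r<R. \<bar>(-1) ^ r * (E r rho - lam ^ r / fact r)\<bar>)" by (rule sum_abs)
  also have "... <= (\<Sum>r<R. (hi ^ r / fact r - lo ^ r / fact r) + e)"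
  proof (rule sum_mono)
   fix r assume "r \<in> {..<R}"
   then show "\<bar>(-1) ^ r * (E r rho - lam ^ r / fact r)\<bar> <= hi ^ r / fact r - lo ^ r / fact r + e"
    using elim(1)[rule_format, of r] pw[of r] by (auto simp: abs_mult)
  qed
  also have "... = (\<Sum>r<R. hi ^ r / fact r - lo ^ r / fact r) + real R * e"
   by (simp add: sum.distrib)
  also have "(\<Sum>r<R. hi ^ r / fact r - lo ^ r / fact r) <= (\<Sum>r. hi ^ r / fact r - lo ^ r / fact r)"
   using sm pw by (intro sum_le_suminf summable_diff) (auto intro: order_trans)
  also have "... = exp hi - exp lo" using sm se by (subst suminf_diff[symmetric]) auto
  finally have 1: "\<bar>(\<Sum>r<R. (-1) ^ r * E r rho) - (\<Sum>r<R. (- lam) ^ r / fact r)\<bar>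
    <= exp hi - exp lo + eps / 4" using e by linarith
  have "E R rho <= hi ^ R / fact R + e" using elim(1) by simp
  then have "E R rho < eps / 4 + eps / 4" using R(1) e(3) by linarith
  then show ?case using 1 R(2) elim(2) by linarith
 qed
qed

section \<open>Multiple mixing in an abstract metric setting\<close>

text \<open>What the probabilistic argument uses of the manifold and of the diffeomorphism: a bounded metric for which \<open>f\<close> is Lipschitz, and multiple mixing for observables with values in \<open>[0,1]\<close>. The metric is bounded by one so that it is finite between components and so that every Lipschitz estimate is global.\<close>

locale mixing_metric_system = prob_space \<mu>
 for \<mu> :: "'a::topological_space measure" +
 fixes D :: "'a => 'a => real" and f :: "'a => 'a" and \<Lambda> :: real
 assumes sets_borel: "sets \<mu> = sets borel"
  and D_nonneg: "0 <= D x y" and D_le_1: "D x y <= 1" and D_refl: "D x x = 0"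
  and D_sym: "D x y = D y x" and D_tri: "D x z <= D x y + D y z"
  and D_measurable: "(%z. D (fst z) (snd z)) \<in> borel_measurable (\<mu> \<Otimes>\<^sub>M \<mu>)"
  and f_measurable [measurable]: "f \<in> \<mu> \<rightarrow>\<^sub>M \<mu>"
  and f_preserves: "distr \<mu> \<mu> f = \<mu>"
  and \<Lambda>_ge_1: "1 <= \<Lambda>" and f_Lipschitz: "D (f x) (f y) <= \<Lambda> * D x y"
  and mixing: "2 <= r ==> \<exists>C>0. \<exists>theta. 0 < theta & theta < 1 & (\<forall>A L m k.
    A \<in> borel_measurable (\<Pi>\<^sub>M j\<in>{..<r}. \<mu>) & (\<forall>X. 0 <= A X & A X <= 1) & 0 <= L &
    (\<forall>X Y. \<bar>A X - A Y\<bar> <= L * (\<Sum>j<r. D (X j) (Y j))) &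
    k 0 = 0 & (\<forall>j. Suc j < r --> k j + m <= k (Suc j)) -->
    \<bar>(LINT x|\<mu>. A (\<lambda>j\<in>{..<r}. (f ^^ k j) x)) - (\<integral>X. A X \<partial>(\<Pi>\<^sub>M j\<in>{..<r}. \<mu>))\<bar> <= C * theta ^ m * (1 + L))"
begin

lemma space_UNIV [simp]: "space \<mu> = UNIV"
 using sets_eq_imp_space_eq[OF sets_borel] by simp

lemma D_measurable' [measurable (raw)]:
 assumes "u \<in> N \<rightarrow>\<^sub>M \<mu>" "v \<in> N \<rightarrow>\<^sub>M \<mu>"
 shows "(%x. D (u x) (v x)) \<in> borel_measurable N"
 using measurable_compose[OF measurable_Pair[OF assms] D_measurable] by simp

lemma f_iter_measurable [measurable]: "f ^^ k \<in> \<mu> \<rightarrow>\<^sub>M \<mu>"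
 by (induction k) (auto intro: measurable_comp f_measurable measurable_id[unfolded id_def[symmetric]] simp: measurable_ident)

lemma f_iter_measurable' [measurable (raw)]:
 "u \<in> N \<rightarrow>\<^sub>M \<mu> ==> (%x. (f ^^ k) (u x)) \<in> N \<rightarrow>\<^sub>M \<mu>"
 by (rule measurable_compose[OF _ f_iter_measurable])

lemma f_iter_preserves: "distr \<mu> \<mu> (f ^^ k) = \<mu>"
proof (induction k)
 case 0
 then show ?case by (simp add: id_def distr_id)
next
 case (Suc k)
 have "distr \<mu> \<mu> (f ^^ Suc k) = distr (distr \<mu> \<mu> (f ^^ k)) \<mu> f"
  by (subst distr_distr) (auto simp: o_def)
 then show ?case by (simp add: Suc f_preserves o_def)
qed

lemma integral_f_iter:
 fixes \<phi> :: "'a => real"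
 assumes [measurable]: "\<phi> \<in> borel_measurable \<mu>"
 shows "(LINT x|\<mu>. \<phi> ((f ^^ k) x)) = (LINT x|\<mu>. \<phi> x)"
 using integral_distr[of "f ^^ k" \<mu> \<mu> \<phi>] by (simp add: f_iter_preserves)

lemma f_iter_Lipschitz: "D ((f ^^ k) x) ((f ^^ k) y) <= \<Lambda> ^ k * D x y"
proof (induction k)
 case (Suc k)
 have "D ((f ^^ Suc k) x) ((f ^^ Suc k) y) <= \<Lambda> * D ((f ^^ k) x) ((f ^^ k) y)"
  using f_Lipschitz by simp
 also have "... <= \<Lambda> * (\<Lambda> ^ k * D x y)" using Suc \<Lambda>_ge_1 by (intro mult_left_mono) auto
 finally show ?case by (simp add: mult.assoc)
qed simp

lemma D_diff_le: "\<bar>D x y - D x' y'\<bar> <= D x x' + D y y'"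
 using D_tri[of x y x'] D_tri[of x' y y'] D_tri[of x' y' x] D_tri[of x y' y] D_sym by smt

lemma integrable_unit:
 fixes \<phi> :: "'a => real"
 assumes "\<phi> \<in> borel_measurable \<mu>" "\<And>x. 0 <= \<phi> x" "\<And>x. \<phi> x <= 1"
 shows "integrable \<mu> \<phi>"
 using assms by (intro integrable_const_bound[where B = 1]) auto

lemma integral_unit:
 fixes \<phi> :: "'a => real"
 assumes "\<phi> \<in> borel_measurable \<mu>" "\<And>x. 0 <= \<phi> x" "\<And>x. \<phi> x <= 1"
 shows "0 <= (LINT x|\<mu>. \<phi> x)" "(LINT x|\<mu>. \<phi> x) <= 1"
proof -
 show "0 <= (LINT x|\<mu>. \<phi> x)" using assms by simp
 have "(LINT x|\<mu>. \<phi> x) <= (LINT x|\<mu>. 1)"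
  using assms by (intro integral_mono integrable_unit) auto
 then show "(LINT x|\<mu>. \<phi> x) <= 1" using prob_space by simp
qed

text \<open>The product integral of \<open>\<Prod> w (X 0) (X j)\<close>: conditionally on the first coordinate the factors are independent, whence a power of the inner integral.\<close>

lemma PiM_integral_star:
 fixes w :: "'a => 'a => real"
 assumes w [measurable]: "case_prod w \<in> borel_measurable (\<mu> \<Otimes>\<^sub>M \<mu>)"
  and w01: "\<And>y z. 0 <= w y z" "\<And>y z. w y z <= 1"
 shows "(\<integral>X. (\<Prod>i\<in>{1..r}. w (X 0) (X i)) \<partial>(\<Pi>\<^sub>M j\<in>{..<Suc r}. \<mu>)) = (LINT y|\<mu>. (LINT z|\<mu>. w y z) ^ r)"
proof -
 interpret P: product_prob_space "%_. \<mu>" "UNIV :: nat set" by unfold_locales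
 have I: "{..<Suc r} = insert 0 {1..r}" by auto
 have [measurable]: "w y \<in> borel_measurable \<mu>" for y by measurable
 have pw: "0 <= (\<Prod>i\<in>{1..r}. w (X 0) (X i))" "(\<Prod>i\<in>{1..r}. w (X 0) (X i)) <= 1" for X
  using w01 by (auto intro!: prod_nonneg prod_le_1)
 have "(\<integral>\<^sup>+X. ennreal (\<Prod>i\<in>{1..r}. w (X 0) (X i)) \<partial>(\<Pi>\<^sub>M j\<in>insert 0 {1..r}. \<mu>))
   = (\<integral>\<^sup>+y. (\<integral>\<^sup>+X. ennreal (\<Prod>i\<in>{1..r}. w ((X(0 := y)) 0) ((X(0 := y)) i)) \<partial>(\<Pi>\<^sub>M j\<in>{1..r}. \<mu>)) \<partial>\<mu>)"
  by (subst P.product_nn_integral_insert_rev) auto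
 also have "... = (\<integral>\<^sup>+y. (\<integral>\<^sup>+X. (\<Prod>i\<in>{1..r}. ennreal (w y (X i))) \<partial>(\<Pi>\<^sub>M j\<in>{1..r}. \<mu>)) \<partial>\<mu>)"
  using w01 by (intro nn_integral_cong) (auto simp: prod_ennreal intro!: prod.cong)
 also have "... = (\<integral>\<^sup>+y. (\<Prod>i\<in>{1..r}. \<integral>\<^sup>+z. ennreal (w y z) \<partial>\<mu>) \<partial>\<mu>)"
  by (intro nn_integral_cong P.product_nn_integral_prod) auto
 also have "... = (\<integral>\<^sup>+y. ennreal ((LINT z|\<mu>. w y z) ^ r) \<partial>\<mu>)"
  using w01 by (intro nn_integral_cong)
   (simp add: nn_integral_eq_integral integrable_unit ennreal_power)
 finally have nn: "(\<integral>\<^sup>+X. ennreal (\<Prod>i\<in>{1..r}. w (X 0) (X i)) \<partial>(\<Pi>\<^sub>M j\<in>{..<Suc r}. \<mu>))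
   = (\<integral>\<^sup>+y. ennreal ((LINT z|\<mu>. w y z) ^ r) \<partial>\<mu>)" unfolding I .
 have m: "(%X. \<Prod>i\<in>{1..r}. w (X 0) (X i)) \<in> borel_measurable (\<Pi>\<^sub>M j\<in>{..<Suc r}. \<mu>)"
  by measurable
 have m2: "(%y. (LINT z|\<mu>. w y z) ^ r) \<in> borel_measurable \<mu>" by measurable
 show ?thesis
  using nn pw w01 m m2 by (subst (1 2) integral_eq_nn_integral) (auto intro!: zero_le_power)
qed

definition separated :: "nat => nat set => bool" where
 "separated m S \<longleftrightarrow> (\<forall>k\<in>S. m <= k) & (\<forall>k\<in>S. \<forall>l\<in>S. k < l --> k + m <= l)"

text \<open>The observable \<open>\<Prod> w (x\<^sub>0, x\<^sub>j)\<close> in one more variable than there are visit times. The base point \<open>y\<close> occupies time zero, so that the same estimate covers targets around a fixed point and targets around the starting point of the orbit.\<close>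

lemma product_mixing:
 assumes r: "1 <= r"
 shows "\<exists>C>0. \<exists>theta. 0 < theta & theta < 1 & (\<forall>w L m S.
  case_prod w \<in> borel_measurable (\<mu> \<Otimes>\<^sub>M \<mu>) & (\<forall>y z. 0 <= w y z & w y z <= 1) & 0 <= L &
  (\<forall>y z y' z'. \<bar>w y z - w y' z'\<bar> <= L * (D y y' + D z z')) &
  finite S & card S = r & separated m S -->
  \<bar>(LINT y|\<mu>. (\<Prod>k\<in>S. w y ((f ^^ k) y))) - (LINT y|\<mu>. (LINT z|\<mu>. w y z) ^ r)\<bar> <= C * theta ^ m * (1 + L))"
proof -
 have "2 <= Suc r" using r by simp
 from mixing[OF this] obtain C theta where C: "C > 0" "0 < theta" "theta < 1" and mix:
  "\<And>A L m k. A \<in> borel_measurable (\<Pi>\<^sub>M j\<in>{..<Suc r}. \<mu>) ==> (\<And>X. 0 <= A X & A X <= 1) ==> 0 <= L ==>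
    (\<And>X Y. \<bar>A X - A Y\<bar> <= L * (\<Sum>j<Suc r. D (X j) (Y j))) ==>
    k 0 = 0 ==> (\<And>j. Suc j < Suc r ==> k j + m <= k (Suc j)) ==>
    \<bar>(LINT x|\<mu>. A (\<lambda>j\<in>{..<Suc r}. (f ^^ k j) x)) - (\<integral>X. A X \<partial>(\<Pi>\<^sub>M j\<in>{..<Suc r}. \<mu>))\<bar> <= C * theta ^ m * (1 + L)"
  by (auto; blast)
 have "\<bar>(LINT y|\<mu>. (\<Prod>k\<in>S. w y ((f ^^ k) y))) - (LINT y|\<mu>. (LINT z|\<mu>. w y z) ^ r)\<bar>
   <= C * real (Suc r) * theta ^ m * (1 + L)"
  if w [measurable]: "case_prod w \<in> borel_measurable (\<mu> \<Otimes>\<^sub>M \<mu>)"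
   and w01: "\<And>y z. 0 <= w y z & w y z <= 1" and L: "0 <= L"
   and Lip: "\<And>y z y' z'. \<bar>w y z - w y' z'\<bar> <= L * (D y y' + D z z')"
   and S: "finite S" "card S = r" "separated m S" for w L m S
 proof -
  define A where "A X = (\<Prod>i\<in>{1..r}. w (X 0) (X i))" for X :: "nat => 'a"
  define k where "k j = (if j = 0 then 0 else sorted_list_of_set S ! (j - 1))" for j
  have len: "length (sorted_list_of_set S) = r" using S by simp
  have k_in: "k i \<in> S" if "i \<in> {1..r}" for i
   unfolding k_def using that len S(1) nth_mem[of "i - 1" "sorted_list_of_set S"] by auto
  have k_less: "k i < k j" if "1 <= i" "i < j" "j <= r" for i j
   using that len strict_sorted_list_of_set[of S]
   unfolding k_def sorted_wrt_iff_nth_less by auto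
  have k_gap: "k j + m <= k (Suc j)" if "Suc j < Suc r" for j
  proof (cases j)
   case 0
   then show ?thesis using k_in[of 1] that S(3) by (auto simp: separated_def k_def)
  next
   case (Suc i)
   then show ?thesis using k_in[of j] k_in[of "Suc j"] k_less[of j "Suc j"] that S(3)
    by (auto simp: separated_def)
  qed
  have bij: "bij_betw k {1..r} S"
  proof -
   have inj: "inj_on k {1..r}"
    by (rule linorder_inj_onI) (use k_less in force)+
   have "k ` {1..r} = S"
    using k_in S inj by (intro card_subset_eq) (auto simp: card_image)
   then show ?thesis using inj by (simp add: bij_betw_def)
  qed
  have A01: "0 <= A X & A X <= 1" for X
   unfolding A_def using w01 by (auto intro!: prod_nonneg prod_le_1)
  have A_Lip: "\<bar>A X - A Y\<bar> <= (real (Suc r) * L) * (\<Sum>j<Suc r. D (X j) (Y j))" for X Y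
  proof -
   let ?s = "\<Sum>j<Suc r. D (X j) (Y j)"
   have s: "(\<Sum>j<Suc r. D (X j) (Y j)) = D (X 0) (Y 0) + (\<Sum>j\<in>{1..r}. D (X j) (Y j))"
    by (subst lessThan_Suc_eq_insert_0) (simp add: sum.reindex sum.atLeast1_atMost_eq)
   have "\<bar>A X - A Y\<bar> <= (\<Sum>i\<in>{1..r}. \<bar>w (X 0) (X i) - w (Y 0) (Y i)\<bar>)"
    unfolding A_def using norm_prod_diff[of "{1..r}" "%i. w (X 0) (X i)" "%i. w (Y 0) (Y i)"] w01
    by auto
   also have "... <= (\<Sum>i\<in>{1..r}. L * (D (X 0) (Y 0) + D (X i) (Y i)))" by (intro sum_mono Lip)
   also have "... = L * (real r * D (X 0) (Y 0) + (\<Sum>i\<in>{1..r}. D (X i) (Y i)))"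
    by (simp add: sum.distrib flip: sum_distrib_left)
   also have "... <= L * (real (Suc r) * ?s)"
   proof (intro mult_left_mono L)
    have d: "0 <= D (X 0) (Y 0)" "0 <= (\<Sum>j\<in>{1..r}. D (X j) (Y j))"
     by (auto intro: sum_nonneg D_nonneg)
    have "0 <= real r * (\<Sum>j\<in>{1..r}. D (X j) (Y j))" using d by simp
    then show "real r * D (X 0) (Y 0) + (\<Sum>i = 1..r. D (X i) (Y i)) <= real (Suc r) * ?s"
     unfolding s using d by (simp add: algebra_simps)
   qed
   finally show ?thesis by (simp add: mult_ac)
  qed
  have mA: "A \<in> borel_measurable (\<Pi>\<^sub>M j\<in>{..<Suc r}. \<mu>)" unfolding A_def by measurable
  have "\<bar>(LINT x|\<mu>. A (\<lambda>j\<in>{..<Suc r}. (f ^^ k j) x)) - (\<integral>X. A X \<partial>(\<Pi>\<^sub>M j\<in>{..<Suc r}. \<mu>))\<bar>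
    <= C * theta ^ m * (1 + real (Suc r) * L)"
   by (rule mix[OF mA A01 _ A_Lip]) (use L k_gap in \<open>auto simp: k_def\<close>)
  also have "(\<integral>X. A X \<partial>(\<Pi>\<^sub>M j\<in>{..<Suc r}. \<mu>)) = (LINT y|\<mu>. (LINT z|\<mu>. w y z) ^ r)"
   unfolding A_def using w w01 by (intro PiM_integral_star) auto
  also have "(LINT x|\<mu>. A (\<lambda>j\<in>{..<Suc r}. (f ^^ k j) x)) = (LINT y|\<mu>. (\<Prod>k\<in>S. w y ((f ^^ k) y)))"
  proof (rule Bochner_Integration.integral_cong)
   fix y
   have "A (\<lambda>j\<in>{..<Suc r}. (f ^^ k j) y) = (\<Prod>i\<in>{1..r}. w y ((f ^^ k i) y))"
    unfolding A_def by (intro prod.cong) (auto simp: k_def)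
   also have "... = (\<Prod>k\<in>S. w y ((f ^^ k) y))" by (rule prod.reindex_bij_betw[OF bij])
   finally show "A (\<lambda>j\<in>{..<Suc r}. (f ^^ k j) y) = (\<Prod>k\<in>S. w y ((f ^^ k) y))" .
  qed simp
  finally have *: "\<bar>(LINT y|\<mu>. (\<Prod>k\<in>S. w y ((f ^^ k) y))) - (LINT y|\<mu>. (LINT z|\<mu>. w y z) ^ r)\<bar>
   <= C * theta ^ m * (1 + real (Suc r) * L)" .
  have "C * theta ^ m * (1 + real (Suc r) * L) <= C * theta ^ m * (real (Suc r) * (1 + L))"
   using C L by (intro mult_left_mono) (auto simp: algebra_simps)
  then show ?thesis using * by (simp add: mult_ac)
 qed
 then show ?thesis using C
  by (intro exI[of _ "C * real (Suc r)"] conjI exI[of _ theta]) auto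
qed

end

section \<open>Time scales\<close>

text \<open>Two gaps that are both negligible against every power of \<open>1/\<rho>\<close>, while \<open>\<theta>\<close> to the power of each gap is smaller than every power of \<open>\<rho>\<close>. Visits closer than the short gap are excluded, and the bulk of the \<open>r\<close>-tuples of visit times is separated by the long gap; the square and the cube make the short gap negligible against the long one, so that observables with Lipschitz constant exponential in the short gap still mix over the long gap.\<close>

definition short_gap :: "real => nat" where "short_gap rho = nat \<lceil>(ln rho)\<^sup>2\<rceil>"
definition long_gap :: "real => nat" where "long_gap rho = nat \<lceil>\<bar>ln rho\<bar> ^ 3\<rceil>"

lemma short_gap_bounds: "(ln rho)\<^sup>2 <= real (short_gap rho)" "real (short_gap rho) <= (ln rho)\<^sup>2 + 1"
proof -
 have "0 <= (ln rho)\<^sup>2" by simp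
 then have "real (short_gap rho) = of_int \<lceil>(ln rho)\<^sup>2\<rceil>" unfolding short_gap_def by (simp add: of_nat_nat)
 then show "(ln rho)\<^sup>2 <= real (short_gap rho)" "real (short_gap rho) <= (ln rho)\<^sup>2 + 1" by linarith+
qed

lemma long_gap_bounds: "\<bar>ln rho\<bar> ^ 3 <= real (long_gap rho)" "real (long_gap rho) <= \<bar>ln rho\<bar> ^ 3 + 1"
proof -
 have "0 <= \<bar>ln rho\<bar> ^ 3" by simp
 then have "real (long_gap rho) = of_int \<lceil>\<bar>ln rho\<bar> ^ 3\<rceil>" unfolding long_gap_def by (simp add: of_nat_nat)
 then show "\<bar>ln rho\<bar> ^ 3 <= real (long_gap rho)" "real (long_gap rho) <= \<bar>ln rho\<bar> ^ 3 + 1" by linarith+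
qed

lemma theta_power_eq: "0 < theta ==> theta ^ n = exp (ln theta * real n)" for theta :: real
 by (metis exp_ln exp_of_nat2_mult powr_def powr_realpow mult.commute)

lemma short_gap_decay:
 fixes theta :: real
 assumes "0 < theta" "theta < 1"
 shows "((%rho. theta ^ short_gap rho * rho powr (- p)) \<longlongrightarrow> 0) (at_right 0)"
proof -
 define a where "a = - ln theta"
 have a: "a > 0" using assms by (simp add: a_def)
 have "((%rho::real. exp (- a * (ln rho)\<^sup>2) * rho powr (- p)) \<longlongrightarrow> 0) (at_right 0)"
  using a by real_asymp
 then show ?thesis
 proof (rule tendsto_0_le[where K = 1])
  show "\<forall>\<^sub>F rho in at_right 0. norm (theta ^ short_gap rho * rho powr - p) \<le>
    norm (exp (- a * (ln rho)\<^sup>2) * rho powr - p) * 1"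
  proof (intro always_eventually allI)
   fix rho :: real
   have "theta ^ short_gap rho <= exp (- a * (ln rho)\<^sup>2)"
    unfolding theta_power_eq[OF assms(1)] using a short_gap_bounds(1)[of rho]
    by (simp add: a_def mult_left_mono_neg)
   then show "norm (theta ^ short_gap rho * rho powr - p) <= norm (exp (- a * (ln rho)\<^sup>2) * rho powr - p) * 1"
    using assms by (simp add: abs_mult mult_right_mono)
  qed
 qed
qed

lemma long_gap_decay:
 fixes theta \<Lambda> :: real
 assumes "0 < theta" "theta < 1" "1 <= \<Lambda>"
 shows "((%rho. theta ^ long_gap rho * \<Lambda> ^ short_gap rho * rho powr (- p)) \<longlongrightarrow> 0) (at_right 0)"
proof -
 define a where "a = - ln theta"
 define b where "b = ln \<Lambda> + 1"
 have a: "a > 0" and b: "b > 0" using assms by (auto simp: a_def b_def add_nonneg_pos)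
 have "((%rho::real. exp (- a * \<bar>ln rho\<bar> ^ 3) * exp (b * ((ln rho)\<^sup>2 + 1)) * rho powr (- p)) \<longlongrightarrow> 0) (at_right 0)"
  using a b by real_asymp
 then show ?thesis
 proof (rule tendsto_0_le[where K = 1])
  show "\<forall>\<^sub>F rho in at_right 0. norm (theta ^ long_gap rho * \<Lambda> ^ short_gap rho * rho powr - p) \<le>
    norm (exp (- a * \<bar>ln rho\<bar> ^ 3) * exp (b * ((ln rho)\<^sup>2 + 1)) * rho powr - p) * 1"
  proof (intro always_eventually allI)
   fix rho :: real
   have 1: "theta ^ long_gap rho <= exp (- a * \<bar>ln rho\<bar> ^ 3)"
    unfolding theta_power_eq[OF assms(1)] using a long_gap_bounds(1)[of rho]
    by (simp add: a_def mult_left_mono_neg)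
   have "\<Lambda> > 0" using assms by simp
   have 2: "\<Lambda> ^ short_gap rho <= exp (b * ((ln rho)\<^sup>2 + 1))"
    unfolding theta_power_eq[OF \<open>\<Lambda> > 0\<close>] exp_le_cancel_iff using assms short_gap_bounds(2)[of rho]
    by (intro mult_mono) (auto simp: b_def)
   show "norm (theta ^ long_gap rho * \<Lambda> ^ short_gap rho * rho powr - p)
    <= norm (exp (- a * \<bar>ln rho\<bar> ^ 3) * exp (b * ((ln rho)\<^sup>2 + 1)) * rho powr - p) * 1"
    using assms 1 2 by (simp add: abs_mult mult_right_mono mult_mono)
  qed
 qed
qed

lemma long_gap_powr: "p > 0 ==> ((%rho. real (long_gap rho) * rho powr p) \<longlongrightarrow> 0) (at_right 0)"
proof -
 assume p: "p > 0"
 have "((%rho::real. (\<bar>ln rho\<bar> ^ 3 + 1) * rho powr p) \<longlongrightarrow> 0) (at_right 0)" using p by real_asymp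
 then show ?thesis
  by (rule tendsto_0_le[where K = 1])
   (auto intro!: always_eventually simp: abs_mult mult_right_mono long_gap_bounds)
qed

lemma short_le_long_gap: "\<forall>\<^sub>F rho in at_right 0. short_gap rho <= long_gap rho"
proof -
 have "\<forall>\<^sub>F rho::real in at_right 0. (ln rho)\<^sup>2 <= \<bar>ln rho\<bar> ^ 3" by real_asymp
 then show ?thesis
  unfolding short_gap_def long_gap_def
  by eventually_elim (rule nat_mono, rule ceiling_mono)
qed

definition horizon :: "real => nat => real => nat" where
 "horizon \<tau> d rho = nat \<lfloor>\<tau> / rho ^ d\<rfloor>"

lemma horizon_bounds:
 assumes "\<tau> > 0" "rho > 0"
 shows "real (horizon \<tau> d rho) <= \<tau> / rho ^ d" "\<tau> / rho ^ d - 1 <= real (horizon \<tau> d rho)"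
proof -
 have "0 <= \<tau> / rho ^ d" using assms by simp
 then have "real (horizon \<tau> d rho) = of_int \<lfloor>\<tau> / rho ^ d\<rfloor>" unfolding horizon_def by (simp add: of_nat_nat)
 then show "real (horizon \<tau> d rho) <= \<tau> / rho ^ d" "\<tau> / rho ^ d - 1 <= real (horizon \<tau> d rho)" by linarith+
qed

lemma horizon_scaled:
 assumes "\<tau> > 0" "1 <= d"
 shows "((%rho. real (horizon \<tau> d rho) * rho ^ d) \<longlongrightarrow> \<tau>) (at_right 0)"
proof (rule tendsto_sandwich)
 have p: "\<forall>\<^sub>F rho::real in at_right 0. rho > 0" by (simp add: eventually_at_right_less)
 show "\<forall>\<^sub>F rho in at_right 0. \<tau> - rho ^ d <= real (horizon \<tau> d rho) * rho ^ d"
  using p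
 proof eventually_elim
  case (elim rho)
  have "(\<tau> / rho ^ d - 1) * rho ^ d <= real (horizon \<tau> d rho) * rho ^ d"
   using horizon_bounds[OF assms(1) elim] elim by (intro mult_right_mono) auto
  then show ?case using elim by (simp add: algebra_simps)
 qed
 show "\<forall>\<^sub>F rho in at_right 0. real (horizon \<tau> d rho) * rho ^ d <= \<tau>"
  using p
 proof eventually_elim
  case (elim rho)
  have "real (horizon \<tau> d rho) * rho ^ d <= (\<tau> / rho ^ d) * rho ^ d"
   using horizon_bounds[OF assms(1) elim] elim by (intro mult_right_mono) auto
  then show ?case using elim by simp
 qed
 have "((%rho::real. rho ^ d) \<longlongrightarrow> 0 ^ d) (at_right 0)" by (intro tendsto_intros)
 then show "((%rho::real. \<tau> - rho ^ d) \<longlongrightarrow> \<tau>) (at_right 0)"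
  using assms tendsto_diff[OF tendsto_const, of "%rho. rho ^ d" 0 "at_right 0" \<tau>] by (simp add: zero_power)
qed simp

lemma horizon_at_top:
 assumes "\<tau> > 0" "1 <= d"
 shows "filterlim (%rho. real (horizon \<tau> d rho)) at_top (at_right 0)"
proof (rule filterlim_at_top_mono)
 have "((%rho::real. rho ^ d) \<longlongrightarrow> 0 ^ d) (at_right 0)" by (intro tendsto_intros)
 then have "filterlim (%rho::real. rho ^ d) (at_right 0) (at_right 0)"
  using assms by (auto simp: filterlim_at eventually_at_right_less zero_power intro!: eventually_at_rightI[of 0 1])
 then have "filterlim (%rho::real. inverse (rho ^ d)) at_top (at_right 0)"
  by (rule filterlim_compose[OF filterlim_inverse_at_top_right])
 then have "filterlim (%rho::real. \<tau> * inverse (rho ^ d)) at_top (at_right 0)"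
  using assms by (intro filterlim_tendsto_pos_mult_at_top[OF tendsto_const]) auto
 then have "filterlim (%rho::real. -1 + \<tau> * inverse (rho ^ d)) at_top (at_right 0)"
  by (rule filterlim_tendsto_add_at_top[OF tendsto_const])
 then show "filterlim (%rho::real. \<tau> / rho ^ d - 1) at_top (at_right 0)"
  by (simp add: divide_inverse add.commute[of "-1"])
 have p: "\<forall>\<^sub>F rho::real in at_right 0. rho > 0" by (simp add: eventually_at_right_less)
 then show "\<forall>\<^sub>F rho in at_right 0. \<tau> / rho ^ d - 1 <= real (horizon \<tau> d rho)"
  by eventually_elim (use horizon_bounds assms in auto)
qed

lemma binomial_lower:
 assumes "r <= n"
 shows "real (n - r) ^ r / fact r <= real (n choose r)"
proof -
 have "fact r * real (n choose r) = (\<Prod>i = 0..<r. real n - real i)"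
  by (simp add: binomial_gbinomial gbinomial_mult_fact)
 moreover have "(\<Prod>i = 0..<r. real (n - r)) <= (\<Prod>i = 0..<r. real n - real i)"
  using assms by (intro prod_mono) auto
 ultimately show ?thesis by (simp add: field_simps)
qed

lemma separated_count:
 assumes r: "1 <= r" and n: "r + M <= n"
 shows "real (n - M - r) ^ r / fact r - real M * real n ^ (r - 1)
  <= real (card {S. S \<subseteq> {M<..n} & card S = r & (\<forall>k\<in>S. \<forall>l\<in>S. k < l --> k + M <= l)})" (is "_ <= real (card ?G)")
proof -
 let ?K = "{M<..n}"
 let ?A = "{S. S \<subseteq> ?K & card S = r}"
 let ?B = "{S. S \<subseteq> ?K & card S = r & \<not> (\<forall>k\<in>S. \<forall>l\<in>S. k < l --> k + M <= l)}"
 have finA: "finite ?A" by simp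
 have fin: "finite ?G" "finite ?B" by (rule finite_subset[OF _ finA], auto)+
 have AGB: "?A = ?G \<union> ?B" "?G \<inter> ?B = {}" by auto
 have cA: "card ?A = card ?G + card ?B"
  by (subst AGB(1), rule card_Un_disjoint[OF fin AGB(2)])
 have "card ?A = (n - M) choose r" using n_subsets[of ?K r] by simp
 then have lowA: "real (n - M - r) ^ r / fact r <= real (card ?A)"
  using binomial_lower[of r "n - M"] n by simp
 have "card ?B <= M * n ^ (r - 1)"
 proof (cases "r = 1")
  case True
  then have "?B = {}" by (auto simp: card_1_singleton_iff)
  then have "card ?B = 0" by (simp only: card.empty)
  then show ?thesis by linarith
 next
  case False
  define q where "q = r - 2"
  have rq: "r = Suc (Suc q)" using False r by (simp add: q_def)
  let ?T = "{T. T \<subseteq> ?K & card T = q}"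
  let ?h = "%(a, g, T). insert a (insert (a + g) T)"
  have sub: "?B \<subseteq> ?h ` (?K \<times> {..<M} \<times> ?T)"
  proof
   fix S assume "S \<in> ?B"
   then obtain k l where kl: "k \<in> S" "l \<in> S" "k < l" "l < k + M" and S: "S \<subseteq> ?K" "card S = r" by auto
   have fS: "finite S" using S finite_subset by blast
   have "card (S - {k} - {l}) = q" using kl S fS rq by simp
   then have "S - {k} - {l} \<in> ?T" using S by auto
   moreover have "S = ?h (k, l - k, S - {k} - {l})" using kl by auto
   moreover have "l - k \<in> {..<M}" "k \<in> ?K" using kl S by auto
   ultimately show "S \<in> ?h ` (?K \<times> {..<M} \<times> ?T)" by blast
  qed
  have "card ?B <= card (?K \<times> {..<M} \<times> ?T)"
   by (rule surj_card_le[OF _ sub]) simp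
  also have "... = (n - M) * (M * ((n - M) choose q))"
   using n_subsets[of ?K q] by (simp add: card_cartesian_product)
  also have "... <= n * (M * n ^ q)"
  proof (intro mult_mono)

   have "((n - M) choose q) * 1 <= ((n - M) choose q) * fact q" by (intro mult_left_mono) auto
   also have "... <= (n - M) ^ q" by (rule binomial_fact_pow)
   also have "... <= n ^ q" by (intro power_mono) auto
   finally show "(n - M) choose q <= n ^ q" by simp
  qed auto
  also have "... = M * n ^ (r - 1)" by (simp add: rq)
  finally show ?thesis .
 qed
 then have "real (card ?B) <= real (M * n ^ (r - 1))" by (rule of_nat_mono)
 also have "... = real M * real n ^ (r - 1)" by simp
 finally have "real (card ?B) <= real M * real n ^ (r - 1)" .
 moreover have "real (card ?A) = real (card ?G) + real (card ?B)" by (subst cA) (rule of_nat_add)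
 ultimately show ?thesis using lowA by linarith
qed

section \<open>Isolated visits\<close>

context mixing_metric_system begin

text \<open>The weight of a visit that is not followed by another visit within \<open>m\<close> steps. The majorant \<open>\<beta>\<close>, which is one on the support of \<open>w\<close>, detects further visits; truncating one minus their sum at zero keeps the weight Lipschitz, with a constant of order \<open>\<Lambda> ^ m\<close>.\<close>

definition isolated :: "('a => 'a => real) => ('a => 'a => real) => nat => 'a => 'a => real" where
 "isolated w \<beta> m y z = w y z * max 0 (1 - (\<Sum>g\<in>{1..<m}. \<beta> y ((f ^^ g) z)))"

definition jointly_Lipschitz :: "real => ('a => 'a => real) => bool" where
 "jointly_Lipschitz L w \<longleftrightarrow> (\<forall>y z y' z'. \<bar>w y z - w y' z'\<bar> <= L * (D y y' + D z z'))"

end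

locale visit_kernel = mixing_metric_system +
 fixes w \<beta> :: "'a => 'a => real" and L :: real
 assumes w_meas [measurable]: "case_prod w \<in> borel_measurable (\<mu> \<Otimes>\<^sub>M \<mu>)"
  and \<beta>_meas [measurable]: "case_prod \<beta> \<in> borel_measurable (\<mu> \<Otimes>\<^sub>M \<mu>)"
  and w0: "0 <= w y z" and w1: "w y z <= 1"
  and \<beta>0: "0 <= \<beta> y z" and \<beta>1: "\<beta> y z <= 1"
  and supp: "w y z ~= 0 ==> \<beta> y z = 1"
  and L0: "0 <= L"
  and w_Lip: "jointly_Lipschitz L w" and \<beta>_Lip: "jointly_Lipschitz L \<beta>"
begin

lemma isolated_bounds: "0 <= isolated w \<beta> m y z" "isolated w \<beta> m y z <= w y z" "isolated w \<beta> m y z <= 1"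
proof -
 have s: "0 <= (\<Sum>g\<in>{1..<m}. \<beta> y ((f ^^ g) z))" by (intro sum_nonneg \<beta>0)
 show "0 <= isolated w \<beta> m y z" using w0 by (simp add: isolated_def)
 show *: "isolated w \<beta> m y z <= w y z"
  unfolding isolated_def using w0 s by (intro mult_left_le) auto
 show "isolated w \<beta> m y z <= 1" using * w1 order_trans by blast
qed

lemma isolated_measurable [measurable]: "case_prod (isolated w \<beta> m) \<in> borel_measurable (\<mu> \<Otimes>\<^sub>M \<mu>)"
 unfolding isolated_def case_prod_unfold by measurable

lemma isolated_loss: "w y z - isolated w \<beta> m y z <= (\<Sum>g\<in>{1..<m}. w y z * \<beta> y ((f ^^ g) z))"
proof -
 let ?s = "\<Sum>g\<in>{1..<m}. \<beta> y ((f ^^ g) z)"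
 have "w y z * (1 - ?s) <= w y z * max 0 (1 - ?s)" using w0 by (intro mult_left_mono) auto
 then have "w y z - isolated w \<beta> m y z <= w y z * ?s"
  unfolding isolated_def by (simp add: algebra_simps)
 then show ?thesis by (simp add: sum_distrib_left)
qed

lemma isolated_Lipschitz: "jointly_Lipschitz (L * (1 + real m * \<Lambda> ^ m)) (isolated w \<beta> m)"
 unfolding jointly_Lipschitz_def
proof (intro allI)
 fix y z y' z'
 define h where "h y z = max 0 (1 - (\<Sum>g\<in>{1..<m}. \<beta> y ((f ^^ g) z)))" for y z
 let ?d = "D y y' + D z z'"
 have d0: "0 <= ?d" using D_nonneg by simp
 have h0: "0 <= h y z" for y z by (simp add: h_def)
 have h1: "h y z <= 1" for y z by (simp add: h_def sum_nonneg \<beta>0)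
 have "\<bar>h y z - h y' z'\<bar> <= \<bar>(\<Sum>g\<in>{1..<m}. \<beta> y ((f ^^ g) z)) - (\<Sum>g\<in>{1..<m}. \<beta> y' ((f ^^ g) z'))\<bar>"
  unfolding h_def by linarith
 also have "... <= (\<Sum>g\<in>{1..<m}. \<bar>\<beta> y ((f ^^ g) z) - \<beta> y' ((f ^^ g) z')\<bar>)"
  unfolding sum_subtractf[symmetric] by (rule sum_abs)
 also have "... <= (\<Sum>g\<in>{1..<m}. L * (\<Lambda> ^ m * ?d))"
 proof (rule sum_mono)
  fix g assume g: "g \<in> {1..<m}"
  have L1: "1 <= \<Lambda> ^ m" using \<Lambda>_ge_1 by simp
  have "\<bar>\<beta> y ((f ^^ g) z) - \<beta> y' ((f ^^ g) z')\<bar> <= L * (D y y' + D ((f ^^ g) z) ((f ^^ g) z'))"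
   using \<beta>_Lip unfolding jointly_Lipschitz_def by blast
  also have "D ((f ^^ g) z) ((f ^^ g) z') <= \<Lambda> ^ m * D z z'"
  proof -
   have "\<Lambda> ^ g <= \<Lambda> ^ m" using g \<Lambda>_ge_1 by (intro power_increasing) auto
   then show ?thesis using f_iter_Lipschitz[of g z z'] D_nonneg[of z z'] mult_right_mono order_trans by blast
  qed
  also have "D y y' <= \<Lambda> ^ m * D y y'" using mult_right_mono[OF L1 D_nonneg[of y y']] by simp
  finally show "\<bar>\<beta> y ((f ^^ g) z) - \<beta> y' ((f ^^ g) z')\<bar> <= L * (\<Lambda> ^ m * ?d)"
   using L0 by (simp add: distrib_left mult_left_mono)
 qed
 also have "... = real (m - 1) * (L * (\<Lambda> ^ m * ?d))" by simp
 also have "... <= real m * (L * (\<Lambda> ^ m * ?d))"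
  using L0 \<Lambda>_ge_1 d0 by (intro mult_right_mono) auto
 finally have hL: "\<bar>h y z - h y' z'\<bar> <= real m * (L * (\<Lambda> ^ m * ?d))" .
 have wL: "\<bar>w y z - w y' z'\<bar> <= L * ?d" using w_Lip by (auto simp: jointly_Lipschitz_def)
 have "\<bar>isolated w \<beta> m y z - isolated w \<beta> m y' z'\<bar> = \<bar>(w y z - w y' z') * h y z + w y' z' * (h y z - h y' z')\<bar>"
  by (simp add: isolated_def h_def algebra_simps)
 also have "... <= \<bar>w y z - w y' z'\<bar> * h y z + w y' z' * \<bar>h y z - h y' z'\<bar>"
  using h0[of y z] w0[of y' z'] by (intro order_trans[OF abs_triangle_ineq]) (simp add: abs_mult)
 also have "... <= \<bar>w y z - w y' z'\<bar> * 1 + 1 * \<bar>h y z - h y' z'\<bar>"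
  using h1[of y z] w1[of y' z'] by (intro add_mono mult_left_mono mult_right_mono) auto
 also have "... <= L * ?d + real m * (L * (\<Lambda> ^ m * ?d))" using hL wL by simp
 also have "... = L * (1 + real m * \<Lambda> ^ m) * ?d" by (simp add: algebra_simps)
 finally show "\<bar>isolated w \<beta> m y z - isolated w \<beta> m y' z'\<bar> <= L * (1 + real m * \<Lambda> ^ m) * ?d" .
qed

text \<open>Isolated visits repel each other: tuples with a gap shorter than \<open>m\<close> contribute nothing to the factorial moments.\<close>

lemma isolated_prod_zero:
 assumes "finite S" "k \<in> S" "l \<in> S" "k < l" "l < k + m"
 shows "(\<Prod>k\<in>S. isolated w \<beta> m y ((f ^^ k) y)) = 0"
proof (rule ccontr)
 assume "(\<Prod>k\<in>S. isolated w \<beta> m y ((f ^^ k) y)) ~= 0"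
 then have nz: "isolated w \<beta> m y ((f ^^ k) y) ~= 0" "isolated w \<beta> m y ((f ^^ l) y) ~= 0"
  using assms by auto
 have "w y ((f ^^ l) y) ~= 0" using nz(2) by (auto simp: isolated_def)
 then have b: "\<beta> y ((f ^^ (l - k)) ((f ^^ k) y)) = 1"
  using supp assms(4) by (metis funpow_add comp_apply le_add_diff_inverse2 less_imp_le)
 have "\<beta> y ((f ^^ (l - k)) ((f ^^ k) y)) <= (\<Sum>g\<in>{1..<m}. \<beta> y ((f ^^ g) ((f ^^ k) y)))"
  using assms \<beta>0 by (intro member_le_sum) auto
 then show False using nz(1) b by (auto simp: isolated_def)
qed

end

lemma power_tangent_le:
 fixes s t :: real
 assumes "0 <= s" "0 <= t" "1 <= r"
 shows "s ^ r + real r * s ^ (r - 1) * (t - s) <= t ^ r"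
proof (cases "s = 0")
 case True
 then show ?thesis using assms by (cases "r = 1") (auto simp: zero_power)
next
 case False
 then have s: "s > 0" using assms by simp
 have "1 + real r * (t / s - 1) <= (1 + (t / s - 1)) ^ r"
  using s assms by (intro Bernoulli_inequality) simp
 then have "s ^ r * (1 + real r * (t / s - 1)) <= s ^ r * (t / s) ^ r"
  using s by (intro mult_left_mono) auto
 also have "... = t ^ r" using s by (simp add: power_divide)
 also have "s ^ r * (1 + real r * (t / s - 1)) = s ^ r + real r * s ^ (r - 1) * (t - s)"
  using s assms(3) by (cases r) (auto simp: field_simps)
 finally show ?thesis .
qed

lemma scaled_short_gap_decay:
 fixes theta \<tau> C :: real
 assumes "0 < theta" "theta < 1" "\<tau> > 0" "C > 0"
 shows "((%rho. real (horizon \<tau> d rho) ^ r * (C * theta ^ short_gap rho * (1 + inverse (rho\<^sup>2)))) \<longlongrightarrow> 0) (at_right 0)"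
proof -
 let ?p = "real (d * r + 2)"
 have "((%rho. (2 * C * \<tau> ^ r) * (theta ^ short_gap rho * rho powr (- ?p))) \<longlongrightarrow> (2 * C * \<tau> ^ r) * 0) (at_right 0)"
  by (intro tendsto_mult tendsto_const short_gap_decay assms)
 then have "((%rho. (2 * C * \<tau> ^ r) * (theta ^ short_gap rho * rho powr (- ?p))) \<longlongrightarrow> 0) (at_right 0)" by simp
 then show ?thesis
 proof (rule tendsto_0_le[where K = 1])
  have "\<forall>\<^sub>F rho::real in at_right 0. rho \<in> {0<..<1}" by (rule eventually_at_right_real) simp
  then show "\<forall>\<^sub>F rho in at_right 0. norm (real (horizon \<tau> d rho) ^ r * (C * theta ^ short_gap rho * (1 + inverse (rho\<^sup>2))))
    <= norm ((2 * C * \<tau> ^ r) * (theta ^ short_gap rho * rho powr (- ?p))) * 1"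
  proof eventually_elim
   case (elim rho)
   then have rho: "0 < rho" "rho < 1" by auto
   have "real (horizon \<tau> d rho) ^ r <= (\<tau> / rho ^ d) ^ r"
    using horizon_bounds[OF assms(3) rho(1)] by (intro power_mono) auto
   moreover have "1 + inverse (rho\<^sup>2) <= 2 * inverse (rho\<^sup>2)"
    using rho by (simp add: field_simps power_le_one)
   ultimately have "real (horizon \<tau> d rho) ^ r * (C * theta ^ short_gap rho * (1 + inverse (rho\<^sup>2)))
     <= (\<tau> / rho ^ d) ^ r * (C * theta ^ short_gap rho * (2 * inverse (rho\<^sup>2)))"
    using assms rho by (intro mult_mono) auto
   also have "... = (2 * C * \<tau> ^ r) * (theta ^ short_gap rho * rho powr (- ?p))"
    unfolding powr_minus powr_realpow[OF rho(1)] using rho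
    by (simp add: field_simps power_divide power_add power_mult power2_eq_square)
   finally show ?case using assms rho by (simp add: abs_mult)
  qed
 qed
qed

lemma scaled_long_gap_decay:
 fixes theta \<tau> C \<Lambda> :: real
 assumes "0 < theta" "theta < 1" "\<tau> > 0" "C > 0" "1 <= \<Lambda>"
 shows "((%rho. real (horizon \<tau> d rho) ^ r * (C * theta ^ long_gap rho *
   (1 + inverse (rho\<^sup>2) * (2 + real (short_gap rho) * \<Lambda> ^ short_gap rho)))) \<longlongrightarrow> 0) (at_right 0)"
proof -
 let ?p = "real (d * r + 3)"
 have "((%rho. (4 * C * \<tau> ^ r) * (theta ^ long_gap rho * \<Lambda> ^ short_gap rho * rho powr (- ?p))) \<longlongrightarrow> (4 * C * \<tau> ^ r) * 0) (at_right 0)"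
  by (intro tendsto_mult tendsto_const long_gap_decay assms)
 then have "((%rho. (4 * C * \<tau> ^ r) * (theta ^ long_gap rho * \<Lambda> ^ short_gap rho * rho powr (- ?p))) \<longlongrightarrow> 0) (at_right 0)" by simp
 then show ?thesis
 proof (rule tendsto_0_le[where K = 1])
  have "\<forall>\<^sub>F rho::real in at_right 0. rho \<in> {0<..<1}" by (rule eventually_at_right_real) simp
  moreover have "\<forall>\<^sub>F rho::real in at_right 0. (ln rho)\<^sup>2 + 1 <= inverse rho" by real_asymp
  ultimately show "\<forall>\<^sub>F rho in at_right 0. norm (real (horizon \<tau> d rho) ^ r * (C * theta ^ long_gap rho *
   (1 + inverse (rho\<^sup>2) * (2 + real (short_gap rho) * \<Lambda> ^ short_gap rho))))
    <= norm ((4 * C * \<tau> ^ r) * (theta ^ long_gap rho * \<Lambda> ^ short_gap rho * rho powr (- ?p))) * 1"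
  proof eventually_elim
   case (elim rho)
   then have rho: "0 < rho" "rho < 1" by auto
   let ?l = "\<Lambda> ^ short_gap rho"
   have l1: "1 <= ?l" using assms by simp
   have i1: "1 <= inverse rho" using rho by (simp add: one_le_inverse)
   have i2: "1 <= inverse (rho\<^sup>2)" using rho by (simp add: one_le_inverse power_le_one)
   have "1 * 1 <= inverse rho * ?l" using i1 l1 rho by (intro mult_mono) auto
   then have il: "1 <= inverse rho * ?l" by simp
   have "real (short_gap rho) * ?l <= inverse rho * ?l"
    using short_gap_bounds(2)[of rho] elim(2) l1 by (intro mult_right_mono) auto
   then have "2 + real (short_gap rho) * ?l <= 3 * (inverse rho * ?l)" using il by linarith
   then have "inverse (rho\<^sup>2) * (2 + real (short_gap rho) * ?l) <= inverse (rho\<^sup>2) * (3 * (inverse rho * ?l))"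
    using rho by (intro mult_left_mono) auto
   moreover have "1 * 1 <= inverse (rho\<^sup>2) * (inverse rho * ?l)" using i2 il rho by (intro mult_mono) auto
   ultimately have e: "1 + inverse (rho\<^sup>2) * (2 + real (short_gap rho) * ?l) <= 4 * (inverse (rho\<^sup>2) * (inverse rho * ?l))"
    by linarith
   have "real (horizon \<tau> d rho) ^ r <= (\<tau> / rho ^ d) ^ r"
    using horizon_bounds[OF assms(3) rho(1)] by (intro power_mono) auto
   then have "real (horizon \<tau> d rho) ^ r * (C * theta ^ long_gap rho *
     (1 + inverse (rho\<^sup>2) * (2 + real (short_gap rho) * ?l)))
     <= (\<tau> / rho ^ d) ^ r * (C * theta ^ long_gap rho * (4 * (inverse (rho\<^sup>2) * (inverse rho * ?l))))"
    using assms rho e l1 by (intro mult_mono) (auto intro!: add_nonneg_nonneg)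
   also have "... = (4 * C * \<tau> ^ r) * (theta ^ long_gap rho * ?l * rho powr (- ?p))"
    unfolding powr_minus powr_realpow[OF rho(1)] using rho
    by (simp add: field_simps power_divide power_add power_mult power2_eq_square power3_eq_cube)
   finally show ?case using assms rho l1 by (simp add: abs_mult add_nonneg_nonneg)
  qed
 qed
qed

lemma long_gap_per_horizon:
 assumes "\<tau> > 0" "1 <= d"
 shows "((%rho. real (long_gap rho) / real (horizon \<tau> d rho)) \<longlongrightarrow> 0) (at_right 0)"
proof -
 have "((%rho. (real (long_gap rho) * rho powr real d) / (real (horizon \<tau> d rho) * rho ^ d)) \<longlongrightarrow> 0 / \<tau>) (at_right 0)"
  using assms by (intro tendsto_divide long_gap_powr horizon_scaled) auto
 moreover have "\<forall>\<^sub>F rho in at_right 0. (real (long_gap rho) * rho powr real d) / (real (horizon \<tau> d rho) * rho ^ d)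
   = real (long_gap rho) / real (horizon \<tau> d rho)"
  using eventually_at_right_less[of "0::real"] by eventually_elim (auto simp: powr_realpow)
 ultimately show ?thesis by (simp cong: filterlim_cong add: tendsto_cong)
qed

context mixing_metric_system begin

lemma integral_power_ge:
 fixes a :: "'a => real"
 assumes a [measurable]: "a \<in> borel_measurable \<mu>" and a01: "\<And>y. 0 <= a y" "\<And>y. a y <= 1" and r: "1 <= r"
 shows "(LINT y|\<mu>. a y) ^ r <= (LINT y|\<mu>. a y ^ r)"
proof -
 let ?s = "\<integral>y. a y \<partial>\<mu>"
 have ia: "integrable \<mu> a" using a01 by (intro integrable_unit) auto
 have ir: "integrable \<mu> (%y. a y ^ r)" using a01 by (intro integrable_unit) (auto simp: power_le_one)
 have s0: "0 <= ?s" using a01 by simp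
 have "(LINT y|\<mu>. ?s ^ r + real r * ?s ^ (r - 1) * (a y - ?s)) <= (LINT y|\<mu>. a y ^ r)"
  using ia ir s0 a01 r by (intro integral_mono power_tangent_le) auto
 also have "(LINT y|\<mu>. ?s ^ r + real r * ?s ^ (r - 1) * (a y - ?s)) = ?s ^ r"
  using ia prob_space by simp
 finally show ?thesis .
qed

end

context visit_kernel begin

definition factorial_moment :: "nat => nat set => nat => real" where
 "factorial_moment m K r = (LINT y|\<mu>. esym r K (%k. isolated w \<beta> m y ((f ^^ k) y)))"

lemma iso_prod_unit:
 "(%y. \<Prod>k\<in>S. isolated w \<beta> m y ((f ^^ k) y)) \<in> borel_measurable \<mu>"
 "0 <= (\<Prod>k\<in>S. isolated w \<beta> m y ((f ^^ k) y))"
 "(\<Prod>k\<in>S. isolated w \<beta> m y ((f ^^ k) y)) <= 1"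
 using isolated_bounds by (measurable, auto intro!: prod_nonneg prod_le_1)

lemma factorial_moment_eq:
 assumes "finite K"
 shows "factorial_moment m K r = (\<Sum>S | S \<subseteq> K & card S = r. \<integral>y. (\<Prod>k\<in>S. isolated w \<beta> m y ((f ^^ k) y)) \<partial>\<mu>)"
 unfolding factorial_moment_def esym_def using assms iso_prod_unit
 by (intro Bochner_Integration.integral_sum integrable_unit) auto

lemma factorial_moment_bonferroni:
 assumes K: "finite K"
 shows "\<bar>(LINT y|\<mu>. (\<Prod>k\<in>K. 1 - isolated w \<beta> m y ((f ^^ k) y))) - (\<Sum>r<R. (-1) ^ r * factorial_moment m K r)\<bar>
   <= factorial_moment m K R"
proof -
 let ?a = "%y k. isolated w \<beta> m y ((f ^^ k) y)"
 have ie: "integrable \<mu> (%y. esym r K (?a y))" for r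
  unfolding esym_def using iso_prod_unit by (intro Bochner_Integration.integrable_sum integrable_unit) auto
 have ip: "integrable \<mu> (%y. \<Prod>k\<in>K. 1 - ?a y k)"
  using isolated_bounds by (intro integrable_unit) (auto intro!: prod_nonneg prod_le_1)
 have pw: "\<bar>(\<Prod>k\<in>K. 1 - ?a y k) - (\<Sum>r<R. (-1) ^ r * esym r K (?a y))\<bar> <= esym R K (?a y)" for y
  by (rule bonferroni_esym[OF K]) (rule isolated_bounds)+
 have iS: "integrable \<mu> (%y. \<Sum>r<R. (-1) ^ r * esym r K (?a y))"
  by (intro Bochner_Integration.integrable_sum integrable_mult_right impI ie)
 have iD: "integrable \<mu> (%y. (\<Prod>k\<in>K. 1 - ?a y k) - (\<Sum>r<R. (-1) ^ r * esym r K (?a y)))"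
  by (rule Bochner_Integration.integrable_diff[OF ip iS])
 then have iA: "integrable \<mu> (%y. \<bar>(\<Prod>k\<in>K. 1 - ?a y k) - (\<Sum>r<R. (-1) ^ r * esym r K (?a y))\<bar>)"
  by (rule integrable_abs)
 have eS: "(LINT y|\<mu>. (\<Sum>r<R. (-1) ^ r * esym r K (?a y))) = (\<Sum>r<R. (-1) ^ r * factorial_moment m K r)"
  unfolding factorial_moment_def
  by (subst Bochner_Integration.integral_sum, rule integrable_mult_right, rule ie) simp
 have "\<bar>(LINT y|\<mu>. (\<Prod>k\<in>K. 1 - ?a y k)) - (\<Sum>r<R. (-1) ^ r * factorial_moment m K r)\<bar>
   = \<bar>\<integral>y. (\<Prod>k\<in>K. 1 - ?a y k) - (\<Sum>r<R. (-1) ^ r * esym r K (?a y)) \<partial>\<mu>\<bar>"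
  unfolding Bochner_Integration.integral_diff[OF ip iS] eS ..
 also have "... <= (LINT y|\<mu>. \<bar>(\<Prod>k\<in>K. 1 - ?a y k) - (\<Sum>r<R. (-1) ^ r * esym r K (?a y))\<bar>)"
  by (rule integral_abs_bound)
 also have "... <= (LINT y|\<mu>. esym R K (?a y))"
  using pw by (intro integral_mono iA ie)
 finally show ?thesis by (simp add: factorial_moment_def)
qed

text \<open>Only separated tuples contribute, and on these the product of isolated weights is bounded by the product of the original weights, whose Lipschitz constant is polynomial in \<open>1/\<rho>\<close>. Hence separation by the short gap suffices for the upper bound.\<close>

lemma factorial_moment_upper:
 assumes r: "1 <= r" and n: "1 <= n" and mM: "m <= M"
  and mix: "\<And>S. finite S ==> card S = r ==> separated m S ==>
   (LINT y|\<mu>. (\<Prod>k\<in>S. w y ((f ^^ k) y))) <= (LINT y|\<mu>. (LINT z|\<mu>. w y z) ^ r) + err" and err: "0 <= err"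
  and hi: "\<And>y. real n * (LINT z|\<mu>. w y z) <= hi"
 shows "factorial_moment m {M<..n} r <= hi ^ r / fact r + real n ^ r * err"
proof -
 let ?K = "{M<..n}"
 let ?A = "{S. S \<subseteq> ?K & card S = r}"
 have [measurable]: "w y \<in> borel_measurable \<mu>" for y by measurable
 have w_int: "0 <= (LINT z|\<mu>. w y z)" "(LINT z|\<mu>. w y z) <= 1" for y
  using w0 w1 by (auto intro!: integral_unit)
 have hi0: "0 <= hi" using hi[of undefined] w_int(1)[of undefined]
  by (meson mult_nonneg_nonneg of_nat_0_le_iff order_trans)
 have "(LINT y|\<mu>. (LINT z|\<mu>. w y z) ^ r) <= (LINT y|\<mu>. (hi / n) ^ r)"
 proof (intro integral_mono power_mono)
  fix y show "(LINT z|\<mu>. w y z) <= hi / n" using hi[of y] n by (simp add: field_simps)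
 qed (use w_int in \<open>auto intro!: integrable_unit simp: power_le_one\<close>)
 then have mean: "(LINT y|\<mu>. (LINT z|\<mu>. w y z) ^ r) <= (hi / n) ^ r" using prob_space by simp
 have each: "(LINT y|\<mu>. (\<Prod>k\<in>S. isolated w \<beta> m y ((f ^^ k) y))) <= (hi / n) ^ r + err" if S: "S \<in> ?A" for S
 proof -
  have fS: "finite S" using S finite_subset by blast
  show ?thesis
  proof (cases "separated m S")
   case True
   have "(LINT y|\<mu>. (\<Prod>k\<in>S. isolated w \<beta> m y ((f ^^ k) y))) <= (LINT y|\<mu>. (\<Prod>k\<in>S. w y ((f ^^ k) y)))"
    using iso_prod_unit isolated_bounds w0 w1
    by (intro integral_mono integrable_unit prod_mono) (auto intro!: prod_nonneg prod_le_1)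
   then show ?thesis using mix[OF fS _ True] S mean by auto
  next
   case False
   then obtain k l where "k \<in> S" "l \<in> S" "k < l" "l < k + m"
    using S mM unfolding separated_def by (auto simp: not_le) 
   then have "(\<Prod>k\<in>S. isolated w \<beta> m y ((f ^^ k) y)) = 0" for y by (rule isolated_prod_zero[OF fS])
   then show ?thesis using hi0 err by simp
  qed
 qed
 have "factorial_moment m ?K r <= real (card ?A) * ((hi / n) ^ r + err)"
  unfolding factorial_moment_eq[OF finite_greaterThanAtMost] by (rule sum_bounded_above[OF each])
 also have "... <= (real n ^ r / fact r) * ((hi / n) ^ r + err)"
 proof (rule mult_right_mono)
  have "card ?A = (n - M) choose r" using n_subsets[of ?K r] by simp
  moreover have "((n - M) choose r) * fact r <= n ^ r"
   using binomial_fact_pow[of "n - M" r] power_mono[of "n - M" n r] by linarith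
  then have "real (((n - M) choose r) * fact r) <= real (n ^ r)" by (rule of_nat_mono)
  ultimately show "real (card ?A) <= real n ^ r / fact r" by (simp add: field_simps)
 qed (use hi0 err in auto)
 also have "... = hi ^ r / fact r + (real n ^ r * err) / fact r"
  using n by (simp add: field_simps power_divide)
 also have "(real n ^ r * err) / fact r <= real n ^ r * err"
  using divide_left_mono[OF fact_ge_1[of r, where 'a = real], of "real n ^ r * err"] err by simp
 finally show ?thesis by simp
qed

text \<open>For the lower bound the isolated weights themselves have to be mixed; their Lipschitz constant is exponential in the short gap, so only tuples separated by the long gap are kept. Jensen's inequality replaces the mean of a power by the power of a mean.\<close>

lemma factorial_moment_lower:
 assumes r: "1 <= r" and n: "r + M <= n"
  and mix: "\<And>S. finite S ==> card S = r ==> separated M S ==>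
   (LINT y|\<mu>. (LINT z|\<mu>. isolated w \<beta> m y z) ^ r) - err
    <= (LINT y|\<mu>. (\<Prod>k\<in>S. isolated w \<beta> m y ((f ^^ k) y)))" and err: "0 <= err"
  and b: "0 <= b" "b <= real n * (LINT y|\<mu>. (LINT z|\<mu>. isolated w \<beta> m y z))"
 shows "((real (n - M - r) / n) ^ r / fact r - real M / real n) * b ^ r - real n ^ r * err
  <= factorial_moment m {M<..n} r"
proof -
 let ?K = "{M<..n}"
 let ?A = "{S. S \<subseteq> ?K & card S = r}"
 let ?G = "{S. S \<subseteq> {M<..n} & card S = r & (\<forall>k\<in>S. \<forall>l\<in>S. k < l --> k + M <= l)}"
 have n1: "1 <= n" using r n by simp
 have [measurable]: "isolated w \<beta> m y \<in> borel_measurable \<mu>" for y by measurable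
 have i_int: "0 <= (LINT z|\<mu>. isolated w \<beta> m y z)" "(LINT z|\<mu>. isolated w \<beta> m y z) <= 1" for y
  using isolated_bounds by (auto intro!: integral_unit)
 have "(b / n) ^ r <= (LINT y|\<mu>. (LINT z|\<mu>. isolated w \<beta> m y z)) ^ r"
  using b n1 by (intro power_mono) (auto simp: field_simps)
 also have "... <= (LINT y|\<mu>. (LINT z|\<mu>. isolated w \<beta> m y z) ^ r)"
  using i_int r by (intro integral_power_ge) auto
 finally have mean: "(b / n) ^ r <= (LINT y|\<mu>. (LINT z|\<mu>. isolated w \<beta> m y z) ^ r)" .
 have each: "(b / n) ^ r - err <= (LINT y|\<mu>. (\<Prod>k\<in>S. isolated w \<beta> m y ((f ^^ k) y)))" if S: "S \<in> ?G" for S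
 proof -
  have "finite S" using S finite_subset by blast
  moreover have "separated M S" using S by (auto simp: separated_def)
  ultimately show ?thesis using mix[of S] S mean by auto
 qed
 have "real (card ?G) * ((b / n) ^ r - err) <= (\<Sum>S\<in>?G. \<integral>y. (\<Prod>k\<in>S. isolated w \<beta> m y ((f ^^ k) y)) \<partial>\<mu>)"
  by (rule sum_bounded_below[OF each])
 also have "... <= factorial_moment m ?K r"
  unfolding factorial_moment_eq[OF finite_greaterThanAtMost]
  using iso_prod_unit by (intro sum_mono2) (auto intro!: integral_nonneg)
 finally have 1: "real (card ?G) * ((b / n) ^ r - err) <= factorial_moment m ?K r" .
 have "real (n - M - r) ^ r / fact r - real M * real n ^ (r - 1) <= real (card ?G)"
  by (rule separated_count[OF r n])
 then have "(real (n - M - r) ^ r / fact r - real M * real n ^ (r - 1)) * (b / n) ^ r <= real (card ?G) * (b / n) ^ r"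
  using b by (intro mult_right_mono) auto
 moreover have "(real (n - M - r) ^ r / fact r - real M * real n ^ (r - 1)) * (b / n) ^ r
   = ((real (n - M - r) / n) ^ r / fact r - real M / real n) * b ^ r"
  using n1 r by (cases r) (auto simp: field_simps power_divide)
 moreover have "real (card ?G) * err <= real n ^ r * err"
 proof (rule mult_right_mono[OF _ err])
  have "card ?G <= card ?A" by (intro card_mono) auto
  also have "card ?A = (n - M) choose r" using n_subsets[of ?K r] by simp
  also have "... <= ((n - M) choose r) * fact r" by simp
  also have "... <= n ^ r"
   using binomial_fact_pow[of "n - M" r] power_mono[of "n - M" n r] by linarith
  finally have "real (card ?G) <= real (n ^ r)" by (rule of_nat_mono)
  then show "real (card ?G) <= real n ^ r" by simp
 qed
 ultimately show ?thesis using 1 by (simp add: right_diff_distrib)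
qed

text \<open>Replacing all visits by isolated visits after time \<open>M\<close> changes the product by at most the expected number of early visits and of visits that are not isolated.\<close>

lemma isolated_replacement:
 assumes Mn: "M <= n"
  and mix: "\<And>k. k \<in> {M<..n} ==> (LINT y|\<mu>. w y ((f ^^ k) y) - isolated w \<beta> m y ((f ^^ k) y))
   <= (LINT y|\<mu>. (LINT z|\<mu>. w y z - isolated w \<beta> m y z)) + err" and err: "0 <= err"
 shows "\<bar>(LINT y|\<mu>. (\<Prod>k\<in>{1..n}. 1 - w y ((f ^^ k) y))) - (LINT y|\<mu>. (\<Prod>k\<in>{M<..n}. 1 - isolated w \<beta> m y ((f ^^ k) y)))\<bar>
  <= (\<Sum>k\<in>{1..M}. \<integral>y. w y ((f ^^ k) y) \<partial>\<mu>)
   + real n * (LINT y|\<mu>. (LINT z|\<mu>. w y z - isolated w \<beta> m y z)) + real n * err"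
proof -
 define v where "v k y = (if k <= M then 0 else isolated w \<beta> m y ((f ^^ k) y))" for k y
 have v: "0 <= v k y" "v k y <= w y ((f ^^ k) y)" "v k y <= 1" for k y
  using isolated_bounds w0 by (auto simp: v_def)
 have [measurable]: "v k \<in> borel_measurable \<mu>" for k unfolding v_def by measurable
 have [measurable]: "w y \<in> borel_measurable \<mu>" "isolated w \<beta> m y \<in> borel_measurable \<mu>" for y by measurable
 have split: "{1..n} = {1..M} \<union> {M<..n}" using Mn by auto
 have "(\<Prod>k\<in>{1..n}. 1 - v k y) = (\<Prod>k\<in>{M<..n}. 1 - isolated w \<beta> m y ((f ^^ k) y))" for y
  unfolding split by (subst prod.union_disjoint) (auto simp: v_def intro!: prod.neutral prod.cong)
 note pv = this
 have iw: "integrable \<mu> (%y. \<Prod>k\<in>{1..n}. 1 - w y ((f ^^ k) y))"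
  using w0 w1 by (intro integrable_unit) (auto intro!: prod_nonneg prod_le_1)
 have iv: "integrable \<mu> (%y. \<Prod>k\<in>{1..n}. 1 - v k y)"
  using v by (intro integrable_unit) (auto intro!: prod_nonneg prod_le_1)
 have "\<bar>(LINT y|\<mu>. (\<Prod>k\<in>{1..n}. 1 - w y ((f ^^ k) y))) - (LINT y|\<mu>. (\<Prod>k\<in>{M<..n}. 1 - isolated w \<beta> m y ((f ^^ k) y)))\<bar>
  = \<bar>\<integral>y. (\<Prod>k\<in>{1..n}. 1 - w y ((f ^^ k) y)) - (\<Prod>k\<in>{1..n}. 1 - v k y) \<partial>\<mu>\<bar>"
  unfolding pv[symmetric] Bochner_Integration.integral_diff[OF iw iv] ..
 also have "... <= (LINT y|\<mu>. \<bar>(\<Prod>k\<in>{1..n}. 1 - w y ((f ^^ k) y)) - (\<Prod>k\<in>{1..n}. 1 - v k y)\<bar>)"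
  by (rule integral_abs_bound)
 also have "... <= (LINT y|\<mu>. (\<Sum>k\<in>{1..n}. w y ((f ^^ k) y) - v k y))"
 proof (intro integral_mono)
  fix y
  have "\<bar>(\<Prod>k\<in>{1..n}. 1 - w y ((f ^^ k) y)) - (\<Prod>k\<in>{1..n}. 1 - v k y)\<bar>
    <= (\<Sum>k\<in>{1..n}. \<bar>(1 - w y ((f ^^ k) y)) - (1 - v k y)\<bar>)"
   using norm_prod_diff[of "{1..n}" "%k. 1 - w y ((f ^^ k) y)" "%k. 1 - v k y"] w0 w1 v by auto
  also have "... = (\<Sum>k\<in>{1..n}. w y ((f ^^ k) y) - v k y)" using v by (intro sum.cong) auto
  finally show "\<bar>(\<Prod>k\<in>{1..n}. 1 - w y ((f ^^ k) y)) - (\<Prod>k\<in>{1..n}. 1 - v k y)\<bar>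
   <= (\<Sum>k\<in>{1..n}. w y ((f ^^ k) y) - v k y)" .
 next
  show "integrable \<mu> (%y. \<bar>(\<Prod>k\<in>{1..n}. 1 - w y ((f ^^ k) y)) - (\<Prod>k\<in>{1..n}. 1 - v k y)\<bar>)"
   by (intro integrable_abs Bochner_Integration.integrable_diff iw iv)
  show "integrable \<mu> (%y. \<Sum>k\<in>{1..n}. w y ((f ^^ k) y) - v k y)"
   using w0 w1 v by (intro Bochner_Integration.integrable_sum Bochner_Integration.integrable_diff integrable_unit) auto
 qed
 also have "... = (\<Sum>k\<in>{1..n}. \<integral>y. w y ((f ^^ k) y) - v k y \<partial>\<mu>)"
  using w0 w1 v by (intro Bochner_Integration.integral_sum Bochner_Integration.integrable_diff integrable_unit) auto
 also have "... = (\<Sum>k\<in>{1..M}. \<integral>y. w y ((f ^^ k) y) - v k y \<partial>\<mu>) + (\<Sum>k\<in>{M<..n}. \<integral>y. w y ((f ^^ k) y) - v k y \<partial>\<mu>)"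
  unfolding split by (rule sum.union_disjoint) auto
 also have "(\<Sum>k\<in>{1..M}. \<integral>y. w y ((f ^^ k) y) - v k y \<partial>\<mu>) = (\<Sum>k\<in>{1..M}. \<integral>y. w y ((f ^^ k) y) \<partial>\<mu>)"
  by (intro sum.cong) (auto simp: v_def)
 also have "(\<Sum>k\<in>{M<..n}. \<integral>y. w y ((f ^^ k) y) - v k y \<partial>\<mu>)
   <= (\<Sum>k\<in>{M<..n}. (LINT y|\<mu>. (LINT z|\<mu>. w y z - isolated w \<beta> m y z)) + err)"
  using mix by (intro sum_mono) (auto simp: v_def)
 also have "... = real (n - M) * ((LINT y|\<mu>. (LINT z|\<mu>. w y z - isolated w \<beta> m y z)) + err)" by simp
 also have "... <= real n * ((LINT y|\<mu>. (LINT z|\<mu>. w y z - isolated w \<beta> m y z)) + err)"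
  using err isolated_bounds by (intro mult_right_mono add_nonneg_nonneg integral_nonneg) auto
 finally show ?thesis by (simp add: distrib_left)
qed

end

section \<open>The Poisson limit for a family of kernels\<close>

context visit_kernel begin

lemma mean_loss:
 "(LINT y|\<mu>. (LINT z|\<mu>. w y z - isolated w \<beta> m y z))
  <= (LINT y|\<mu>. (\<Sum>g\<in>{1..<m}. \<integral>z. w y z * \<beta> y ((f ^^ g) z) \<partial>\<mu>))"
proof -
 have [measurable]: "w y \<in> borel_measurable \<mu>" "\<beta> y \<in> borel_measurable \<mu>"
  "isolated w \<beta> m y \<in> borel_measurable \<mu>" for y by measurable
 have iwb: "integrable \<mu> (%z. w y z * \<beta> y ((f ^^ g) z))" for y g
  using w0 w1 \<beta>0 \<beta>1 by (intro integrable_unit) (auto intro!: mult_nonneg_nonneg mult_le_one)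
 have iwi: "integrable \<mu> (%z. w y z - isolated w \<beta> m y z)" for y
  using w0 w1 isolated_bounds by (intro Bochner_Integration.integrable_diff integrable_unit) auto
 have le: "(LINT z|\<mu>. w y z - isolated w \<beta> m y z) <= (\<Sum>g\<in>{1..<m}. \<integral>z. w y z * \<beta> y ((f ^^ g) z) \<partial>\<mu>)" for y
 proof -
  have "(LINT z|\<mu>. w y z - isolated w \<beta> m y z) <= (LINT z|\<mu>. (\<Sum>g\<in>{1..<m}. w y z * \<beta> y ((f ^^ g) z)))"
   by (intro integral_mono iwi Bochner_Integration.integrable_sum iwb isolated_loss)
  then show ?thesis by (simp add: Bochner_Integration.integral_sum iwb)
 qed
 have u: "0 <= (LINT z|\<mu>. w y z * \<beta> y ((f ^^ g) z))" "(LINT z|\<mu>. w y z * \<beta> y ((f ^^ g) z)) <= 1" for y g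
  using w0 w1 \<beta>0 \<beta>1 by (auto intro!: integral_unit mult_nonneg_nonneg mult_le_one)
 have i0: "0 <= (LINT z|\<mu>. w y z - isolated w \<beta> m y z)" for y
  by (rule Bochner_Integration.integral_nonneg) (use isolated_bounds in simp)
 have i1: "(LINT z|\<mu>. w y z - isolated w \<beta> m y z) <= 1" for y
  using isolated_bounds w1 w0 by (intro integral_unit) (auto intro: add_increasing2 simp: le_diff_eq diff_le_eq)
 show ?thesis
 proof (rule integral_mono[OF _ _ le])
  show "integrable \<mu> (%y. \<integral>z. w y z - isolated w \<beta> m y z \<partial>\<mu>)"
   using i0 i1 by (intro integrable_unit) auto
  show "integrable \<mu> (%y. \<Sum>g\<in>{1..<m}. \<integral>z. w y z * \<beta> y ((f ^^ g) z) \<partial>\<mu>)"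
   using u by (intro Bochner_Integration.integrable_sum integrable_unit) auto
 qed
qed

lemma mean_split:
 assumes "\<And>y. lo <= real n * (LINT z|\<mu>. w y z)"
 shows "lo - real n * (LINT y|\<mu>. (LINT z|\<mu>. w y z - isolated w \<beta> m y z))
  <= real n * (LINT y|\<mu>. (LINT z|\<mu>. isolated w \<beta> m y z))"
proof -
 have [measurable]: "w y \<in> borel_measurable \<mu>" "isolated w \<beta> m y \<in> borel_measurable \<mu>" for y by measurable
 have iw: "integrable \<mu> (w y)" "integrable \<mu> (isolated w \<beta> m y)" for y
  using w0 w1 isolated_bounds by (auto intro!: integrable_unit)
 have u: "0 <= (LINT z|\<mu>. w y z)" "(LINT z|\<mu>. w y z) <= 1"
   "0 <= (LINT z|\<mu>. isolated w \<beta> m y z)" "(LINT z|\<mu>. isolated w \<beta> m y z) <= 1" for y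
  using w0 w1 isolated_bounds by (auto intro!: integral_unit)
 have iI: "integrable \<mu> (%y. \<integral>z. w y z \<partial>\<mu>)" "integrable \<mu> (%y. \<integral>z. isolated w \<beta> m y z \<partial>\<mu>)"
  using u by (auto intro!: integrable_unit)
 have "(LINT y|\<mu>. lo) <= (LINT y|\<mu>. real n * (LINT z|\<mu>. w y z))"
  using assms iI by (intro integral_mono) auto
 then have "lo <= real n * (LINT y|\<mu>. (LINT z|\<mu>. w y z))" using prob_space by simp
 moreover have "(LINT y|\<mu>. (LINT z|\<mu>. w y z - isolated w \<beta> m y z))
  = (LINT y|\<mu>. (LINT z|\<mu>. w y z)) - (LINT y|\<mu>. (LINT z|\<mu>. isolated w \<beta> m y z))"
  by (simp add: Bochner_Integration.integral_diff iw iI)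
 ultimately show ?thesis by (simp add: right_diff_distrib)
qed

end

context mixing_metric_system begin

text \<open>The generating function of the number of visits. The hypotheses are the three classical ones: the expected number of visits has a limit, uniformly in the base point; visits are not followed by further visits within the short gap; and there are no visits at very early times. The two-sided slack \<open>\<delta>\<close> in the mean allows a later approximation of discontinuous targets.\<close>

theorem poisson_limit:
 fixes w \<beta> :: "real => 'a => 'a => real"
 defines "R \<equiv> %rho. \<integral>y. (\<Sum>g\<in>{1..<short_gap rho}. \<integral>z. w rho y z * \<beta> rho y ((f ^^ g) z) \<partial>\<mu>) \<partial>\<mu>"
 assumes \<tau>: "\<tau> > 0" and d: "1 <= d" and lam: "0 <= lam" and delta: "0 <= delta"
  and ker: "\<forall>\<^sub>F rho in at_right 0. visit_kernel \<mu> D f \<Lambda> (w rho) (\<beta> rho) (inverse (rho\<^sup>2))"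
  and mean: "\<forall>\<^sub>F rho in at_right 0. \<forall>y. \<bar>real (horizon \<tau> d rho) * (LINT z|\<mu>. w rho y z) - lam\<bar> <= delta"
  and rec: "((%rho. real (horizon \<tau> d rho) * R rho) \<longlongrightarrow> 0) (at_right 0)"
  and early: "((%rho. \<Sum>k\<in>{1..long_gap rho}. \<integral>y. w rho y ((f ^^ k) y) \<partial>\<mu>) \<longlongrightarrow> 0) (at_right 0)"
  and eps: "eps > 0"
 shows "\<forall>\<^sub>F rho in at_right 0. \<bar>(LINT y|\<mu>. (\<Prod>k\<in>{1..horizon \<tau> d rho}. 1 - w rho y ((f ^^ k) y))) - exp (- lam)\<bar>
   < exp (lam + delta) - exp (max 0 (lam - delta)) + eps"
proof -
 define n where "n = horizon \<tau> d"
 define m where "m = short_gap"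
 define M where "M = long_gap"
 define L where "L rho = inverse (rho\<^sup>2)" for rho :: real
 define K where "K rho = {M rho<..n rho}" for rho
 define v where "v rho = isolated (w rho) (\<beta> rho) (m rho)" for rho
 define V where "V rho = (LINT y|\<mu>. (\<Prod>k\<in>K rho. 1 - v rho y ((f ^^ k) y)))" for rho
 define E where "E r rho = (LINT y|\<mu>. esym r (K rho) (%k. v rho y ((f ^^ k) y)))" for r rho
 define lo where "lo = max 0 (lam - delta)"
 define hi where "hi = lam + delta"
 note defs = n_def m_def M_def L_def K_def v_def V_def E_def
 have E_eq: "E r rho = visit_kernel.factorial_moment \<mu> f (w rho) (\<beta> rho) (m rho) {M rho<..n rho} r"
  if "visit_kernel \<mu> D f \<Lambda> (w rho) (\<beta> rho) (inverse (rho\<^sup>2))" for r rho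
  using visit_kernel.factorial_moment_def[OF that] by (simp add: defs)
 have n_top: "filterlim (%rho. real (n rho)) at_top (at_right 0)" unfolding n_def by (rule horizon_at_top[OF \<tau> d])
 have Mn: "((%rho. real (M rho) / real (n rho)) \<longlongrightarrow> 0) (at_right 0)"
  unfolding M_def n_def by (rule long_gap_per_horizon[OF \<tau> d])
 have room: "\<forall>\<^sub>F rho in at_right 0. r + M rho <= n rho" for r
 proof -
  have "\<forall>\<^sub>F rho in at_right 0. real (M rho) / real (n rho) < 1 / 2" using Mn by (rule order_tendstoD) simp
  moreover have "\<forall>\<^sub>F rho in at_right 0. real (n rho) > 2 * real r" using n_top by (simp add: filterlim_at_top_dense)
  ultimately show ?thesis
  proof eventually_elim
   case (elim rho)
   then have "real (M rho) < real (n rho) / 2" by (simp add: field_simps)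
   then show ?case using elim(2) by linarith
  qed
 qed
 have mM: "\<forall>\<^sub>F rho in at_right 0. m rho <= M rho" unfolding m_def M_def by (rule short_le_long_gap)
 have mean_hi: "\<forall>\<^sub>F rho in at_right 0. \<forall>y. real (n rho) * (LINT z|\<mu>. w rho y z) <= hi"
  using mean unfolding n_def by eventually_elim (auto simp: hi_def abs_le_iff algebra_simps)
 have mean_lo: "\<forall>\<^sub>F rho in at_right 0. \<forall>y. lam - delta <= real (n rho) * (LINT z|\<mu>. w rho y z)"
  using mean unfolding n_def by eventually_elim (auto simp: abs_le_iff algebra_simps)
 have ker': "\<forall>\<^sub>F rho in at_right 0. visit_kernel \<mu> D f \<Lambda> (w rho) (\<beta> rho) (L rho)" using ker by (simp add: L_def)
 have pos: "\<forall>\<^sub>F rho::real in at_right 0. 0 < rho" by (rule eventually_at_right_less)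

 have bonf: "\<forall>\<^sub>F rho in at_right 0. \<bar>V rho - (\<Sum>r<q. (-1) ^ r * E r rho)\<bar> <= E q rho" for q
  using ker
 proof eventually_elim
  case (elim rho)
  then interpret visit_kernel \<mu> D f \<Lambda> "w rho" "\<beta> rho" "inverse (rho\<^sup>2)" .
  show ?case using factorial_moment_bonferroni[of "{M rho<..n rho}" "m rho" q] E_eq[OF elim]
   by (simp add: V_def v_def K_def)
 qed
 have up: "\<forall>\<^sub>F rho in at_right 0. E r rho <= hi ^ r / fact r + e" if e: "e > 0" for r e
 proof (cases "r = 0")
  case True
  then show ?thesis using e prob_space by (simp add: E_def esym_0 K_def)
 next
  case False
  then have r: "1 <= r" by simp
  from product_mixing[OF r] obtain C theta where C: "C > 0" "0 < theta" "theta < 1" and mix: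
   "\<And>w L m S. case_prod w \<in> borel_measurable (\<mu> \<Otimes>\<^sub>M \<mu>) & (\<forall>y z. 0 <= w y z & w y z <= 1) & 0 <= L &
  (\<forall>y z y' z'. \<bar>w y z - w y' z'\<bar> <= L * (D y y' + D z z')) &
  finite S & card S = r & separated m S ==>
  \<bar>(LINT y|\<mu>. (\<Prod>k\<in>S. w y ((f ^^ k) y))) - (LINT y|\<mu>. (LINT z|\<mu>. w y z) ^ r)\<bar> <= C * theta ^ m * (1 + L)" by blast
  have "\<forall>\<^sub>F rho in at_right 0. real (n rho) ^ r * (C * theta ^ m rho * (1 + L rho)) < e"
   unfolding n_def m_def L_def by (rule order_tendstoD(2)[OF scaled_short_gap_decay[OF C(2,3) \<tau> C(1)] e])
  with ker mM room[of 1] mean_hi show ?thesis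
  proof eventually_elim
   case (elim rho)
   then interpret visit_kernel \<mu> D f \<Lambda> "w rho" "\<beta> rho" "inverse (rho\<^sup>2)" by simp
   let ?err = "C * theta ^ m rho * (1 + L rho)"
   have err: "0 <= ?err" using C L0 by (simp add: L_def)
   have "E r rho <= hi ^ r / fact r + real (n rho) ^ r * ?err"
    unfolding E_eq[OF elim(1)]
   proof (rule factorial_moment_upper[OF r _ elim(2) _ err])
    show "1 <= n rho" using elim(3) by simp
    show "real (n rho) * (LINT z|\<mu>. w rho y z) <= hi" for y using elim(4) by simp
    fix S assume S: "finite S" "card S = r" "separated (m rho) S"
    have "\<bar>(LINT y|\<mu>. (\<Prod>k\<in>S. w rho y ((f ^^ k) y))) - (LINT y|\<mu>. (LINT z|\<mu>. w rho y z) ^ r)\<bar> <= ?err"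
     by (rule mix) (use S w_meas w0 w1 L0 w_Lip in \<open>auto simp: jointly_Lipschitz_def L_def\<close>)
    then show "(LINT y|\<mu>. (\<Prod>k\<in>S. w rho y ((f ^^ k) y))) <= (LINT y|\<mu>. (LINT z|\<mu>. w rho y z) ^ r) + ?err"
     by linarith
   qed
   then show ?case using elim(5) by linarith
  qed
 qed
 have R0: "\<forall>\<^sub>F rho in at_right 0. real (n rho) * (LINT y|\<mu>. (LINT z|\<mu>. w rho y z - v rho y z)) <= real (n rho) * R rho"
  using ker
 proof eventually_elim
  case (elim rho)
  then interpret visit_kernel \<mu> D f \<Lambda> "w rho" "\<beta> rho" "inverse (rho\<^sup>2)" .
  show ?case using mean_loss[of "m rho"] unfolding v_def R_def m_def by (intro mult_left_mono) auto
 qed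
 have low: "\<forall>\<^sub>F rho in at_right 0. lo ^ r / fact r - e <= E r rho" if e: "e > 0" for r e
 proof (cases "r = 0")
  case True
  then show ?thesis using e prob_space by (simp add: E_def esym_0 K_def)
 next
  case False
  then have r: "1 <= r" by simp
  from product_mixing[OF r] obtain C theta where C: "C > 0" "0 < theta" "theta < 1" and mix:
   "\<And>w L m S. case_prod w \<in> borel_measurable (\<mu> \<Otimes>\<^sub>M \<mu>) & (\<forall>y z. 0 <= w y z & w y z <= 1) & 0 <= L &
  (\<forall>y z y' z'. \<bar>w y z - w y' z'\<bar> <= L * (D y y' + D z z')) &
  finite S & card S = r & separated m S ==>
  \<bar>(LINT y|\<mu>. (\<Prod>k\<in>S. w y ((f ^^ k) y))) - (LINT y|\<mu>. (LINT z|\<mu>. w y z) ^ r)\<bar> <= C * theta ^ m * (1 + L)" by blast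
  define err where "err rho = C * theta ^ M rho * (1 + L rho * (2 + real (m rho) * \<Lambda> ^ m rho))" for rho
  define b where "b rho = max 0 (lam - delta - real (n rho) * R rho)" for rho
  define q where "q rho = real (n rho - M rho - r) / real (n rho)" for rho
  have lim_err: "((%rho. real (n rho) ^ r * err rho) \<longlongrightarrow> 0) (at_right 0)"
   unfolding n_def err_def M_def L_def m_def by (rule scaled_long_gap_decay[OF C(2,3) \<tau> C(1) \<Lambda>_ge_1])
  have lim_b: "(b \<longlongrightarrow> lo) (at_right 0)"
  proof -
   have "((%rho. max 0 (lam - delta - real (n rho) * R rho)) \<longlongrightarrow> max 0 (lam - delta - 0)) (at_right 0)"
    using rec unfolding n_def by (intro tendsto_max tendsto_const tendsto_diff)
   moreover have "b = (%rho. max 0 (lam - delta - real (n rho) * R rho))" by (simp add: b_def fun_eq_iff)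
   ultimately show ?thesis by (simp add: lo_def)
  qed
  have lim_q: "(q \<longlongrightarrow> 1) (at_right 0)"
  proof -
   have "((%rho. real r / real (n rho)) \<longlongrightarrow> 0) (at_right 0)"
    by (rule tendsto_divide_0[OF tendsto_const filterlim_at_top_imp_at_infinity[OF n_top]])
   then have "((%rho. 1 - real (M rho) / real (n rho) - real r / real (n rho)) \<longlongrightarrow> 1 - 0 - 0) (at_right 0)"
    by (intro tendsto_diff tendsto_const Mn)
   moreover have "\<forall>\<^sub>F rho in at_right 0. 1 - real (M rho) / real (n rho) - real r / real (n rho) = q rho"
    using room[of r]
   proof eventually_elim
    case (elim rho)
    then have "real (n rho - M rho - r) = real (n rho) - real (M rho) - real r" "n rho > 0" using r by linarith+
    then show ?case by (simp add: q_def field_simps)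
   qed
   ultimately show ?thesis by (simp add: tendsto_cong)
  qed
  have "((%rho. (q rho ^ r / fact r - real (M rho) / real (n rho)) * b rho ^ r - real (n rho) ^ r * err rho)
    \<longlongrightarrow> (1 ^ r / fact r - 0) * lo ^ r - 0) (at_right 0)"
   by (intro tendsto_intros lim_q Mn lim_b lim_err) simp
  then have "\<forall>\<^sub>F rho in at_right 0. lo ^ r / fact r - e
    < (q rho ^ r / fact r - real (M rho) / real (n rho)) * b rho ^ r - real (n rho) ^ r * err rho"
   by (rule order_tendstoD) (use e in simp)
  with ker mM room[of r] mean_lo R0 show ?thesis
  proof eventually_elim
   case (elim rho)
   then interpret visit_kernel \<mu> D f \<Lambda> "w rho" "\<beta> rho" "inverse (rho\<^sup>2)" by simp
   have l1: "0 <= real (m rho) * \<Lambda> ^ m rho" using \<Lambda>_ge_1 by simp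
   have L00: "0 <= L rho" by (simp add: L_def)
   have "0 <= L rho * (2 + real (m rho) * \<Lambda> ^ m rho)" using L00 l1 by simp
   then have err: "0 <= err rho" using C unfolding err_def by simp
   have "(q rho ^ r / fact r - real (M rho) / real (n rho)) * b rho ^ r - real (n rho) ^ r * err rho <= E r rho"
    unfolding E_eq[OF elim(1)] q_def
   proof (rule factorial_moment_lower[OF r elim(3) _ err])
    show "0 <= b rho" by (simp add: b_def)
    have "lam - delta - real (n rho) * R rho <= real (n rho) * (LINT y|\<mu>. (LINT z|\<mu>. v rho y z))"
     using mean_split[of "lam - delta" "n rho" "m rho"] elim(4,5) unfolding v_def by (auto intro: order_trans[rotated])
    moreover have "0 <= real (n rho) * (LINT y|\<mu>. (LINT z|\<mu>. v rho y z))"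
     using isolated_bounds(1) unfolding v_def by (intro mult_nonneg_nonneg integral_nonneg) auto
    ultimately show "b rho <= real (n rho) * (LINT y|\<mu>. (LINT z|\<mu>. isolated (w rho) (\<beta> rho) (m rho) y z))"
     unfolding v_def b_def by simp
    fix S assume S: "finite S" "card S = r" "separated (M rho) S"
    let ?L' = "L rho * (1 + real (m rho) * \<Lambda> ^ m rho)"
    have L': "0 <= ?L'" using L00 l1 by simp
    have "\<bar>(LINT y|\<mu>. (\<Prod>k\<in>S. v rho y ((f ^^ k) y))) - (LINT y|\<mu>. (LINT z|\<mu>. v rho y z) ^ r)\<bar>
      <= C * theta ^ M rho * (1 + ?L')"
     unfolding v_def
     by (rule mix) (use S isolated_measurable isolated_bounds L' isolated_Lipschitz[of "m rho"] in
      \<open>auto simp: jointly_Lipschitz_def L_def\<close>)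
    also have "... <= err rho" unfolding err_def
     using C L00 by (intro mult_left_mono add_left_mono) auto
    finally show "(LINT y|\<mu>. (LINT z|\<mu>. isolated (w rho) (\<beta> rho) (m rho) y z) ^ r) - err rho
     <= (LINT y|\<mu>. (\<Prod>k\<in>S. isolated (w rho) (\<beta> rho) (m rho) y ((f ^^ k) y)))"
     unfolding v_def by linarith
   qed
   then show ?case using elim(6) by linarith
  qed
 qed
 have main: "\<forall>\<^sub>F rho in at_right 0. \<bar>V rho - exp (- lam)\<bar> < exp hi - exp lo + eps / 2"
  by (rule poisson_limit_from_factorial_moments[OF _ _ _ bonf up low]) (use lam delta eps in \<open>auto simp: lo_def hi_def\<close>)
 have "\<forall>\<^sub>F rho in at_right 0. \<bar>(LINT y|\<mu>. (\<Prod>k\<in>{1..n rho}. 1 - w rho y ((f ^^ k) y))) - V rho\<bar> < eps / 2"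
 proof -
  from product_mixing[of 1] obtain C theta where C: "C > 0" "0 < theta" "theta < 1" and mix:
   "\<And>w L m S. case_prod w \<in> borel_measurable (\<mu> \<Otimes>\<^sub>M \<mu>) & (\<forall>y z. 0 <= w y z & w y z <= 1) & 0 <= L &
  (\<forall>y z y' z'. \<bar>w y z - w y' z'\<bar> <= L * (D y y' + D z z')) &
  finite S & card S = 1 & separated m S ==>
  \<bar>(LINT y|\<mu>. (\<Prod>k\<in>S. w y ((f ^^ k) y))) - (LINT y|\<mu>. (LINT z|\<mu>. w y z) ^ 1)\<bar> <= C * theta ^ m * (1 + L)" by blast
  define err where "err rho = C * theta ^ M rho * (1 + L rho * (2 + real (m rho) * \<Lambda> ^ m rho))" for rho
  have "((%rho. real (n rho) ^ 1 * err rho) \<longlongrightarrow> 0) (at_right 0)"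
   unfolding n_def err_def M_def L_def m_def by (rule scaled_long_gap_decay[OF C(2,3) \<tau> C(1) \<Lambda>_ge_1])
  then have "((%rho. (\<Sum>k\<in>{1..M rho}. \<integral>y. w rho y ((f ^^ k) y) \<partial>\<mu>) + real (n rho) * R rho + real (n rho) * err rho)
    \<longlongrightarrow> 0 + 0 + 0) (at_right 0)"
   using early rec unfolding M_def n_def by (intro tendsto_add) auto
  then have "\<forall>\<^sub>F rho in at_right 0. (\<Sum>k\<in>{1..M rho}. \<integral>y. w rho y ((f ^^ k) y) \<partial>\<mu>) + real (n rho) * R rho + real (n rho) * err rho < eps / 2"
   by (rule order_tendstoD) (use eps in simp)
  with ker room[of 0] R0 pos show ?thesis
  proof eventually_elim
   case (elim rho)
   then interpret visit_kernel \<mu> D f \<Lambda> "w rho" "\<beta> rho" "inverse (rho\<^sup>2)" by simp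
   have l1: "0 <= real (m rho) * \<Lambda> ^ m rho" using \<Lambda>_ge_1 by simp
   have L00: "0 <= L rho" by (simp add: L_def)
   have L2: "0 <= L rho * (2 + real (m rho) * \<Lambda> ^ m rho)" using L00 l1 by simp
   have err: "0 <= err rho" using C L2 unfolding err_def by simp
   define u where "u y z = w rho y z - isolated (w rho) (\<beta> rho) (m rho) y z" for y z
   have u01: "0 <= u y z" "u y z <= 1" for y z
    using isolated_bounds(1,2)[of "m rho" y z] w1[of y z] by (auto simp: u_def)
   have uL: "\<bar>u y z - u y' z'\<bar> <= (L rho * (2 + real (m rho) * \<Lambda> ^ m rho)) * (D y y' + D z z')" for y z y' z'
   proof -
    let ?v = "isolated (w rho) (\<beta> rho) (m rho)"
    have "\<bar>u y z - u y' z'\<bar> <= \<bar>w rho y z - w rho y' z'\<bar> + \<bar>?v y z - ?v y' z'\<bar>" by (simp add: u_def)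
    also have "... <= L rho * (D y y' + D z z') + L rho * (1 + real (m rho) * \<Lambda> ^ m rho) * (D y y' + D z z')"
     using w_Lip isolated_Lipschitz[of "m rho"] unfolding jointly_Lipschitz_def L_def by (intro add_mono) blast+
    finally show ?thesis by (simp add: algebra_simps)
   qed
   have um: "case_prod u \<in> borel_measurable (\<mu> \<Otimes>\<^sub>M \<mu>)"
    unfolding u_def case_prod_unfold using w_meas isolated_measurable by measurable
   have "\<bar>(LINT y|\<mu>. (\<Prod>k\<in>{1..n rho}. 1 - w rho y ((f ^^ k) y))) - (LINT y|\<mu>. (\<Prod>k\<in>{M rho<..n rho}. 1 - isolated (w rho) (\<beta> rho) (m rho) y ((f ^^ k) y)))\<bar>
    <= (\<Sum>k\<in>{1..M rho}. \<integral>y. w rho y ((f ^^ k) y) \<partial>\<mu>)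
     + real (n rho) * (LINT y|\<mu>. (LINT z|\<mu>. w rho y z - isolated (w rho) (\<beta> rho) (m rho) y z)) + real (n rho) * err rho"
   proof (rule isolated_replacement[OF _ _ err])
    show "M rho <= n rho" using elim(2) by simp
    fix k assume k: "k \<in> {M rho<..n rho}"
    have "\<bar>(LINT y|\<mu>. (\<Prod>k\<in>{k}. u y ((f ^^ k) y))) - (LINT y|\<mu>. (LINT z|\<mu>. u y z) ^ 1)\<bar>
      <= C * theta ^ M rho * (1 + L rho * (2 + real (m rho) * \<Lambda> ^ m rho))"
     by (rule mix) (use um u01 L2 uL k in \<open>auto simp: separated_def\<close>)
    then show "(LINT y|\<mu>. w rho y ((f ^^ k) y) - isolated (w rho) (\<beta> rho) (m rho) y ((f ^^ k) y))
      <= (LINT y|\<mu>. (LINT z|\<mu>. w rho y z - isolated (w rho) (\<beta> rho) (m rho) y z)) + err rho"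
     unfolding u_def err_def by simp
   qed
   then show ?case using elim(3,5) unfolding V_def v_def K_def by linarith
  qed
 qed
 with main show ?thesis unfolding hi_def lo_def n_def
  by eventually_elim linarith
qed

end

section \<open>Short returns\<close>

definition ramp :: "real => real => real => real" where
 "ramp a b t = max 0 (min 1 ((b - t) / (b - a)))"

lemma ramp_bounds: "0 <= ramp a b t" "ramp a b t <= 1"
 by (auto simp: ramp_def)

lemma ramp_one: "a < b ==> t <= a ==> ramp a b t = 1"
 by (auto simp: ramp_def max_def min_def field_simps)

lemma ramp_zero: "a < b ==> b <= t ==> ramp a b t = 0"
 by (auto simp: ramp_def max_def min_def field_simps)

lemma ramp_Lipschitz: "a < b ==> \<bar>ramp a b t - ramp a b u\<bar> <= \<bar>t - u\<bar> / (b - a)"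
proof -
 assume "a < b"
 have "\<bar>ramp a b t - ramp a b u\<bar> <= \<bar>(b - t) / (b - a) - (b - u) / (b - a)\<bar>"
  unfolding ramp_def by linarith
 also have "... = \<bar>t - u\<bar> / (b - a)"
  using \<open>a < b\<close> by (simp add: abs_minus_commute flip: diff_divide_distrib)
 finally show ?thesis .
qed

lemma ramp_measurable [measurable]: "ramp a b \<in> borel_measurable borel"
 unfolding ramp_def by measurable

locale mixing_metric_space = mixing_metric_system +
 fixes d :: nat and \<gamma> :: "'a => real" and c G :: real
 assumes d_ge_1: "1 <= d" and c_pos: "0 < c" and \<gamma>_ge: "c <= \<gamma> x" and \<gamma>_le: "\<gamma> x <= G"
  and volume: "eps > 0 ==> \<exists>r0>0. \<forall>x rho. 0 < rho & rho < r0 -->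
    \<bar>measure \<mu> {y. D x y < rho} - \<gamma> x * rho ^ d\<bar> <= eps * rho ^ d"
  and \<gamma>_continuous: "eps > 0 ==> \<exists>delta>0. \<forall>x y. D x y < delta --> \<bar>\<gamma> x - \<gamma> y\<bar> < eps"
  and continuous_measurable: "\<And>h :: 'a => real. (\<And>eps. eps > 0 ==> \<exists>delta>0. \<forall>x y. D x y < delta --> \<bar>h x - h y\<bar> < eps) ==> h \<in> borel_measurable \<mu>"
begin

lemma sets_UNIV_D [measurable (raw)]:
 assumes "u \<in> \<mu> \<rightarrow>\<^sub>M \<mu>" "v \<in> \<mu> \<rightarrow>\<^sub>M \<mu>"
 shows "{y. D (u y) (v y) < rho} \<in> sets \<mu>"
proof -
 note assms [measurable]
 have "{y \<in> space \<mu>. D (u y) (v y) < rho} \<in> sets \<mu>" by measurable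
 then show ?thesis by simp
qed

lemma ball_sets [measurable]: "{y. D x y < rho} \<in> sets \<mu>"
 by (rule sets_UNIV_D) auto

lemma volume_upper: "\<exists>H\<ge>1. \<forall>x s. 0 < s --> measure \<mu> {y. D x y < s} <= H * s ^ d"
proof -
 obtain r0 where r0: "r0 > 0" "\<And>x rho. 0 < rho ==> rho < r0 ==> \<bar>measure \<mu> {y. D x y < rho} - \<gamma> x * rho ^ d\<bar> <= 1 * rho ^ d"
  using volume[of 1] by auto
 define H where "H = max (max 1 (G + 1)) (1 / r0 ^ d)"
 have "measure \<mu> {y. D x y < s} <= H * s ^ d" if s: "0 < s" for x s
 proof (cases "s < r0")
  case True
  have "measure \<mu> {y. D x y < s} <= (\<gamma> x + 1) * s ^ d" using r0(2)[OF s True, of x] by (simp add: algebra_simps abs_le_iff)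
  also have "... <= H * s ^ d"
   using s \<gamma>_le[of x] by (intro mult_right_mono) (auto simp: H_def)
  finally show ?thesis .
 next
  case False
  have "measure \<mu> {y. D x y < s} <= 1" by simp
  also have "1 <= (1 / r0 ^ d) * s ^ d" using False r0(1) by (simp add: field_simps power_mono)
  also have "... <= H * s ^ d" using s by (intro mult_right_mono) (auto simp: H_def)
  finally show ?thesis .
 qed
 then show ?thesis by (intro exI[of _ H]) (auto simp: H_def)
qed

text \<open>A return at time \<open>n\<close> is nearly repeated at all multiples of \<open>n\<close>.\<close>

lemma D_iterate: "D x ((f ^^ (q * n)) x) <= (2 * \<Lambda>) ^ (q * n) * D x ((f ^^ n) x)" if "1 <= n"
proof -
 have "D x ((f ^^ (q * n)) x) <= real q * \<Lambda> ^ (q * n) * D x ((f ^^ n) x)"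
 proof (induction q)
  case 0
  then show ?case by (simp add: D_refl)
 next
  case (Suc q)
  let ?t = "D x ((f ^^ n) x)"
  have e: "(f ^^ (Suc q * n)) x = (f ^^ (q * n)) ((f ^^ n) x)"
   by (metis add.commute comp_apply funpow_add mult_Suc)
  have "D x ((f ^^ (Suc q * n)) x) <= D x ((f ^^ (q * n)) x) + D ((f ^^ (q * n)) x) ((f ^^ (q * n)) ((f ^^ n) x))"
   unfolding e by (rule D_tri)
  also have "... <= real q * \<Lambda> ^ (q * n) * ?t + \<Lambda> ^ (q * n) * ?t"
   using Suc f_iter_Lipschitz by (rule add_mono)
  also have "... = real (Suc q) * (\<Lambda> ^ (q * n) * ?t)" by (simp add: algebra_simps)
  also have "... <= real (Suc q) * (\<Lambda> ^ (Suc q * n) * ?t)"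
   using D_nonneg \<Lambda>_ge_1 by (intro mult_left_mono mult_right_mono power_increasing) auto
  finally show ?case by (simp add: mult.assoc)
 qed
 also have "real q <= 2 ^ (q * n)"
 proof -
  have "q * 1 <= q * n" using that by (intro mult_le_mono2)
  then have "q < 2 ^ (q * n)" using less_exp[of "q * n"] by linarith
  then have "real q < real (2 ^ (q * n))" by (rule of_nat_less_iff[THEN iffD2])
  then show ?thesis by simp
 qed
 finally show ?thesis using D_nonneg \<Lambda>_ge_1
  by (simp add: power_mult_distrib mult_right_mono)
qed

text \<open>At times \<open>l\<close> with \<open>\<theta> ^ l \<le> s\<^sup>2\<close> two-fold mixing makes \<open>x\<close> and its image independent enough to bound the probability of an \<open>s\<close>-return by the measure of an \<open>s\<close>-ball.\<close>

lemma return_at_mixing_scale: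
 "\<exists>C>0. \<exists>theta. 0 < theta & theta < 1 & (\<forall>l s. 0 < s & s <= 1 & theta ^ l <= s\<^sup>2 -->
   measure \<mu> {x. D x ((f ^^ l) x) < s} <= C * s)"
proof -
 obtain H where H: "H \<ge> 1" "\<And>x s. 0 < s ==> measure \<mu> {y. D x y < s} <= H * s ^ d"
  using volume_upper by blast
 from product_mixing[of 1] obtain C theta where C: "C > 0" "0 < theta" "theta < 1" and mix:
   "\<And>w L m S. case_prod w \<in> borel_measurable (\<mu> \<Otimes>\<^sub>M \<mu>) & (\<forall>y z. 0 <= w y z & w y z <= 1) & 0 <= L &
  (\<forall>y z y' z'. \<bar>w y z - w y' z'\<bar> <= L * (D y y' + D z z')) &
  finite S & card S = 1 & separated m S ==>
  \<bar>(LINT y|\<mu>. (\<Prod>k\<in>S. w y ((f ^^ k) y))) - (LINT y|\<mu>. (LINT z|\<mu>. w y z) ^ 1)\<bar> <= C * theta ^ m * (1 + L)" by blast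
 have "measure \<mu> {x. D x ((f ^^ l) x) < s} <= (H * 2 ^ d + 2 * C) * s"
  if s: "0 < s" "s <= 1" "theta ^ l <= s\<^sup>2" for l s
 proof -
  define w where "w y z = ramp s (2 * s) (D y z)" for y z
  have wm [measurable]: "case_prod w \<in> borel_measurable (\<mu> \<Otimes>\<^sub>M \<mu>)"
   unfolding w_def case_prod_unfold by measurable
  have [measurable]: "w y \<in> borel_measurable \<mu>" for y by measurable
  have w01: "0 <= w y z" "w y z <= 1" for y z by (simp_all add: w_def ramp_bounds)
  have wL: "\<bar>w y z - w y' z'\<bar> <= (1 / s) * (D y y' + D z z')" for y z y' z'
  proof -
   have "\<bar>w y z - w y' z'\<bar> <= \<bar>D y z - D y' z'\<bar> / (2 * s - s)"
    unfolding w_def using s by (intro ramp_Lipschitz) simp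
   also have "... <= (D y y' + D z z') / s" using D_diff_le[of y z y' z'] s by (simp add: divide_right_mono)
   finally show ?thesis by simp
  qed
  have "\<bar>(LINT y|\<mu>. (\<Prod>k\<in>{l}. w y ((f ^^ k) y))) - (LINT y|\<mu>. (LINT z|\<mu>. w y z) ^ 1)\<bar> <= C * theta ^ l * (1 + 1 / s)"
   by (rule mix) (use wm w01 wL s in \<open>auto simp: separated_def\<close>)
  then have "(LINT y|\<mu>. w y ((f ^^ l) y)) <= (LINT y|\<mu>. (LINT z|\<mu>. w y z)) + C * theta ^ l * (1 + 1 / s)"
   by simp
  also have "(LINT y|\<mu>. (LINT z|\<mu>. w y z)) <= H * 2 ^ d * s"
  proof -
   have each: "(LINT z|\<mu>. w y z) <= H * 2 ^ d * s" for y
   proof -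
    have "(LINT z|\<mu>. w y z) <= (LINT z|\<mu>. indicator {z. D y z < 2 * s} z)"
    proof (rule integral_mono)
     show "w y z <= indicator {z. D y z < 2 * s} z" for z
      using s w01 by (auto simp: w_def ramp_zero indicator_def not_less)
    qed (use w01 in \<open>auto intro!: integrable_unit integrable_real_indicator simp: emeasure_eq_measure\<close>)
    also have "... = measure \<mu> {z. D y z < 2 * s}" by simp
    also have "... <= H * (2 * s) ^ d" using s by (intro H) simp
    also have "... = H * 2 ^ d * s ^ d" by (simp add: power_mult_distrib)
    also have "... <= H * 2 ^ d * s ^ 1"
     using s H(1) d_ge_1 by (intro mult_left_mono power_decreasing) auto
    finally show ?thesis by simp
   qed
   have "(LINT y|\<mu>. (LINT z|\<mu>. w y z)) <= (LINT y|\<mu>. H * 2 ^ d * s)"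
   proof (rule integral_mono)
    show "integrable \<mu> (%y. \<integral>z. w y z \<partial>\<mu>)"
     by (rule integrable_unit) (use w01 in \<open>auto intro!: integral_unit\<close>)
   qed (use each in auto)
   then show ?thesis using prob_space by simp
  qed
  also have "C * theta ^ l * (1 + 1 / s) <= C * s\<^sup>2 * (2 / s)"
   using s C by (intro mult_mono) (auto simp: field_simps)
  also have "C * s\<^sup>2 * (2 / s) = 2 * C * s" using s by (simp add: power2_eq_square)
  finally have "(LINT y|\<mu>. w y ((f ^^ l) y)) <= (H * 2 ^ d + 2 * C) * s" by (simp add: algebra_simps)
  moreover have "measure \<mu> {x. D x ((f ^^ l) x) < s} <= (LINT y|\<mu>. w y ((f ^^ l) y))"
  proof -
   have m: "{x. D x ((f ^^ l) x) < s} \<in> sets \<mu>" by (rule sets_UNIV_D) auto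
   have "measure \<mu> {x. D x ((f ^^ l) x) < s} = (LINT x|\<mu>. indicator {x. D x ((f ^^ l) x) < s} x)" using m by simp
   also have "... <= (LINT y|\<mu>. w y ((f ^^ l) y))"
   proof (rule integral_mono)
    show "indicator {x. D x ((f ^^ l) x) < s} x <= w x ((f ^^ l) x)" for x
     using s w01 by (auto simp: w_def ramp_one indicator_def)
    show "integrable \<mu> (%y. w y ((f ^^ l) y))" using w01 by (intro integrable_unit) auto
   qed (use m in \<open>auto intro!: integrable_real_indicator simp: emeasure_eq_measure\<close>)
   finally show ?thesis .
  qed
  ultimately show ?thesis by linarith
 qed
 moreover have "H * 2 ^ d + 2 * C > 0" using H(1) C(1) by (intro add_pos_pos) auto
 ultimately show ?thesis using C(2,3)
  by (intro exI[of _ "H * 2 ^ d + 2 * C"] conjI exI[of _ theta] allI impI) auto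
qed

text \<open>Close returns are unlikely at all times, with a uniform power. For large \<open>n\<close> this is mixing. For small \<open>n\<close> a return within \<open>\<rho>\<close> at time \<open>n\<close> entails a return within a power of \<open>\<rho>\<close> at a multiple of \<open>n\<close> of logarithmic size, by the Lipschitz property, and there mixing applies. The exponent comes from balancing the expansion rate against the mixing rate.\<close>

lemma short_returns:
 "\<exists>C>0. \<exists>eta>0. \<forall>n\<ge>1. \<forall>rho. 0 < rho & rho < 1 --> measure \<mu> {x. D x ((f ^^ n) x) < rho} <= C * rho powr eta"
proof -
 obtain C theta where C: "C > 0" "0 < theta" "theta < 1" and ret: "\<And>l s. 0 < s ==> s <= 1 ==> theta ^ l <= s\<^sup>2 ==>
   measure \<mu> {x. D x ((f ^^ l) x) < s} <= C * s" using return_at_mixing_scale by blast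
 define b where "b = ln (2 * \<Lambda>)"
 define t where "t = - ln theta"
 define eta where "eta = min (1 / 2) (t / (8 * b))"
 have b: "b > 0" using \<Lambda>_ge_1 by (simp add: b_def)
 have t: "t > 0" using C by (simp add: t_def)
 have eta: "eta > 0" "eta <= 1 / 2" "eta <= t / (8 * b)" using b t by (auto simp: eta_def)
 have "measure \<mu> {x. D x ((f ^^ n) x) < rho} <= C * rho powr eta" if n: "1 <= n" and rho: "0 < rho" "rho < 1" for n rho
 proof -
  define l0 where "l0 = - ln rho / (2 * b)"
  have l0: "l0 > 0" using rho b by (simp add: l0_def divide_neg_pos)
  define s where "s = rho powr eta"
  have s: "0 < s" "s <= 1" using rho eta by (auto simp: s_def powr_le_one_le powr_le1)
  have half: "rho powr (1 / 2) <= s" unfolding s_def using rho eta by (intro powr_mono') auto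
  have thetal: "theta ^ l <= s\<^sup>2" if "l0 / 2 <= real l" for l
  proof -
   have "theta ^ l = exp (- t * real l)" using C by (simp add: theta_power_eq t_def)
   also have "... <= exp (- t * (l0 / 2))" using that t by simp
   also have "- t * (l0 / 2) = (2 * (t / (8 * b))) * ln rho" by (simp add: l0_def)
   also have "exp ... <= exp ((2 * eta) * ln rho)"
    unfolding exp_le_cancel_iff using eta(3) rho by (intro mult_right_mono_neg) auto
   also have "... = s\<^sup>2" using rho by (simp add: s_def powr_def exp_double[symmetric] mult.assoc)
   finally show ?thesis .
  qed
  obtain q where q: "l0 / 2 <= real (q * n)" "q = 1 \<or> real (q * n) <= l0"
  proof (cases "l0 / 2 <= real n")
   case True
   then show ?thesis by (intro that[of 1]) auto
  next
   case False
   define q where "q = nat \<lfloor>l0 / real n\<rfloor>"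
   have "real q = of_int \<lfloor>l0 / real n\<rfloor>" using l0 n by (simp add: q_def)
   then have "real q <= l0 / real n" "l0 / real n < real q + 1" by linarith+
   then have "real q * real n <= l0" "l0 < (real q + 1) * real n" using n by (auto simp: field_simps)
   then have "real (q * n) <= l0" "l0 / 2 <= real (q * n)" using False by (auto simp: algebra_simps)
   then show ?thesis using that by blast
  qed
  have sub: "{x. D x ((f ^^ n) x) < rho} \<subseteq> {x. D x ((f ^^ (q * n)) x) < s}"
  proof (intro subsetI CollectI, drule CollectD)
   fix x assume x: "D x ((f ^^ n) x) < rho"
   show "D x ((f ^^ (q * n)) x) < s"
   proof (cases "q = 1")
    case True
    have "rho powr 1 <= rho powr (1 / 2)" using rho by (intro powr_mono') auto
    then show ?thesis using x True half rho by simp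
   next
    case False
    have "D x ((f ^^ (q * n)) x) <= (2 * \<Lambda>) ^ (q * n) * D x ((f ^^ n) x)" by (rule D_iterate[OF n])
    also have "... < (2 * \<Lambda>) ^ (q * n) * rho" using x \<Lambda>_ge_1 by (intro mult_strict_left_mono) auto
    also have "(2 * \<Lambda>) ^ (q * n) = exp (b * real (q * n))"
     unfolding b_def by (rule theta_power_eq) (use \<Lambda>_ge_1 in simp)
    also have "... <= exp (b * l0)" using q(2) False b by simp
    also have "exp (b * l0) * rho = exp (- (1/2) * ln rho) * exp (ln rho)" using rho b by (simp add: l0_def)
    also have "... = rho powr (1 / 2)" unfolding exp_add[symmetric] using rho by (simp add: powr_def)
    also have "... <= s" by (rule half)
    finally show ?thesis using rho by simp
   qed
  qed
  have "measure \<mu> {x. D x ((f ^^ n) x) < rho} <= measure \<mu> {x. D x ((f ^^ (q * n)) x) < s}"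
   by (rule finite_measure_mono[OF sub]) (rule sets_UNIV_D, auto)
  also have "... <= C * s" using s thetal q by (intro ret) auto
  finally show ?thesis by (simp add: s_def)
 qed
 then show ?thesis using C eta by blast
qed

lemma double_visit_sets: "{y. D x y < s & D x ((f ^^ g) y) < s} \<in> sets \<mu>"
proof -
 have "{y \<in> space \<mu>. D x y < s & D x ((f ^^ g) y) < s} \<in> sets \<mu>" by measurable
 then show ?thesis by simp
qed

text \<open>A point \<open>y\<close> that visits the ball around \<open>x\<close> now and at time \<open>g\<close> makes a \<open>2s\<close>-close return. Integrating first over \<open>x\<close>, which lies in the \<open>s\<close>-ball of \<open>y\<close>, gains the factor \<open>s ^ d\<close>.\<close>

lemma double_visits:
 "(%x. measure \<mu> {y. D x y < s & D x ((f ^^ g) y) < s}) \<in> borel_measurable \<mu>" (is ?meas)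
 "\<exists>C>0. \<exists>\<zeta>>0. \<forall>g\<ge>1. \<forall>s. 0 < s & s < 1 / 2 -->
   (LINT x|\<mu>. measure \<mu> {y. D x y < s & D x ((f ^^ g) y) < s}) <= C * s ^ d * s powr \<zeta>" (is ?int)
proof -
 obtain H where H: "H \<ge> 1" "\<And>x s. 0 < s ==> measure \<mu> {y. D x y < s} <= H * s ^ d"
  using volume_upper by blast
 obtain C \<zeta> where C: "C > 0" "\<zeta> > 0" and ret: "\<And>n rho. 1 <= n ==> 0 < rho ==> rho < 1 ==>
   measure \<mu> {x. D x ((f ^^ n) x) < rho} <= C * rho powr \<zeta>" using short_returns by blast
 define b where "b g s x = measure \<mu> {y. D x y < s & D x ((f ^^ g) y) < s}" for g s x
 define q where "q s x y g = (indicator {0<..} (s - D x y) * indicator {0<..} (s - D x ((f ^^ g) y)) :: real)" for s x y g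
 have q_meas [measurable]: "(%z. q s (fst z) (snd z) g) \<in> borel_measurable (\<mu> \<Otimes>\<^sub>M \<mu>)" for s g
  unfolding q_def by measurable
 have q_meas': "(%z. q s (snd z) (fst z) g) \<in> borel_measurable (\<mu> \<Otimes>\<^sub>M \<mu>)" for s g
  unfolding q_def by measurable
 have q_meas1 [measurable]: "(%y. q s x y g) \<in> borel_measurable \<mu>" "(%x. q s x y g) \<in> borel_measurable \<mu>" for s g x y
  unfolding q_def by measurable
 have q01: "0 <= q s x y g" "q s x y g <= 1" for s x y g by (auto simp: q_def indicator_def)
 have sets_b: "{y. D x y < s & D x ((f ^^ g) y) < s} \<in> sets \<mu>" for x g s
 proof -
  have "{y \<in> space \<mu>. D x y < s & D x ((f ^^ g) y) < s} \<in> sets \<mu>" by measurable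
  then show ?thesis by simp
 qed
 have b_eq: "b g s x = (LINT y|\<mu>. q s x y g)" for g s x
 proof -
  have "b g s x = (LINT y|\<mu>. indicator {y. D x y < s & D x ((f ^^ g) y) < s} y)"
   unfolding b_def using sets_b by simp
  also have "... = (LINT y|\<mu>. q s x y g)"
   by (intro Bochner_Integration.integral_cong) (auto simp: q_def indicator_def)
  finally show ?thesis .
 qed
 have b_meas [measurable]: "b g s \<in> borel_measurable \<mu>" for g s
  unfolding b_eq[abs_def] using q_meas[of s g] by (intro borel_measurable_lebesgue_integral) (simp add: case_prod_unfold)
 have b01: "0 <= b g s x" "b g s x <= 1" for g s x by (auto simp: b_def)
 interpret PP: pair_prob_space \<mu> \<mu> by unfold_locales
 have b_int: "(LINT x|\<mu>. b g s x) <= H * C * 2 powr \<zeta> * s ^ d * s powr \<zeta>" if g: "1 <= g" and s: "0 < s" "s < 1 / 2" for g s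
 proof -
  let ?A = "{y. D y ((f ^^ g) y) < 2 * s}"
  have A: "?A \<in> sets \<mu>" by (rule sets_UNIV_D) auto
  have "(LINT x|\<mu>. b g s x) = (LINT x|\<mu>. (LINT y|\<mu>. q s x y g))" by (simp add: b_eq)
  also have "... = (LINT y|\<mu>. (LINT x|\<mu>. q s x y g))"
   using q_meas[of s g] q01
   by (intro PP.Fubini_integral[where f = "%x y. q s x y g", symmetric] PP.P.integrable_const_bound[where B = 1])
    (auto simp: case_prod_unfold)
  also have "... <= (LINT y|\<mu>. H * s ^ d * indicator ?A y)"
  proof (rule integral_mono)
   show "integrable \<mu> (%y. \<integral>x. q s x y g \<partial>\<mu>)"
    using q01 q_meas'[of s g] by (intro integrable_unit borel_measurable_lebesgue_integral)
     (auto simp: case_prod_unfold intro!: integral_unit)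
   show "integrable \<mu> (%y. H * s ^ d * indicator ?A y)"
    using A by (intro integrable_mult_right integrable_real_indicator) (auto simp: emeasure_eq_measure)
   fix y
   have "(LINT x|\<mu>. q s x y g) <= (LINT x|\<mu>. indicator ?A y * indicator {x. D y x < s} x)"
   proof (rule integral_mono)
    show "integrable \<mu> (%x. q s x y g)" using q01 by (intro integrable_unit) auto
    show "integrable \<mu> (%x. indicator ?A y * indicator {x. D y x < s} x :: real)"
     by (intro integrable_mult_right integrable_real_indicator) (auto simp: emeasure_eq_measure)
    fix x show "q s x y g <= indicator ?A y * indicator {x. D y x < s} x"
     using D_tri[of y "(f ^^ g) y" x] D_sym[of x y] by (auto simp: q_def indicator_def)
   qed
   also have "... = indicator ?A y * measure \<mu> {x. D y x < s}" by simp
   also have "... <= indicator ?A y * (H * s ^ d)" using s by (intro mult_left_mono H) auto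
   finally show "(LINT x|\<mu>. q s x y g) <= H * s ^ d * indicator ?A y" by (simp add: mult_ac)
  qed
  also have "... = H * s ^ d * measure \<mu> ?A" using A by simp
  also have "... <= H * s ^ d * (C * (2 * s) powr \<zeta>)"
   using s H g by (intro mult_left_mono ret) auto
  also have "... = H * C * 2 powr \<zeta> * s ^ d * s powr \<zeta>" using s by (simp add: powr_mult)
  finally show ?thesis .
 qed
 show ?meas using b_meas[of g s] by (simp add: b_def[abs_def])
 show ?int using b_int H C unfolding b_def
  by (intro exI[of _ "H * C * 2 powr \<zeta>"] conjI exI[of _ \<zeta>]) auto
qed

text \<open>Almost every point is not a target of quick repeated visits. A Borel-Cantelli argument along a geometric sequence of radii turns the averaged bound for double visits into one for almost every centre; monotonicity in the radius covers the radii in between.\<close>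

lemma slow_recurrence:
 "\<exists>eta>0. AE x in \<mu>. \<exists>s0>0. \<forall>s. 0 < s & s < s0 --> (\<forall>g\<ge>1. real g <= s powr (- eta) -->
   measure \<mu> {y. D x y < s & D x ((f ^^ g) y) < s} <= s ^ d * s powr eta)"
proof -
 obtain C \<zeta> where C: "C > 0" "\<zeta> > 0" and bi: "\<And>g s. 1 <= g ==> 0 < s ==> s < 1 / 2 ==>
   (LINT x|\<mu>. measure \<mu> {y. D x y < s & D x ((f ^^ g) y) < s}) <= C * s ^ d * s powr \<zeta>"
  using double_visits(2) by blast
 \<comment> \<open>One quarter pays for the union over \<open>g\<close>, one for the threshold, and one half is left for summability.\<close>
 define eta where "eta = \<zeta> / 4"
 have eta: "eta > 0" using C by (simp add: eta_def)
 define b where "b g s x = measure \<mu> {y. D x y < s & D x ((f ^^ g) y) < s}" for g s x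
 have b_meas [measurable]: "b g s \<in> borel_measurable \<mu>" for g s
  unfolding b_def by (rule double_visits(1))
 have b01: "0 <= b g s x" "b g s x <= 1" for g s x by (auto simp: b_def)
 have b_int: "(LINT x|\<mu>. b g s x) <= C * s ^ d * s powr \<zeta>" if "1 <= g" "0 < s" "s < 1 / 2" for g s
  unfolding b_def using that by (rule bi)
 define s where "s j = (1 / 2 :: real) ^ j" for j :: nat
 have s: "0 < s j" "s (Suc j) = s j / 2" for j by (simp_all add: s_def)
 \<comment> \<open>Thresholds are taken at the next smaller scale, so that monotonicity in the radius covers all radii in between.\<close>
 define thr where "thr j = s (Suc j) ^ d * s (Suc j) powr eta" for j
 have thr: "0 < thr j" for j using s(1)[of "Suc j"] by (simp add: thr_def)
 define N where "N j = nat \<lfloor>s (Suc j) powr (- eta)\<rfloor>" for j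
 have N: "real (N j) <= s (Suc j) powr (- eta)" for j by (simp add: N_def)
 define A where "A j = (if j <= 1 then {} else (\<Union>g\<in>{1..N j}. {x\<in>space \<mu>. thr j <= b g (s j) x}))" for j
 have thr_sets: "{x\<in>space \<mu>. thr j <= b g (s j) x} \<in> sets \<mu>" for j g by measurable
 then have A_sets: "A j \<in> sets \<mu>" for j unfolding A_def by (auto simp del: space_UNIV)
 define B where "B = C * 2 ^ d * 2 powr (2 * eta)"
 have A_le: "measure \<mu> (A j) <= B * (2 powr (- 2 * eta)) ^ j" for j
 proof (cases "j <= 1")
  case True
  then show ?thesis using C by (simp add: A_def B_def)
 next
  case False
  have s_half: "s j < 1 / 2" using False power_strict_decreasing[of 1 j "1/2::real"] by (simp add: s_def)
  have "measure \<mu> (A j) <= (\<Sum>g\<in>{1..N j}. measure \<mu> {x\<in>space \<mu>. thr j <= b g (s j) x})"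
   unfolding A_def using False thr_sets by (auto intro!: finite_measure_subadditive_finite simp del: space_UNIV)
  also have "... <= (\<Sum>g\<in>{1..N j}. C * s j ^ d * s j powr \<zeta> / thr j)"
  proof (rule sum_mono)
   fix g assume g: "g \<in> {1..N j}"
   have "measure \<mu> {x\<in>space \<mu>. thr j <= b g (s j) x} <= (LINT x|\<mu>. b g (s j) x) / thr j"
    using b01 thr by (intro integral_Markov_inequality_measure[where A = "{}"] integrable_unit) auto
   also have "... <= C * s j ^ d * s j powr \<zeta> / thr j"
    using g s s_half thr[of j] by (intro divide_right_mono b_int) auto
   finally show "measure \<mu> {x\<in>space \<mu>. thr j <= b g (s j) x} <= C * s j ^ d * s j powr \<zeta> / thr j" .
  qed
  also have "... = real (N j) * (C * s j ^ d * s j powr \<zeta> / thr j)" by simp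
  also have "... <= s (Suc j) powr (- eta) * (C * s j ^ d * s j powr \<zeta> / thr j)"
   using N thr[of j] C s(1)[of j] by (intro mult_right_mono) auto
  also have "... = B * s j powr (2 * eta)"
  proof -
   have z: "\<zeta> = 4 * eta" by (simp add: eta_def)
   have p: "s j powr \<zeta> = s j powr (2 * eta) * s j powr (2 * eta)" unfolding z by (simp flip: powr_add)
   have t: "thr j = s j ^ d / 2 ^ d * (s j powr eta / 2 powr eta)"
    using s(1)[of j] unfolding thr_def s(2) by (simp add: power_divide powr_divide)
   have n: "s (Suc j) powr (- eta) = 2 powr eta / s j powr eta"
    using s(1)[of j] unfolding s(2) by (simp add: powr_divide powr_minus field_simps)
   have e: "s j powr (2 * eta) = s j powr eta * s j powr eta" by (simp flip: powr_add)
   have e2: "2 powr (2 * eta) = 2 powr eta * (2 powr eta :: real)" by (simp flip: powr_add)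
   have nz: "s j powr eta ~= 0" "s j ~= 0" using s(1)[of j] by auto
   show ?thesis unfolding p t n B_def e e2 using nz by (simp add: field_simps)
  qed
  also have "s j powr (2 * eta) = (2 powr (- 2 * eta)) ^ j"
  proof -
   have "s j = 2 powr (- real j)" by (simp add: s_def powr_minus powr_realpow power_one_over inverse_eq_divide)
   then show ?thesis by (simp add: powr_powr mult_ac flip: powr_realpow)
  qed
  finally show ?thesis .
 qed
 have q2: "2 powr (- 2 * eta) < (1::real)" using eta powr_less_mono[of "- 2 * eta" 0 2] by simp
 have "summable (%j. measure \<mu> (A j))"
 proof (rule summable_comparison_test')
  show "summable (%j. B * (2 powr (- 2 * eta)) ^ j)" using q2 by (intro summable_mult summable_geometric) simp
  show "norm (measure \<mu> (A j)) <= B * (2 powr (- 2 * eta)) ^ j" if "j \<ge> 0" for j using A_le by simp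
 qed
 then have "AE x in \<mu>. \<forall>\<^sub>F j in sequentially. x \<in> space \<mu> - A j"
  using A_sets by (intro borel_cantelli_AE1) (auto simp: emeasure_eq_measure)
 then have "AE x in \<mu>. \<exists>s0>0. \<forall>s. 0 < s & s < s0 --> (\<forall>g\<ge>1. real g <= s powr (- eta) -->
   measure \<mu> {y. D x y < s & D x ((f ^^ g) y) < s} <= s ^ d * s powr eta)"
 proof (rule AE_mp, intro AE_I2 impI)
  fix x assume "\<forall>\<^sub>F j in sequentially. x \<in> space \<mu> - A j"
  then obtain J where J: "\<And>j. J <= j ==> x \<notin> A j" by (auto simp: eventually_sequentially)
  have "measure \<mu> {y. D x y < t & D x ((f ^^ g) y) < t} <= t ^ d * t powr eta"
   if t: "0 < t" "t < s (J + 2)" and g: "1 <= g" "real g <= t powr (- eta)" for t g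
  proof -
   have "\<exists>n. s n <= t" using real_arch_pow_inv[of t "1/2"] t by (auto simp: s_def intro: less_imp_le)
   define n where "n = (LEAST n. s n <= t)"
   have n: "s n <= t" unfolding n_def by (rule LeastI_ex) fact
   have less: "t < s k" if "k < n" for k using not_less_Least[of k "%n. s n <= t"] that by (auto simp: n_def)
   have "J + 2 < n"
   proof (rule ccontr)
    assume "\<not> J + 2 < n"
    then have "s (J + 2) <= s n" unfolding s_def by (intro power_decreasing) auto
    then show False using n t by linarith
   qed
   then obtain j where j: "n = Suc j" "J + 2 <= j" by (metis Suc_leI less_imp_Suc_add le_add1 add_Suc_right less_Suc_eq_le)
   have sj: "s (Suc j) <= t" "t < s j" using n less[of j] j by auto
   have "t powr (- eta) <= s (Suc j) powr (- eta)" by (rule powr_mono2') (use sj(1) s(1)[of "Suc j"] eta in linarith)+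
   then have "real g <= s (Suc j) powr (- eta)" using g by simp
   then have "g <= N j" unfolding N_def by (simp add: le_nat_floor)
   then have "b g (s j) x < thr j" using J[of j] j g by (auto simp: A_def not_le)
   moreover have "thr j <= t ^ d * t powr eta"
    unfolding thr_def by (rule mult_mono[OF power_mono powr_mono2])
     (use sj(1) s(1)[of "Suc j"] eta t in auto)
   ultimately have "b g (s j) x <= t ^ d * t powr eta" by linarith
   moreover have "measure \<mu> {y. D x y < t & D x ((f ^^ g) y) < t} <= b g (s j) x"
    unfolding b_def using sj by (intro finite_measure_mono double_visit_sets) auto
   ultimately show ?thesis by linarith
  qed
  then show "\<exists>s0>0. \<forall>s. 0 < s & s < s0 --> (\<forall>g\<ge>1. real g <= s powr (- eta) -->
   measure \<mu> {y. D x y < s & D x ((f ^^ g) y) < s} <= s ^ d * s powr eta)"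
   using s(1) by (intro exI[of _ "s (J + 2)"]) auto
 qed
 then show ?thesis using eta by blast
qed

end

section \<open>Smooth targets\<close>

lemma short_gap_powr: "p > 0 ==> ((%rho. real (short_gap rho) * rho powr p) \<longlongrightarrow> 0) (at_right 0)"
proof -
 assume p: "p > 0"
 have "((%rho::real. ((ln rho)\<^sup>2 + 1) * rho powr p) \<longlongrightarrow> 0) (at_right 0)" using p by real_asymp
 then show ?thesis
  by (rule tendsto_0_le[where K = 1])
   (auto intro!: always_eventually simp: abs_mult mult_right_mono short_gap_bounds)
qed

context mixing_metric_space begin

text \<open>The three parameters cover both kinds of targets: the centre is constant for hitting statistics and is the base point for return statistics, where the radius also depends on the base point.\<close>

definition targeted :: "('a => 'a) => ('a => real) => (real => real) => real => 'a => 'a => real" where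
 "targeted ctr r u rho y z = u (D (ctr y) z / (rho * r y))"

definition targets :: "('a => 'a) => ('a => real) => real => real => real => bool" where
 "targets ctr r a b K \<longleftrightarrow> ctr \<in> \<mu> \<rightarrow>\<^sub>M \<mu> & r \<in> borel_measurable \<mu> & 0 < a & 0 <= K &
   (\<forall>y. a <= r y & r y <= b) & (\<forall>y y'. D (ctr y) (ctr y') <= D y y') & (\<forall>y y'. \<bar>r y - r y'\<bar> <= K * D y y')"

definition profile :: "(real => real) => real => real => bool" where
 "profile u T Lu \<longleftrightarrow> u \<in> borel_measurable borel & 0 < T & 0 <= Lu & (\<forall>t. 0 <= u t & u t <= 1) &
   (\<forall>t\<ge>T. u t = 0) & (\<forall>t t'. \<bar>u t - u t'\<bar> <= Lu * \<bar>t - t'\<bar>)"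

lemma targeted_Lipschitz:
 assumes tg: "targets ctr r a b K" and pr: "profile u T Lu" and rho: "0 < rho"
 shows "\<bar>targeted ctr r u rho y z - targeted ctr r u rho y' z'\<bar>
  <= Lu * (1 / a + K / a\<^sup>2) / rho * (D y y' + D z z')"
proof -
 have a: "0 < a" "0 <= K" and ra: "\<And>y. a <= r y" and rK: "\<bar>r y - r y'\<bar> <= K * D y y'"
  and cD: "D (ctr y) (ctr y') <= D y y'"
  using tg by (auto simp: targets_def)
 have Lu: "0 <= Lu" and uL: "\<And>t t'. \<bar>u t - u t'\<bar> <= Lu * \<bar>t - t'\<bar>" using pr by (auto simp: profile_def)
 let ?A = "D (ctr y) z" and ?B = "D (ctr y') z'"
 have rp: "0 < r y" "0 < r y'" using a ra[of y] ra[of y'] by linarith+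
 have nD: "0 <= D y y'" "0 <= D z z'" "0 <= ?B" "?B <= 1" using D_nonneg D_le_1 by auto
 have 1: "\<bar>?A - ?B\<bar> / r y <= (D y y' + D z z') / a"
  using D_diff_le[of "ctr y" z "ctr y'" z'] cD a ra nD by (intro frac_le) auto
 have "\<bar>1 / r y - 1 / r y'\<bar> = \<bar>r y - r y'\<bar> / (r y * r y')"
  using rp by (simp add: field_simps abs_minus_commute abs_mult)
 also have "... <= (K * D y y') / (a * a)"
  using rK ra[of y] ra[of y'] a nD by (intro frac_le mult_mono mult_nonneg_nonneg) auto
 finally have 2: "?B * \<bar>1 / r y - 1 / r y'\<bar> <= 1 * ((K * D y y') / (a * a))"
  using nD by (intro mult_mono) auto
 have "?A / (rho * r y) - ?B / (rho * r y') = ((?A - ?B) / r y + ?B * (1 / r y - 1 / r y')) / rho"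
  using rho rp by (simp add: field_simps)
 also have "\<bar>...\<bar> <= (\<bar>?A - ?B\<bar> / r y + ?B * \<bar>1 / r y - 1 / r y'\<bar>) / rho"
  using rho rp nD by (auto simp: abs_mult intro!: divide_right_mono order_trans[OF abs_triangle_ineq])
 also have "... <= ((D y y' + D z z') / a + (K * D y y') / (a * a)) / rho"
  using 1 2 rho by (intro divide_right_mono add_mono) auto
 also have "... <= ((D y y' + D z z') / a + (K * (D y y' + D z z')) / (a * a)) / rho"
  using nD a rho by (intro divide_right_mono add_left_mono mult_left_mono) auto
 also have "... = (1 / a + K / a\<^sup>2) / rho * (D y y' + D z z')"
  using a rho by (simp add: field_simps power2_eq_square)
 finally have "Lu * \<bar>?A / (rho * r y) - ?B / (rho * r y')\<bar> <= Lu * ((1 / a + K / a\<^sup>2) / rho * (D y y' + D z z'))"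
  using Lu by (rule mult_left_mono)
 then show ?thesis unfolding targeted_def using uL order_trans by (fastforce simp: mult.assoc)
qed

lemma ramp_profile:
 assumes "0 < a" "a < b"
 shows "profile (ramp a b) b (1 / (b - a))"
 unfolding profile_def using assms ramp_Lipschitz[of a b] by (auto simp: ramp_bounds ramp_zero field_simps)

lemma const_targets: "targets ctr r a b K ==> targets ctr (%_. 1) 1 1 0"
 by (auto simp: targets_def)

lemma targeted_kernel:
 assumes tg: "targets ctr r a b K" and pr: "profile u T Lu"
 shows "\<forall>\<^sub>F rho in at_right 0. visit_kernel \<mu> D f \<Lambda> (targeted ctr r u rho)
   (targeted ctr (%_. 1) (ramp (T * b) (2 * T * b)) rho) (inverse (rho\<^sup>2))"
proof -
 have [measurable]: "ctr \<in> \<mu> \<rightarrow>\<^sub>M \<mu>" "r \<in> borel_measurable \<mu>" "u \<in> borel_measurable borel"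
  using tg pr by (auto simp: targets_def profile_def)
 have a: "0 < a" "\<And>y. a <= r y" "\<And>y. r y <= b" "0 <= K" using tg by (auto simp: targets_def)
 have u: "0 < T" "0 <= Lu" "\<And>t. 0 <= u t" "\<And>t. u t <= 1" "\<And>t. T <= t ==> u t = 0"
  using pr by (auto simp: profile_def)
 have b: "0 < b" using a(1) a(2)[of undefined] a(3)[of undefined] by linarith
 have Tb: "0 < T * b" "T * b < 2 * T * b" using u b by auto
 define C where "C = max (Lu * (1 / a + K / a\<^sup>2)) (1 / (T * b))"
 have C0: "C > 0" using Tb by (simp add: C_def less_max_iff_disj)
 have "\<forall>\<^sub>F rho::real in at_right 0. rho \<in> {0<..<1 / C}" using C0 by (intro eventually_at_right_real) simp
 then show ?thesis
 proof eventually_elim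
  case (elim rho)
  then have rho: "0 < rho" "rho < 1 / C" by auto
  have L: "C / rho <= inverse (rho\<^sup>2)" using rho C0 by (simp add: field_simps power2_eq_square)
  have Lip: "\<bar>targeted ctr s v rho y z - targeted ctr s v rho y' z'\<bar> <= inverse (rho\<^sup>2) * (D y y' + D z z')"
   if "targets ctr s a' b' K'" "profile v T' Lv" "Lv * (1 / a' + K' / a'\<^sup>2) <= C" for s v a' b' K' T' Lv y z y' z'
  proof -
   have "Lv * (1 / a' + K' / a'\<^sup>2) / rho <= inverse (rho\<^sup>2)"
    using L divide_right_mono[OF that(3), of rho] rho by linarith
   then have "Lv * (1 / a' + K' / a'\<^sup>2) / rho * (D y y' + D z z') <= inverse (rho\<^sup>2) * (D y y' + D z z')"
    using D_nonneg by (intro mult_right_mono) auto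
   then show ?thesis using targeted_Lipschitz[OF that(1,2) rho(1)] order_trans by blast
  qed
  show ?case
  proof (unfold_locales)
   show "case_prod (targeted ctr r u rho) \<in> borel_measurable (\<mu> \<Otimes>\<^sub>M \<mu>)"
    unfolding targeted_def case_prod_unfold by measurable
   show "case_prod (targeted ctr (%_. 1) (ramp (T * b) (2 * T * b)) rho) \<in> borel_measurable (\<mu> \<Otimes>\<^sub>M \<mu>)"
    unfolding targeted_def case_prod_unfold by measurable
   show "jointly_Lipschitz (inverse (rho\<^sup>2)) (targeted ctr r u rho)"
    unfolding jointly_Lipschitz_def using Lip[OF tg pr] by (auto simp: C_def)
   have "(1 / (2 * T * b - T * b)) * (1 / 1 + 0 / 1\<^sup>2) <= C" by (simp add: C_def)
   then show "jointly_Lipschitz (inverse (rho\<^sup>2)) (targeted ctr (%_. 1) (ramp (T * b) (2 * T * b)) rho)"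
    unfolding jointly_Lipschitz_def using Lip[OF const_targets[OF tg] ramp_profile[OF Tb]] by blast
   show "0 <= inverse (rho\<^sup>2)" by simp
   fix y z
   show "0 <= targeted ctr r u rho y z" "targeted ctr r u rho y z <= 1" using u by (auto simp: targeted_def)
   show "0 <= targeted ctr (%_. 1) (ramp (T * b) (2 * T * b)) rho y z"
    "targeted ctr (%_. 1) (ramp (T * b) (2 * T * b)) rho y z <= 1"
    by (auto simp: targeted_def ramp_bounds)
   assume nz: "targeted ctr r u rho y z ~= 0"
   have rp: "0 < r y" using a(1) a(2)[of y] by linarith
   have "D (ctr y) z / (rho * r y) < T" by (rule ccontr) (use nz u(5) in \<open>auto simp: targeted_def not_less\<close>)
   then have "D (ctr y) z < T * (rho * r y)" using rho rp by (simp add: field_simps)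
   also have "... <= T * (rho * b)" using a(3)[of y] u rho by (intro mult_left_mono) auto
   finally have "D (ctr y) z / (rho * 1) <= T * b" using rho by (simp add: field_simps)
   then show "targeted ctr (%_. 1) (ramp (T * b) (2 * T * b)) rho y z = 1"
    unfolding targeted_def by (intro ramp_one Tb)
  qed
 qed
qed

lemma targeted_pair_le:
 assumes tg: "targets ctr r a b K" and pr: "profile u T Lu" and rho: "0 < rho"
 shows "(LINT z|\<mu>. targeted ctr r u rho y z * targeted ctr (%_. 1) (ramp (T * b) (2 * T * b)) rho y ((f ^^ g) z))
   <= measure \<mu> {z. D (ctr y) z < 2 * T * b * rho & D (ctr y) ((f ^^ g) z) < 2 * T * b * rho}" (is "_ <= measure \<mu> ?S")
  and "targeted ctr r u rho y z <= indicator {z. D (ctr y) z < 2 * T * b * rho} z"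
proof -
 have [measurable]: "ctr \<in> \<mu> \<rightarrow>\<^sub>M \<mu>" "r \<in> borel_measurable \<mu>" "u \<in> borel_measurable borel"
  using tg pr by (auto simp: targets_def profile_def)
 have a: "0 < a" "\<And>y. a <= r y" "\<And>y. r y <= b" "0 <= K" using tg by (auto simp: targets_def)
 have u: "0 < T" "0 <= Lu" "\<And>t. 0 <= u t" "\<And>t. u t <= 1" "\<And>t. T <= t ==> u t = 0"
  using pr by (auto simp: profile_def)
 have b: "0 < b" using a(1) a(2)[of undefined] a(3)[of undefined] by linarith
 have Tb: "0 < T * b" "T * b < 2 * T * b" using u b by auto
 have w: "targeted ctr r u rho y z <= indicator {z. D (ctr y) z < 2 * T * b * rho} z" for z
 proof (cases "D (ctr y) z < 2 * T * b * rho")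
  case False
  have rp: "0 < r y" using a(1) a(2)[of y] by linarith
  have "T * (rho * r y) <= T * (rho * b)" using a(3)[of y] u rho by (intro mult_left_mono) auto
  also have "... <= 2 * T * b * rho" using mult_pos_pos[OF Tb(1) rho] by (simp add: mult_ac)
  finally have "T <= D (ctr y) z / (rho * r y)" using False rho rp by (simp add: field_simps)
  then show ?thesis using u(5) by (simp add: targeted_def)
 qed (use u in \<open>auto simp: targeted_def\<close>)
 then show "targeted ctr r u rho y z <= indicator {z. D (ctr y) z < 2 * T * b * rho} z" .
 have \<beta>: "targeted ctr (%_. 1) (ramp (T * b) (2 * T * b)) rho y z <= indicator {z. D (ctr y) z < 2 * T * b * rho} z" for z
 proof (cases "D (ctr y) z < 2 * T * b * rho")
  case False
  then have "2 * T * b <= D (ctr y) z / (rho * 1)" using rho by (simp add: field_simps)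
  then show ?thesis using ramp_zero[OF Tb(2)] by (simp add: targeted_def)
 qed (auto simp: targeted_def ramp_bounds)
 have S: "?S \<in> sets \<mu>" by (rule double_visit_sets)
 have w0: "0 <= targeted ctr r u rho y z" "targeted ctr r u rho y z <= 1"
  "0 <= targeted ctr (%_. 1) (ramp (T * b) (2 * T * b)) rho y z" 
  "targeted ctr (%_. 1) (ramp (T * b) (2 * T * b)) rho y z <= 1" for z
  using u by (auto simp: targeted_def ramp_bounds)
 have [measurable]: "targeted ctr r u rho y \<in> borel_measurable \<mu>"
   "targeted ctr (%_. 1) (ramp (T * b) (2 * T * b)) rho y \<in> borel_measurable \<mu>"
  unfolding targeted_def by measurable
 have "(LINT z|\<mu>. targeted ctr r u rho y z * targeted ctr (%_. 1) (ramp (T * b) (2 * T * b)) rho y ((f ^^ g) z))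
   <= (LINT z|\<mu>. indicator ?S z)"
 proof (rule integral_mono)
  show "integrable \<mu> (%z. targeted ctr r u rho y z * targeted ctr (%_. 1) (ramp (T * b) (2 * T * b)) rho y ((f ^^ g) z))"
   using w0 by (intro integrable_unit) (auto intro!: mult_nonneg_nonneg mult_le_one)
  show "integrable \<mu> (indicator ?S :: 'a => real)" using S by (intro integrable_real_indicator) (auto simp: emeasure_eq_measure)
  fix z
  show "targeted ctr r u rho y z * targeted ctr (%_. 1) (ramp (T * b) (2 * T * b)) rho y ((f ^^ g) z) <= indicator ?S z"
   using mult_mono[OF w[of z] \<beta>[of "(f ^^ g) z"]] w0 by (auto simp: indicator_def)
 qed
 then show "(LINT z|\<mu>. targeted ctr r u rho y z * targeted ctr (%_. 1) (ramp (T * b) (2 * T * b)) rho y ((f ^^ g) z))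
   <= measure \<mu> ?S" using S by simp
qed

end

context mixing_metric_space begin

text \<open>For a fixed centre the condition on short returns is the slow recurrence of that centre.\<close>

lemma hitting_limit:
 assumes pr: "profile u T Lu" and \<tau>: "\<tau> > 0" and eta: "eta > 0" and s0: "s0 > 0"
  and slow: "\<And>s g. 0 < s ==> s < s0 ==> 1 <= g ==> real g <= s powr (- eta) ==>
   measure \<mu> {y. D x y < s & D x ((f ^^ g) y) < s} <= s ^ d * s powr eta"
  and lam: "0 <= lam" and delta: "0 <= delta"
  and mean: "\<forall>\<^sub>F rho in at_right 0. \<bar>real (horizon \<tau> d rho) * (LINT z|\<mu>. u (D x z / rho)) - lam\<bar> <= delta"
  and eps: "eps > 0"
 shows "\<forall>\<^sub>F rho in at_right 0. \<bar>(LINT y|\<mu>. (\<Prod>k\<in>{1..horizon \<tau> d rho}. 1 - u (D x ((f ^^ k) y) / rho))) - exp (- lam)\<bar>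
   < exp (lam + delta) - exp (max 0 (lam - delta)) + eps"
proof -
 obtain H where H: "H \<ge> 1" "\<And>x s. 0 < s ==> measure \<mu> {y. D x y < s} <= H * s ^ d"
  using volume_upper by blast
 let ?n = "horizon \<tau> d"
 define w where "w = targeted (%_. x) (%_. 1) u"
 define \<beta> where "\<beta> = targeted (%_. x) (%_. 1) (ramp (T * 1) (2 * T * 1))"
 have tg: "targets (%_. x) (%_. 1) 1 1 0" by (simp add: targets_def D_nonneg D_refl)
 have T: "0 < T" and u01: "\<And>t. 0 <= u t" "\<And>t. u t <= 1" and [measurable]: "u \<in> borel_measurable borel"
  using pr by (auto simp: profile_def)
 define S where "S = 2 * T"
 have S: "0 < S" using T by (simp add: S_def)
 have pos: "\<forall>\<^sub>F rho::real in at_right 0. 0 < rho" by (rule eventually_at_right_less)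
 have w_eq: "w rho y z = u (D x z / rho)" for rho y z by (simp add: w_def targeted_def)
 have ker: "\<forall>\<^sub>F rho in at_right 0. visit_kernel \<mu> D f \<Lambda> (w rho) (\<beta> rho) (inverse (rho\<^sup>2))"
  unfolding w_def \<beta>_def by (rule targeted_kernel[OF tg pr])
 have mean': "\<forall>\<^sub>F rho in at_right 0. \<forall>y. \<bar>real (?n rho) * (LINT z|\<mu>. w rho y z) - lam\<bar> <= delta"
  using mean by (simp add: w_eq)
 define R where "R rho = (LINT y|\<mu>. (\<Sum>g\<in>{1..<short_gap rho}. \<integral>z. w rho y z * \<beta> rho y ((f ^^ g) z) \<partial>\<mu>))" for rho
 have rec: "((%rho. real (?n rho) * R rho) \<longlongrightarrow> 0) (at_right 0)"
 proof (rule tendsto_0_le)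
  show "((%rho. real (short_gap rho) * rho powr eta) \<longlongrightarrow> 0) (at_right 0)" by (rule short_gap_powr[OF eta])
  have "\<forall>\<^sub>F rho::real in at_right 0. (ln rho)\<^sup>2 + 1 <= (S * rho) powr (- eta)" using S eta by real_asymp
  moreover have "\<forall>\<^sub>F rho::real in at_right 0. rho \<in> {0<..<s0 / S}"
   using S s0 by (intro eventually_at_right_real) simp
  ultimately show "\<forall>\<^sub>F rho in at_right 0. norm (real (?n rho) * R rho) <= norm (real (short_gap rho) * rho powr eta) * (\<tau> * S ^ d * S powr eta)"
   using ker
  proof eventually_elim
   case (elim rho)
   then interpret visit_kernel \<mu> D f \<Lambda> "w rho" "\<beta> rho" "inverse (rho\<^sup>2)" by simp
   have rho: "0 < rho" "S * rho < s0" "0 < S * rho" using elim S by (auto simp: field_simps)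
   let ?b = "(S * rho) ^ d * (S * rho) powr eta"
   have each: "(LINT z|\<mu>. w rho y z * \<beta> rho y ((f ^^ g) z)) <= ?b" if g: "g \<in> {1..<short_gap rho}" for g y
   proof -
    have "(LINT z|\<mu>. w rho y z * \<beta> rho y ((f ^^ g) z))
     <= measure \<mu> {z. D x z < 2 * T * 1 * rho & D x ((f ^^ g) z) < 2 * T * 1 * rho}"
     unfolding w_def \<beta>_def by (rule targeted_pair_le(1)[OF tg pr rho(1)])
    also have "... <= ?b" unfolding S_def[symmetric] mult_1_right
     using g rho short_gap_bounds(2)[of rho] elim(1) by (intro slow) auto
    finally show ?thesis .
   qed
   have nn: "0 <= (LINT z|\<mu>. w rho y z * \<beta> rho y ((f ^^ g) z))" for y g
    using w0 \<beta>0 by (intro Bochner_Integration.integral_nonneg) auto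
   have R0: "0 <= R rho" unfolding R_def by (rule Bochner_Integration.integral_nonneg) (intro sum_nonneg nn)
   have "R rho = (\<Sum>g\<in>{1..<short_gap rho}. \<integral>z. w rho x z * \<beta> rho x ((f ^^ g) z) \<partial>\<mu>)"
    unfolding R_def w_def \<beta>_def targeted_def using prob_space by simp
   also have "... <= real (card {1..<short_gap rho}) * ?b" by (rule sum_bounded_above[OF each])
   also have "... <= real (short_gap rho) * ?b" using rho by (intro mult_right_mono) auto
   finally have "real (?n rho) * R rho <= (\<tau> / rho ^ d) * (real (short_gap rho) * ?b)"
    using R0 horizon_bounds(1)[OF \<tau> rho(1), of d] \<tau> rho by (intro mult_mono) auto
   also have "... = real (short_gap rho) * rho powr eta * (\<tau> * S ^ d * S powr eta)"
    using rho S by (simp add: power_mult_distrib powr_mult field_simps)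
   finally show ?case using R0 by simp
  qed
 qed
 have early: "((%rho. \<Sum>k\<in>{1..long_gap rho}. \<integral>y. w rho y ((f ^^ k) y) \<partial>\<mu>) \<longlongrightarrow> 0) (at_right 0)"
 proof (rule tendsto_0_le)
  show "((%rho. real (long_gap rho) * rho powr real d) \<longlongrightarrow> 0) (at_right 0)" using d_ge_1 by (intro long_gap_powr) simp
  show "\<forall>\<^sub>F rho in at_right 0. norm (\<Sum>k\<in>{1..long_gap rho}. \<integral>y. w rho y ((f ^^ k) y) \<partial>\<mu>)
    <= norm (real (long_gap rho) * rho powr real d) * (H * S ^ d)"
   using pos
  proof eventually_elim
   case (elim rho)
   have "(LINT y|\<mu>. w rho y ((f ^^ k) y)) <= H * (S * rho) ^ d" for k
   proof -
    have "(LINT y|\<mu>. w rho y ((f ^^ k) y)) = (LINT z|\<mu>. u (D x z / rho))"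
     unfolding w_eq by (intro integral_f_iter) measurable
    also have "... <= (LINT z|\<mu>. indicator {z. D x z < S * rho} z)"
    proof (rule integral_mono)
     show "integrable \<mu> (%z. u (D x z / rho))" using u01 by (intro integrable_unit) auto
     show "integrable \<mu> (indicator {z. D x z < S * rho} :: 'a => real)"
      by (intro integrable_real_indicator) (auto simp: emeasure_eq_measure)
     show "u (D x z / rho) <= indicator {z. D x z < S * rho} z" for z
      using targeted_pair_le(2)[OF tg pr elim, of x z] by (simp add: targeted_def S_def)
    qed
    also have "... = measure \<mu> {z. D x z < S * rho}" by simp
    also have "... <= H * (S * rho) ^ d" using elim S by (intro H) simp
    finally show ?thesis .
   qed
   then have "(\<Sum>k\<in>{1..long_gap rho}. \<integral>y. w rho y ((f ^^ k) y) \<partial>\<mu>) <= real (card {1..long_gap rho}) * (H * (S * rho) ^ d)"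
    by (intro sum_bounded_above)
   moreover have "0 <= (\<Sum>k\<in>{1..long_gap rho}. \<integral>y. w rho y ((f ^^ k) y) \<partial>\<mu>)"
    using u01 by (intro sum_nonneg Bochner_Integration.integral_nonneg) (simp add: w_eq)
   ultimately show ?case using elim by (simp add: power_mult_distrib powr_realpow mult_ac)
  qed
 qed
 have "\<forall>\<^sub>F rho in at_right 0. \<bar>(LINT y|\<mu>. (\<Prod>k\<in>{1..?n rho}. 1 - w rho y ((f ^^ k) y))) - exp (- lam)\<bar>
   < exp (lam + delta) - exp (max 0 (lam - delta)) + eps"
  by (rule poisson_limit[OF \<tau> d_ge_1 lam delta ker mean' rec[unfolded R_def] early eps])
 then show ?thesis by (simp add: w_eq)
qed

text \<open>When the centre is the starting point of the orbit, the average over the centre is built in, and the averaged bound for double visits suffices.\<close>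

lemma return_limit:
 assumes tg: "targets (%y. y) r a b K" and pr: "profile u T Lu" and \<tau>: "\<tau> > 0"
  and lam: "0 <= lam" and delta: "0 <= delta"
  and mean: "\<forall>\<^sub>F rho in at_right 0. \<forall>y. \<bar>real (horizon \<tau> d rho) * (LINT z|\<mu>. u (D y z / (rho * r y))) - lam\<bar> <= delta"
  and eps: "eps > 0"
 shows "\<forall>\<^sub>F rho in at_right 0. \<bar>(LINT y|\<mu>. (\<Prod>k\<in>{1..horizon \<tau> d rho}. 1 - u (D y ((f ^^ k) y) / (rho * r y)))) - exp (- lam)\<bar>
   < exp (lam + delta) - exp (max 0 (lam - delta)) + eps"
proof -
 obtain C eta where C: "C > 0" "eta > 0" and dbl: "\<And>g s. 1 <= g ==> 0 < s ==> s < 1 / 2 ==>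
   (LINT x|\<mu>. measure \<mu> {y. D x y < s & D x ((f ^^ g) y) < s}) <= C * s ^ d * s powr eta"
  using double_visits(2) by blast
 obtain C' \<zeta> where C': "C' > 0" "\<zeta> > 0" and ret: "\<And>n rho. 1 <= n ==> 0 < rho ==> rho < 1 ==>
   measure \<mu> {x. D x ((f ^^ n) x) < rho} <= C' * rho powr \<zeta>" using short_returns by blast
 let ?n = "horizon \<tau> d"
 define w where "w = targeted (%y. y) r u"
 define \<beta> where "\<beta> = targeted (%y. y) (%_. 1) (ramp (T * b) (2 * T * b))"
 have T: "0 < T" and u01: "\<And>t. 0 <= u t" "\<And>t. u t <= 1" and [measurable]: "u \<in> borel_measurable borel"
  using pr by (auto simp: profile_def)
 have a: "0 < a" "\<And>y. a <= r y" "\<And>y. r y <= b" and [measurable]: "r \<in> borel_measurable \<mu>"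
  using tg by (auto simp: targets_def)
 have b: "0 < b" using a(1) a(2)[of undefined] a(3)[of undefined] by linarith
 define S where "S = 2 * T * b"
 have S: "0 < S" using T b by (simp add: S_def)
 have w_eq: "w rho y z = u (D y z / (rho * r y))" for rho y z by (simp add: w_def targeted_def)
 have ker: "\<forall>\<^sub>F rho in at_right 0. visit_kernel \<mu> D f \<Lambda> (w rho) (\<beta> rho) (inverse (rho\<^sup>2))"
  unfolding w_def \<beta>_def by (rule targeted_kernel[OF tg pr])
 have mean': "\<forall>\<^sub>F rho in at_right 0. \<forall>y. \<bar>real (?n rho) * (LINT z|\<mu>. w rho y z) - lam\<bar> <= delta"
  using mean by (simp add: w_eq)
 define R where "R rho = (LINT y|\<mu>. (\<Sum>g\<in>{1..<short_gap rho}. \<integral>z. w rho y z * \<beta> rho y ((f ^^ g) z) \<partial>\<mu>))" for rho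
 have rec: "((%rho. real (?n rho) * R rho) \<longlongrightarrow> 0) (at_right 0)"
 proof (rule tendsto_0_le)
  show "((%rho. real (short_gap rho) * rho powr eta) \<longlongrightarrow> 0) (at_right 0)" by (rule short_gap_powr[OF C(2)])
  have "\<forall>\<^sub>F rho::real in at_right 0. rho \<in> {0<..<1 / (2 * S)}"
   using S by (intro eventually_at_right_real) simp
  then show "\<forall>\<^sub>F rho in at_right 0. norm (real (?n rho) * R rho) <= norm (real (short_gap rho) * rho powr eta) * (\<tau> * C * S ^ d * S powr eta)"
   using ker
  proof eventually_elim
   case (elim rho)
   then interpret visit_kernel \<mu> D f \<Lambda> "w rho" "\<beta> rho" "inverse (rho\<^sup>2)" by simp
   have rho: "0 < rho" "S * rho < 1 / 2" "0 < S * rho" using elim S by (auto simp: field_simps)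
   let ?b = "C * (S * rho) ^ d * (S * rho) powr eta"
   have nn: "0 <= (LINT z|\<mu>. w rho y z * \<beta> rho y ((f ^^ g) z))" for y g
    using w0 \<beta>0 by (intro Bochner_Integration.integral_nonneg) auto
   have [measurable]: "w rho y \<in> borel_measurable \<mu>" "\<beta> rho y \<in> borel_measurable \<mu>" for y by measurable
   have le1: "(LINT z|\<mu>. w rho y z * \<beta> rho y ((f ^^ g) z)) <= 1" for y g
    using w0 w1 \<beta>0 \<beta>1 by (intro integral_unit) (auto intro!: mult_nonneg_nonneg mult_le_one)
   have ii: "integrable \<mu> (%y. \<integral>z. w rho y z * \<beta> rho y ((f ^^ g) z) \<partial>\<mu>)" for g
    using nn le1 by (intro integrable_unit) auto
   have each: "(LINT y|\<mu>. (LINT z|\<mu>. w rho y z * \<beta> rho y ((f ^^ g) z))) <= ?b" if g: "g \<in> {1..<short_gap rho}" for g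
   proof -
    have "(LINT y|\<mu>. (LINT z|\<mu>. w rho y z * \<beta> rho y ((f ^^ g) z)))
     <= (LINT y|\<mu>. measure \<mu> {z. D y z < S * rho & D y ((f ^^ g) z) < S * rho})"
    proof (rule integral_mono[OF ii])
     show "integrable \<mu> (%y. measure \<mu> {z. D y z < S * rho & D y ((f ^^ g) z) < S * rho})"
      by (intro integrable_unit double_visits(1)) auto
     show "(LINT z|\<mu>. w rho y z * \<beta> rho y ((f ^^ g) z)) <= measure \<mu> {z. D y z < S * rho & D y ((f ^^ g) z) < S * rho}" for y
      unfolding w_def \<beta>_def S_def by (rule targeted_pair_le(1)[OF tg pr rho(1)])
    qed
    also have "... <= ?b" using g rho by (intro dbl) auto
    finally show ?thesis .
   qed
   have R0: "0 <= R rho" unfolding R_def by (rule Bochner_Integration.integral_nonneg) (intro sum_nonneg nn)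
   have "R rho = (\<Sum>g\<in>{1..<short_gap rho}. \<integral>y. (LINT z|\<mu>. w rho y z * \<beta> rho y ((f ^^ g) z)) \<partial>\<mu>)"
    unfolding R_def by (rule Bochner_Integration.integral_sum) (rule ii)
   also have "... <= real (card {1..<short_gap rho}) * ?b" by (rule sum_bounded_above[OF each])
   also have "... <= real (short_gap rho) * ?b" using rho C by (intro mult_right_mono) auto
   finally have "real (?n rho) * R rho <= (\<tau> / rho ^ d) * (real (short_gap rho) * ?b)"
    using R0 horizon_bounds(1)[OF \<tau> rho(1), of d] \<tau> rho by (intro mult_mono) auto
   also have "... = real (short_gap rho) * rho powr eta * (\<tau> * C * S ^ d * S powr eta)"
    using rho S by (simp add: power_mult_distrib powr_mult field_simps)
   finally show ?case using R0 by simp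
  qed
 qed
 have early: "((%rho. \<Sum>k\<in>{1..long_gap rho}. \<integral>y. w rho y ((f ^^ k) y) \<partial>\<mu>) \<longlongrightarrow> 0) (at_right 0)"
 proof (rule tendsto_0_le)
  show "((%rho. real (long_gap rho) * rho powr \<zeta>) \<longlongrightarrow> 0) (at_right 0)" by (rule long_gap_powr[OF C'(2)])
  have "\<forall>\<^sub>F rho::real in at_right 0. rho \<in> {0<..<1 / S}"
   using S by (intro eventually_at_right_real) simp
  then show "\<forall>\<^sub>F rho in at_right 0. norm (\<Sum>k\<in>{1..long_gap rho}. \<integral>y. w rho y ((f ^^ k) y) \<partial>\<mu>)
    <= norm (real (long_gap rho) * rho powr \<zeta>) * (C' * S powr \<zeta>)"
  proof eventually_elim
   case (elim rho)
   then have rho: "0 < rho" "S * rho < 1" "0 < S * rho" using S by (auto simp: field_simps)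
   have each: "(LINT y|\<mu>. w rho y ((f ^^ k) y)) <= C' * (S * rho) powr \<zeta>" if k: "k \<in> {1..long_gap rho}" for k
   proof -
    have m: "{y. D y ((f ^^ k) y) < S * rho} \<in> sets \<mu>" by (rule sets_UNIV_D) auto
    have "(LINT y|\<mu>. w rho y ((f ^^ k) y)) <= (LINT y|\<mu>. indicator {y. D y ((f ^^ k) y) < S * rho} y)"
    proof (rule integral_mono)
     show "integrable \<mu> (%y. w rho y ((f ^^ k) y))" using u01 unfolding w_eq by (intro integrable_unit) auto
     show "integrable \<mu> (indicator {y. D y ((f ^^ k) y) < S * rho} :: 'a => real)"
      using m by (intro integrable_real_indicator) (auto simp: emeasure_eq_measure)
     show "w rho y ((f ^^ k) y) <= indicator {y. D y ((f ^^ k) y) < S * rho} y" for y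
      using targeted_pair_le(2)[OF tg pr rho(1), of y "(f ^^ k) y"] by (simp add: w_def S_def indicator_def)
    qed
    also have "... = measure \<mu> {y. D y ((f ^^ k) y) < S * rho}" using m by simp
    also have "... <= C' * (S * rho) powr \<zeta>" using rho k by (intro ret) auto
    finally show ?thesis .
   qed
   then have "(\<Sum>k\<in>{1..long_gap rho}. \<integral>y. w rho y ((f ^^ k) y) \<partial>\<mu>) <= real (card {1..long_gap rho}) * (C' * (S * rho) powr \<zeta>)"
    by (intro sum_bounded_above)
   moreover have "0 <= (\<Sum>k\<in>{1..long_gap rho}. \<integral>y. w rho y ((f ^^ k) y) \<partial>\<mu>)"
    using u01 by (intro sum_nonneg Bochner_Integration.integral_nonneg) (simp add: w_eq)
   ultimately show ?case using rho S by (simp add: powr_mult mult_ac)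
  qed
 qed
 have "\<forall>\<^sub>F rho in at_right 0. \<bar>(LINT y|\<mu>. (\<Prod>k\<in>{1..?n rho}. 1 - w rho y ((f ^^ k) y))) - exp (- lam)\<bar>
   < exp (lam + delta) - exp (max 0 (lam - delta)) + eps"
  by (rule poisson_limit[OF \<tau> d_ge_1 lam delta ker mean' rec[unfolded R_def] early eps])
 then show ?thesis by (simp add: w_eq)
qed

end

section \<open>Sharp targets with several radii\<close>

text \<open>The product \<open>\<Prod> step_weight a \<sigma> q (d\<^sub>k / \<rho>)\<close> over the visit times equals \<open>\<Prod> \<sigma>\<^sub>j ^ N\<^sub>j\<close> where \<open>N\<^sub>j\<close> is the number of visits to the ball of radius \<open>\<rho> a\<^sub>j\<close>. Thus one scalar product carries the joint generating function of all these counts.\<close>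

definition step_weight :: "(nat => real) => (nat => real) => nat => real => real" where
 "step_weight a sg q t = (\<Prod>j\<in>{1..q}. if t < a j then sg j else 1)"

definition ramp_weight :: "(nat => real) => (nat => real) => (nat => real) => nat => real => real" where
 "ramp_weight b c sg q t = (\<Prod>j\<in>{1..q}. 1 - (1 - sg j) * ramp (b j) (c j) t)"

lemma step_weight_measurable [measurable]: "step_weight a sg q \<in> borel_measurable borel"
 unfolding step_weight_def by measurable

lemma ramp_weight_measurable [measurable]: "ramp_weight b c sg q \<in> borel_measurable borel"
 unfolding ramp_weight_def by measurable

lemma step_weight_bounds:
 assumes "\<And>j. j \<in> {1..q} ==> 0 <= sg j & sg j <= 1"
 shows "0 <= step_weight a sg q t" "step_weight a sg q t <= 1"
 unfolding step_weight_def using assms by (auto intro!: prod_nonneg prod_le_1)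

lemma ramp_factor:
 assumes "0 <= s" "s <= (1::real)"
 shows "0 <= 1 - (1 - s) * ramp b c t" "1 - (1 - s) * ramp b c t <= 1" "s <= 1 - (1 - s) * ramp b c t"
proof -
 have "(1 - s) * ramp b c t <= (1 - s) * 1" using assms ramp_bounds by (intro mult_left_mono) auto
 then show "0 <= 1 - (1 - s) * ramp b c t" "s <= 1 - (1 - s) * ramp b c t" using assms by auto
 show "1 - (1 - s) * ramp b c t <= 1" using assms ramp_bounds by simp
qed

text \<open>Each factor of the sharp weight lies between ramps whose breakpoints enclose the radius; this is how the discontinuous target is reached from Lipschitz ones.\<close>

lemma ramp_weight_sandwich:
 assumes sg: "\<And>j. j \<in> {1..q} ==> 0 <= sg j & sg j <= 1" and bc: "\<And>j. j \<in> {1..q} ==> b j < c j"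
 shows "step_weight c sg q t <= ramp_weight b c sg q t" "ramp_weight b c sg q t <= step_weight b sg q t"
 unfolding step_weight_def ramp_weight_def
 using sg bc ramp_factor by (auto intro!: prod_mono simp: ramp_one ramp_zero not_less)

context mixing_metric_space begin

lemma ramp_weight_profile:
 assumes sg: "\<And>j. j \<in> {1..q} ==> 0 <= sg j & sg j <= 1" and bc: "\<And>j. j \<in> {1..q} ==> 0 < b j & b j < b' j"
 shows "\<exists>T Lu. profile (%t. 1 - ramp_weight b b' sg q t) T Lu"
proof -
 define T where "T = 1 + (\<Sum>j\<in>{1..q}. b' j)"
 define Lu where "Lu = (\<Sum>j\<in>{1..q}. 1 / (b' j - b j))"
 have c0: "0 <= b' j" if "j \<in> {1..q}" for j using bc[OF that] by linarith
 have cT: "b' j <= T" if "j \<in> {1..q}" for j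
  using member_le_sum[of j "{1..q}" b'] that c0 by (auto simp: T_def)
 have "0 <= (\<Sum>j\<in>{1..q}. b' j)" using c0 by (rule sum_nonneg)
 then have T: "0 < T" by (simp add: T_def)
 have Lu: "0 <= Lu" unfolding Lu_def using bc by (intro sum_nonneg) (simp add: less_imp_le)
 have w01: "0 <= ramp_weight b b' sg q t & ramp_weight b b' sg q t <= 1" for t
  unfolding ramp_weight_def using ramp_factor sg by (auto intro!: prod_nonneg prod_le_1)
 have zero: "ramp_weight b b' sg q t = 1" if "T <= t" for t
  unfolding ramp_weight_def
 proof (intro prod.neutral ballI)
  fix j assume j: "j \<in> {1..q}"
  have "ramp (b j) (b' j) t = 0" using bc[OF j] cT[OF j] that by (intro ramp_zero) auto
  then show "1 - (1 - sg j) * ramp (b j) (b' j) t = 1" by simp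
 qed
 have Lip: "\<bar>ramp_weight b b' sg q t - ramp_weight b b' sg q t'\<bar> <= Lu * \<bar>t - t'\<bar>" for t t'
 proof -
  have "\<bar>ramp_weight b b' sg q t - ramp_weight b b' sg q t'\<bar>
    <= (\<Sum>j\<in>{1..q}. \<bar>(1 - (1 - sg j) * ramp (b j) (b' j) t) - (1 - (1 - sg j) * ramp (b j) (b' j) t')\<bar>)"
   unfolding ramp_weight_def real_norm_def[symmetric]
   using ramp_factor sg by (intro norm_prod_diff) (auto simp: abs_le_iff)
  also have "... <= (\<Sum>j\<in>{1..q}. 1 / (b' j - b j) * \<bar>t - t'\<bar>)"
  proof (rule sum_mono)
   fix j assume j: "j \<in> {1..q}"
   have "(1 - (1 - sg j) * ramp (b j) (b' j) t) - (1 - (1 - sg j) * ramp (b j) (b' j) t')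
    = (1 - sg j) * (ramp (b j) (b' j) t' - ramp (b j) (b' j) t)" by (simp add: algebra_simps)
   then have "\<bar>(1 - (1 - sg j) * ramp (b j) (b' j) t) - (1 - (1 - sg j) * ramp (b j) (b' j) t')\<bar>
    = (1 - sg j) * \<bar>ramp (b j) (b' j) t' - ramp (b j) (b' j) t\<bar>"
    using sg[OF j] by (simp add: abs_mult)
   also have "... <= 1 * (\<bar>t' - t\<bar> / (b' j - b j))"
    using sg[OF j] bc[OF j] by (intro mult_mono ramp_Lipschitz) auto
   finally show "\<bar>(1 - (1 - sg j) * ramp (b j) (b' j) t) - (1 - (1 - sg j) * ramp (b j) (b' j) t')\<bar>
     <= 1 / (b' j - b j) * \<bar>t - t'\<bar>" by (simp add: abs_minus_commute)
  qed
  also have "... = Lu * \<bar>t - t'\<bar>" by (simp add: Lu_def sum_distrib_right)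
  finally show ?thesis .
 qed
 have "profile (%t. 1 - ramp_weight b b' sg q t) T Lu"
  unfolding profile_def using T Lu w01 zero Lip by (auto simp: abs_minus_commute)
 then show ?thesis by blast
qed

lemma expected_visits_uniform:
 assumes \<tau>: "\<tau> > 0" and hi: "0 < hi" and eps: "eps > 0"
 shows "\<forall>\<^sub>F rho in at_right 0. \<forall>y s. 0 <= s & s <= hi -->
  \<bar>real (horizon \<tau> d rho) * measure \<mu> {z. D y z < rho * s} - \<tau> * \<gamma> y * s ^ d\<bar> <= eps"
proof -
 have G: "0 < G" using c_pos \<gamma>_ge[of undefined] \<gamma>_le[of undefined] by linarith
 define e1 where "e1 = eps / (2 * (\<tau> * hi ^ d + 1))"
 define e2 where "e2 = eps / (2 * (G * hi ^ d + 1))"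
 have dn: "0 < \<tau> * hi ^ d + 1" "0 < G * hi ^ d + 1" using \<tau> hi G by (auto intro!: add_pos_pos)
 have e: "e1 > 0" "e2 > 0" using eps dn by (auto simp: e1_def e2_def)
 have e1': "\<tau> * hi ^ d * e1 <= eps / 2" unfolding e1_def using dn eps by (simp add: field_simps)
 have e2': "e2 * (G * hi ^ d) <= eps / 2" unfolding e2_def using dn eps by (simp add: field_simps)
 obtain r0 where r0: "r0 > 0" "\<And>x rho. 0 < rho ==> rho < r0 ==> \<bar>measure \<mu> {y. D x y < rho} - \<gamma> x * rho ^ d\<bar> <= e1 * rho ^ d"
  using volume[OF e(1)] by auto
 have "\<forall>\<^sub>F rho::real in at_right 0. rho \<in> {0<..<r0 / hi}" using r0 hi by (intro eventually_at_right_real) simp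
 moreover have "\<forall>\<^sub>F rho in at_right 0. dist (real (horizon \<tau> d rho) * rho ^ d) \<tau> < e2"
  by (rule tendstoD[OF horizon_scaled[OF \<tau> d_ge_1] e(2)])
 ultimately show ?thesis
 proof (eventually_elim, intro allI impI)
  fix rho y s assume "rho \<in> {0<..<r0 / hi}" and d2: "dist (real (horizon \<tau> d rho) * rho ^ d) \<tau> < e2" and s: "0 <= s & s <= hi"
  then have rho: "0 < rho" "rho * hi < r0" using hi by (auto simp: field_simps)
  let ?n = "real (horizon \<tau> d rho)"
  have n1: "?n * rho ^ d <= \<tau>"
   using mult_right_mono[OF horizon_bounds(1)[OF \<tau> rho(1), of d], of "rho ^ d"] rho by simp
  have sd: "0 <= s ^ d" "s ^ d <= hi ^ d" using s by (auto intro: power_mono)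
  show "\<bar>?n * measure \<mu> {z. D y z < rho * s} - \<tau> * \<gamma> y * s ^ d\<bar> <= eps"
  proof (cases "s = 0")
   case True
   have "{z. D y z < rho * s} = {}" using True D_nonneg by (auto simp: not_less)
   then show ?thesis using True d_ge_1 eps by (simp add: power_0_left)
  next
   case False
   then have s0: "0 < s" using s by simp
   have "rho * s <= rho * hi" using s rho by (intro mult_left_mono) auto
   then have "rho * s < r0" using rho by linarith
   then have m: "\<bar>measure \<mu> {z. D y z < rho * s} - \<gamma> y * (rho * s) ^ d\<bar> <= e1 * (rho * s) ^ d"
    using s0 rho by (intro r0) auto
   have "?n * measure \<mu> {z. D y z < rho * s} - \<tau> * \<gamma> y * s ^ d
    = ?n * (measure \<mu> {z. D y z < rho * s} - \<gamma> y * (rho * s) ^ d) + (?n * rho ^ d - \<tau>) * (\<gamma> y * s ^ d)"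
    by (simp add: algebra_simps power_mult_distrib)
   also have "\<bar>...\<bar> <= ?n * \<bar>measure \<mu> {z. D y z < rho * s} - \<gamma> y * (rho * s) ^ d\<bar> + \<bar>?n * rho ^ d - \<tau>\<bar> * (\<gamma> y * s ^ d)"
    using c_pos \<gamma>_ge[of y] sd by (intro order_trans[OF abs_triangle_ineq]) (simp add: abs_mult)
   also have "... <= ?n * (e1 * (rho * s) ^ d) + e2 * (G * hi ^ d)"
    using m d2 c_pos \<gamma>_ge[of y] \<gamma>_le[of y] sd e G
    by (intro add_mono mult_left_mono mult_mono) (auto simp: dist_real_def)
   also have "?n * (e1 * (rho * s) ^ d) = (?n * rho ^ d) * s ^ d * e1" by (simp add: power_mult_distrib mult_ac)
   also have "... <= \<tau> * hi ^ d * e1" using n1 sd e \<tau> by (intro mult_right_mono mult_mono) auto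
   finally show ?thesis using e1' e2' by linarith
  qed
 qed
qed

lemma exp_window:
 fixes lam eps :: real
 assumes "0 <= lam" "eps > 0"
 shows "\<exists>delta>0. exp (lam + delta) - exp (max 0 (lam - delta)) < eps"
proof -
 have "((%delta. exp (lam + delta) - exp (max 0 (lam - delta))) \<longlongrightarrow> exp (lam + 0) - exp (max 0 (lam - 0))) (at_right 0)"
  by (intro tendsto_intros)
 then have "\<forall>\<^sub>F delta in at_right 0. exp (lam + delta) - exp (max 0 (lam - delta)) < eps"
  by (rule order_tendstoD) (use assms in simp)
 moreover have "\<forall>\<^sub>F delta::real in at_right 0. 0 < delta" by (rule eventually_at_right_less)
 ultimately have "\<forall>\<^sub>F delta in at_right 0. exp (lam + delta) - exp (max 0 (lam - delta)) < eps & 0 < delta" by eventually_elim auto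
 from eventually_happens[OF this] show ?thesis by (auto simp: trivial_limit_at_right_real)
qed

text \<open>A point in the shell between \<open>a\<^sub>i\<close> and \<open>a\<^bsub>i+1\<^esub>\<close> is counted for exactly the radii with index above \<open>i\<close>.\<close>

lemma step_weight_shells:
 assumes a: "a 0 = 0" "strict_mono_on {..q} a" and t: "0 <= t"
 shows "1 - step_weight a sg q t
  = (\<Sum>i<q. (1 - (\<Prod>j\<in>{Suc i..q}. sg j)) * (indicator {..<a (Suc i)} t - indicator {..<a i} t))"
proof -
 define i where "i = Max {i. i <= q & a i <= t}"
 have fin: "finite {i. i <= q & a i <= t}" by simp
 have "0 \<in> {i. i <= q & a i <= t}" using a t by simp
 then have i_in: "i \<in> {i. i <= q & a i <= t}" unfolding i_def using fin Max_in by blast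
 have iff: "t < a j \<longleftrightarrow> i < j" if "j <= q" for j
 proof
  assume "t < a j"
  show "i < j"
  proof (rule ccontr)
   assume "\<not> i < j"
   then have "a j <= a i" using strict_mono_onD[OF a(2), of j i] that i_in by (cases "j = i") auto
   then show False using i_in \<open>t < a j\<close> by auto
  qed
 next
  assume "i < j"
  then have "j \<notin> {i. i <= q & a i <= t}" using Max_ge[OF fin, of j] unfolding i_def by linarith
  then show "t < a j" using that by auto
 qed
 have sw: "step_weight a sg q t = (\<Prod>j\<in>{Suc i..q}. sg j)"
 proof -
  have "step_weight a sg q t = (\<Prod>j\<in>{1..q}. if i < j then sg j else 1)"
   unfolding step_weight_def using iff by (intro prod.cong) auto
  also have "... = (\<Prod>j\<in>{1..q} \<inter> {j. i < j}. sg j)" by (simp add: prod.inter_filter[symmetric] Int_def prod.If_cases)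
  also have "{1..q} \<inter> {j. i < j} = {Suc i..q}" by auto
  finally show ?thesis .
 qed
 have "(\<Sum>k<q. (1 - (\<Prod>j\<in>{Suc k..q}. sg j)) * (indicator {..<a (Suc k)} t - indicator {..<a k} t))
   = (\<Sum>k<q. if k = i then 1 - (\<Prod>j\<in>{Suc i..q}. sg j) else 0)"
 proof (intro sum.cong refl)
  fix k assume "k \<in> {..<q}"
  then show "(1 - (\<Prod>j\<in>{Suc k..q}. sg j)) * (indicator {..<a (Suc k)} t - indicator {..<a k} t)
    = (if k = i then 1 - (\<Prod>j\<in>{Suc i..q}. sg j) else 0)"
   using iff[of k] iff[of "Suc k"] by (auto simp: indicator_def)
 qed
 also have "... = 1 - (\<Prod>j\<in>{Suc i..q}. sg j)" using i_in by (cases "i < q") auto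
 finally show ?thesis using sw by simp
qed

definition shell_rate :: "(nat => real) => (nat => real) => nat => real" where
 "shell_rate a sg q = (\<Sum>i<q. (1 - (\<Prod>j\<in>{Suc i..q}. sg j)) * (a (Suc i) ^ d - a i ^ d))"

lemma expected_step_weight:
 assumes \<tau>: "\<tau> > 0" and a: "a 0 = 0" "strict_mono_on {..q} a"
 shows "((%rho. real (horizon \<tau> d rho) * (LINT z|\<mu>. 1 - step_weight a sg q (D x z / rho)))
  \<longlongrightarrow> \<tau> * \<gamma> x * shell_rate a sg q) (at_right 0)"
proof -
 have a0: "0 <= a i" if "i <= q" for i
  using strict_mono_onD[OF a(2), of 0 i] a(1) that by (cases "i = 0") auto
 have one: "((%rho. real (horizon \<tau> d rho) * measure \<mu> {z. D x z < rho * s}) \<longlongrightarrow> \<tau> * \<gamma> x * s ^ d) (at_right 0)"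
  if "0 <= s" for s
 proof (rule tendstoI)
  fix e :: real assume "e > 0"
  then have "\<forall>\<^sub>F rho in at_right 0. \<forall>y s'. 0 <= s' & s' <= s + 1 -->
   \<bar>real (horizon \<tau> d rho) * measure \<mu> {z. D y z < rho * s'} - \<tau> * \<gamma> y * s' ^ d\<bar> <= e / 2"
   using that by (intro expected_visits_uniform \<tau>) auto
  then show "\<forall>\<^sub>F rho in at_right 0. dist (real (horizon \<tau> d rho) * measure \<mu> {z. D x z < rho * s}) (\<tau> * \<gamma> x * s ^ d) < e"
  proof eventually_elim
   case (elim rho)
   then have "\<bar>real (horizon \<tau> d rho) * measure \<mu> {z. D x z < rho * s} - \<tau> * \<gamma> x * s ^ d\<bar> <= e / 2"
    using that by simp
   then show ?case using \<open>e > 0\<close> unfolding dist_real_def by linarith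
  qed
 qed
 have "((%rho. \<Sum>i<q. (1 - (\<Prod>j\<in>{Suc i..q}. sg j)) *
   (real (horizon \<tau> d rho) * measure \<mu> {z. D x z < rho * a (Suc i)} - real (horizon \<tau> d rho) * measure \<mu> {z. D x z < rho * a i}))
   \<longlongrightarrow> (\<Sum>i<q. (1 - (\<Prod>j\<in>{Suc i..q}. sg j)) * (\<tau> * \<gamma> x * a (Suc i) ^ d - \<tau> * \<gamma> x * a i ^ d))) (at_right 0)"
  using a0 by (intro tendsto_sum tendsto_mult tendsto_const tendsto_diff one) auto
 also have "(\<Sum>i<q. (1 - (\<Prod>j\<in>{Suc i..q}. sg j)) * (\<tau> * \<gamma> x * a (Suc i) ^ d - \<tau> * \<gamma> x * a i ^ d))
   = \<tau> * \<gamma> x * shell_rate a sg q"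
  by (simp add: shell_rate_def sum_distrib_left algebra_simps)
 finally show ?thesis
 proof (rule Lim_transform_eventually)
  have pos: "\<forall>\<^sub>F rho::real in at_right 0. 0 < rho" by (rule eventually_at_right_less)
  then show "\<forall>\<^sub>F rho in at_right 0. (\<Sum>i<q. (1 - (\<Prod>j\<in>{Suc i..q}. sg j)) *
   (real (horizon \<tau> d rho) * measure \<mu> {z. D x z < rho * a (Suc i)} - real (horizon \<tau> d rho) * measure \<mu> {z. D x z < rho * a i}))
   = real (horizon \<tau> d rho) * (LINT z|\<mu>. 1 - step_weight a sg q (D x z / rho))"
  proof eventually_elim
   case (elim rho)
   have ind: "indicator {..<b} (D x z / rho) = (indicator {z. D x z < rho * b} z :: real)" for b z
    using elim by (auto simp: indicator_def field_simps)
   have ii: "integrable \<mu> (indicator {z. D x z < rho * b} :: 'a => real)" for b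
    by (intro integrable_real_indicator) (auto simp: emeasure_eq_measure)
   have "(LINT z|\<mu>. 1 - step_weight a sg q (D x z / rho))
    = (LINT z|\<mu>. (\<Sum>i<q. (1 - (\<Prod>j\<in>{Suc i..q}. sg j)) * (indicator {z. D x z < rho * a (Suc i)} z - indicator {z. D x z < rho * a i} z)))"
    using elim D_nonneg by (intro Bochner_Integration.integral_cong) (simp_all add: step_weight_shells[OF a] ind)
   also have "... = (\<Sum>i<q. (1 - (\<Prod>j\<in>{Suc i..q}. sg j)) * (measure \<mu> {z. D x z < rho * a (Suc i)} - measure \<mu> {z. D x z < rho * a i}))"
    using ii by (subst Bochner_Integration.integral_sum) auto
   finally show ?case by (simp add: sum_distrib_left algebra_simps)
  qed
 qed
qed

end

context mixing_metric_space begin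

lemma step_integrable:
 assumes sg: "\<And>j. j \<in> {1..q} ==> 0 <= sg j & sg j <= 1" and h: "h \<in> borel_measurable \<mu>"
 shows "integrable \<mu> (%z. 1 - step_weight a sg q (h z))" "integrable \<mu> (%z. 1 - ramp_weight a b sg q (h z))"
proof -
 note h [measurable]
 have "0 <= ramp_weight a b sg q t & ramp_weight a b sg q t <= 1" for t
  unfolding ramp_weight_def using ramp_factor sg by (auto intro!: prod_nonneg prod_le_1)
 then show "integrable \<mu> (%z. 1 - step_weight a sg q (h z))" "integrable \<mu> (%z. 1 - ramp_weight a b sg q (h z))"
  using step_weight_bounds[OF sg] by (auto intro!: integrable_unit)
qed

text \<open>Squeezing the sharp weights between ramps of width \<open>\<kappa>\<close> changes the expected number of visits by a quantity that vanishes with \<open>\<kappa>\<close>, so both bounds have the same limit.\<close>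

lemma hitting_pgf:
 assumes \<tau>: "\<tau> > 0" and eta: "eta > 0" and s0: "s0 > 0"
  and slow: "\<And>s g. 0 < s ==> s < s0 ==> 1 <= g ==> real g <= s powr (- eta) ==>
   measure \<mu> {y. D x y < s & D x ((f ^^ g) y) < s} <= s ^ d * s powr eta"
  and a: "a 0 = 0" "strict_mono_on {..q} a" and sg: "\<And>j. j \<in> {1..q} ==> 0 <= sg j & sg j <= 1"
 shows "((%rho. \<integral>y. (\<Prod>k\<in>{1..horizon \<tau> d rho}. step_weight a sg q (D x ((f ^^ k) y) / rho)) \<partial>\<mu>)
  \<longlongrightarrow> exp (- (\<tau> * \<gamma> x * shell_rate a sg q))) (at_right 0)"
proof (rule tendstoI)
 fix e :: real assume e: "e > 0"
 define lam where "lam = \<tau> * \<gamma> x * shell_rate a sg q"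
 have apos: "0 < a j" if "j \<in> {1..q}" for j
  using strict_mono_onD[OF a(2), of 0 j] a(1) that by auto
 have ainc: "0 <= a i" "a i <= a (Suc i)" if "i < q" for i
  using strict_mono_onD[OF a(2), of i "Suc i"] strict_mono_onD[OF a(2), of 0 i] a(1) that by (cases "i = 0"; auto)+
 have "0 <= shell_rate a sg q"
  unfolding shell_rate_def using sg ainc
  by (intro sum_nonneg mult_nonneg_nonneg) (auto intro!: prod_le_1 power_mono)
 then have lam: "0 <= lam" using \<tau> c_pos \<gamma>_ge[of x] by (simp add: lam_def)
 obtain delta where delta: "delta > 0" "exp (lam + delta) - exp (max 0 (lam - delta)) < e / 2"
  using exp_window[OF lam, of "e / 2"] e by auto
 obtain kappa where kappa: "0 < kappa" "kappa < 1" "\<bar>(1 + kappa) ^ d * lam - lam\<bar> < delta" "\<bar>(1 - kappa) ^ d * lam - lam\<bar> < delta"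
 proof -
  have "((%kappa. (1 + kappa) ^ d * lam - lam) \<longlongrightarrow> (1 + 0) ^ d * lam - lam) (at_right 0)"
   "((%kappa. (1 - kappa) ^ d * lam - lam) \<longlongrightarrow> (1 - 0) ^ d * lam - lam) (at_right 0)" by (intro tendsto_intros)+
  then have "\<forall>\<^sub>F kappa in at_right 0. dist ((1 + kappa) ^ d * lam - lam) 0 < delta"
    "\<forall>\<^sub>F kappa in at_right 0. dist ((1 - kappa) ^ d * lam - lam) 0 < delta" using delta by (auto dest!: tendstoD[of _ _ _ delta])
  moreover have "\<forall>\<^sub>F kappa::real in at_right 0. kappa \<in> {0<..<1}" by (rule eventually_at_right_real) simp
  ultimately have "\<forall>\<^sub>F kappa in at_right 0. 0 < kappa & kappa < 1 & \<bar>(1 + kappa) ^ d * lam - lam\<bar> < delta & \<bar>(1 - kappa) ^ d * lam - lam\<bar> < delta"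
   by eventually_elim auto
  from eventually_happens[OF this] that show thesis by (auto simp: trivial_limit_at_right_real)
 qed
 have rate: "shell_rate (%j. s * a j) sg q = s ^ d * shell_rate a sg q" for s
  by (simp add: shell_rate_def power_mult_distrib sum_distrib_left algebra_simps)
 have scaled: "((%rho. real (horizon \<tau> d rho) * (LINT z|\<mu>. 1 - step_weight (%j. s * a j) sg q (D x z / rho)))
  \<longlongrightarrow> s ^ d * lam) (at_right 0)" if s: "0 < s" for s
 proof -
  have "strict_mono_on {..q} (%j. s * a j)" using a(2) s by (auto simp: strict_mono_on_def)
  then show ?thesis using expected_step_weight[OF \<tau>, of "%j. s * a j" q sg x] a(1)
   by (simp add: rate lam_def mult_ac)
 qed
 have close: "\<forall>\<^sub>F rho in at_right 0. \<bar>(LINT y|\<mu>. (\<Prod>k\<in>{1..horizon \<tau> d rho}.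
   ramp_weight (%j. s * a j) (%j. t * a j) sg q (D x ((f ^^ k) y) / rho))) - exp (- lam)\<bar> < e"
  if st: "0 < s" "s < t" "\<bar>s ^ d * lam - lam\<bar> < delta" "\<bar>t ^ d * lam - lam\<bar> < delta" for s t
 proof -
  let ?b = "%j. s * a j" and ?c = "%j. t * a j"
  have bc: "0 < ?b j & ?b j < ?c j" if "j \<in> {1..q}" for j using apos[OF that] st by simp
  obtain T Lu where pr: "profile (%t. 1 - ramp_weight ?b ?c sg q t) T Lu"
   using ramp_weight_profile[where q = q and sg = sg and b = ?b and b' = ?c, OF sg] bc by blast
  have "\<forall>\<^sub>F rho in at_right 0. lam - delta < real (horizon \<tau> d rho) * (LINT z|\<mu>. 1 - step_weight ?b sg q (D x z / rho))"
   using scaled[of s] st by (intro order_tendstoD) auto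
  moreover have "\<forall>\<^sub>F rho in at_right 0. real (horizon \<tau> d rho) * (LINT z|\<mu>. 1 - step_weight ?c sg q (D x z / rho)) < lam + delta"
   using scaled[of t] st by (intro order_tendstoD) auto
  ultimately have mean: "\<forall>\<^sub>F rho in at_right 0. \<bar>real (horizon \<tau> d rho) * (LINT z|\<mu>. 1 - ramp_weight ?b ?c sg q (D x z / rho)) - lam\<bar> <= delta"
  proof eventually_elim
   case (elim rho)
   have m: "(%z. D x z / rho) \<in> borel_measurable \<mu>" by measurable
   have 1: "(LINT z|\<mu>. 1 - step_weight ?b sg q (D x z / rho)) <= (LINT z|\<mu>. 1 - ramp_weight ?b ?c sg q (D x z / rho))"
    using ramp_weight_sandwich(2)[where q = q and sg = sg and b = ?b and c = ?c, OF sg] bc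
    by (intro integral_mono step_integrable[OF sg m]) auto
   have 2: "(LINT z|\<mu>. 1 - ramp_weight ?b ?c sg q (D x z / rho)) <= (LINT z|\<mu>. 1 - step_weight ?c sg q (D x z / rho))"
    using ramp_weight_sandwich(1)[where q = q and sg = sg and b = ?b and c = ?c, OF sg] bc
    by (intro integral_mono step_integrable[OF sg m]) auto
   show ?case using mult_left_mono[OF 1, of "real (horizon \<tau> d rho)"] mult_left_mono[OF 2, of "real (horizon \<tau> d rho)"] elim
    by linarith
  qed
  have "\<forall>\<^sub>F rho in at_right 0. \<bar>(LINT y|\<mu>. (\<Prod>k\<in>{1..horizon \<tau> d rho}. 1 - (1 - ramp_weight ?b ?c sg q (D x ((f ^^ k) y) / rho)))) - exp (- lam)\<bar>
   < exp (lam + delta) - exp (max 0 (lam - delta)) + e / 2"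
   using delta e by (intro hitting_limit[OF pr \<tau> eta s0 slow lam _ mean]) auto
  then show ?thesis by eventually_elim (use delta in simp)
 qed
 have up: "\<forall>\<^sub>F rho in at_right 0. \<bar>(LINT y|\<mu>. (\<Prod>k\<in>{1..horizon \<tau> d rho}.
   ramp_weight (%j. (1 - kappa) * a j) (%j. 1 * a j) sg q (D x ((f ^^ k) y) / rho))) - exp (- lam)\<bar> < e"
  using kappa delta by (intro close) auto
 have low: "\<forall>\<^sub>F rho in at_right 0. \<bar>(LINT y|\<mu>. (\<Prod>k\<in>{1..horizon \<tau> d rho}.
   ramp_weight (%j. 1 * a j) (%j. (1 + kappa) * a j) sg q (D x ((f ^^ k) y) / rho))) - exp (- lam)\<bar> < e"
  using kappa delta by (intro close) auto
 from up low show "\<forall>\<^sub>F rho in at_right 0. dist (LINT y|\<mu>. (\<Prod>k\<in>{1..horizon \<tau> d rho}. step_weight a sg q (D x ((f ^^ k) y) / rho)))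
   (exp (- (\<tau> * \<gamma> x * shell_rate a sg q))) < e"
 proof eventually_elim
  case (elim rho)
  have sw: "0 <= step_weight a sg q t" "step_weight a sg q t <= 1" for t by (rule step_weight_bounds[OF sg]; assumption)+
  have rw: "0 <= ramp_weight b b' sg q t" "ramp_weight b b' sg q t <= 1" for b b' t
   unfolding ramp_weight_def using ramp_factor sg by (auto intro!: prod_nonneg prod_le_1)
  have iS: "integrable \<mu> (%y. \<Prod>k\<in>{1..horizon \<tau> d rho}. step_weight a sg q (D x ((f ^^ k) y) / rho))"
   using sw by (intro integrable_unit) (auto intro!: prod_nonneg prod_le_1)
  have ir: "integrable \<mu> (%y. \<Prod>k\<in>{1..horizon \<tau> d rho}. ramp_weight b b' sg q (D x ((f ^^ k) y) / rho))" for b b'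
   using rw by (intro integrable_unit) (auto intro!: prod_nonneg prod_le_1)
  have 1: "(LINT y|\<mu>. (\<Prod>k\<in>{1..horizon \<tau> d rho}. ramp_weight (%j. 1 * a j) (%j. (1 + kappa) * a j) sg q (D x ((f ^^ k) y) / rho)))
   <= (LINT y|\<mu>. (\<Prod>k\<in>{1..horizon \<tau> d rho}. step_weight a sg q (D x ((f ^^ k) y) / rho)))"
   using ramp_weight_sandwich(2)[where q = q and sg = sg and b = "%j. 1 * a j" and c = "%j. (1 + kappa) * a j", OF sg] apos kappa rw
   by (intro integral_mono iS ir prod_mono) auto
  have 2: "(LINT y|\<mu>. (\<Prod>k\<in>{1..horizon \<tau> d rho}. step_weight a sg q (D x ((f ^^ k) y) / rho)))
   <= (LINT y|\<mu>. (\<Prod>k\<in>{1..horizon \<tau> d rho}. ramp_weight (%j. (1 - kappa) * a j) (%j. 1 * a j) sg q (D x ((f ^^ k) y) / rho)))"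
   using ramp_weight_sandwich(1)[where q = q and sg = sg and b = "%j. (1 - kappa) * a j" and c = "%j. 1 * a j", OF sg] apos kappa sw
   by (intro integral_mono iS ir prod_mono) auto
  show ?case using elim 1 2 unfolding dist_real_def lam_def[symmetric] by linarith
 qed
qed

text \<open>The density is merely uniformly continuous, whereas the target radius has to be Lipschitz: the sup-convolution \<open>r x = sup (h z - K D x z)\<close> is an upper approximation with Lipschitz constant \<open>K\<close>.\<close>

lemma Lipschitz_upper_approximation:
 assumes bd: "\<And>x. p <= h x" "\<And>x. h x <= P" and p: "0 <= p"
  and cont: "\<And>eps. eps > 0 ==> \<exists>delta>0. \<forall>x y. D x y < delta --> \<bar>h x - h y\<bar> < eps" and kappa: "kappa > 0"
 shows "\<exists>r K. 0 <= K & (\<forall>x y. \<bar>r x - r y\<bar> <= K * D x y) & (\<forall>x. h x <= r x & r x <= h x + kappa)"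
proof -
 obtain delta where delta: "delta > 0" "\<And>x y. D x y < delta ==> \<bar>h x - h y\<bar> < kappa" using cont[OF kappa] by blast
 \<comment> \<open>Points at distance at least \<open>delta\<close> contribute at most zero to the supremum below.\<close>
 define K where "K = P / delta"
 have P: "0 <= P" using bd[of undefined] p by linarith
 then have K: "0 <= K" using delta by (simp add: K_def)
 define r where "r x = (SUP y. h y - K * D x y)" for x
 have bdd: "bdd_above (range (%y. h y - K * D x y))" for x
 proof (rule bdd_aboveI2)
  fix y
  have "0 <= K * D x y" using K D_nonneg by simp
  then show "h y - K * D x y <= P" using bd(2)[of y] by linarith
 qed
 have lower: "h y - K * D x y <= r x" for x y unfolding r_def by (rule cSUP_upper[OF _ bdd]) simp
 have upper: "r x <= b" if "\<And>y. h y - K * D x y <= b" for x b unfolding r_def using that by (intro cSUP_least) auto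
 have Lip1: "r x <= r y + K * D x y" for x y
 proof (rule upper)
  fix z
  have "K * D y z <= K * (D x y + D x z)" using D_tri[of y z x] D_sym[of x y] K by (intro mult_left_mono) auto
  then show "h z - K * D x z <= r y + K * D x y" using lower[of z y] by (simp add: algebra_simps)
 qed
 have "\<bar>r x - r y\<bar> <= K * D x y" for x y using Lip1[of x y] Lip1[of y x] D_sym[of x y] by (simp add: abs_le_iff)
 moreover have "h x <= r x" for x using lower[of x x] by (simp add: D_refl)
 moreover have "r x <= h x + kappa" for x
 proof (rule upper)
  fix y
  show "h y - K * D x y <= h x + kappa"
  proof (cases "D x y < delta")
   case True
   have "0 <= K * D x y" using K D_nonneg by simp
   then show ?thesis using delta(2)[OF True] by linarith
  next
   case False
   have "P = K * delta" using delta by (simp add: K_def)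
   also have "... <= K * D x y" using False K by (intro mult_left_mono) auto
   finally show ?thesis using bd[of x] bd[of y] p kappa by linarith
  qed
 qed
 ultimately show ?thesis using K by blast
qed

lemma Lipschitz_measurable:
 assumes "\<And>x y. \<bar>r x - r y\<bar> <= K * D x y"
 shows "r \<in> borel_measurable \<mu>"
proof (rule continuous_measurable)
 fix eps :: real assume e: "eps > 0"
 show "\<exists>delta>0. \<forall>x y. D x y < delta --> \<bar>r x - r y\<bar> < eps"
 proof (intro exI conjI allI impI)
  show "eps / (\<bar>K\<bar> + 1) > 0" using e by simp
  fix x y assume "D x y < eps / (\<bar>K\<bar> + 1)"
  then have "(\<bar>K\<bar> + 1) * D x y < eps" by (simp add: field_simps add_pos_nonneg)
  moreover have "K * D x y <= (\<bar>K\<bar> + 1) * D x y" using D_nonneg by (intro mult_right_mono) auto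
  ultimately show "\<bar>r x - r y\<bar> < eps" using assms[of x y] by linarith
 qed
qed

lemma \<gamma>_measurable [measurable]: "\<gamma> \<in> borel_measurable \<mu>"
 by (rule continuous_measurable) (rule \<gamma>_continuous)

definition unit_radius :: "'a => real" where "unit_radius x = 1 / \<gamma> x powr (1 / real d)"

lemma unit_radius_pow: "0 < unit_radius x" "\<gamma> x * unit_radius x ^ d = 1"
proof -
 have g: "0 < \<gamma> x" using c_pos \<gamma>_ge[of x] by linarith
 then show "0 < unit_radius x" by (simp add: unit_radius_def)
 have "(\<gamma> x powr (1 / real d)) ^ d = \<gamma> x powr (1 / real d * real d)"
  using g by (simp add: powr_realpow[symmetric] powr_powr)
 also have "... = \<gamma> x" using g d_ge_1 by simp
 finally show "\<gamma> x * unit_radius x ^ d = 1" using g by (simp add: unit_radius_def power_divide)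
qed

lemma unit_radius_bounds: "1 / G powr (1 / real d) <= unit_radius x" "unit_radius x <= 1 / c powr (1 / real d)"
proof -
 have g: "0 < \<gamma> x" "0 < c" using c_pos \<gamma>_ge[of x] by linarith+
 show "1 / G powr (1 / real d) <= unit_radius x" "unit_radius x <= 1 / c powr (1 / real d)"
  unfolding unit_radius_def using g \<gamma>_ge[of x] \<gamma>_le[of x] by (auto intro!: divide_left_mono powr_mono2)
qed

lemma unit_radius_continuous:
 assumes "eps > 0"
 shows "\<exists>delta>0. \<forall>x y. D x y < delta --> \<bar>unit_radius x - unit_radius y\<bar> < eps"
proof -
 have "continuous_on {c..G} (%t. 1 / t powr (1 / real d))"
  using c_pos by (intro continuous_intros) auto
 then have "uniformly_continuous_on {c..G} (%t. 1 / t powr (1 / real d))"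
  by (intro compact_uniformly_continuous) auto
 then obtain e where e: "e > 0" "\<And>s t. s \<in> {c..G} ==> t \<in> {c..G} ==> dist t s < e ==>
  dist (1 / t powr (1 / real d)) (1 / s powr (1 / real d)) < eps"
  using assms unfolding uniformly_continuous_on_def by metis
 obtain delta where delta: "delta > 0" "\<And>x y. D x y < delta ==> \<bar>\<gamma> x - \<gamma> y\<bar> < e" using \<gamma>_continuous[OF e(1)] by blast
 show ?thesis
  using e(2) delta \<gamma>_ge \<gamma>_le by (intro exI[of _ delta]) (auto simp: unit_radius_def dist_real_def)
qed

text \<open>With the radius normalised by the density, the expected number of visits is asymptotically \<open>\<tau>\<close> for every starting point, so the limit carries no average over the density.\<close>

lemma return_pgf:
 assumes \<tau>: "\<tau> > 0" and sg: "0 <= sg" "sg <= 1"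
 shows "((%rho. \<integral>y. (\<Prod>k\<in>{1..horizon \<tau> d rho}. if D y ((f ^^ k) y) < rho * unit_radius y then sg else 1) \<partial>\<mu>)
  \<longlongrightarrow> exp (- (\<tau> * (1 - sg)))) (at_right 0)"
proof (rule tendstoI)
 fix e :: real assume e: "e > 0"
 define lam where "lam = \<tau> * (1 - sg)"
 have lam: "0 <= lam" using \<tau> sg by (simp add: lam_def)
 obtain delta where delta: "delta > 0" "exp (lam + delta) - exp (max 0 (lam - delta)) < e / 2"
  using exp_window[OF lam, of "e / 2"] e by auto
 obtain kappa where kappa: "0 < kappa" "kappa < 1" "\<tau> * ((1 + kappa) * (1 + kappa)) ^ d < \<tau> + delta / 2" "\<tau> - delta / 2 < \<tau> * ((1 - kappa) / (1 + kappa)) ^ d"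
 proof -
  have "((%kappa. \<tau> * ((1 + kappa) * (1 + kappa)) ^ d) \<longlongrightarrow> \<tau> * ((1 + 0) * (1 + 0)) ^ d) (at_right 0)"
   "((%kappa. \<tau> * ((1 - kappa) / (1 + kappa)) ^ d) \<longlongrightarrow> \<tau> * ((1 - 0) / (1 + 0)) ^ d) (at_right 0)" by (intro tendsto_intros; simp)+
  then have "\<forall>\<^sub>F kappa in at_right 0. \<tau> * ((1 + kappa) * (1 + kappa)) ^ d < \<tau> + delta / 2"
   "\<forall>\<^sub>F kappa in at_right 0. \<tau> - delta / 2 < \<tau> * ((1 - kappa) / (1 + kappa)) ^ d" using delta by (auto intro!: order_tendstoD)
  moreover have "\<forall>\<^sub>F kappa::real in at_right 0. kappa \<in> {0<..<1}" by (rule eventually_at_right_real) simp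
  ultimately have "\<forall>\<^sub>F kappa in at_right 0. 0 < kappa & kappa < 1 & \<tau> * ((1 + kappa) * (1 + kappa)) ^ d < \<tau> + delta / 2
    & \<tau> - delta / 2 < \<tau> * ((1 - kappa) / (1 + kappa)) ^ d"
   by eventually_elim auto
  from eventually_happens[OF this] that show thesis by (auto simp: trivial_limit_at_right_real)
 qed
 define p where "p = 1 / G powr (1 / real d)"
 define P where "P = 1 / c powr (1 / real d)"
 have G: "0 < G" using c_pos \<gamma>_ge[of undefined] \<gamma>_le[of undefined] by linarith
 have p: "0 < p" "p <= unit_radius x" "unit_radius x <= P" for x
  using G unit_radius_bounds by (auto simp: p_def P_def)
 have P0: "0 < P" using p(1) p(2,3)[of undefined] by linarith
 have "\<exists>r K. 0 <= K & (\<forall>x y. \<bar>r x - r y\<bar> <= K * D x y) & (\<forall>x. unit_radius x <= r x & r x <= unit_radius x + kappa * p)"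
  using p kappa by (intro Lipschitz_upper_approximation[of p unit_radius P] unit_radius_continuous) auto
 then obtain r K where K: "0 <= K" "\<And>x y. \<bar>r x - r y\<bar> <= K * D x y" and
   r0: "\<And>x. unit_radius x <= r x" "\<And>x. r x <= unit_radius x + kappa * p" by blast
 have r_hi: "r x <= (1 + kappa) * unit_radius x" for x
 proof -
  have "kappa * p <= kappa * unit_radius x" using p kappa by (intro mult_left_mono) auto
  then show ?thesis using r0(2)[of x] by (simp add: algebra_simps)
 qed
 have rm: "r \<in> borel_measurable \<mu>" by (rule Lipschitz_measurable[OF K(2)])
 have close: "\<forall>\<^sub>F rho in at_right 0. \<bar>(LINT y|\<mu>. (\<Prod>k\<in>{1..horizon \<tau> d rho}.
   ramp_weight (%_. s) (%_. t) (%_. sg) 1 (D y ((f ^^ k) y) / (rho * r' y)))) - exp (- lam)\<bar> < e"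
  if st: "0 < s" "s < t" and tg: "targets (%y. y) r' a b K'"
   and lo: "\<And>y. \<tau> - delta / 2 <= \<tau> * (\<gamma> y * (s * r' y) ^ d)" and hi: "\<And>y. \<tau> * (\<gamma> y * (t * r' y) ^ d) <= \<tau> + delta / 2" for s t r' a b K'
 proof -
  obtain T Lu where pr: "profile (%x. 1 - ramp_weight (%_. s) (%_. t) (%_. sg) 1 x) T Lu"
   using ramp_weight_profile[of 1 "%_. sg" "%_. s" "%_. t"] sg st by auto
  have ab: "0 < a" "\<And>y. a <= r' y" "\<And>y. r' y <= b" and [measurable]: "r' \<in> borel_measurable \<mu>"
   using tg by (auto simp: targets_def)
  have b: "0 < b" using ab(1) ab(2)[of undefined] ab(3)[of undefined] by linarith
  have step: "1 - step_weight (%_. s) (%_. sg) 1 (D y z / (rho * r' y)) = (1 - sg) * indicator {z. D y z < rho * (s * r' y)} z"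
   if "0 < rho" for s y z rho
  proof -
   have "0 < r' y" using ab(1) ab(2)[of y] by linarith
   then show ?thesis using that by (auto simp: step_weight_def indicator_def field_simps)
  qed
  have mean: "\<forall>\<^sub>F rho in at_right 0. \<forall>y. \<bar>real (horizon \<tau> d rho) *
    (LINT z|\<mu>. 1 - ramp_weight (%_. s) (%_. t) (%_. sg) 1 (D y z / (rho * r' y))) - lam\<bar> <= delta"
  proof -
   have "\<forall>\<^sub>F rho in at_right 0. \<forall>y s'. 0 <= s' & s' <= t * b -->
    \<bar>real (horizon \<tau> d rho) * measure \<mu> {z. D y z < rho * s'} - \<tau> * \<gamma> y * s' ^ d\<bar> <= delta / 2"
    using delta st b by (intro expected_visits_uniform \<tau>) auto
   moreover have "\<forall>\<^sub>F rho::real in at_right 0. 0 < rho" by (rule eventually_at_right_less)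
   ultimately show ?thesis
   proof (eventually_elim, intro allI)
    fix rho y
    assume uni: "\<forall>y s'. 0 <= s' & s' <= t * b -->
     \<bar>real (horizon \<tau> d rho) * measure \<mu> {z. D y z < rho * s'} - \<tau> * \<gamma> y * s' ^ d\<bar> <= delta / 2" and rho: "0 < rho"
    let ?n = "real (horizon \<tau> d rho)"
    let ?I = "\<integral>z. 1 - ramp_weight (%_. s) (%_. t) (%_. sg) 1 (D y z / (rho * r' y)) \<partial>\<mu>"
    have m: "(%z. D y z / (rho * r' y)) \<in> borel_measurable \<mu>" by measurable
    have rp: "0 < r' y" using ab(1) ab(2)[of y] by linarith
    have sI: "(LINT z|\<mu>. 1 - step_weight (%_. s') (%_. sg) 1 (D y z / (rho * r' y))) = (1 - sg) * measure \<mu> {z. D y z < rho * (s' * r' y)}" for s'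
     unfolding step[OF rho] by simp
    have "(LINT z|\<mu>. 1 - step_weight (%_. s) (%_. sg) 1 (D y z / (rho * r' y))) <= ?I"
     using ramp_weight_sandwich(2)[of 1 "%_. sg" "%_. s" "%_. t"] sg st
     by (intro integral_mono step_integrable m) auto
    then have 1: "?n * ((1 - sg) * measure \<mu> {z. D y z < rho * (s * r' y)}) <= ?n * ?I"
     unfolding sI by (rule mult_left_mono) simp
    have "?I <= (LINT z|\<mu>. 1 - step_weight (%_. t) (%_. sg) 1 (D y z / (rho * r' y)))"
     using ramp_weight_sandwich(1)[of 1 "%_. sg" "%_. s" "%_. t"] sg st
     by (intro integral_mono step_integrable m) auto
    then have 2: "?n * ?I <= ?n * ((1 - sg) * measure \<mu> {z. D y z < rho * (t * r' y)})"
     unfolding sI by (rule mult_left_mono) simp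
    have "s * r' y <= t * b" "t * r' y <= t * b" using st rp ab(3)[of y] by (auto intro!: mult_mono)
    then have u: "\<bar>?n * measure \<mu> {z. D y z < rho * (s * r' y)} - \<tau> * \<gamma> y * (s * r' y) ^ d\<bar> <= delta / 2"
     "\<bar>?n * measure \<mu> {z. D y z < rho * (t * r' y)} - \<tau> * \<gamma> y * (t * r' y) ^ d\<bar> <= delta / 2"
     using uni st rp by auto
    have l: "\<tau> - delta <= ?n * measure \<mu> {z. D y z < rho * (s * r' y)}" using u(1) lo[of y] unfolding mult.assoc by linarith
    have h: "?n * measure \<mu> {z. D y z < rho * (t * r' y)} <= \<tau> + delta" using u(2) hi[of y] unfolding mult.assoc by linarith
    have "(1 - sg) * (\<tau> - delta) <= ?n * ?I" using mult_left_mono[OF l, of "1 - sg"] 1 sg by (simp add: mult_ac)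
    moreover have "?n * ?I <= (1 - sg) * (\<tau> + delta)" using mult_left_mono[OF h, of "1 - sg"] 2 sg by (simp add: mult_ac)
    moreover have "(1 - sg) * delta <= delta" using sg delta by (simp add: mult_left_le_one_le)
    ultimately show "\<bar>?n * ?I - lam\<bar> <= delta" unfolding lam_def by (simp add: algebra_simps abs_le_iff)
   qed
  qed
  have "\<forall>\<^sub>F rho in at_right 0. \<bar>(LINT y|\<mu>. (\<Prod>k\<in>{1..horizon \<tau> d rho}. 1 - (1 - ramp_weight (%_. s) (%_. t) (%_. sg) 1 (D y ((f ^^ k) y) / (rho * r' y))))) - exp (- lam)\<bar>
   < exp (lam + delta) - exp (max 0 (lam - delta)) + e / 2"
   using delta e by (intro return_limit[OF tg pr \<tau> lam _ mean]) auto
  then show ?thesis by eventually_elim (use delta in simp)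
 qed
 define r2 where "r2 y = r y / (1 + kappa)" for y
 have r2m: "r2 \<in> borel_measurable \<mu>" unfolding r2_def using rm by measurable
 have rb: "p <= r y" "r y <= 2 * P" for y
 proof -
  show "p <= r y" using r0(1)[of y] p(2)[of y] by linarith
  have "(1 + kappa) * unit_radius y <= 2 * P" using kappa p(1) p(2,3)[of y] unit_radius_pow(1)[of y] by (intro mult_mono) auto
  then show "r y <= 2 * P" using r_hi[of y] by linarith
 qed
 have tg1: "targets (%y. y) r p (2 * P) K" using rm p(1) K rb by (auto simp: targets_def)
 have tg2: "targets (%y. y) r2 (p / (1 + kappa)) (2 * P) K"
 proof -
  have "\<bar>r2 x - r2 y\<bar> <= K * D x y" for x y
  proof -
   have "\<bar>r2 x - r2 y\<bar> = \<bar>r x - r y\<bar> / (1 + kappa)" using kappa by (simp add: r2_def flip: diff_divide_distrib)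
   also have "... <= \<bar>r x - r y\<bar>" using kappa by (simp add: field_simps)
   finally show ?thesis using K(2)[of x y] by linarith
  qed
  moreover have "r2 y <= 2 * P" for y
  proof -
   have "r2 y <= r y" using kappa rb[of y] p(1) by (simp add: r2_def field_simps)
   then show ?thesis using rb[of y] by linarith
  qed
  moreover have "p / (1 + kappa) <= r2 y" for y using rb(1)[of y] kappa by (simp add: r2_def divide_right_mono)
  ultimately show ?thesis using r2m p(1) K kappa by (auto simp: targets_def)
 qed
 have r2_hi: "r2 y <= unit_radius y" for y using r_hi[of y] kappa by (simp add: r2_def field_simps)
 have r2_lo: "unit_radius y / (1 + kappa) <= r2 y" for y using r0(1)[of y] kappa by (simp add: r2_def divide_right_mono)
 have g0: "0 < \<gamma> y" for y using c_pos \<gamma>_ge[of y] by linarith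
 have low: "\<forall>\<^sub>F rho in at_right 0. \<bar>(LINT y|\<mu>. (\<Prod>k\<in>{1..horizon \<tau> d rho}.
   ramp_weight (%_. 1) (%_. 1 + kappa) (%_. sg) 1 (D y ((f ^^ k) y) / (rho * r y)))) - exp (- lam)\<bar> < e"
 proof (rule close[OF _ _ tg1])
  fix y
  have "1 <= \<gamma> y * (1 * r y) ^ d"
   using mult_left_mono[OF power_mono[OF r0(1)[of y], of d], of "\<gamma> y"] unit_radius_pow[of y] g0[of y] by simp
  then have "\<tau> * 1 <= \<tau> * (\<gamma> y * (1 * r y) ^ d)" using \<tau> by (intro mult_left_mono) auto
  then show "\<tau> - delta / 2 <= \<tau> * (\<gamma> y * (1 * r y) ^ d)" using delta(1) by linarith
  have "(1 + kappa) * r y <= (1 + kappa) * ((1 + kappa) * unit_radius y)" using r_hi[of y] kappa by (intro mult_left_mono) auto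
  then have "((1 + kappa) * r y) ^ d <= ((1 + kappa) * ((1 + kappa) * unit_radius y)) ^ d"
   using kappa rb[of y] p(1) by (intro power_mono) auto
  then have "\<gamma> y * ((1 + kappa) * r y) ^ d <= \<gamma> y * ((1 + kappa) * ((1 + kappa) * unit_radius y)) ^ d" using g0[of y] by simp
  also have "... = ((1 + kappa) * (1 + kappa)) ^ d * (\<gamma> y * unit_radius y ^ d)" by (simp add: power_mult_distrib mult_ac)
  also have "... = ((1 + kappa) * (1 + kappa)) ^ d" by (simp add: unit_radius_pow)
  finally have "\<tau> * (\<gamma> y * ((1 + kappa) * r y) ^ d) <= \<tau> * ((1 + kappa) * (1 + kappa)) ^ d" using \<tau> by (intro mult_left_mono) auto
  then show "\<tau> * (\<gamma> y * ((1 + kappa) * r y) ^ d) <= \<tau> + delta / 2" using kappa(3) by linarith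
 qed (use kappa in auto)
 have up: "\<forall>\<^sub>F rho in at_right 0. \<bar>(LINT y|\<mu>. (\<Prod>k\<in>{1..horizon \<tau> d rho}.
   ramp_weight (%_. 1 - kappa) (%_. 1) (%_. sg) 1 (D y ((f ^^ k) y) / (rho * r2 y)))) - exp (- lam)\<bar> < e"
 proof (rule close[OF _ _ tg2])
  fix y
  have u: "0 < unit_radius y" by (rule unit_radius_pow)
  have r2p: "0 <= r2 y" using r2_lo[of y] u kappa by (smt (verit) divide_nonneg_pos)
  have "\<gamma> y * (1 * r2 y) ^ d <= 1"
   using mult_left_mono[OF power_mono[OF r2_hi[of y] r2p, of d], of "\<gamma> y"] unit_radius_pow(2)[of y] g0[of y] by simp
  then have "\<tau> * (\<gamma> y * (1 * r2 y) ^ d) <= \<tau> * 1" using \<tau> by (intro mult_left_mono) auto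
  then show "\<tau> * (\<gamma> y * (1 * r2 y) ^ d) <= \<tau> + delta / 2" using delta(1) by linarith
  have "(1 - kappa) * (unit_radius y / (1 + kappa)) <= (1 - kappa) * r2 y" using r2_lo[of y] kappa by (intro mult_left_mono) auto
  then have "((1 - kappa) / (1 + kappa) * unit_radius y) ^ d <= ((1 - kappa) * r2 y) ^ d"
   using kappa u by (intro power_mono) auto
  then have "\<gamma> y * ((1 - kappa) / (1 + kappa) * unit_radius y) ^ d <= \<gamma> y * ((1 - kappa) * r2 y) ^ d" using g0[of y] by simp
  moreover have "\<gamma> y * ((1 - kappa) / (1 + kappa) * unit_radius y) ^ d = ((1 - kappa) / (1 + kappa)) ^ d * (\<gamma> y * unit_radius y ^ d)"
   by (simp only: power_mult_distrib mult_ac)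
  ultimately have "((1 - kappa) / (1 + kappa)) ^ d <= \<gamma> y * ((1 - kappa) * r2 y) ^ d" by (simp add: unit_radius_pow)
  then have "\<tau> * ((1 - kappa) / (1 + kappa)) ^ d <= \<tau> * (\<gamma> y * ((1 - kappa) * r2 y) ^ d)" using \<tau> by (intro mult_left_mono) auto
  then show "\<tau> - delta / 2 <= \<tau> * (\<gamma> y * ((1 - kappa) * r2 y) ^ d)" using kappa(4) by linarith
 qed (use kappa in auto)
 have [measurable]: "unit_radius \<in> borel_measurable \<mu>" unfolding unit_radius_def by measurable
 have "\<forall>\<^sub>F rho::real in at_right 0. 0 < rho" by (rule eventually_at_right_less)
 with up low show "\<forall>\<^sub>F rho in at_right 0. dist (LINT y|\<mu>. (\<Prod>k\<in>{1..horizon \<tau> d rho}. if D y ((f ^^ k) y) < rho * unit_radius y then sg else 1))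
   (exp (- (\<tau> * (1 - sg)))) < e"
 proof eventually_elim
  case (elim rho)
  have rw: "0 <= ramp_weight b b' (%_. sg) 1 t" "ramp_weight b b' (%_. sg) 1 t <= 1" for b b' t
   unfolding ramp_weight_def using ramp_factor sg by (auto intro!: prod_nonneg prod_le_1)
  let ?s = "%y k. if D y ((f ^^ k) y) < rho * unit_radius y then sg else 1"
  have iS: "integrable \<mu> (%y. \<Prod>k\<in>{1..horizon \<tau> d rho}. ?s y k)"
   using sg by (intro integrable_unit) (auto intro!: prod_nonneg prod_le_1)
  have ir: "integrable \<mu> (%y. \<Prod>k\<in>{1..horizon \<tau> d rho}. ramp_weight b b' (%_. sg) 1 (D y ((f ^^ k) y) / (rho * r' y)))"
   if [measurable]: "r' \<in> borel_measurable \<mu>" for b b' r'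
   using rw by (intro integrable_unit) (auto intro!: prod_nonneg prod_le_1)
  have l: "ramp_weight (%_. 1) (%_. 1 + kappa) (%_. sg) 1 (D y ((f ^^ k) y) / (rho * r y)) <= ?s y k" for y k
  proof (cases "D y ((f ^^ k) y) < rho * unit_radius y")
   case True
   have "rho * unit_radius y <= rho * r y" using r0(1)[of y] elim(3) by (intro mult_left_mono) auto
   then have "D y ((f ^^ k) y) < rho * r y" using True by linarith
   moreover have "0 < r y" using rb(1)[of y] p(1) by linarith
   ultimately have "D y ((f ^^ k) y) / (rho * r y) < 1" using elim(3) by (simp add: field_simps)
   then have "step_weight (%_. 1) (%_. sg) 1 (D y ((f ^^ k) y) / (rho * r y)) = sg" by (simp add: step_weight_def)
   then show ?thesis using ramp_weight_sandwich(2)[of 1 "%_. sg" "%_. 1" "%_. 1 + kappa" "D y ((f ^^ k) y) / (rho * r y)"] sg kappa True by simp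
  qed (use rw in simp)
  have h: "?s y k <= ramp_weight (%_. 1 - kappa) (%_. 1) (%_. sg) 1 (D y ((f ^^ k) y) / (rho * r2 y))" for y k
  proof -
   have r2p: "0 < r2 y" using r2_lo[of y] unit_radius_pow(1)[of y] kappa by (smt (verit) divide_pos_pos)
   have "rho * r2 y <= rho * unit_radius y" using r2_hi[of y] elim(3) by (intro mult_left_mono) auto
   then have imp: "D y ((f ^^ k) y) < rho * r2 y ==> D y ((f ^^ k) y) < rho * unit_radius y" by linarith
   have eq: "D y ((f ^^ k) y) / (rho * r2 y) < 1 \<longleftrightarrow> D y ((f ^^ k) y) < rho * r2 y"
    using elim(3) r2p by (simp add: field_simps)
   have "?s y k <= step_weight (%_. 1) (%_. sg) 1 (D y ((f ^^ k) y) / (rho * r2 y))"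
    using sg imp unfolding step_weight_def eq by auto
   also have "... <= ramp_weight (%_. 1 - kappa) (%_. 1) (%_. sg) 1 (D y ((f ^^ k) y) / (rho * r2 y))"
    using sg kappa by (intro ramp_weight_sandwich) auto
   finally show ?thesis .
  qed
  have 1: "(LINT y|\<mu>. (\<Prod>k\<in>{1..horizon \<tau> d rho}. ramp_weight (%_. 1) (%_. 1 + kappa) (%_. sg) 1 (D y ((f ^^ k) y) / (rho * r y))))
   <= (LINT y|\<mu>. (\<Prod>k\<in>{1..horizon \<tau> d rho}. ?s y k))"
   using l rw by (intro integral_mono iS ir[OF rm] prod_mono) auto
  have 2: "(LINT y|\<mu>. (\<Prod>k\<in>{1..horizon \<tau> d rho}. ?s y k)) \<le>
   (LINT y|\<mu>. (\<Prod>k\<in>{1..horizon \<tau> d rho}. ramp_weight (%_. 1 - kappa) (%_. 1) (%_. sg) 1 (D y ((f ^^ k) y) / (rho * r2 y))))"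
   using h sg by (intro integral_mono iS ir[OF r2m] prod_mono) auto
  show ?case using elim 1 2 unfolding dist_real_def lam_def[symmetric] by linarith
 qed
qed

end

section \<open>Convergence in law from reciprocal moments\<close>

text \<open>The values \<open>1 / W\<close> lie in \<open>[0,1]\<close>, so convergence of their moments gives convergence for all continuous functions by the Weierstrass theorem.\<close>

lemma reciprocal_moment_polynomial:
 fixes W :: "'r => 'w => nat" and P :: "'w measure" and W' :: "'v => nat" and Q :: "'v measure" and h :: "real => real"
 assumes P: "prob_space P" and Q: "prob_space Q"
  and W_meas: "\<And>rho. W rho \<in> P \<rightarrow>\<^sub>M count_space UNIV" and W'_meas: "W' \<in> Q \<rightarrow>\<^sub>M count_space UNIV"
  and mom: "\<And>i. ((%rho. \<integral>y. (1 / real (W rho y)) ^ i \<partial>P) \<longlongrightarrow> (LINT z|Q. (1 / real (W' z)) ^ i)) F"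
  and h: "continuous_on {0..1} h"
 shows "((%rho. \<integral>y. h (1 / real (W rho y)) \<partial>P) \<longlongrightarrow> (LINT z|Q. h (1 / real (W' z)))) F"
proof (rule tendstoI)
 interpret P: prob_space P by fact
 interpret Q: prob_space Q by fact
 fix e :: real assume e: "e > 0"
 obtain g where g: "real_polynomial_function g" and gh: "\<And>x. x \<in> {0..1} ==> \<bar>h x - g x\<bar> < e / 3"
  using Stone_Weierstrass_real_polynomial_function[of "{0..1}" h "e / 3"] h e by auto
 from g obtain a n where ga: "g = (%x. \<Sum>i\<le>n. a i * x ^ i)" by (auto simp: real_polynomial_function_iff_sum)
 have unit: "1 / real k \<in> {0..1}" for k :: nat by (cases k) auto
 have "bounded (h ` {0..1})" by (intro compact_imp_bounded compact_continuous_image h) simp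
 then obtain B where "\<forall>x\<in>h ` {0..1}. norm x <= B" unfolding bounded_iff ..
 then have B: "\<bar>h (1 / real k)\<bar> <= B" for k :: nat using unit[of k] by fastforce
 have unit01: "0 <= (1 / real k) ^ i" "(1 / real k) ^ i <= 1" for k i :: nat
  using unit[of k] by (auto simp del: power_one_over intro: power_le_one)
 have pw: "integrable M (%y. (1 / real (X y)) ^ i)"
  if "prob_space M" "X \<in> M \<rightarrow>\<^sub>M count_space UNIV" for M :: "'x measure" and X i
 proof -
  interpret M: prob_space M by fact
  note that(2) [measurable]
  show ?thesis using unit01 by (intro M.integrable_const_bound[where B = 1]) (simp_all del: power_one_over)
 qed
 have hh: "integrable M (%y. h (1 / real (X y)))" if "prob_space M" "X \<in> M \<rightarrow>\<^sub>M count_space UNIV" for M :: "'x measure" and X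
 proof -
  interpret M: prob_space M by fact
  note that(2) [measurable]
  show ?thesis using B by (intro M.integrable_const_bound[where B = B]) simp_all
 qed
 have diff: "\<bar>(LINT y|M. h (1 / real (X y))) - (\<Sum>i\<le>n. a i * (LINT y|M. (1 / real (X y)) ^ i))\<bar> <= e / 3"
  if "prob_space M" "X \<in> M \<rightarrow>\<^sub>M count_space UNIV" "\<And>i. integrable M (%y. (1 / real (X y)) ^ i)"
   "integrable M (%y. h (1 / real (X y)))" for M :: "'x measure" and X
 proof -
  interpret M: prob_space M by fact
  have ig: "integrable M (%y. g (1 / real (X y)))" unfolding ga using that(3) by auto
  have "(\<Sum>i\<le>n. a i * (LINT y|M. (1 / real (X y)) ^ i)) = (LINT y|M. g (1 / real (X y)))"
   unfolding ga using that(3) by (subst Bochner_Integration.integral_sum) auto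
  then have "\<bar>(LINT y|M. h (1 / real (X y))) - (\<Sum>i\<le>n. a i * (LINT y|M. (1 / real (X y)) ^ i))\<bar>
    = \<bar>\<integral>y. h (1 / real (X y)) - g (1 / real (X y)) \<partial>M\<bar>" using that ig by simp
  also have "... <= (LINT y|M. \<bar>h (1 / real (X y)) - g (1 / real (X y))\<bar>)" by (rule integral_abs_bound)
  also have "... <= (LINT y|M. e / 3)"
   using that(4) ig gh[OF unit] by (intro integral_mono integrable_abs Bochner_Integration.integrable_diff) (auto intro: less_imp_le)
  finally show ?thesis by (simp add: M.prob_space)
 qed
 have "((%rho. \<Sum>i\<le>n. a i * (LINT y|P. (1 / real (W rho y)) ^ i)) \<longlongrightarrow> (\<Sum>i\<le>n. a i * (LINT z|Q. (1 / real (W' z)) ^ i))) F"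
  by (intro tendsto_sum tendsto_mult tendsto_const mom)
 then have "\<forall>\<^sub>F rho in F. dist (\<Sum>i\<le>n. a i * (LINT y|P. (1 / real (W rho y)) ^ i)) (\<Sum>i\<le>n. a i * (LINT z|Q. (1 / real (W' z)) ^ i)) < e / 3"
  using e by (intro tendstoD) auto
 then show "\<forall>\<^sub>F rho in F. dist (LINT y|P. h (1 / real (W rho y))) (LINT z|Q. h (1 / real (W' z))) < e"
 proof eventually_elim
  case (elim rho)
  note P.prob_space_axioms Q.prob_space_axioms
  have 1: "\<bar>(LINT y|P. h (1 / real (W rho y))) - (\<Sum>i\<le>n. a i * (LINT y|P. (1 / real (W rho y)) ^ i))\<bar> <= e / 3"
   by (rule diff[OF P W_meas pw[OF P W_meas] hh[OF P W_meas]])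
  have 2: "\<bar>(LINT y|Q. h (1 / real (W' y))) - (\<Sum>i\<le>n. a i * (LINT y|Q. (1 / real (W' y)) ^ i))\<bar> <= e / 3"
   by (rule diff[OF Q W'_meas pw[OF Q W'_meas] hh[OF Q W'_meas]])
  show ?case using elim 1 2 unfolding dist_real_def by linarith
 qed
qed

text \<open>The points \<open>1 / v\<close> with \<open>v \<ge> 1\<close> are isolated, so a hat function at \<open>1 / w\<close> is a continuous indicator of \<open>w\<close>.\<close>

lemma reciprocal_hat:
 assumes "1 <= v" "1 <= w"
 shows "max 0 (1 - \<bar>1 / real v - 1 / real w\<bar> * (real w * (real w + 1))) = (if v = w then 1 else 0)"
proof (cases "v = w")
 case False
 have "1 / real v - 1 / real w = (real w - real v) / (real v * real w)" using assms by (simp add: field_simps)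
 then have eq: "\<bar>1 / real v - 1 / real w\<bar> = \<bar>real w - real v\<bar> / (real v * real w)" by (simp add: abs_mult)
 have "real v * real w <= \<bar>real w - real v\<bar> * (real w * (real w + 1))"
 proof -
  have "real v <= \<bar>real w - real v\<bar> * (real w + 1)"
  proof (cases "v < w")
   case True
   then have "1 <= \<bar>real w - real v\<bar>" by linarith
   then have "1 * (real w + 1) <= \<bar>real w - real v\<bar> * (real w + 1)" by (intro mult_right_mono) auto
   moreover have "real v <= 1 * (real w + 1)" using True by simp
   ultimately show ?thesis by (rule order_trans[rotated])
  next
   case False2: False
   then obtain k where "v = w + k" using le_iff_add[of w v] by auto
   then have k: "v = w + k" "1 <= k" using False by auto
   have "real w * 1 <= real w * real k" using k by (intro mult_left_mono) auto
   then show ?thesis using k by (simp add: algebra_simps)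
  qed
  then have "real v * real w <= (\<bar>real w - real v\<bar> * (real w + 1)) * real w" by (intro mult_right_mono) auto
  then show ?thesis by (simp add: mult_ac)
 qed
 then have "1 <= \<bar>1 / real v - 1 / real w\<bar> * (real w * (real w + 1))"
  unfolding eq using assms by (simp add: field_simps)
 then show ?thesis using False by simp
qed simp

text \<open>Reciprocal moments determine the point probabilities; as these sum to one in the limit, no mass escapes to infinity, and all bounded functions are covered. The moments of \<open>1 / W\<close> are generating functions when \<open>W\<close> is a product of prime powers whose exponents are counts.\<close>

theorem law_from_reciprocal_moments:
 fixes W :: "'r => 'w => nat" and P :: "'w measure" and W' :: "'v => nat" and Q :: "'v measure" and G :: "nat => real"
 assumes P: "prob_space P" and Q: "prob_space Q"
  and W_meas: "\<And>rho. W rho \<in> P \<rightarrow>\<^sub>M count_space UNIV" and W'_meas: "W' \<in> Q \<rightarrow>\<^sub>M count_space UNIV"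
  and W_pos: "\<And>rho y. 1 <= W rho y" and W'_pos: "\<And>z. 1 <= W' z"
  and mom: "\<And>i. ((%rho. \<integral>y. (1 / real (W rho y)) ^ i \<partial>P) \<longlongrightarrow> (LINT z|Q. (1 / real (W' z)) ^ i)) F"
  and G: "\<And>w. \<bar>G w\<bar> <= B"
 shows "((%rho. \<integral>y. G (W rho y) \<partial>P) \<longlongrightarrow> (LINT z|Q. G (W' z))) F"
proof -
 interpret P: prob_space P by fact
 interpret Q: prob_space Q by fact
 note W_meas [measurable] W'_meas [measurable]
 define p where "p rho w = (LINT y|P. (indicator {w} (W rho y) :: real))" for rho w
 define p' where "p' w = (LINT z|Q. (indicator {w} (W' z) :: real))" for w
 have B0: "0 <= B" using G[of 0] by linarith
 have point: "((%rho. p rho w) \<longlongrightarrow> p' w) F" for w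
 proof (cases "w = 0")
  case True
  have "W rho y ~= 0" "W' z ~= 0" for rho y z using W_pos[of rho y] W'_pos[of z] by auto
  then show ?thesis using True by (simp add: p_def p'_def)
 next
  case False
  define h where "h x = max 0 (1 - \<bar>x - 1 / real w\<bar> * (real w * (real w + 1)))" for x :: real
  have "continuous_on {0..1} h" unfolding h_def by (intro continuous_intros)
  from reciprocal_moment_polynomial[OF P Q W_meas W'_meas mom this]
  show ?thesis using W_pos W'_pos False
   by (simp add: h_def reciprocal_hat p_def p'_def indicator_def of_bool_def)
 qed
 have split: "\<bar>(LINT y|M. G (X y)) - (\<Sum>w\<le>K. G w * (LINT y|M. indicator {w} (X y)))\<bar> <= B * (1 - (\<Sum>w\<le>K. \<integral>y. indicator {w} (X y) \<partial>M))"
  if "prob_space M" and X [measurable]: "X \<in> M \<rightarrow>\<^sub>M count_space UNIV" for M :: "'x measure" and X K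
 proof -
  interpret M: prob_space M by fact
  have ii: "integrable M (%y. indicator {w} (X y) :: real)" for w
   by (intro M.integrable_const_bound[where B = 1]) (auto simp: indicator_def)
  have iG: "integrable M (%y. G (X y))" using G by (intro M.integrable_const_bound[where B = B]) auto
  have s: "(\<Sum>w\<le>K. c w * indicator {w} k) = (if k <= K then c k else 0)" for k and c :: "nat => real"
   by (simp add: indicator_def if_distrib cong: if_cong)
  have iS: "integrable M (%y. \<Sum>w\<le>K. c w * indicator {w} (X y))" for c :: "nat => real"
   by (intro Bochner_Integration.integrable_sum integrable_mult_right ii)
  have eS: "(LINT y|M. (\<Sum>w\<le>K. c w * indicator {w} (X y))) = (\<Sum>w\<le>K. c w * (LINT y|M. indicator {w} (X y)))"
   for c :: "nat => real"
   by (subst Bochner_Integration.integral_sum, rule integrable_mult_right, rule ii)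
    (simp only: integral_mult_right_zero)
  have "\<bar>(LINT y|M. G (X y)) - (\<Sum>w\<le>K. G w * (LINT y|M. indicator {w} (X y)))\<bar>
   = \<bar>\<integral>y. G (X y) - (\<Sum>w\<le>K. G w * indicator {w} (X y)) \<partial>M\<bar>"
   unfolding Bochner_Integration.integral_diff[OF iG iS] eS ..
  also have "... <= (LINT y|M. \<bar>G (X y) - (\<Sum>w\<le>K. G w * indicator {w} (X y))\<bar>)" by (rule integral_abs_bound)
  also have "... <= (LINT y|M. B * (1 - (\<Sum>w\<le>K. 1 * indicator {w} (X y))))"
  proof (intro integral_mono)
   show "integrable M (%y. \<bar>G (X y) - (\<Sum>w\<le>K. G w * indicator {w} (X y))\<bar>)"
    by (intro integrable_abs Bochner_Integration.integrable_diff iG iS)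
   show "integrable M (%y. B * (1 - (\<Sum>w\<le>K. 1 * indicator {w} (X y))))"
    by (intro integrable_mult_right Bochner_Integration.integrable_diff iS M.integrable_const)
   show "\<bar>G (X y) - (\<Sum>w\<le>K. G w * indicator {w} (X y))\<bar> <= B * (1 - (\<Sum>w\<le>K. 1 * indicator {w} (X y)))" for y
    unfolding s using G B0 by auto
  qed
  also have "... = B * (1 - (\<Sum>w\<le>K. \<integral>y. indicator {w} (X y) \<partial>M))"
   unfolding integral_mult_right_zero Bochner_Integration.integral_diff[OF M.integrable_const iS] eS
   by (simp add: M.prob_space)
  finally show ?thesis .
 qed
 have tail: "(%K. \<Sum>w\<le>K. p' w) \<longlonglongrightarrow> 1"
 proof -
  have eq: "(\<Sum>w\<le>K. p' w) = (LINT z|Q. indicator {..K} (W' z))" for K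
  proof -
   have ii: "integrable Q (%y. indicator {w} (W' y) :: real)" for w
    by (intro Q.integrable_const_bound[where B = 1]) (auto simp: indicator_def)
   have "(\<Sum>w\<le>K. indicator {w} k) = (indicator {..K} k :: real)" for k by (simp add: indicator_def)
   then show ?thesis unfolding p'_def using ii by (simp add: Bochner_Integration.integral_sum[symmetric])
  qed
  have "(%K. \<integral>z. indicator {..K} (W' z) \<partial>Q) \<longlonglongrightarrow> (LINT z|Q. (1::real))"
  proof (rule integral_dominated_convergence[where w = "%_. 1"])
   show "AE z in Q. (%K. indicator {..K} (W' z) :: real) \<longlonglongrightarrow> 1"
   proof (intro AE_I2 tendsto_eventually)
    fix z show "\<forall>\<^sub>F K in sequentially. indicator {..K} (W' z) = (1::real)"
     using eventually_ge_at_top[of "W' z"] by eventually_elim auto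
   qed
  qed (auto simp: indicator_def)
  then show ?thesis by (simp add: eq Q.prob_space)
 qed
 show ?thesis
 proof (rule tendstoI)
  fix e :: real assume e: "e > 0"
  define e' where "e' = e / (4 * (B + 1))"
  have e': "e' > 0" "B * e' <= e / 4" using e B0 by (auto simp: e'_def field_simps)
  have "\<forall>\<^sub>F K in sequentially. 1 - e' < (\<Sum>w\<le>K. p' w)" using e' by (intro order_tendstoD(1)[OF tail]) simp
  then obtain K where K: "1 - e' < (\<Sum>w\<le>K. p' w)" by (auto simp: eventually_sequentially)
  have split1: "\<bar>(LINT y|P. G (W rho y)) - (\<Sum>w\<le>K. G w * p rho w)\<bar> <= B * (1 - (\<Sum>w\<le>K. p rho w))" for rho
   unfolding p_def by (rule split[OF P W_meas])
  have split2: "\<bar>(LINT y|Q. G (W' y)) - (\<Sum>w\<le>K. G w * p' w)\<bar> <= B * (1 - (\<Sum>w\<le>K. p' w))"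
   unfolding p'_def by (rule split[OF Q W'_meas])
  have lims: "((%rho. \<Sum>w\<le>K. G w * p rho w) \<longlongrightarrow> (\<Sum>w\<le>K. G w * p' w)) F"
   "((%rho. \<Sum>w\<le>K. p rho w) \<longlongrightarrow> (\<Sum>w\<le>K. p' w)) F"
   by (intro tendsto_sum tendsto_mult tendsto_const point)+
  have "\<forall>\<^sub>F rho in F. dist (\<Sum>w\<le>K. G w * p rho w) (\<Sum>w\<le>K. G w * p' w) < e / 4"
   by (rule tendstoD[OF lims(1)]) (use e in simp)
  moreover have "\<forall>\<^sub>F rho in F. 1 - e' < (\<Sum>w\<le>K. p rho w)"
   by (rule order_tendstoD(1)[OF lims(2) K])
  ultimately show "\<forall>\<^sub>F rho in F. dist (LINT y|P. G (W rho y)) (LINT z|Q. G (W' z)) < e"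
  proof eventually_elim
   case (elim rho)
   have "B * (1 - (\<Sum>w\<le>K. p rho w)) <= B * e'" using elim B0 by (intro mult_left_mono) auto
   then have 1: "\<bar>(LINT y|P. G (W rho y)) - (\<Sum>w\<le>K. G w * p rho w)\<bar> <= e / 4"
    using split1[of rho] e' by linarith
   have "B * (1 - (\<Sum>w\<le>K. p' w)) <= B * e'" using K B0 by (intro mult_left_mono) auto
   then have 2: "\<bar>(LINT y|Q. G (W' y)) - (\<Sum>w\<le>K. G w * p' w)\<bar> <= e / 4"
    using split2 e' by linarith
   show ?case using elim(1) 1 2 e unfolding dist_real_def by linarith
  qed
 qed
qed

lemma poisson_pgf:
 fixes N :: "'w => nat"
 assumes P: "prob_space P" and N [measurable]: "N \<in> P \<rightarrow>\<^sub>M count_space UNIV" and l: "0 <= l"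
  and law: "\<And>k. measure P {\<omega> \<in> space P. N \<omega> = k} = exp (- l) * l ^ k / fact k" and s: "0 <= s" "s <= 1"
 shows "(LINT \<omega>|P. s ^ N \<omega>) = exp (- (l * (1 - s)))"
proof -
 interpret P: prob_space P by fact
 have eq: "distr P (count_space UNIV) N = density (count_space UNIV) (%k. ennreal (exp (- l) * l ^ k / fact k))"
 proof (rule measure_eqI_countable[where A = UNIV])
  fix k :: nat
  have "emeasure (distr P (count_space UNIV) N) {k} = emeasure P {\<omega> \<in> space P. N \<omega> = k}"
   by (subst emeasure_distr) (auto intro!: arg_cong[where f = "emeasure P"])
  also have "... = ennreal (exp (- l) * l ^ k / fact k)" by (simp add: P.emeasure_eq_measure law)
  finally show "emeasure (distr P (count_space UNIV) N) {k} = emeasure (density (count_space UNIV) (%k. ennreal (exp (- l) * l ^ k / fact k))) {k}"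
   by (simp add: emeasure_density)
 qed auto
 have "(LINT \<omega>|P. s ^ N \<omega>) = (\<integral>k. s ^ k \<partial>distr P (count_space UNIV) N)" by (subst integral_distr) auto
 also have "... = (\<integral>k. (exp (- l) * l ^ k / fact k) * s ^ k \<partial>count_space UNIV)"
  unfolding eq using l by (subst integral_density) auto
 also have "... = exp (- l) * exp (l * s)"
 proof -
  have "(%k. exp (- l) * ((l * s) ^ k /\<^sub>R fact k)) sums (exp (- l) * exp (l * s))"
   by (intro sums_mult exp_converges)
  then have S: "(%k. exp (- l) * l ^ k / fact k * s ^ k) sums (exp (- l) * exp (l * s))"
   by (simp add: power_mult_distrib divide_inverse mult_ac)
  have "integrable (count_space UNIV) (%k. exp (- l) * l ^ k / fact k * s ^ k)"
   unfolding integrable_count_space_nat_iff using sums_summable[OF S] l s by simp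
  then show ?thesis using S by (simp add: integral_count_space_nat sums_unique[symmetric])
 qed
 finally show ?thesis by (simp add: algebra_simps flip: exp_add)
qed

section \<open>Convergence in law of random sequences\<close>

text \<open>The map \<open>t \<mapsto> 1 / (1 + t)\<close> identifies the extended half-line with the unit interval, so that the space of sequences becomes a compact cube. It reverses the order; \<open>j / (n - j)\<close> corresponds to \<open>1 - j / n\<close>.\<close>

definition ennreal_to_unit :: "ennreal => real" where
 "ennreal_to_unit x = enn2real (inverse (1 + x))"

definition unit_to_ennreal :: "real => ennreal" where
 "unit_to_ennreal s = inverse (ennreal s) - 1"

lemma ennreal_to_unit_ennreal: "0 <= t ==> ennreal_to_unit (ennreal t) = 1 / (1 + t)"
proof -
 assume t: "0 <= t"
 have "1 + ennreal t = ennreal (1 + t)" using t by (simp flip: ennreal_plus ennreal_1)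
 moreover have "inverse (ennreal (1 + t)) = ennreal (1 / (1 + t))"
  using t by (subst inverse_ennreal) (auto simp: inverse_eq_divide)
 ultimately show ?thesis using t by (simp only: ennreal_to_unit_def enn2real_ennreal divide_nonneg_nonneg)
qed

lemma ennreal_to_unit_top: "ennreal_to_unit \<top> = 0"
 by (simp add: ennreal_to_unit_def)

lemma ennreal_to_unit_bounds: "0 <= ennreal_to_unit x" "ennreal_to_unit x <= 1"
 by (cases x; simp add: ennreal_to_unit_ennreal ennreal_to_unit_top)+

lemma unit_to_ennreal_inverse: "unit_to_ennreal (ennreal_to_unit x) = x"
proof (cases x)
 case (real t)
 then have "inverse (ennreal (1 / (1 + t))) = ennreal (1 + t)"
  by (subst inverse_ennreal) auto
 moreover have "ennreal (1 + t) - 1 = ennreal t"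
  using real by (simp add: ennreal_minus flip: ennreal_1)
 ultimately show ?thesis using real by (simp add: ennreal_to_unit_ennreal unit_to_ennreal_def)
qed (simp add: ennreal_to_unit_top unit_to_ennreal_def)

lemma unit_to_ennreal_continuous: "continuous_on {0..1} unit_to_ennreal"
proof -
 have inv: "continuous_on {0..1} (%s. inverse (ennreal s))"
  by (intro continuous_on_inverse_ennreal continuous_on_ennreal continuous_on_id)
 have minus: "continuous_on UNIV (%x :: ennreal. x - 1)"
 proof (rule continuous_onI_mono)
  have "x \<in> range (%x :: ennreal. x - 1)" for x
   using ennreal_add_diff_cancel_right[of 1 x] by (intro image_eqI[of _ _ "x + 1"]) simp_all
  then have "range (%x :: ennreal. x - 1) = UNIV" by blast
  then show "open (range (%x :: ennreal. x - 1))" by simp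
  show "x - 1 <= y - 1" if "x <= y" for x y :: ennreal using that by (intro ennreal_minus_mono) auto
 qed
 show ?thesis unfolding unit_to_ennreal_def
  by (rule continuous_on_compose2[OF minus inv]) simp
qed

lemma ennreal_to_unit_less_iff:
 assumes "1 <= j" "j < n"
 shows "x < ennreal (real j / real (n - j)) \<longleftrightarrow> real (n - j) / real n < ennreal_to_unit x"
proof (cases x)
 case (real t)
 then have "x < ennreal (real j / real (n - j)) \<longleftrightarrow> t < real j / real (n - j)" by (simp add: ennreal_less_iff)
 also have "... \<longleftrightarrow> real (n - j) / real n < 1 / (1 + t)"
  using assms real by (simp add: field_simps of_nat_diff)
 finally show ?thesis using real by (simp add: ennreal_to_unit_ennreal)
next
 case top
 have "0 <= real (n - j) / real n" by simp
 then show ?thesis using top by (simp add: ennreal_to_unit_top not_less)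
qed

lemma grid_count:
 assumes "0 <= s" "s <= 1" "1 <= n"
 shows "\<bar>s - real (card {j \<in> {1..<n}. real (n - j) / real n < s}) / real n\<bar> <= 1 / real n"
proof -
 define L where "L = nat \<lfloor>real n - real n * s\<rfloor>"
 have ns: "0 <= real n * s" "real n * s <= real n" using assms by (auto simp: mult_left_le)
 then have "real L = of_int \<lfloor>real n - real n * s\<rfloor>" unfolding L_def by simp
 then have L: "real L <= real n - real n * s" "real n - real n * s < real L + 1" by linarith+
 have "{j \<in> {1..<n}. real (n - j) / real n < s} = {Suc L..<n}"
 proof (intro set_eqI)
  fix j
  have "real (n - j) / real n < s \<longleftrightarrow> real n - real n * s < real j" if "j < n"
   using that assms by (simp add: field_simps of_nat_diff)
  moreover have "real n - real n * s < real j \<longleftrightarrow> Suc L <= j"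
   using L by linarith
  ultimately show "j \<in> {j \<in> {1..<n}. real (n - j) / real n < s} \<longleftrightarrow> j \<in> {Suc L..<n}" by auto
 qed
 then have c: "real (card {j \<in> {1..<n}. real (n - j) / real n < s}) = real (n - Suc L)" by simp
 have "\<bar>real n * s - real (n - Suc L)\<bar> <= 1"
  using L ns by (cases "Suc L <= n") (auto simp: of_nat_diff abs_le_iff)
 then have "\<bar>real n * s - real (n - Suc L)\<bar> / real n <= 1 / real n" by (rule divide_right_mono) simp
 moreover have "s - real (n - Suc L) / real n = (real n * s - real (n - Suc L)) / real n"
  using assms by (simp add: field_simps)
 ultimately show ?thesis unfolding c by simp
qed

lemma compact_unit_cube: "compact {s :: nat => real. \<forall>i. s i \<in> {0..1}}"
proof -
 have "compactin (product_topology (%i. euclidean) UNIV) (PiE UNIV (%i::nat. {0..1::real}))"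
  by (subst compactin_PiE) auto
 then show ?thesis
  by (simp add: euclidean_product_topology PiE_UNIV_domain Pi_def)
qed

definition discretise :: "nat => nat => (nat => nat => bool) => nat => real" where
 "discretise r n b i = (if i < r then real (card {j \<in> {1..<n}. b i j}) / real n else 0)"

lemma discretise_bounds: "0 <= discretise r n b i" "discretise r n b i <= 1"
proof -
 show "0 <= discretise r n b i" by (simp add: discretise_def)
 have "card {j \<in> {1..<n}. b i j} <= card {1..<n}" by (intro card_mono) auto
 then have "real (card {j \<in> {1..<n}. b i j}) <= real n" by simp
 then show "discretise r n b i <= 1" by (auto simp: discretise_def divide_le_eq)
qed

text \<open>A continuous function on the compact cube is uniformly continuous and depends, up to a small error, on finitely many coordinates, each of which is known to precision \<open>1/n\<close> from its comparison with the thresholds \<open>j / (n - j)\<close>.\<close>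

lemma uniform_discretisation:
 fixes h :: "(nat => ennreal) => real"
 assumes h: "continuous_on UNIV h" and eps: "eps > 0"
 shows "\<exists>r n. 1 <= n & (\<forall>x. \<bar>h x - h (%i. unit_to_ennreal (discretise r n (%i j. x i < ennreal (real j / real (n - j))) i))\<bar> < eps)"
proof -
 let ?S = "{s :: nat => real. \<forall>i. s i \<in> {0..1}}"
 have "continuous_on ?S (%s i. unit_to_ennreal (s i))"
 proof (rule continuous_on_coordinatewise_then_product)
  fix i
  have "continuous_on ?S (%s. s i)" by (intro continuous_on_product_coordinates continuous_on_subset[OF continuous_on_product_coordinates]) auto
  then show "continuous_on ?S (%s. unit_to_ennreal (s i))"
   by (rule continuous_on_compose2[OF unit_to_ennreal_continuous]) auto
 qed
 then have "continuous_on ?S (%s. h (%i. unit_to_ennreal (s i)))"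
  by (rule continuous_on_compose2[OF h]) auto
 then have "uniformly_continuous_on ?S (%s. h (%i. unit_to_ennreal (s i)))"
  using compact_unit_cube by (rule compact_uniformly_continuous)
 note uc = this
 obtain delta where delta: "delta > 0" "\<And>s s'. s \<in> ?S ==> s' \<in> ?S ==> dist s' s < delta ==>
   dist (h (%i. unit_to_ennreal (s' i))) (h (%i. unit_to_ennreal (s i))) < eps"
 proof (rule uniformly_continuous_onE[OF uc eps])
  fix delta :: real assume "0 < delta" and close: "\<And>s s'. s \<in> ?S ==> s' \<in> ?S ==> dist s' s < delta ==>
   dist (h (%i. unit_to_ennreal (s' i))) (h (%i. unit_to_ennreal (s i))) < eps"
  show thesis by (rule that[OF \<open>0 < delta\<close> close])
 qed
 have "\<exists>N. (1 / 2 :: real) ^ N < delta / 2" using delta(1) by (intro real_arch_pow_inv) auto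
 then obtain N where N: "(1 / 2 :: real) ^ N < delta / 2" by blast
 define r where "r = Suc (Max ((from_nat :: nat => nat) ` {..N}))"
 have r: "from_nat k < r" if "k <= N" for k
  unfolding r_def less_Suc_eq_le by (rule Max_ge) (use that in auto)
 have "0 < delta / 4" using delta(1) by simp
 then obtain m where m: "inverse (real (Suc m)) < delta / 4" using reals_Archimedean by blast
 define n where "n = Suc m"
 have n: "1 <= n" "1 / real n < delta / 4" using m by (simp_all add: n_def inverse_eq_divide)
 have "\<bar>h x - h (%i. unit_to_ennreal (discretise r n (%i j. x i < ennreal (real j / real (n - j))) i))\<bar> < eps" for x
 proof -
  define s where "s i = ennreal_to_unit (x i)" for i
  define s' where "s' = discretise r n (%i j. x i < ennreal (real j / real (n - j)))"
  have sS: "s \<in> ?S" "s' \<in> ?S" using ennreal_to_unit_bounds discretise_bounds by (auto simp: s_def s'_def)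
  have close: "dist (s i) (s' i) <= 1 / real n" if "i < r" for i
  proof -
   have "{j \<in> {1..<n}. x i < ennreal (real j / real (n - j))} = {j \<in> {1..<n}. real (n - j) / real n < s i}"
    unfolding s_def using ennreal_to_unit_less_iff by auto
   then show ?thesis using grid_count[of "s i" n] n(1) ennreal_to_unit_bounds[of "x i"] that
    by (simp add: s'_def discretise_def dist_real_def s_def)
  qed
  have "dist s s' <= 2 * Max {dist (s (from_nat k)) (s' (from_nat k)) |k. k <= N} + (1 / 2) ^ N"
   by (rule dist_fun_le_dist_first_terms)
  also have "Max {dist (s (from_nat k)) (s' (from_nat k)) |k. k <= N} <= 1 / real n"
  proof (rule Max.boundedI)
   have "{dist (s (from_nat k)) (s' (from_nat k)) |k. k <= N} = (%k. dist (s (from_nat k)) (s' (from_nat k))) ` {..N}" by auto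
   then show "finite {dist (s (from_nat k)) (s' (from_nat k)) |k. k <= N}" by simp
  qed (use close r in auto)
  finally have "dist s s' < delta" using N n(2) by linarith
  then have "dist (h (%i. unit_to_ennreal (s i))) (h (%i. unit_to_ennreal (s' i))) < eps"
   by (rule delta(2)[OF sS(2) sS(1)])
  then show ?thesis by (simp add: s_def s'_def unit_to_ennreal_inverse dist_real_def)
 qed
 then show ?thesis using n(1) by blast
qed

text \<open>Only the joint law of finitely many comparisons with thresholds is needed. The hypothesis admits discontinuous functions of the comparisons: these are determined by integer counts, for which convergence in law is convergence of all point probabilities.\<close>

theorem sequence_law_from_thresholds:
 fixes X :: "'r => 'w => nat => ennreal" and T :: "'v => nat => ennreal"
 assumes P: "prob_space P" and Q: "prob_space Q"
  and X_meas: "\<And>rho i. (%y. X rho y i) \<in> borel_measurable P" and T_meas: "\<And>i. (%z. T z i) \<in> borel_measurable Q"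
  and conv: "\<And>(a :: nat => real) q (G :: (nat => nat => bool) => real) B.
   a 0 = 0 ==> strict_mono_on {..q} a ==> (\<And>b. \<bar>G b\<bar> <= B) ==>
   (%z. G (%i j. j \<in> {1..q} & T z i < ennreal (a j))) \<in> borel_measurable Q ==>
   ((%rho. \<integral>y. G (%i j. j \<in> {1..q} & X rho y i < ennreal (a j)) \<partial>P)
    \<longlongrightarrow> (LINT z|Q. G (%i j. j \<in> {1..q} & T z i < ennreal (a j)))) F"
 shows "converges_in_law P X (distr Q borel T) F"
 unfolding converges_in_law_def
proof (intro allI impI)
 fix h :: "(nat => ennreal) => real" assume h: "continuous_on UNIV h & bounded (range h)"
 interpret P: prob_space P by fact
 interpret Q: prob_space Q by fact
 have hm: "h \<in> borel_measurable borel" using h by (intro borel_measurable_continuous_onI) auto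
 obtain B where B: "\<And>x. \<bar>h x\<bar> <= B" using h by (auto simp: bounded_iff)
 have X_m: "X rho \<in> borel_measurable P" for rho by (rule measurable_coordinatewise_then_product[OF X_meas])
 have T_m: "T \<in> borel_measurable Q" by (rule measurable_coordinatewise_then_product[OF T_meas])
 have "((%rho. \<integral>y. h (X rho y) \<partial>P) \<longlongrightarrow> (LINT z|Q. h (T z))) F"
 proof (rule tendstoI)
  fix e :: real assume e: "e > 0"
  obtain r n where n: "1 <= n" and unif: "\<And>x. \<bar>h x - h (%i. unit_to_ennreal (discretise r n (%i j. x i < ennreal (real j / real (n - j))) i))\<bar> < e / 3"
   using uniform_discretisation[of h "e / 3"] h e by auto
  define G where "G b = h (%i. unit_to_ennreal (discretise r n b i))" for b
  define a where "a j = real j / real (n - j)" for j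
  define th where "th x i j \<longleftrightarrow> j \<in> {1..n - 1} & x i < ennreal (a j)" for x :: "nat => ennreal" and i j
  have th_eq: "discretise r n (th x) i = discretise r n (%i j. x i < ennreal (real j / real (n - j))) i" for x i
  proof -
   have "{j \<in> {1..<n}. th x i j} = {j \<in> {1..<n}. x i < ennreal (real j / real (n - j))}"
    by (auto simp: th_def a_def)
   then show ?thesis by (simp add: discretise_def)
  qed
  have close: "\<bar>h x - G (th x)\<bar> < e / 3" for x using unif[of x] by (simp add: G_def th_eq)
  have a0: "a 0 = 0" by (simp add: a_def)
  have a_mono: "strict_mono_on {..n - 1} a"
  proof (rule strict_mono_onI)
   fix i j assume ij: "i \<in> {..n - 1}" "j \<in> {..n - 1}" "i < j"
   then have "real i * real (n - j) < real j * real (n - i)"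
    using n by (intro mult_less_le_imp_less) auto
   then show "a i < a j" using ij n by (auto simp: a_def field_simps)
  qed
  have GB: "\<bar>G b\<bar> <= B" for b unfolding G_def by (rule B)
  have gm: "(%y. G (th (Y y))) \<in> borel_measurable M"
   if M: "prob_space M" and Ym: "\<And>i. (%y. Y y i) \<in> borel_measurable M" for M :: "'x measure" and Y
  proof -
   interpret M: prob_space M by fact
   note Ym [measurable]
   have Y [measurable]: "Y \<in> borel_measurable M" by (rule measurable_coordinatewise_then_product[OF Ym])
   have cm: "(%y. real (card {j \<in> {1..<n}. th (Y y) i j})) \<in> borel_measurable M" for i
   proof -
    have "real (card {j \<in> {1..<n}. th (Y y) i j}) = (\<Sum>j\<in>{1..<n}. if Y y i < ennreal (a j) then 1 else 0)" for y
    proof -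
     have "{j \<in> {1..<n}. th (Y y) i j} = {j \<in> {1..<n}. Y y i < ennreal (a j)}" by (auto simp: th_def)
     then show ?thesis by (simp add: sum.If_cases Int_def)
    qed
    then show ?thesis by simp
   qed
   have dm: "(%y. discretise r n (th (Y y)) i) \<in> borel_measurable M" for i
   proof (cases "i < r")
    case True
    have "(%y. discretise r n (th (Y y)) i) = (%y. real (card {j \<in> {1..<n}. th (Y y) i j}) / real n)"
     by (simp add: discretise_def True fun_eq_iff)
    then show ?thesis using cm[of i] by (simp only: borel_measurable_divide borel_measurable_const)
   qed (simp add: discretise_def)
   have um: "unit_to_ennreal \<in> borel_measurable borel" unfolding unit_to_ennreal_def by measurable
   have "(%y i. unit_to_ennreal (discretise r n (th (Y y)) i)) \<in> borel_measurable M"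
    by (intro measurable_coordinatewise_then_product measurable_compose[OF dm um])
   then show "(%y. G (th (Y y))) \<in> borel_measurable M" unfolding G_def by (rule measurable_compose[OF _ hm])
  qed
  have "((%rho. \<integral>y. G (th (X rho y)) \<partial>P) \<longlongrightarrow> (LINT z|Q. G (th (T z)))) F"
   unfolding th_def by (rule conv[OF a0 a_mono GB gm[OF Q T_meas, unfolded th_def]])
  then have ev: "\<forall>\<^sub>F rho in F. dist (LINT y|P. G (th (X rho y))) (LINT z|Q. G (th (T z))) < e / 3"
   using e by (intro tendstoD) auto
  have diff: "\<bar>(LINT y|M. h (Y y)) - (LINT y|M. G (th (Y y)))\<bar> <= e / 3"
   if M: "prob_space M" and Ym: "\<And>i. (%y. Y y i) \<in> borel_measurable M" for M :: "'x measure" and Y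
  proof -
   interpret M: prob_space M by fact
   note Ym [measurable]
   have Y [measurable]: "Y \<in> borel_measurable M" by (rule measurable_coordinatewise_then_product[OF Ym])
   note Gm = gm[OF M Ym]
   have hYm: "(%y. h (Y y)) \<in> borel_measurable M" by (rule measurable_compose[OF Y hm])
   have i1: "integrable M (%y. h (Y y))" using B by (intro M.integrable_const_bound[where B = B] hYm) auto
   have i2: "integrable M (%y. G (th (Y y)))" using GB by (intro M.integrable_const_bound[where B = B] Gm) auto
   have "\<bar>(LINT y|M. h (Y y)) - (LINT y|M. G (th (Y y)))\<bar> = \<bar>\<integral>y. h (Y y) - G (th (Y y)) \<partial>M\<bar>" using i1 i2 by simp
   also have "... <= (LINT y|M. \<bar>h (Y y) - G (th (Y y))\<bar>)" by (rule integral_abs_bound)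
   also have "... <= (LINT y|M. e / 3)"
    using i1 i2 close by (intro integral_mono integrable_abs Bochner_Integration.integrable_diff) (auto intro: less_imp_le)
   finally show ?thesis by (simp add: M.prob_space)
  qed
  from ev show "\<forall>\<^sub>F rho in F. dist (LINT y|P. h (X rho y)) (LINT z|Q. h (T z)) < e"
  proof eventually_elim
   case (elim rho)
   have 1: "\<bar>(LINT y|P. h (X rho y)) - (LINT y|P. G (th (X rho y)))\<bar> <= e / 3" by (rule diff[OF P X_meas])
   have 2: "\<bar>(LINT z|Q. h (T z)) - (LINT z|Q. G (th (T z)))\<bar> <= e / 3" by (rule diff[OF Q T_meas])
   show ?case using elim 1 2 unfolding dist_real_def by linarith
  qed
 qed
 also have "(LINT z|Q. h (T z)) = (\<integral>b. h b \<partial>distr Q borel T)" by (rule integral_distr[symmetric, OF T_m hm])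
 finally show "((%rho. \<integral>y. h (X rho y) \<partial>P) \<longlongrightarrow> (\<integral>b. h b \<partial>distr Q borel T)) F" .
qed

section \<open>Poisson variables and Poisson processes\<close>

lemma count_measurable:
 fixes P :: "nat => 'w => bool"
 assumes "\<And>k. Measurable.pred M (P k)"
 shows "(%y. card {k \<in> {1..n}. P k y}) \<in> M \<rightarrow>\<^sub>M count_space UNIV"
proof -
 note assms [measurable]
 have "real (card {k \<in> {1..n}. P k y}) = (\<Sum>k\<in>{1..n}. if P k y then 1 else 0)" for y
 proof -
  have "(\<Sum>k\<in>{k \<in> {1..n}. P k y}. 1::real) = (\<Sum>k\<in>{1..n}. if P k y then 1 else 0)" by (rule sum.inter_filter) simp
  then show ?thesis by simp
 qed
 then have "card {k \<in> {1..n}. P k y} = nat \<lfloor>\<Sum>k\<in>{1..n}. if P k y then 1 else (0::real)\<rfloor>" for y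
  by (metis floor_of_nat nat_int)
 moreover have "(%y. nat \<lfloor>\<Sum>k\<in>{1..n}. if P k y then 1 else (0::real)\<rfloor>) \<in> M \<rightarrow>\<^sub>M count_space UNIV" by measurable
 ultimately show ?thesis by simp
qed

lemma prod_if_card: "(\<Prod>k\<in>{1..n::nat}. if P k then sg else (1::real)) = sg ^ card {k \<in> {1..n}. P k}"
proof -
 have "(\<Prod>k\<in>{1..n}. if P k then sg else 1) = (\<Prod>k\<in>{k \<in> {1..n}. P k}. sg)" by (rule prod.inter_filter[symmetric]) simp
 then show ?thesis by simp
qed

text \<open>The reciprocal moments of \<open>2 ^ N\<close> are the values of the generating function of \<open>N\<close> at the powers of a half.\<close>

theorem poisson_law_from_pgf:
 fixes N :: "'r => 'w => nat" and P :: "'w measure" and h :: "nat => real"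
 assumes P: "prob_space P" and N: "\<And>rho. N rho \<in> P \<rightarrow>\<^sub>M count_space UNIV" and l: "0 < l"
  and pgf: "\<And>s. 0 <= s ==> s <= 1 ==> ((%rho. \<integral>y. s ^ N rho y \<partial>P) \<longlongrightarrow> exp (- (l * (1 - s)))) F"
  and h: "bounded (range h)"
 shows "((%rho. \<integral>y. h (N rho y) \<partial>P) \<longlongrightarrow> (\<integral>k. h k \<partial>measure_pmf (poisson_pmf l))) F"
proof -
 let ?Q = "measure_pmf (poisson_pmf l)"
 obtain B where B: "\<And>k. \<bar>h k\<bar> <= B" using h by (auto simp: bounded_iff)
 \<comment> \<open>Any function of \<open>k\<close> is a function of \<open>2 ^ k\<close>.\<close>
 have inj: "inj (%k. (2::nat) ^ k)" by (auto intro!: injI)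
 define G where "G w = h (inv (%k. (2::nat) ^ k) w)" for w
 have G: "G (2 ^ k) = h k" for k unfolding G_def using inv_f_f[OF inj, of k] by simp
 have cm: "(%k::nat. (2::nat) ^ k) \<in> count_space UNIV \<rightarrow>\<^sub>M count_space UNIV" by simp
 have e: "(1 / real (2 ^ k)) ^ i = ((1 / 2) ^ i) ^ k" for k i :: nat
  by (simp add: power_one_over mult.commute flip: power_mult)
 have "((%rho. \<integral>y. G (2 ^ N rho y) \<partial>P) \<longlongrightarrow> (LINT k|?Q. G (2 ^ k))) F"
 proof (rule law_from_reciprocal_moments[OF P measure_pmf.prob_space_axioms measurable_compose[OF N cm] _ _ _ _])
  show "(%k. 2 ^ k) \<in> ?Q \<rightarrow>\<^sub>M count_space UNIV" by simp
  show "1 <= (2::nat) ^ N rho y" for rho y by simp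
  show "1 <= (2::nat) ^ k" for k by simp
  show "\<bar>G w\<bar> <= B" for w unfolding G_def by (rule B)
  fix i
  have s: "0 <= (1 / 2 :: real) ^ i" "(1 / 2 :: real) ^ i <= 1" by (simp_all add: power_le_one)
  have "measure ?Q {k \<in> space ?Q. k = j} = exp (- l) * l ^ j / fact j" for j
  proof -
   have "measure ?Q {j} = pmf (poisson_pmf l) j" by (simp add: pmf.rep_eq)
   then show ?thesis using l by (simp add: pmf_poisson)
  qed
  from poisson_pgf[OF measure_pmf.prob_space_axioms, of "%k. k" _ l, OF _ less_imp_le[OF l] this s]
  have "(LINT k|?Q. ((1 / 2) ^ i) ^ k) = exp (- (l * (1 - (1 / 2) ^ i)))" by simp
  then show "((%rho. \<integral>y. (1 / real (2 ^ N rho y)) ^ i \<partial>P) \<longlongrightarrow> (LINT k|?Q. (1 / real (2 ^ k)) ^ i)) F"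
   unfolding e using pgf[OF s] by simp
 qed
 then show ?thesis by (simp only: G)
qed

lemma sort_nth_less:
 fixes xs :: "'b::linorder list"
 assumes "i < length xs"
 shows "sort xs ! i < t \<longleftrightarrow> i < length (filter (%x. x < t) xs)"
proof -
 have "ys ! i < t \<longleftrightarrow> i < length (filter (%x. x < t) ys)" if "sorted ys" "i < length ys" for ys
  using that
 proof (induction ys arbitrary: i)
  case (Cons y ys)
  show ?case
  proof (cases "y < t")
   case True
   then show ?thesis using Cons by (cases i) auto
  next
   case False
   then have nl: "\<not> x < t" if "x \<in> set (y # ys)" for x using Cons.prems(1) that by auto
   have 1: "filter (%x. x < t) (y # ys) = []" unfolding filter_empty_conv by (intro ballI nl)
   have 2: "\<not> (y # ys) ! i < t" by (rule nl[OF nth_mem[OF Cons.prems(2)]])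
   show ?thesis unfolding 1 using 2 by simp
  qed
 qed simp
 moreover have "length (filter (%x. x < t) (sort xs)) = length (filter (%x. x < t) xs)"
  by (metis mset_filter mset_sort size_mset)
 ultimately show ?thesis using assms by (metis length_sort sorted_sort)
qed

text \<open>Order statistics are dual to counts: the \<open>(i+1)\<close>-st smallest distance is below \<open>t\<close> if and only if more than \<open>i\<close> distances are.\<close>

lemma nth_closest_less:
 "nth_closest E f n (Suc i) x y < t \<longleftrightarrow> i < card {k \<in> {1..n}. E x ((f ^^ k) y) < t}"
proof (cases "Suc i <= n")
 case True
 have "length (filter (%u. u < t) (map (%k. E x ((f ^^ k) y)) [1..<Suc n])) = length (filter (%k. E x ((f ^^ k) y) < t) [1..<Suc n])"
  by (simp add: filter_map o_def del: upt_Suc)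
 also have "... = card {k \<in> {1..n}. E x ((f ^^ k) y) < t}"
  by (subst distinct_length_filter) (auto simp del: upt_Suc intro!: arg_cong[where f = card])
 finally show ?thesis using True by (simp add: nth_closest_def sort_nth_less del: upt_Suc)
next
 case False
 have "card {k \<in> {1..n}. E x ((f ^^ k) y) < t} <= card {1..n}" by (rule card_mono) auto
 then show ?thesis using False by (simp add: nth_closest_def)
qed

lemma ennreal_divide_less:
 assumes "0 < r" "0 <= a"
 shows "u / ennreal r < ennreal a \<longleftrightarrow> u < ennreal (r * a)"
proof (cases u)
 case (real v)
 then have "u / ennreal r = ennreal (v / r)" using assms by (simp add: divide_ennreal)
 then show ?thesis using real assms by (simp add: ennreal_less_iff pos_divide_less_eq mult.commute)
next
 case top
 then show ?thesis using assms by (simp add: ennreal_top_divide)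
qed

lemma exists_distinct_primes: "\<exists>p :: nat => nat. inj p & (\<forall>j. prime (p j))"
proof -
 let ?S = "{p::nat. prime p}"
 have "inj (enumerate ?S)" using strict_mono_enumerate[OF primes_infinite] by (rule strict_mono_imp_inj_on)
 moreover have "prime (enumerate ?S j)" for j using enumerate_in_set[OF primes_infinite, of j] by simp
 ultimately show ?thesis by blast
qed

text \<open>Unique factorisation recovers a finite vector of counts from a single natural number.\<close>

lemma prime_code_multiplicity:
 fixes p N :: "nat => nat"
 assumes p: "inj p" "\<And>j. prime (p j)" and j: "j \<in> {1..q}"
 shows "multiplicity (p j) (\<Prod>j\<in>{1..q}. p j ^ N j) = N j"
proof -
 have eq: "(\<Prod>j\<in>{1..q}. p j ^ N j) = (\<Prod>u\<in>p ` {1..q}. u ^ N (inv p u))"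
  using p(1) by (subst prod.reindex) (auto intro: inj_on_subset)
 have mult: "multiplicity (p j) (\<Prod>u\<in>p ` {1..q}. u ^ N (inv p u)) = (if p j \<in> p ` {1..q} then N (inv p (p j)) else 0)"
  by (rule multiplicity_prod_prime_powers) (use p(2) in auto)
 have "p j \<in> p ` {1..q}" using j by (rule imageI)
 then show ?thesis unfolding eq mult inv_f_f[OF p(1)] by simp
qed

text \<open>Summation by parts in exponents: counts below the radii \<open>a\<^sub>j\<close> are partial sums of counts in shells.\<close>

lemma prod_prefix_powers:
 fixes s :: "nat => 'b::comm_semiring_1"
 shows "(\<Prod>j\<in>{1..q}. s j ^ (\<Sum>i<j. c i)) = (\<Prod>i<q. (\<Prod>j\<in>{Suc i..q}. s j) ^ c i)"
proof -
 have "(\<Prod>j\<in>{1..q}. s j ^ (\<Sum>i<j. c i)) = (\<Prod>j\<in>{1..q}. \<Prod>i<q. if i < j then s j ^ c i else 1)"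
 proof (rule prod.cong)
  fix j assume j: "j \<in> {1..q}"
  have set: "{..<j} = {i \<in> {..<q}. i < j}" using j by auto
  have "s j ^ (\<Sum>i<j. c i) = (\<Prod>i<j. s j ^ c i)" by (rule power_sum)
  also have "... = (\<Prod>i\<in>{i \<in> {..<q}. i < j}. s j ^ c i)" by (simp only: set)
  also have "... = (\<Prod>i<q. if i < j then s j ^ c i else 1)" by (rule prod.inter_filter) simp
  finally show "s j ^ (\<Sum>i<j. c i) = (\<Prod>i<q. if i < j then s j ^ c i else 1)" .
 qed simp
 also have "... = (\<Prod>i<q. \<Prod>j\<in>{1..q}. if i < j then s j ^ c i else 1)" by (rule prod.swap)
 also have "... = (\<Prod>i<q. (\<Prod>j\<in>{Suc i..q}. s j) ^ c i)"
 proof (rule prod.cong)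
  fix i
  have "(\<Prod>j\<in>{1..q}. if i < j then s j ^ c i else 1) = (\<Prod>j\<in>{j \<in> {1..q}. i < j}. s j ^ c i)"
   by (simp only: prod.inter_filter[OF finite_atLeastAtMost])
  also have "{j \<in> {1..q}. i < j} = {Suc i..q}" by auto
  finally show "(\<Prod>j\<in>{1..q}. if i < j then s j ^ c i else 1) = (\<Prod>j\<in>{Suc i..q}. s j) ^ c i"
   by (simp add: prod_power_distrib)
 qed simp
 finally show ?thesis .
qed

lemma poisson_intensity:
 assumes "0 <= K" "1 <= d" "0 <= a" "a <= b"
 shows "measure (density lborel (%t. ennreal (K * real d * t ^ (d - 1)) * indicator {0<..} t)) {a..<b} = K * (b ^ d - a ^ d)"
proof -
 let ?\<Lambda> = "density lborel (%t. ennreal (K * real d * t ^ (d - 1)) * indicator {0<..} t)"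
 have "emeasure ?\<Lambda> {a..<b} = (\<integral>\<^sup>+ t. ennreal (K * real d * t ^ (d - 1)) * indicator {0<..} t * indicator {a..<b} t \<partial>lborel)"
  by (subst emeasure_density) auto
 also have "... = (\<integral>\<^sup>+ t. ennreal (K * real d * t ^ (d - 1)) * indicator {a..b} t \<partial>lborel)"
 proof (rule nn_integral_cong_AE)
  have "AE t in lborel. t ~= 0 & t ~= b" using AE_lborel_singleton[of 0] AE_lborel_singleton[of b] by eventually_elim simp
  then show "AE t in lborel. ennreal (K * real d * t ^ (d - 1)) * indicator {0<..} t * indicator {a..<b} t
   = ennreal (K * real d * t ^ (d - 1)) * indicator {a..b} t"
   by eventually_elim (use assms in \<open>auto simp: indicator_def\<close>)
 qed
 also have "... = ennreal (K * b ^ d - K * a ^ d)"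
 proof -
  have der: "((%t. K * t ^ d) has_real_derivative K * real d * t ^ (d - 1)) (at t)" for t
   by (auto intro!: derivative_eq_intros)
  have nn: "0 <= K * real d * t ^ (d - 1)" if "a <= t" for t using assms that by simp
  show ?thesis
   by (rule nn_integral_FTC_Icc[where F = "%t. K * t ^ d" and f = "%t. K * real d * t ^ (d - 1)", OF _ der nn assms(4)]) auto
 qed
 finally have "emeasure ?\<Lambda> {a..<b} = ennreal (K * (b ^ d - a ^ d))" by (simp add: algebra_simps)
 moreover have "0 <= K * (b ^ d - a ^ d)" using assms by (simp add: power_mono)
 ultimately show ?thesis by (simp add: measure_def)
qed

text \<open>The points of the process below \<open>a\<^sub>j\<close> are counted by independent Poisson variables, one for each shell. As the points are ordered and tend to infinity, the indices of the points below a threshold form an initial segment.\<close>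

lemma poisson_process_shells:
 fixes T :: "nat => 'w => real"
 assumes pp: "poisson_process P T (density lborel (%t. ennreal (K * real d * t ^ (d - 1)) * indicator {0<..} t))"
  and K: "0 <= K" and d: "1 <= d" and a: "a 0 = 0" "strict_mono_on {..q} a"
 defines "n \<equiv> %i \<omega>. card {k. T k \<omega> \<in> {a i..<a (Suc i)}}"
 shows "i < q ==> n i \<in> P \<rightarrow>\<^sub>M count_space UNIV"
  and "AE \<omega> in P. \<forall>j\<in>{1..q}. \<forall>k. T k \<omega> < a j \<longleftrightarrow> k < (\<Sum>i<j. n i \<omega>)"
  and "(\<And>i. i < q ==> 0 <= S i & S i <= 1) ==>
   (LINT \<omega>|P. (\<Prod>i<q. S i ^ n i \<omega>)) = exp (- (\<Sum>i<q. K * (a (Suc i) ^ d - a i ^ d) * (1 - S i)))"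
proof -
 let ?\<Lambda> = "density lborel (%t. ennreal (K * real d * t ^ (d - 1)) * indicator {0<..} t)"
 have P: "prob_space P" using pp by (simp add: poisson_process_def)
 interpret P: prob_space P by (rule P)
 have mono: "a i <= a j" if "i <= j" "j <= q" for i j
  using a(2) that by (cases "i = j") (auto dest: strict_mono_onD[of _ a i j])
 have a0: "0 <= a i" if "i <= q" for i using mono[of 0 i] a(1) that by simp
 have disj: "disjoint_family_on (%i. {a i..<a (Suc i)}) {..<q}"
 proof (unfold disjoint_family_on_def, intro ballI impI)
  fix i j assume ij: "i \<in> {..<q}" "j \<in> {..<q}" "i ~= j"
  then have "a (Suc i) <= a j \<or> a (Suc j) <= a i" using mono[of "Suc i" j] mono[of "Suc j" i] by (cases "i < j") auto
  then show "{a i..<a (Suc i)} \<inter> {a j..<a (Suc j)} = {}" by auto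
 qed
 note parts = pp[unfolded poisson_process_def]
 have bd: "bounded {a i..<a (Suc i)}" for i
  by (rule bounded_subset[OF bounded_closed_interval[of "a i" "a (Suc i)"]]) auto
 have "\<forall>m. \<forall>B :: nat => real set. (\<forall>j<m. B j \<in> sets borel & bounded (B j)) & disjoint_family_on B {..<m} -->
    P.indep_vars (%_. count_space UNIV) (%j \<omega>. card {i. T i \<omega> \<in> B j}) {..<m}"
  using parts by (elim conjE)
 from this[THEN spec, THEN spec, THEN mp, of q "%i. {a i..<a (Suc i)}"]
 have ind: "P.indep_vars (%_. count_space UNIV) n {..<q}"
  unfolding n_def using disj bd by simp
 then show meas: "n i \<in> P \<rightarrow>\<^sub>M count_space UNIV" if "i < q" for i
  using that unfolding P.indep_vars_def by auto
 have ae: "AE \<omega> in P. (\<forall>i. 0 <= T i \<omega> & T i \<omega> <= T (Suc i) \<omega>) & filterlim (%i. T i \<omega>) at_top sequentially"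
  using parts by (elim conjE)
 then show "AE \<omega> in P. \<forall>j\<in>{1..q}. \<forall>k. T k \<omega> < a j \<longleftrightarrow> k < (\<Sum>i<j. n i \<omega>)"
 proof eventually_elim
  case (elim \<omega>)
  have inc: "T i \<omega> <= T j \<omega>" if "i <= j" for i j using lift_Suc_mono_le[of "%i. T i \<omega>" i j] elim that by blast
  show ?case
  proof (intro ballI allI)
   fix j k assume j: "j \<in> {1..q}"
   let ?A = "{k. T k \<omega> < a j}"
   have "\<forall>\<^sub>F i in sequentially. a j <= T i \<omega>" using elim by (auto simp: filterlim_at_top)
   then obtain m where m: "\<And>i. m <= i ==> a j <= T i \<omega>" by (auto simp: eventually_sequentially)
   have fin: "finite ?A" by (rule finite_subset[of _ "{..<m}"]) (use m in \<open>force simp: not_le[symmetric]\<close>)+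
   have Aeq: "?A = (\<Union>i<j. {k. T k \<omega> \<in> {a i..<a (Suc i)}})"
   proof (intro set_eqI iffI)
    fix k assume k: "k \<in> ?A"
    define i where "i = (LEAST i. T k \<omega> < a (Suc i))"
    have ex: "T k \<omega> < a (Suc (j - 1))" using k j by simp
    have i1: "T k \<omega> < a (Suc i)" unfolding i_def by (rule LeastI[of "%i. T k \<omega> < a (Suc i)", OF ex])
    have i2: "i <= j - 1" unfolding i_def by (rule Least_le[of "%i. T k \<omega> < a (Suc i)", OF ex])
    have "a i <= T k \<omega>"
    proof (cases i)
     case 0
     then show ?thesis using a(1) elim by simp
    next
     case (Suc i')
     then have "i' < (LEAST i. T k \<omega> < a (Suc i))" by (simp add: i_def[symmetric])
     from not_less_Least[OF this] show ?thesis using Suc by simp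
    qed
    then show "k \<in> (\<Union>i<j. {k. T k \<omega> \<in> {a i..<a (Suc i)}})" using i1 i2 j by (intro UN_I[of i]) auto
   next
    fix k assume "k \<in> (\<Union>i<j. {k. T k \<omega> \<in> {a i..<a (Suc i)}})"
    then obtain i where "i < j" "T k \<omega> < a (Suc i)" by auto
    then show "k \<in> ?A" using mono[of "Suc i" j] j by simp
   qed
   have "card (\<Union>i<j. {k. T k \<omega> \<in> {a i..<a (Suc i)}}) = (\<Sum>i<j. n i \<omega>)"
    unfolding n_def
   proof (rule card_UN_disjoint)
    show "\<forall>i\<in>{..<j}. finite {k. T k \<omega> \<in> {a i..<a (Suc i)}}"
    proof
     fix i assume "i \<in> {..<j}"
     then have "{k. T k \<omega> \<in> {a i..<a (Suc i)}} \<subseteq> ?A" unfolding Aeq by (rule UN_upper)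
     then show "finite {k. T k \<omega> \<in> {a i..<a (Suc i)}}" using fin by (rule finite_subset)
    qed
    show "\<forall>i\<in>{..<j}. \<forall>i'\<in>{..<j}. i ~= i' --> {k. T k \<omega> \<in> {a i..<a (Suc i)}} \<inter> {k. T k \<omega> \<in> {a i'..<a (Suc i')}} = {}"
    proof (intro ballI impI)
     fix i i' assume ii: "i \<in> {..<j}" "i' \<in> {..<j}" "i ~= i'"
     have "i \<in> {..<q}" "i' \<in> {..<q}" using ii(1,2) j by simp_all
     from disjoint_family_onD[OF disj this ii(3)]
     show "{k. T k \<omega> \<in> {a i..<a (Suc i)}} \<inter> {k. T k \<omega> \<in> {a i'..<a (Suc i')}} = {}" by blast
    qed
   qed simp
   then have cA: "card ?A = (\<Sum>i<j. n i \<omega>)" by (simp only: Aeq)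
   have "\<exists>m. ?A = {..<m}"
   proof -
    define m0 where "m0 = (LEAST i. \<not> T i \<omega> < a j)"
    have ex: "\<not> T m \<omega> < a j" using m[of m] by simp
    have "\<not> T m0 \<omega> < a j" unfolding m0_def by (rule LeastI[of "%i. \<not> T i \<omega> < a j", OF ex])
    then have "T k \<omega> < a j \<longleftrightarrow> k < m0" for k
     using inc[of m0 k] not_less_Least[of k "%i. \<not> T i \<omega> < a j"] unfolding m0_def[symmetric] by (cases "k < m0") auto
    then show ?thesis by auto
   qed
   then obtain m' where m': "?A = {..<m'}" ..
   then show "T k \<omega> < a j \<longleftrightarrow> k < (\<Sum>i<j. n i \<omega>)" using cA by auto
  qed
 qed
 have laws: "\<forall>B\<in>sets borel. bounded B --> (\<forall>k. measure P {\<omega> \<in> space P. card {i. T i \<omega> \<in> B} = k} =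
      exp (- measure ?\<Lambda> B) * measure ?\<Lambda> B ^ k / fact k)"
  using parts by (elim conjE)
 assume S: "\<And>i. i < q ==> 0 <= S i & S i <= 1"
 have S': "0 <= S i ^ k & S i ^ k <= 1" if "i < q" for i k using S[OF that] by (simp add: power_le_one)
 have "(LINT \<omega>|P. (\<Prod>i\<in>{..<q}. S i ^ n i \<omega>)) = (\<Prod>i\<in>{..<q}. \<integral>\<omega>. S i ^ n i \<omega> \<partial>P)"
 proof (rule P.indep_vars_lebesgue_integral)
  show "P.indep_vars (%_. borel) (%i \<omega>. S i ^ n i \<omega>) {..<q}"
   by (rule P.indep_vars_compose2[OF ind, of "%i k. S i ^ k"]) simp
  fix i assume i: "i \<in> {..<q}"
  note meas[of i, measurable]
  show "integrable P (%\<omega>. S i ^ n i \<omega>)"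
   using i S'[of i] by (intro P.integrable_const_bound[where B = 1]) (auto intro!: measurable_compose[OF meas])
 qed simp
 also have "... = (\<Prod>i\<in>{..<q}. exp (- (K * (a (Suc i) ^ d - a i ^ d) * (1 - S i))))"
 proof (rule prod.cong)
  fix i assume i: "i \<in> {..<q}"
  have l: "measure ?\<Lambda> {a i..<a (Suc i)} = K * (a (Suc i) ^ d - a i ^ d)"
   using i by (intro poisson_intensity K d a0 mono) auto
  have law: "measure P {\<omega> \<in> space P. n i \<omega> = k} = exp (- measure ?\<Lambda> {a i..<a (Suc i)}) * measure ?\<Lambda> {a i..<a (Suc i)} ^ k / fact k" for k
   unfolding n_def by (rule laws[THEN bspec, THEN mp, THEN spec, OF _ bd]) simp
  show "(LINT \<omega>|P. S i ^ n i \<omega>) = exp (- (K * (a (Suc i) ^ d - a i ^ d) * (1 - S i)))"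
   unfolding l[symmetric] using i S[of i] by (intro poisson_pgf[OF P meas _ law]) auto
 qed simp
 also have "... = exp (- (\<Sum>i<q. K * (a (Suc i) ^ d - a i ^ d) * (1 - S i)))"
  by (simp add: exp_sum sum_negf[symmetric])
 finally show "(LINT \<omega>|P. (\<Prod>i<q. S i ^ n i \<omega>)) = exp (- (\<Sum>i<q. K * (a (Suc i) ^ d - a i ^ d) * (1 - S i)))" .
qed

section \<open>The limit laws in the metric setting\<close>

lemma count_prod_measurable:
 fixes F :: "'i => 'w => nat"
 assumes "finite I" "\<And>i. i \<in> I ==> F i \<in> M \<rightarrow>\<^sub>M count_space UNIV"
 shows "(%y. \<Prod>i\<in>I. F i y) \<in> M \<rightarrow>\<^sub>M count_space UNIV"
 using assms
proof (induction rule: finite_induct)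
 case (insert i I)
 have g: "(%y. \<Prod>i\<in>I. F i y) \<in> M \<rightarrow>\<^sub>M count_space UNIV" using insert by simp
 have "(%y. F i y * (\<Prod>i\<in>I. F i y)) \<in> M \<rightarrow>\<^sub>M count_space UNIV"
 proof (rule measurable_compose_countable[where f = "%k y. k * (\<Prod>i\<in>I. F i y)"])
  show "(%y. k * (\<Prod>i\<in>I. F i y)) \<in> M \<rightarrow>\<^sub>M count_space UNIV" for k by (rule measurable_compose[OF g]) simp
 qed (use insert in simp)
 then show ?case using insert by simp
qed simp

lemma reciprocal_code: "(1 / real (\<Prod>j\<in>I. b j ^ e j)) ^ i = (\<Prod>j\<in>I. ((1 / real (b j)) ^ i) ^ e j)"
proof (induction I rule: infinite_finite_induct)
 case (insert k I)
 have "(1 / real (b k ^ e k)) ^ i = ((1 / real (b k)) ^ i) ^ e k"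
  by (simp add: power_one_over mult.commute flip: power_mult)
 moreover have "(1 / real (\<Prod>j\<in>insert k I. b j ^ e j)) ^ i = (1 / real (b k ^ e k)) ^ i * (1 / real (\<Prod>j\<in>I. b j ^ e j)) ^ i"
  using insert.hyps by (simp add: power_divide power_mult_distrib)
 ultimately have "(1 / real (\<Prod>j\<in>insert k I. b j ^ e j)) ^ i = ((1 / real (b k)) ^ i) ^ e k * (\<Prod>j\<in>I. ((1 / real (b j)) ^ i) ^ e j)"
  by (simp only: insert.IH)
 also have "... = (\<Prod>j\<in>insert k I. ((1 / real (b j)) ^ i) ^ e j)" using insert.hyps by simp
 finally show ?case .
qed simp_all

context mixing_metric_space begin

lemma D_orbit_measurable: "(%y. D x ((f ^^ k) y)) \<in> borel_measurable \<mu>"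
proof -
 have "x \<in> space \<mu>" using sets_eq_imp_space_eq[OF sets_borel] by simp
 then have "(%y. (x, (f ^^ k) y)) \<in> \<mu> \<rightarrow>\<^sub>M \<mu> \<Otimes>\<^sub>M \<mu>" by (intro measurable_Pair measurable_const f_iter_measurable)
 from measurable_compose[OF this D_measurable] show ?thesis by simp
qed

lemma D_return_measurable: "(%y. D y ((f ^^ k) y)) \<in> borel_measurable \<mu>"
proof -
 have "(%y. (y, (f ^^ k) y)) \<in> \<mu> \<rightarrow>\<^sub>M \<mu> \<Otimes>\<^sub>M \<mu>" by (intro measurable_Pair f_iter_measurable) simp
 from measurable_compose[OF this D_measurable] show ?thesis by simp
qed

theorem return_law:
 fixes h :: "nat => real"
 assumes \<tau>: "\<tau> > 0" and h: "bounded (range h)"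
 shows "((%rho. \<integral>y. h (card {k \<in> {1..horizon \<tau> d rho}. D y ((f ^^ k) y) < rho * unit_radius y}) \<partial>\<mu>)
  \<longlongrightarrow> (\<integral>k. h k \<partial>measure_pmf (poisson_pmf \<tau>))) (at_right 0)"
proof (rule poisson_law_from_pgf[where h = h and N = "%rho y. card {k \<in> {1..horizon \<tau> d rho}. D y ((f ^^ k) y) < rho * unit_radius y}"])
 show "prob_space \<mu>" "0 < \<tau>" "bounded (range h)" by (fact prob_space_axioms \<tau> h)+
 note D_return_measurable [measurable] \<gamma>_measurable [measurable]
 have [measurable]: "unit_radius \<in> borel_measurable \<mu>" unfolding unit_radius_def[abs_def] by measurable
 show "(%y. card {k \<in> {1..horizon \<tau> d rho}. D y ((f ^^ k) y) < rho * unit_radius y}) \<in> \<mu> \<rightarrow>\<^sub>M count_space UNIV" for rho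
  by (rule count_measurable) measurable
 fix s :: real assume s: "0 <= s" "s <= 1"
 from return_pgf[OF \<tau> s, unfolded prod_if_card]
 show "((%rho. \<integral>y. s ^ card {k \<in> {1..horizon \<tau> d rho}. D y ((f ^^ k) y) < rho * unit_radius y} \<partial>\<mu>)
  \<longlongrightarrow> exp (- (\<tau> * (1 - s)))) (at_right 0)" .
qed

context
 fixes \<tau> eta s0 :: real and x
 assumes \<tau>: "\<tau> > 0" and eta: "eta > 0" and s0: "s0 > 0"
  and slow: "\<And>s g. 0 < s ==> s < s0 ==> 1 <= g ==> real g <= s powr (- eta) ==>
   measure \<mu> {y. D x y < s & D x ((f ^^ g) y) < s} <= s ^ d * s powr eta"
begin

lemma \<gamma>_pos: "0 < \<gamma> x"
 using c_pos \<gamma>_ge[of x] by linarith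

theorem hitting_law:
 fixes h :: "nat => real"
 assumes h: "bounded (range h)"
 shows "((%rho. \<integral>y. h (card {k \<in> {1..horizon \<tau> d rho}. D x ((f ^^ k) y) < rho}) \<partial>\<mu>)
  \<longlongrightarrow> (\<integral>k. h k \<partial>measure_pmf (poisson_pmf (\<tau> * \<gamma> x)))) (at_right 0)"
proof (rule poisson_law_from_pgf[where h = h and N = "%rho y. card {k \<in> {1..horizon \<tau> d rho}. D x ((f ^^ k) y) < rho}"])
 show "prob_space \<mu>" "bounded (range h)" by (fact prob_space_axioms h)+
 note D_orbit_measurable [measurable]
 show "(%y. card {k \<in> {1..horizon \<tau> d rho}. D x ((f ^^ k) y) < rho}) \<in> \<mu> \<rightarrow>\<^sub>M count_space UNIV" for rho
  by (rule count_measurable) measurable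
 show "0 < \<tau> * \<gamma> x" using \<tau> \<gamma>_pos by simp
 fix s :: real assume s: "0 <= s" "s <= 1"
 let ?sg = "%_::nat. s"
 have a: "real 0 = 0" "strict_mono_on {..1} real" by (auto intro: strict_mono_onI)
 have rate: "shell_rate real ?sg 1 = 1 - s" using d_ge_1 by (simp add: shell_rate_def)
 have "((%rho. \<integral>y. (\<Prod>k\<in>{1..horizon \<tau> d rho}. step_weight real ?sg 1 (D x ((f ^^ k) y) / rho)) \<partial>\<mu>)
  \<longlongrightarrow> exp (- (\<tau> * \<gamma> x * shell_rate real ?sg 1))) (at_right 0)"
  by (rule hitting_pgf[OF \<tau> eta s0 slow a]) (use s in auto)
 moreover have "\<forall>\<^sub>F rho in at_right (0::real). (LINT y|\<mu>. (\<Prod>k\<in>{1..horizon \<tau> d rho}. step_weight real ?sg 1 (D x ((f ^^ k) y) / rho)))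
   = (LINT y|\<mu>. s ^ card {k \<in> {1..horizon \<tau> d rho}. D x ((f ^^ k) y) < rho})"
  using eventually_at_right_less[of "0::real"]
 proof eventually_elim
  case (elim rho)
  then show ?case unfolding prod_if_card[symmetric] by (simp add: step_weight_def)
 qed
 ultimately show "((%rho. \<integral>y. s ^ card {k \<in> {1..horizon \<tau> d rho}. D x ((f ^^ k) y) < rho} \<partial>\<mu>)
  \<longlongrightarrow> exp (- (\<tau> * \<gamma> x * (1 - s)))) (at_right 0)" unfolding rate by (rule Lim_transform_eventually)
qed

text \<open>Both the rescaled distances and the points of the Poisson process enter only through the counts below finitely many thresholds. These counts are encoded in one natural number by prime powers, whose reciprocal moments are exactly the joint generating functions computed above on either side.\<close>

theorem closest_distances_law:
 fixes E :: "'a => 'a => ennreal" and P :: "'w measure" and T :: "nat => 'w => real"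
 assumes E: "\<And>r y. r <= 1 ==> E x y < ennreal r \<longleftrightarrow> D x y < r" and E_meas: "E x \<in> borel_measurable \<mu>"
  and pp: "poisson_process P T (density lborel (%t. ennreal (\<gamma> x * \<tau> * real d * t ^ (d - 1)) * indicator {0<..} t))"
 shows "converges_in_law \<mu> (%rho y. %i. nth_closest E f (horizon \<tau> d rho) (Suc i) x y / ennreal rho)
  (distr P borel (%\<omega> i. ennreal (T i \<omega>))) (at_right 0)"
proof (rule sequence_law_from_thresholds[OF prob_space_axioms])
 note parts = pp[unfolded poisson_process_def]
 show P: "prob_space P" using parts by (elim conjE)
 interpret P: prob_space P by (rule P)
 have T_m: "T i \<in> borel_measurable P" for i using parts by (elim conjE) (rule spec)
 then show "(%z. ennreal (T i z)) \<in> borel_measurable P" for i by measurable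
 have Em: "(%y. E x ((f ^^ k) y)) \<in> borel_measurable \<mu>" for k by (rule measurable_compose[OF f_iter_measurable E_meas])
 show "(%y. nth_closest E f (horizon \<tau> d rho) (Suc i) x y / ennreal rho) \<in> borel_measurable \<mu>" for rho i
 proof -
  have "(%y. nth_closest E f (horizon \<tau> d rho) (Suc i) x y) \<in> borel_measurable \<mu>"
  proof (rule borel_measurableI_less)
   fix t
   note Em [measurable]
   have "(%y. card {k \<in> {1..horizon \<tau> d rho}. E x ((f ^^ k) y) < t}) \<in> \<mu> \<rightarrow>\<^sub>M count_space UNIV"
    by (rule count_measurable) measurable
   from measurable_sets[OF this, of "{i<..}"]
   show "{y \<in> space \<mu>. nth_closest E f (horizon \<tau> d rho) (Suc i) x y < t} \<in> sets \<mu>"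
    unfolding nth_closest_less by (simp add: vimage_def Int_def conj_commute)
  qed
  then show ?thesis unfolding divide_ennreal_def by measurable
 qed
 fix a :: "nat => real" and q :: nat and G :: "(nat => nat => bool) => real" and B
 assume a: "a 0 = 0" "strict_mono_on {..q} a" and GB: "\<And>b. \<bar>G b\<bar> <= B"
  and Gm: "(%z. G (%i j. j \<in> {1..q} & ennreal (T i z) < ennreal (a j))) \<in> borel_measurable P"
 have K: "0 <= \<gamma> x * \<tau>" using \<tau> \<gamma>_pos by simp
 define n where "n i \<omega> = card {k. T k \<omega> \<in> {a i..<a (Suc i)}}" for i \<omega>
 note shells = poisson_process_shells[OF pp K d_ge_1 a, folded n_def]
 obtain p :: "nat => nat" where p: "inj p" "\<And>j. prime (p j)" using exists_distinct_primes by blast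
 have p1: "1 <= p j" for j using prime_ge_1_nat[OF p(2)] .
 define N where "N rho y j = card {k \<in> {1..horizon \<tau> d rho}. D x ((f ^^ k) y) / rho < a j}" for rho y j
 define W where "W rho y = (\<Prod>j\<in>{1..q}. p j ^ N rho y j)" for rho y
 define W' where "W' z = (\<Prod>i<q. (\<Prod>j\<in>{Suc i..q}. p j) ^ n i z)" for z
 define G' where "G' w = G (%i j. j \<in> {1..q} & i < multiplicity (p j) w)" for w
 have G'm: "G' \<in> count_space UNIV \<rightarrow>\<^sub>M borel" by simp
 note D_orbit_measurable [measurable]
 have W_m: "W rho \<in> \<mu> \<rightarrow>\<^sub>M count_space UNIV" for rho
  unfolding W_def[abs_def]
 proof (rule count_prod_measurable)
  fix j
  have "(%y. N rho y j) \<in> \<mu> \<rightarrow>\<^sub>M count_space UNIV" unfolding N_def by (rule count_measurable) measurable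
  from measurable_compose[OF this, of "%k. p j ^ k"] show "(%y. p j ^ N rho y j) \<in> \<mu> \<rightarrow>\<^sub>M count_space UNIV" by simp
 qed simp
 have W'_m: "W' \<in> P \<rightarrow>\<^sub>M count_space UNIV"
  unfolding W'_def[abs_def]
 proof (rule count_prod_measurable)
  fix i assume "i \<in> {..<q}"
  then have "n i \<in> P \<rightarrow>\<^sub>M count_space UNIV" by (intro shells(1)) simp
  from measurable_compose[OF this, of "%k. (\<Prod>j\<in>{Suc i..q}. p j) ^ k"]
  show "(%z. (\<Prod>j\<in>{Suc i..q}. p j) ^ n i z) \<in> P \<rightarrow>\<^sub>M count_space UNIV" by simp
 qed simp
 have pos: "1 <= W rho y" "1 <= W' z" for rho y z
  unfolding W_def W'_def by (intro prod_ge_1 one_le_power p1)+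
 have lim: "((%rho. \<integral>y. G' (W rho y) \<partial>\<mu>) \<longlongrightarrow> (LINT z|P. G' (W' z))) (at_right 0)"
 proof (rule law_from_reciprocal_moments[OF prob_space_axioms P W_m W'_m pos])
  show "\<bar>G' w\<bar> <= B" for w unfolding G'_def by (rule GB)
  fix m
  define sg where "sg j = (1 / real (p j)) ^ m" for j
  have sg: "0 <= sg j & sg j <= 1" for j
  proof -
   have "1 <= real (p j)" using p1[of j] by simp
   then show ?thesis unfolding sg_def by (intro conjI zero_le_power power_le_one) auto
  qed
  define S where "S i = (\<Prod>j\<in>{Suc i..q}. sg j)" for i
  have S: "0 <= S i & S i <= 1" for i unfolding S_def using sg by (auto intro!: prod_nonneg prod_le_1)
  have Wm: "(1 / real (W rho y)) ^ m = (\<Prod>k\<in>{1..horizon \<tau> d rho}. step_weight a sg q (D x ((f ^^ k) y) / rho))" for rho y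
  proof -
   have "(1 / real (W rho y)) ^ m = (\<Prod>j\<in>{1..q}. sg j ^ N rho y j)" unfolding W_def reciprocal_code sg_def ..
   also have "... = (\<Prod>j\<in>{1..q}. \<Prod>k\<in>{1..horizon \<tau> d rho}. if D x ((f ^^ k) y) / rho < a j then sg j else 1)"
    unfolding N_def prod_if_card ..
   also have "... = (\<Prod>k\<in>{1..horizon \<tau> d rho}. step_weight a sg q (D x ((f ^^ k) y) / rho))"
    unfolding step_weight_def by (rule prod.swap)
   finally show ?thesis .
  qed
  have W'm: "(1 / real (W' z)) ^ m = (\<Prod>i<q. S i ^ n i z)" for z
  proof -
   have "(1 / real (\<Prod>j\<in>{Suc i..q}. p j)) ^ m = S i" for i
    using reciprocal_code[where I = "{Suc i..q}" and b = p and e = "%_. 1" and i = m] by (simp add: S_def sg_def)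
   then show ?thesis unfolding W'_def reciprocal_code by simp
  qed
  have "(LINT z|P. (1 / real (W' z)) ^ m) = exp (- (\<Sum>i<q. \<gamma> x * \<tau> * (a (Suc i) ^ d - a i ^ d) * (1 - S i)))"
   unfolding W'm by (rule shells(3)) (rule S)
  also have "(\<Sum>i<q. \<gamma> x * \<tau> * (a (Suc i) ^ d - a i ^ d) * (1 - S i)) = \<tau> * \<gamma> x * shell_rate a sg q"
   unfolding shell_rate_def S_def sum_distrib_left by (intro sum.cong) (simp_all add: mult_ac)
  finally have W'e: "(LINT z|P. (1 / real (W' z)) ^ m) = exp (- (\<tau> * \<gamma> x * shell_rate a sg q))" .
  show "((%rho. \<integral>y. (1 / real (W rho y)) ^ m \<partial>\<mu>) \<longlongrightarrow> (LINT z|P. (1 / real (W' z)) ^ m)) (at_right 0)"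
   unfolding Wm W'e by (rule hitting_pgf[OF \<tau> eta s0 slow a sg])
 qed
 have T_side: "(LINT z|P. G (%i j. j \<in> {1..q} & ennreal (T i z) < ennreal (a j))) = (LINT z|P. G' (W' z))"
 proof (rule integral_cong_AE[OF Gm measurable_compose[OF W'_m G'm]])
  have "AE \<omega> in P. (\<forall>i. 0 <= T i \<omega> & T i \<omega> <= T (Suc i) \<omega>) & filterlim (%i. T i \<omega>) at_top sequentially"
   using parts by (elim conjE)
  with shells(2) show "AE z in P. G (%i j. j \<in> {1..q} & ennreal (T i z) < ennreal (a j)) = G' (W' z)"
  proof eventually_elim
   case (elim z)
   have "W' z = (\<Prod>j\<in>{1..q}. p j ^ (\<Sum>i<j. n i z))" unfolding W'_def prod_prefix_powers ..
   then have "multiplicity (p j) (W' z) = (\<Sum>i<j. n i z)" if "j \<in> {1..q}" for j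
    using prime_code_multiplicity[OF p that] by simp
   then have "(%i j. j \<in> {1..q} & i < multiplicity (p j) (W' z)) = (%i j. j \<in> {1..q} & ennreal (T i z) < ennreal (a j))"
    using elim by (intro ext conj_cong refl) (simp add: ennreal_less_iff)
   then show ?case by (simp add: G'_def)
  qed
 qed
 have aq: "0 <= a q" using a by (cases "q = 0") (auto dest: strict_mono_onD[of _ a 0 q])
 \<comment> \<open>For these \<open>rho\<close> all radii are at most one, so that \<open>E\<close> and \<open>D\<close> have the same balls.\<close>
 have "\<forall>\<^sub>F rho in at_right 0. 0 < rho & rho < 1 / (1 + a q)"
  unfolding eventually_at_right_field using aq by (intro exI[of _ "1 / (1 + a q)"]) auto
 then have "\<forall>\<^sub>F rho in at_right 0. (LINT y|\<mu>. G' (W rho y))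
  = (LINT y|\<mu>. G (%i j. j \<in> {1..q} & nth_closest E f (horizon \<tau> d rho) (Suc i) x y / ennreal rho < ennreal (a j)))"
 proof eventually_elim
  case (elim rho)
  have "multiplicity (p j) (W rho y) = card {k \<in> {1..horizon \<tau> d rho}. E x ((f ^^ k) y) < ennreal (rho * a j)}"
   "0 <= a j" if j: "j \<in> {1..q}" for j y
  proof -
   have aj: "0 <= a j" "a j <= a q"
   proof -
    have "a 0 <= a j" "a j <= a q" using strict_mono_on_imp_mono_on[OF a(2)] j by (auto simp: mono_on_def)
    then show "0 <= a j" "a j <= a q" by (simp_all only: a(1))
   qed
   then show "0 <= a j" by simp
   have "rho * a j <= rho * (1 + a q)" using elim aj by (intro mult_left_mono) auto
   also have "... <= 1" using elim aq by (simp add: pos_less_divide_eq less_imp_le)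
   finally have r: "rho * a j <= 1" .
   have "E x ((f ^^ k) y) < ennreal (rho * a j) \<longleftrightarrow> D x ((f ^^ k) y) / rho < a j" for k
    unfolding E[OF r] using elim by (simp add: pos_divide_less_eq mult.commute)
   then show "multiplicity (p j) (W rho y) = card {k \<in> {1..horizon \<tau> d rho}. E x ((f ^^ k) y) < ennreal (rho * a j)}"
    unfolding W_def prime_code_multiplicity[OF p j] N_def by simp
  qed
  note mult = this
  have "(%i j. j \<in> {1..q} & i < multiplicity (p j) (W rho y))
   = (%i j. j \<in> {1..q} & nth_closest E f (horizon \<tau> d rho) (Suc i) x y / ennreal rho < ennreal (a j))" for y
  proof (intro ext conj_cong refl)
   fix i j assume j: "j \<in> {1..q}"
   show "i < multiplicity (p j) (W rho y) \<longleftrightarrow> nth_closest E f (horizon \<tau> d rho) (Suc i) x y / ennreal rho < ennreal (a j)"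
    unfolding mult(1)[OF j] ennreal_divide_less[OF conjunct1[OF elim] mult(2)[OF j]] nth_closest_less ..
  qed
  then show ?case by (simp add: G'_def)
 qed
 from Lim_transform_eventually[OF lim this]
 show "((%rho. \<integral>y. G (%i j. j \<in> {1..q} & nth_closest E f (horizon \<tau> d rho) (Suc i) x y / ennreal rho < ennreal (a j)) \<partial>\<mu>)
  \<longlongrightarrow> (LINT z|P. G (%i j. j \<in> {1..q} & ennreal (T i z) < ennreal (a j)))) (at_right 0)"
  unfolding T_side .
qed

end

end

section \<open>Preliminaries on inner products and curves\<close>

text \<open>The value of the metric at one point of a chart, as a norm on the coordinate space.\<close>

locale inner_form =
 fixes B :: "real ^ 'n => real ^ 'n => real"
 assumes bilin: "bilinear B" and sym: "B v w = B w v" and pos: "v ~= 0 ==> 0 < B v v"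
begin

definition N :: "real ^ 'n => real" where "N v = sqrt (B v v)"

lemma B_simps:
 "B (u + v) w = B u w + B v w" "B u (v + w) = B u v + B u w" "B (r *\<^sub>R v) w = r * B v w" "B v (r *\<^sub>R w) = r * B v w"
 "B 0 w = 0" "B v 0 = 0" "B (u - v) w = B u w - B v w" "B u (v - w) = B u v - B u w"
 using bilin by (simp_all add: bilinear_ladd bilinear_radd bilinear_lmul bilinear_rmul bilinear_lzero bilinear_rzero bilinear_lsub bilinear_rsub)

lemma nonneg: "0 <= B v v"
 using pos[of v] by (cases "v = 0") (auto simp: B_simps)

lemma N_sq: "N v * N v = B v v" and N_nonneg: "0 <= N v" and N_zero: "N 0 = 0"
 using nonneg[of v] by (auto simp: N_def B_simps)

lemma cauchy_schwarz: "\<bar>B u v\<bar> <= N u * N v"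
proof (cases "v = 0")
 case False
 define t where "t = B u v / B v v"
 have bv: "0 < B v v" using pos False by blast
 have "0 <= B (u - t *\<^sub>R v) (u - t *\<^sub>R v)" by (rule nonneg)
 also have "... = B u u - 2 * t * B u v + t * t * B v v" by (simp add: B_simps sym[of v u] algebra_simps)
 also have "... = B u u - B u v * B u v / B v v" using bv by (simp add: t_def field_simps)
 finally have "(B u v)\<^sup>2 <= B u u * B v v" using bv by (simp add: field_simps power2_eq_square)
 then have "sqrt ((B u v)\<^sup>2) <= sqrt (B u u * B v v)" by (rule real_sqrt_le_mono)
 then show ?thesis by (simp add: N_def real_sqrt_mult)
qed (simp add: B_simps N_def)

lemma N_triangle: "N (u + v) <= N u + N v"
proof (rule power2_le_imp_le)
 have "(N (u + v))\<^sup>2 = B u u + 2 * B u v + B v v" by (simp add: power2_eq_square N_sq B_simps sym[of v u])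
 also have "... <= B u u + 2 * (N u * N v) + B v v" using cauchy_schwarz[of u v] by linarith
 also have "... = (N u + N v)\<^sup>2" by (simp add: power2_eq_square algebra_simps N_sq)
 finally show "(N (u + v))\<^sup>2 <= (N u + N v)\<^sup>2" .
qed (simp add: N_nonneg)

lemma N_scale: "N (r *\<^sub>R v) = \<bar>r\<bar> * N v"
 by (simp add: N_def B_simps real_sqrt_mult flip: mult.assoc)

lemma continuous_B: "continuous_on S (%x. B (p x) (q x))" if "continuous_on S p" "continuous_on S q"
 using that bilin unfolding bilinear_conv_bounded_bilinear by (rule bounded_bilinear.continuous_on[rotated])

lemma continuous_N: "continuous_on S p ==> continuous_on S (%x. N (p x))"
 unfolding N_def by (intro continuous_on_real_sqrt continuous_B)

lemma equivalent: "\<exists>a b. 0 < a & 0 < b & (\<forall>v. a * norm v <= N v & N v <= b * norm v)"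
proof -
 let ?S = "sphere 0 1 :: (real ^ 'n) set"
 have ne: "?S ~= {}" by simp
 have c: "continuous_on ?S N" by (rule continuous_N) (rule continuous_on_id)
 obtain u where u: "u \<in> ?S" "\<And>v. v \<in> ?S ==> N u <= N v" using continuous_attains_inf[OF compact_sphere ne c] by blast
 obtain w where w: "w \<in> ?S" "\<And>v. v \<in> ?S ==> N v <= N w" using continuous_attains_sup[OF compact_sphere ne c] by blast
 have "u ~= 0" using u(1) by auto
 then have Nu: "0 < N u" using pos[of u] by (simp add: N_def)
 have "N u * norm v <= N v & N v <= N w * norm v" for v
 proof (cases "v = 0")
  case False
  have "N v = norm v * N ((1 / norm v) *\<^sub>R v)" using False by (simp add: N_scale)
  moreover have "(1 / norm v) *\<^sub>R v \<in> ?S" using False by simp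
  ultimately show ?thesis using u(2)[of "(1 / norm v) *\<^sub>R v"] w(2)[of "(1 / norm v) *\<^sub>R v"] by (simp add: mult.commute mult_left_mono)
 qed (simp add: N_zero)
 moreover have "0 < N w" using Nu u(2)[OF w(1)] by linarith
 ultimately show ?thesis using Nu by blast
qed

end

lemma bilinear_expand:
 fixes B :: "real ^ 'n => real ^ 'n => real"
 assumes "bilinear B"
 shows "B v w = (\<Sum>i\<in>UNIV. \<Sum>j\<in>UNIV. v $ i * w $ j * B (axis i 1) (axis j 1))"
proof -
 have "B v w = B (\<Sum>i\<in>UNIV. v $ i *\<^sub>R axis i 1) (\<Sum>j\<in>UNIV. w $ j *\<^sub>R axis j 1)"
  using basis_expansion[of v] basis_expansion[of w] by (simp add: scalar_mult_eq_scaleR)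
 also have "... = (\<Sum>(i, j)\<in>UNIV \<times> UNIV. B (v $ i *\<^sub>R axis i 1) (w $ j *\<^sub>R axis j 1))"
  by (rule bilinear_sum[OF assms]) 
 also have "... = (\<Sum>i\<in>UNIV. \<Sum>j\<in>UNIV. v $ i * w $ j * B (axis i 1) (axis j 1))"
  using assms by (simp add: sum.cartesian_product bilinear_lmul bilinear_rmul mult.assoc del: UNIV_Times_UNIV)
 finally show ?thesis .
qed

text \<open>The fundamental theorem of calculus for a function that is continuous and continuously differentiable off a finite set. If the derivative is not integrable the bound is trivial.\<close>

lemma increment_le_total_variation:
 fixes F F' :: "real => real"
 assumes ab: "a <= b" and S: "finite S" and cont: "continuous_on {a..b} F"
  and deriv: "\<And>t. t \<in> {a<..<b} - S ==> (F has_real_derivative F' t) (at t)"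
  and cont': "continuous_on ({a<..<b} - S) F'"
 shows "ennreal (F b - F a) <= (\<integral>\<^sup>+t. ennreal \<bar>F' t\<bar> * indicator ({a<..<b} - S) t \<partial>lborel)"
proof -
 let ?A = "{a<..<b} - S"
 define H where "H t = indicator ?A t * F' t" for t
 have A: "open ?A" using S by (intro open_Diff finite_imp_closed) auto
 have H_m: "H \<in> borel_measurable borel"
  unfolding H_def using borel_measurable_continuous_on_indicator[OF _ cont'] A by simp
 have eq: "(\<integral>\<^sup>+t. ennreal \<bar>F' t\<bar> * indicator ?A t \<partial>lborel) = (\<integral>\<^sup>+t. ennreal \<bar>H t\<bar> \<partial>lborel)"
  by (intro nn_integral_cong) (auto simp: H_def indicator_def)
 show ?thesis
 proof (cases "(\<integral>\<^sup>+t. ennreal \<bar>H t\<bar> \<partial>lborel) = \<infinity>")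
  case True
  then show ?thesis unfolding eq by simp
 next
  case False
  then have int: "integrable lborel H"
   using H_m by (intro integrableI_bounded) (auto simp: less_top)
  have "(H has_integral (F b - F a)) {a..b}"
  proof (rule fundamental_theorem_of_calculus_interior_strong[OF S ab _ cont])
   fix t assume t: "t \<in> {a<..<b} - S"
   then show "(F has_vector_derivative H t) (at t)"
    using deriv[OF t] by (simp add: H_def has_real_derivative_iff_has_vector_derivative)
  qed
  then have "(H has_integral (F b - F a)) UNIV"
   by (rule has_integral_on_superset) (auto simp: H_def indicator_def)
  then have "F b - F a = integral\<^sup>L lborel H"
   using has_integral_integral_lborel[OF int] by (rule has_integral_unique)
  also have "... <= (LINT t|lborel. \<bar>H t\<bar>)"
   using int by (intro integral_mono) auto
  finally have "ennreal (F b - F a) <= ennreal (LINT t|lborel. \<bar>H t\<bar>)" by (rule ennreal_leI)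
  also have "... = (\<integral>\<^sup>+t. ennreal \<bar>H t\<bar> \<partial>lborel)"
   using int by (intro nn_integral_eq_integral[symmetric]) auto
  finally show ?thesis unfolding eq .
 qed
qed

lemma C1_differentiable_onI:
 fixes f :: "real => 'b::real_normed_vector"
 assumes "\<And>t. t \<in> S ==> (f has_vector_derivative f' t) (at t)" "continuous_on S f'"
 shows "f C1_differentiable_on S"
 using assms unfolding C1_differentiable_on_def by blast

lemma smooth_onD:
 assumes "smooth_on S F" "x \<in> S"
 shows "(F has_derivative frechet_derivative F (at x)) (at x)"
proof -
 have "Ck_on (Suc 0) S F" using assms(1) unfolding smooth_on_def by blast
 then have "F differentiable (at x)" using assms(2) by simp
 then show ?thesis by (simp add: frechet_derivative_works)
qed

lemma smooth_on_deriv_continuous: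
 assumes "smooth_on S F"
 shows "continuous_on S (%x. frechet_derivative F (at x) v)"
proof -
 have "Ck_on (Suc 0) S F" using assms unfolding smooth_on_def by blast
 then show ?thesis by simp
qed

lemma smooth_on_continuous: "smooth_on S F ==> continuous_on S F"
 unfolding smooth_on_def using Ck_on.simps(1) by blast

section \<open>Charts and speeds of curves\<close>

locale riemannian =
 fixes \<A> :: "('a::{t2_space, second_countable_topology}, 'n::finite) chart set" and g :: "('a, 'n) metric"
 assumes atlas: "smooth_atlas \<A>" and metric: "riemannian_metric \<A> g"
begin

lemma chart_open: "c \<in> \<A> ==> open (fst c)" "c \<in> \<A> ==> open (snd c ` fst c)"
 and chart_homeo: "c \<in> \<A> ==> homeomorphism (fst c) (snd c ` fst c) (snd c) (chart_inv c)"
 and transition_smooth: "c \<in> \<A> ==> c' \<in> \<A> ==> smooth_on (snd c ` (fst c \<inter> fst c')) (snd c' \<circ> chart_inv c)"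
 using atlas unfolding smooth_atlas_def by blast+

lemma chart_at: "\<exists>c\<in>\<A>. p \<in> fst c"
 using atlas unfolding smooth_atlas_def by blast

lemma chart_cont: "c \<in> \<A> ==> continuous_on (fst c) (snd c)" "c \<in> \<A> ==> continuous_on (snd c ` fst c) (chart_inv c)"
 and chart_inv_in: "c \<in> \<A> ==> z \<in> snd c ` fst c ==> chart_inv c z \<in> fst c"
 and chart_inv_left: "c \<in> \<A> ==> p \<in> fst c ==> chart_inv c (snd c p) = p"
 and chart_inv_right: "c \<in> \<A> ==> z \<in> snd c ` fst c ==> snd c (chart_inv c z) = z"
 using chart_homeo[of c] unfolding homeomorphism_def by auto

lemma chart_inj: "c \<in> \<A> ==> p \<in> fst c ==> q \<in> fst c ==> snd c p = snd c q ==> p = q"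
 by (metis chart_inv_left)

lemma chart_image_open: "c \<in> \<A> ==> open U ==> U \<subseteq> fst c ==> open (snd c ` U)"
proof -
 assume c: "c \<in> \<A>" and U: "open U" "U \<subseteq> fst c"
 have "snd c ` U = snd c ` fst c \<inter> chart_inv c -` U"
  using U chart_inv_left[OF c] chart_inv_right[OF c] by (auto simp: image_iff subset_eq)
 moreover have "open (snd c ` fst c \<inter> chart_inv c -` U)"
  using continuous_open_preimage[OF chart_cont(2)[OF c] chart_open(2)[OF c] U(1)] .
 ultimately show ?thesis by simp
qed

lemma chart_inv_image_open: "c \<in> \<A> ==> open V ==> open {p \<in> fst c. snd c p \<in> V}"
 using continuous_open_preimage[OF chart_cont(1) chart_open(1)] by (simp add: Int_def vimage_def)

lemma metric_form: "c \<in> \<A> ==> p \<in> fst c ==> inner_form (g c p)"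
 using metric unfolding riemannian_metric_def inner_form_def by blast

lemma metric_smooth: "c \<in> \<A> ==> smooth_on (snd c ` fst c) (%z. g c (chart_inv c z) v w)"
 using metric unfolding riemannian_metric_def by blast

lemma metric_transform:
 assumes "c \<in> \<A>" "c' \<in> \<A>" "p \<in> fst c" "p \<in> fst c'"
 shows "g c p v w = g c' p (frechet_derivative (snd c' \<circ> chart_inv c) (at (snd c p)) v)
   (frechet_derivative (snd c' \<circ> chart_inv c) (at (snd c p)) w)"
 using metric assms unfolding riemannian_metric_def Let_def by blast

lemma metric_entry_continuous: "c \<in> \<A> ==> continuous_on (fst c) (%p. g c p v w)"
proof -
 assume c: "c \<in> \<A>"
 have "continuous_on (fst c) (%p. g c (chart_inv c (snd c p)) v w)"
  using continuous_on_compose2[OF smooth_on_continuous[OF metric_smooth[OF c]] chart_cont(1)[OF c]] by auto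
 then show ?thesis by (rule continuous_on_eq) (simp add: chart_inv_left[OF c])
qed

lemma metric_continuous:
 assumes c: "c \<in> \<A>" and p: "continuous_on T p" "\<And>t. t \<in> T ==> p t \<in> fst c"
  and v: "continuous_on T v" and w: "continuous_on T w"
 shows "continuous_on T (%t. g c (p t) (v t) (w t))"
proof -
 have "continuous_on T (%t. \<Sum>i\<in>UNIV. \<Sum>j\<in>UNIV. v t $ i * w t $ j * g c (p t) (axis i 1) (axis j 1))"
  by (intro continuous_on_sum continuous_on_mult continuous_on_component v w
    continuous_on_compose2[OF metric_entry_continuous[OF c] p(1)]) (use p(2) in auto)
 moreover have "g c (p t) (v t) (w t) = (\<Sum>i\<in>UNIV. \<Sum>j\<in>UNIV. v t $ i * w t $ j * g c (p t) (axis i 1) (axis j 1))"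
  if "t \<in> T" for t
  using metric_form[OF c p(2)[OF that]] by (intro bilinear_expand) (simp add: inner_form_def)
 ultimately show ?thesis by (simp cong: continuous_on_cong)
qed

definition chart_norm :: "('a, 'n) chart => 'a => real ^ 'n => real" where
 "chart_norm c p v = sqrt (g c p v v)"

lemma chart_norm_N: "chart_norm c p = inner_form.N (g c p)" if "c \<in> \<A>" "p \<in> fst c"
 using inner_form.N_def[OF metric_form[OF that]] by (simp add: chart_norm_def fun_eq_iff)

text \<open>Near \<open>p0\<close> the metric is comparable with its value frozen at \<open>p0\<close>, with constants arbitrarily close to one.\<close>

lemma good_chart_ball:
 assumes c: "c \<in> \<A>" and p0: "p0 \<in> fst c" and eps: "0 < eps" "eps < 1"
 shows "\<exists>R>0. \<forall>z. chart_norm c p0 (z - snd c p0) < R --> z \<in> snd c ` fst c &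
  (\<forall>v. (1 - eps) * chart_norm c p0 v <= chart_norm c (chart_inv c z) v &
     chart_norm c (chart_inv c z) v <= (1 + eps) * chart_norm c p0 v)"
proof -
 interpret F: inner_form "g c p0" by (rule metric_form[OF c p0])
 have N: "chart_norm c p0 = F.N" by (rule chart_norm_N[OF c p0])
 obtain a b where ab: "0 < a" "\<And>v. a * norm v <= F.N v" "\<And>v. F.N v <= b * norm v"
  using F.equivalent by blast
 define n where "n = real CARD('n)"
 have n: "0 < n" by (simp add: n_def)
 define eta where "eta = eps * (a * a) / (n * n)"
 have eta: "0 < eta" using eps ab n by (simp add: eta_def)
 let ?G = "%z i j. g c (chart_inv c z) (axis i 1) (axis j 1)"
 have z0: "snd c p0 \<in> snd c ` fst c" using p0 by simp
 have cont: "isCont (%z. ?G z i j) (snd c p0)" for i j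
  using smooth_on_continuous[OF metric_smooth[OF c]] z0 continuous_on_eq_continuous_at[OF chart_open(2)[OF c]] by blast
 have "\<forall>\<^sub>F z in nhds (snd c p0). \<bar>?G z i j - ?G (snd c p0) i j\<bar> < eta" for i j
 proof -
  have "((%z. ?G z i j) \<longlongrightarrow> ?G (snd c p0) i j) (nhds (snd c p0))"
   using cont[of i j] unfolding isCont_def by (rule tendsto_at_iff_tendsto_nhds[THEN iffD1])
  from tendstoD[OF this eta] show ?thesis by (simp add: dist_real_def)
 qed
 then have "\<forall>\<^sub>F z in nhds (snd c p0). \<forall>i\<in>UNIV. \<forall>j\<in>UNIV. \<bar>?G z i j - ?G (snd c p0) i j\<bar> < eta"
  by (intro eventually_ball_finite ballI) auto
 moreover have "\<forall>\<^sub>F z in nhds (snd c p0). z \<in> snd c ` fst c" using z0 chart_open(2)[OF c] by (rule eventually_nhds_in_open[rotated])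
 ultimately have "\<forall>\<^sub>F z in nhds (snd c p0). z \<in> snd c ` fst c & (\<forall>i j. \<bar>?G z i j - ?G (snd c p0) i j\<bar> < eta)"
  by eventually_elim auto
 then obtain r where r: "0 < r" and rz: "\<And>z. dist z (snd c p0) < r ==> z \<in> snd c ` fst c & (\<forall>i j. \<bar>?G z i j - ?G (snd c p0) i j\<bar> < eta)"
  unfolding eventually_nhds_metric by blast
 show ?thesis
 proof (intro exI[of _ "a * r"] conjI allI impI)
  show "0 < a * r" using ab r by simp
  fix z assume z: "chart_norm c p0 (z - snd c p0) < a * r"
  have "a * norm (z - snd c p0) < a * r" using ab(2)[of "z - snd c p0"] z unfolding N by linarith
  then have "dist z (snd c p0) < r" using ab(1) by (simp add: dist_norm)
  note zz = rz[OF this]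
  then show zi: "z \<in> snd c ` fst c" by blast
  fix v
  define q where "q = chart_inv c z"
  have q: "q \<in> fst c" unfolding q_def by (rule chart_inv_in[OF c zi])
  have b1: "bilinear (g c q)" "bilinear (g c p0)" using metric_form[OF c q] metric_form[OF c p0] by (auto simp: inner_form_def)
  have "\<bar>g c q v v - g c p0 v v\<bar> = \<bar>\<Sum>i\<in>UNIV. \<Sum>j\<in>UNIV. v $ i * v $ j * (?G z i j - ?G (snd c p0) i j)\<bar>"
   unfolding bilinear_expand[OF b1(1), of v v] bilinear_expand[OF b1(2), of v v]
   by (simp add: q_def chart_inv_left[OF c p0] right_diff_distrib sum_subtractf)
  also have "... <= (\<Sum>i\<in>UNIV. \<bar>\<Sum>j\<in>UNIV. v $ i * v $ j * (?G z i j - ?G (snd c p0) i j)\<bar>)"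
   by (rule sum_abs)
  also have "... <= (\<Sum>i\<in>UNIV. \<Sum>j\<in>UNIV. \<bar>v $ i * v $ j * (?G z i j - ?G (snd c p0) i j)\<bar>)"
   by (intro sum_mono sum_abs)
  also have "... <= (\<Sum>i\<in>(UNIV::'n set). \<Sum>j\<in>(UNIV::'n set). norm v * norm v * eta)"
  proof (intro sum_mono)
   fix i j :: 'n
   have "\<bar>?G z i j - ?G (snd c p0) i j\<bar> <= eta" using zz by (auto intro: less_imp_le)
   then show "\<bar>v $ i * v $ j * (?G z i j - ?G (snd c p0) i j)\<bar> <= norm v * norm v * eta"
    unfolding abs_mult by (intro mult_mono component_le_norm_cart mult_nonneg_nonneg) auto
  qed
  also have "... = n * (n * (norm v * norm v * eta))" by (simp add: n_def)
  also have "... = eps * ((a * norm v) * (a * norm v))" using n by (simp add: eta_def)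
  also have "... <= eps * (F.N v * F.N v)"
  proof -
   have "(a * norm v) * (a * norm v) <= F.N v * F.N v"
    by (rule mult_mono[OF ab(2) ab(2) F.N_nonneg]) (use ab(1) in simp)
   then show ?thesis using eps by (intro mult_left_mono) auto
  qed
  finally have d: "\<bar>g c q v v - g c p0 v v\<bar> <= eps * g c p0 v v" by (simp add: F.N_sq)
  have nn: "0 <= g c p0 v v" by (rule F.nonneg)
  have "(1 - eps)\<^sup>2 <= 1 - eps" using eps by (simp add: power2_eq_square mult_left_le)
  then have "(1 - eps)\<^sup>2 * g c p0 v v <= (1 - eps) * g c p0 v v" using nn by (rule mult_right_mono)
  also have "... <= g c q v v" using d by (simp add: algebra_simps abs_le_iff)
  finally have "sqrt ((1 - eps)\<^sup>2 * g c p0 v v) <= sqrt (g c q v v)" by (rule real_sqrt_le_mono)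
  then show "(1 - eps) * chart_norm c p0 v <= chart_norm c (chart_inv c z) v"
   using eps by (simp add: chart_norm_def q_def real_sqrt_mult)
  have "1 + eps <= (1 + eps)\<^sup>2" using eps by (simp add: power2_eq_square algebra_simps)
  then have "(1 + eps) * g c p0 v v <= (1 + eps)\<^sup>2 * g c p0 v v" using nn by (rule mult_right_mono)
  moreover have "g c q v v <= (1 + eps) * g c p0 v v" using d by (simp add: algebra_simps abs_le_iff)
  ultimately have "sqrt (g c q v v) <= sqrt ((1 + eps)\<^sup>2 * g c p0 v v)" by (intro real_sqrt_le_mono) linarith
  then show "chart_norm c (chart_inv c z) v <= (1 + eps) * chart_norm c p0 v"
   using eps by (simp add: chart_norm_def q_def real_sqrt_mult)
 qed
qed

text \<open>Fixing the exceptional set makes it available for gluing curves.\<close>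

definition regular_off :: "real set => (real => 'a) => bool" where
 "regular_off S sg \<longleftrightarrow> finite S & continuous_on {0..1} sg &
   (\<forall>c\<in>\<A>. (snd c \<circ> sg) C1_differentiable_on {t \<in> {0<..<1} - S. sg t \<in> fst c})"

lemma piecewise_regular: "piecewise_C1_curve \<A> sg \<longleftrightarrow> (\<exists>S. regular_off S sg)"
 unfolding piecewise_C1_curve_def regular_off_def by blast

context
 fixes S sg assumes reg: "regular_off S sg"
begin

abbreviation "vel c t \<equiv> vector_derivative (snd c \<circ> sg) (at t)"

lemma times_open: "open ({0<..<1} - S)" "c \<in> \<A> ==> open {t \<in> {0<..<1} - S. sg t \<in> fst c}"
proof -
 show o: "open ({0<..<1} - S)" using reg by (intro open_Diff finite_imp_closed) (auto simp: regular_off_def)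
 assume c: "c \<in> \<A>"
 have "continuous_on ({0<..<1} - S) sg" using reg by (auto simp: regular_off_def intro: continuous_on_subset)
 from continuous_open_preimage[OF this o chart_open(1)[OF c]]
 show "open {t \<in> {0<..<1} - S. sg t \<in> fst c}" by (simp add: Int_def vimage_def)
qed

lemma vel_derivative:
 assumes "c \<in> \<A>" "t \<in> {0<..<1} - S" "sg t \<in> fst c"
 shows "((snd c \<circ> sg) has_vector_derivative vel c t) (at t)"
 using reg assms unfolding regular_off_def C1_differentiable_on_eq
 by (auto simp: vector_derivative_works[symmetric])

lemma vel_continuous: "c \<in> \<A> ==> continuous_on {t \<in> {0<..<1} - S. sg t \<in> fst c} (vel c)"
 using reg unfolding regular_off_def C1_differentiable_on_eq by auto

lemma vel_transform:
 assumes c: "c \<in> \<A>" "c' \<in> \<A>" and t: "t \<in> {0<..<1} - S" "sg t \<in> fst c" "sg t \<in> fst c'"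
 shows "vel c' t = frechet_derivative (snd c' \<circ> chart_inv c) (at (snd c (sg t))) (vel c t)"
proof -
 let ?\<Psi> = "snd c' \<circ> chart_inv c" and ?z = "snd c (sg t)"
 have d1: "((snd c \<circ> sg) has_derivative (%h. h *\<^sub>R vel c t)) (at t)"
  using vel_derivative[OF c(1) t(1,2)] by (simp add: has_vector_derivative_def)
 have d2: "(?\<Psi> has_derivative frechet_derivative ?\<Psi> (at ?z)) (at ((snd c \<circ> sg) t))"
  using smooth_onD[OF transition_smooth[OF c], of ?z] t by auto
 have d3: "((?\<Psi> \<circ> (snd c \<circ> sg)) has_derivative (frechet_derivative ?\<Psi> (at ?z) \<circ> (%h. h *\<^sub>R vel c t))) (at t)"
  by (rule diff_chain_at[OF d1 d2])
 have "((snd c' \<circ> sg) has_derivative (frechet_derivative ?\<Psi> (at ?z) \<circ> (%h. h *\<^sub>R vel c t))) (at t)"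
 proof (rule has_derivative_transform_within_open[OF d3 times_open(2)[OF c(1)]])
  show "t \<in> {t \<in> {0<..<1} - S. sg t \<in> fst c}" using t by auto
 qed (auto simp: chart_inv_left[OF c(1)])
 moreover interpret bounded_linear "frechet_derivative ?\<Psi> (at ?z)" using d2 by (rule has_derivative_bounded_linear)
 have "(frechet_derivative ?\<Psi> (at ?z) \<circ> (%h. h *\<^sub>R vel c t)) = (%h. h *\<^sub>R frechet_derivative ?\<Psi> (at ?z) (vel c t))"
  by (simp add: fun_eq_iff scaleR)
 ultimately have "((snd c' \<circ> sg) has_vector_derivative frechet_derivative ?\<Psi> (at ?z) (vel c t)) (at t)"
  by (simp add: has_vector_derivative_def)
 then show ?thesis by (rule vector_derivative_at)
qed

text \<open>By the transformation law, any chart around the point may be used in place of the one that was chosen in the definition of the speed.\<close>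

lemma speed_chart:
 assumes c: "c \<in> \<A>" and t: "t \<in> {0<..<1} - S" "sg t \<in> fst c"
 shows "speed \<A> g sg t = chart_norm c (sg t) (vel c t)"
proof -
 define c' where "c' = (SOME c. c \<in> \<A> & sg t \<in> fst c)"
 have c': "c' \<in> \<A>" "sg t \<in> fst c'" unfolding c'_def using someI_ex[of "%c. c \<in> \<A> & sg t \<in> fst c"] c t by blast+
 have "speed \<A> g sg t = sqrt (g c' (sg t) (vel c' t) (vel c' t))" by (simp add: speed_def c'_def Let_def)
 also have "g c' (sg t) (vel c' t) (vel c' t) = g c (sg t) (vel c t) (vel c t)"
  unfolding vel_transform[OF c c'(1) t(1) t(2) c'(2)] using metric_transform[OF c c'(1) t(2) c'(2)] by simp
 finally show ?thesis by (simp add: chart_norm_def)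
qed

lemma speed_continuous: "continuous_on ({0<..<1} - S) (speed \<A> g sg)"
proof -
 have loc: "continuous_on {t \<in> {0<..<1} - S. sg t \<in> fst c} (speed \<A> g sg)" if c: "c \<in> \<A>" for c
 proof -
  have s: "continuous_on {t \<in> {0<..<1} - S. sg t \<in> fst c} sg" using reg by (auto simp: regular_off_def intro: continuous_on_subset)
  have "continuous_on {t \<in> {0<..<1} - S. sg t \<in> fst c} (%t. sqrt (g c (sg t) (vel c t) (vel c t)))"
   by (intro continuous_on_real_sqrt metric_continuous[OF c s] vel_continuous[OF c]) auto
  then show ?thesis by (rule continuous_on_eq) (use speed_chart[OF c] in \<open>auto simp: chart_norm_def\<close>)
 qed
 have "continuous_on (\<Union>c\<in>\<A>. {t \<in> {0<..<1} - S. sg t \<in> fst c}) (speed \<A> g sg)"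
  by (rule continuous_on_open_UN) (use times_open(2) loc in auto)
 moreover have "(\<Union>c\<in>\<A>. {t \<in> {0<..<1} - S. sg t \<in> fst c}) = {0<..<1} - S" using chart_at by auto
 ultimately show ?thesis by simp
qed

end

lemma regular_length:
 assumes reg: "regular_off S sg" and S': "finite S'" "S \<subseteq> S'"
 shows "curve_length \<A> g sg = (\<integral>\<^sup>+ t. ennreal (speed \<A> g sg t) * indicator ({0<..<1} - S') t \<partial>lborel)"
proof -
 have "AE t in lborel. t \<notin> S'" using S' by (intro AE_I'[of S']) (auto simp: null_sets_def finite_imp_closed intro!: borel_closed emeasure_lborel_countable countable_finite)
 then show ?thesis unfolding curve_length_def
  by (intro nn_integral_cong_AE) (auto elim!: eventually_mono simp: indicator_def)
qed

lemma regular_speed_measurable: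
 assumes reg: "regular_off S sg" and A: "open A" "A \<subseteq> {0<..<1} - S"
 shows "(%t. ennreal (speed \<A> g sg t) * indicator A t) \<in> borel_measurable borel"
proof -
 have "(%t. indicator A t *\<^sub>R speed \<A> g sg t) \<in> borel_measurable borel"
  using A by (intro borel_measurable_continuous_on_indicator continuous_on_subset[OF speed_continuous[OF reg]]) auto
 then have "(%t. ennreal (indicator A t *\<^sub>R speed \<A> g sg t)) \<in> borel_measurable borel" by measurable
 moreover have "(%t. ennreal (indicator A t *\<^sub>R speed \<A> g sg t)) = (%t. ennreal (speed \<A> g sg t) * indicator A t)"
  by (auto simp: indicator_def fun_eq_iff)
 ultimately show ?thesis by simp
qed

end

section \<open>Riemannian distance in a chart\<close>

context riemannian begin

text \<open>Project the curve onto the direction of its increment: the linear functional \<open>v \<mapsto> k B(v,u) / N(u)\<close> is bounded by \<open>k N(v)\<close>, hence by the speed, and it takes the value \<open>k N(u)\<close> at the increment \<open>u\<close>.\<close>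

lemma curve_staying_estimate:
 assumes reg: "regular_off S sg" and c: "c \<in> \<A>" and F: "inner_form B"
  and k: "0 < k" and cmp: "\<And>t v. 0 < t ==> t < s ==> k * inner_form.N B v <= chart_norm c (sg t) v"
  and s: "0 <= s" "s <= 1" and stay: "\<And>t. 0 <= t ==> t <= s ==> sg t \<in> fst c"
 shows "ennreal (k * inner_form.N B (snd c (sg s) - snd c (sg 0))) <= curve_length \<A> g sg"
proof -
 interpret F: inner_form B by (rule F)
 define u where "u = snd c (sg s) - snd c (sg 0)"
 have fin: "finite S" and cont: "continuous_on {0..1} sg" using reg by (auto simp: regular_off_def)
 show ?thesis
 proof (cases "u = 0")
  case True
  then show ?thesis by (simp add: u_def[symmetric] F.N_zero)
 next
  case False
  have Nu: "0 < F.N u" using F.pos[OF False] by (simp add: F.N_def)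
  define l where "l v = (k / F.N u) * B v u" for v
  have lN: "\<bar>l v\<bar> <= k * F.N v" for v
  proof -
   have "k / F.N u * \<bar>B v u\<bar> <= k / F.N u * (F.N v * F.N u)"
    using F.cauchy_schwarz[of v u] k Nu by (intro mult_left_mono) auto
   then show ?thesis using k Nu by (simp add: l_def abs_mult)
  qed
  have "bounded_bilinear B" using F.bilin by (simp add: bilinear_conv_bounded_bilinear)
  then have "bounded_linear (%v. B v u)" by (rule bounded_bilinear.bounded_linear_left)
  then have blin: "bounded_linear l" unfolding l_def[abs_def] by (rule bounded_linear_const_mult)
  define \<phi> where "\<phi> t = l (snd c (sg t))" for t
  let ?v = "%t. vector_derivative (snd c \<circ> sg) (at t)"
  have sub: "{0<..<s} - S \<subseteq> {t \<in> {0<..<1} - S. sg t \<in> fst c}" using s stay by auto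
  have cs: "continuous_on {0..s} (%t. snd c (sg t))"
   using s stay by (intro continuous_on_compose2[OF chart_cont(1)[OF c] continuous_on_subset[OF cont]]) auto
  have "ennreal (\<phi> s - \<phi> 0) <= (\<integral>\<^sup>+t. ennreal \<bar>l (?v t)\<bar> * indicator ({0<..<s} - S) t \<partial>lborel)"
  proof (rule increment_le_total_variation[OF s(1) fin])
   show "continuous_on {0..s} \<phi>" unfolding \<phi>_def by (rule bounded_linear.continuous_on[OF blin cs])
   show "continuous_on ({0<..<s} - S) (%t. l (?v t))"
    by (rule bounded_linear.continuous_on[OF blin continuous_on_subset[OF vel_continuous[OF reg c] sub]])
   fix t assume "t \<in> {0<..<s} - S"
   then have "t \<in> {0<..<1} - S" "sg t \<in> fst c" using sub by blast+
   then have "((snd c \<circ> sg) has_vector_derivative ?v t) (at t)" by (rule vel_derivative[OF reg c])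
   then have "((%t. l ((snd c \<circ> sg) t)) has_vector_derivative l (?v t)) (at t)"
    by (rule bounded_linear.has_vector_derivative[OF blin])
   then show "(\<phi> has_real_derivative l (?v t)) (at t)"
    by (simp add: \<phi>_def[abs_def] has_real_derivative_iff_has_vector_derivative o_def)
  qed
  also have "... <= (\<integral>\<^sup>+t. ennreal (speed \<A> g sg t) * indicator ({0<..<1} - S) t \<partial>lborel)"
  proof (rule nn_integral_mono)
   fix t
   show "ennreal \<bar>l (?v t)\<bar> * indicator ({0<..<s} - S) t <= ennreal (speed \<A> g sg t) * indicator ({0<..<1} - S) t"
   proof (cases "t \<in> {0<..<s} - S")
    case True
    then have t: "t \<in> {0<..<1} - S" "sg t \<in> fst c" using sub by blast+
    have "\<bar>l (?v t)\<bar> <= speed \<A> g sg t"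
     unfolding speed_chart[OF reg c t] using lN[of "?v t"] cmp[of t "?v t"] True by auto
    then show ?thesis using True t by (simp add: ennreal_leI)
   qed simp
  qed
  also have "... = curve_length \<A> g sg" by (rule regular_length[OF reg fin, symmetric]) simp
  also have "\<phi> s - \<phi> 0 = k * F.N u"
  proof -
   have "\<phi> s - \<phi> 0 = l u" unfolding \<phi>_def u_def by (rule linear_diff[OF bounded_linear.linear[OF blin], symmetric])
   also have "... = k * F.N u" using Nu by (simp add: l_def F.N_sq[symmetric])
   finally show ?thesis .
  qed
  finally show ?thesis by (simp add: u_def)
 qed
qed

definition frozen_ball :: "('a, 'n) chart => 'a => real => real => bool" where
 "frozen_ball c p0 eps R \<longleftrightarrow> c \<in> \<A> & p0 \<in> fst c & 0 < eps & eps < 1 & 0 < R &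
  (\<forall>z. chart_norm c p0 (z - snd c p0) < R --> z \<in> snd c ` fst c &
  (\<forall>v. (1 - eps) * chart_norm c p0 v <= chart_norm c (chart_inv c z) v &
     chart_norm c (chart_inv c z) v <= (1 + eps) * chart_norm c p0 v))"

lemma frozen_ballD:
 assumes "frozen_ball c p0 eps R"
 shows "c \<in> \<A>" "p0 \<in> fst c" "0 < eps" "eps < 1" "0 < R"
  and "chart_norm c p0 (z - snd c p0) < R ==> z \<in> snd c ` fst c"
  and "chart_norm c p0 (z - snd c p0) < R ==> (1 - eps) * chart_norm c p0 v <= chart_norm c (chart_inv c z) v"
  and "chart_norm c p0 (z - snd c p0) < R ==> chart_norm c (chart_inv c z) v <= (1 + eps) * chart_norm c p0 v"
proof -
 note conj = assms[unfolded frozen_ball_def]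
 show "c \<in> \<A>" "p0 \<in> fst c" "0 < eps" "eps < 1" "0 < R"
  by (rule conj[THEN conjunct1] conj[THEN conjunct2, THEN conjunct1] conj[THEN conjunct2, THEN conjunct2, THEN conjunct1]
   conj[THEN conjunct2, THEN conjunct2, THEN conjunct2, THEN conjunct1]
   conj[THEN conjunct2, THEN conjunct2, THEN conjunct2, THEN conjunct2, THEN conjunct1])+
 have *: "\<forall>z. chart_norm c p0 (z - snd c p0) < R --> z \<in> snd c ` fst c &
  (\<forall>v. (1 - eps) * chart_norm c p0 v <= chart_norm c (chart_inv c z) v &
     chart_norm c (chart_inv c z) v <= (1 + eps) * chart_norm c p0 v)"
  by (rule conj[THEN conjunct2, THEN conjunct2, THEN conjunct2, THEN conjunct2, THEN conjunct2])
 assume "chart_norm c p0 (z - snd c p0) < R"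
 from *[rule_format, OF this]
 show "z \<in> snd c ` fst c" "(1 - eps) * chart_norm c p0 v <= chart_norm c (chart_inv c z) v"
  "chart_norm c (chart_inv c z) v <= (1 + eps) * chart_norm c p0 v" by auto
qed

lemma frozen_ball_exists: "c \<in> \<A> ==> p0 \<in> fst c ==> 0 < eps ==> eps < 1 ==> \<exists>R. frozen_ball c p0 eps R"
 using good_chart_ball[of c p0 eps] unfolding frozen_ball_def by blast

text \<open>A short curve that starts near \<open>p0\<close> cannot leave the frozen ball. Otherwise consider the first exit time: up to then the curve stays in a compact set inside the ball, by the length estimate, so by continuity it is still there at the exit time. A priori the curve could have left the chart domain at that time, so the compact set is taken on the manifold, where it is closed.\<close>

lemma rdist_lower:
 assumes fb: "frozen_ball c p0 eps R" and x: "x \<in> fst c" "chart_norm c p0 (snd c x - snd c p0) < R / 2"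
  and y: "rdist \<A> g x y < ennreal ((1 - eps) * (R / 2))"
 shows "y \<in> fst c" "chart_norm c p0 (snd c y - snd c p0) < R"
  "ennreal ((1 - eps) * chart_norm c p0 (snd c y - snd c x)) <= rdist \<A> g x y"
proof -
 note c = frozen_ballD(1)[OF fb] and p0 = frozen_ballD(2)[OF fb] and eps = frozen_ballD(3,4)[OF fb] and R = frozen_ballD(5)[OF fb]
  and good = frozen_ballD(6)[OF fb] and cmp = frozen_ballD(7)[OF fb]
 interpret F: inner_form "g c p0" by (rule metric_form[OF c p0])
 have N: "chart_norm c p0 = F.N" by (rule chart_norm_N[OF c p0])
 define U where "U = {p \<in> fst c. snd c p \<in> {z. F.N (z - snd c p0) < R}}"
 have oU: "open U" unfolding U_def
 proof (rule chart_inv_image_open[OF c])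
  have "continuous_on UNIV (%z. F.N (z - snd c p0))" by (intro F.continuous_N continuous_intros)
  then show "open {z. F.N (z - snd c p0) < R}" by (intro open_Collect_less continuous_intros) auto
 qed
 have key: "sg 1 \<in> fst c & F.N (snd c (sg 1) - snd c p0) < R & ennreal ((1 - eps) * F.N (snd c (sg 1) - snd c x)) <= curve_length \<A> g sg"
  if reg: "regular_off S sg" and sg0: "sg 0 = x" and short: "curve_length \<A> g sg < ennreal ((1 - eps) * (R / 2))" for S sg
 proof -
  have cont: "continuous_on {0..1} sg" using reg by (auto simp: regular_off_def)
  obtain l where l: "curve_length \<A> g sg = ennreal l" "0 <= l" "l < (1 - eps) * (R / 2)"
   using short by (cases "curve_length \<A> g sg") (auto simp: ennreal_less_iff)
  define K where "K = {z. F.N (z - snd c x) <= l / (1 - eps)}"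
  have lR: "l / (1 - eps) < R / 2" using l eps by (simp add: field_simps)
  have KU: "F.N (z - snd c p0) < R" if "z \<in> K" for z
  proof -
   have "F.N (z - snd c p0) <= F.N (z - snd c x) + F.N (snd c x - snd c p0)" using F.N_triangle[of "z - snd c x" "snd c x - snd c p0"] by simp
   moreover have "F.N (z - snd c x) <= l / (1 - eps)" using that by (simp add: K_def)
   ultimately show ?thesis using x(2) lR unfolding N by linarith
  qed
  have KI: "K \<subseteq> snd c ` fst c" using KU good unfolding N by blast
  have compK: "compact K"
  proof -
   obtain a b where ab: "0 < a" "\<And>v. a * norm v <= F.N v" using F.equivalent by blast
   have "closed K" unfolding K_def
    by (intro closed_Collect_le F.continuous_N continuous_intros)
   moreover have "bounded K"
   proof (rule boundedI)
    fix z assume "z \<in> K"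
    then have "a * norm (z - snd c x) <= l / (1 - eps)" using ab(2)[of "z - snd c x"] by (simp add: K_def)
    then have "norm (z - snd c x) <= l / (1 - eps) / a" by (subst pos_le_divide_eq[OF ab(1)]) (simp only: mult.commute)
    then show "norm z <= l / (1 - eps) / a + norm (snd c x)" using norm_triangle_sub[of z "snd c x"] by linarith
   qed
   ultimately show ?thesis by (simp add: compact_eq_bounded_closed)
  qed
  have clZ: "closed (chart_inv c ` K)"
   by (intro compact_imp_closed compact_continuous_image continuous_on_subset[OF chart_cont(2)[OF c] KI] compK)
  have ZU: "chart_inv c ` K \<subseteq> U"
  proof
   fix p assume "p \<in> chart_inv c ` K"
   then obtain z where z: "z \<in> K" "p = chart_inv c z" by blast
   have "z \<in> snd c ` fst c" using KI z(1) by (rule subsetD)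
   from chart_inv_in[OF c this] chart_inv_right[OF c this] KU[OF z(1)]
   show "p \<in> U" unfolding z(2) U_def by simp
  qed
  have step: "sg s \<in> fst c & snd c (sg s) \<in> K" if s: "0 <= s" "s <= 1" and stay: "\<And>t. 0 <= t ==> t <= s ==> sg t \<in> U" for s
  proof -
   have "ennreal ((1 - eps) * F.N (snd c (sg s) - snd c (sg 0))) <= curve_length \<A> g sg"
   proof (rule curve_staying_estimate[OF reg c F.inner_form_axioms _ _ s])
    fix t v assume t: "0 < t" "t < s"
    then have "sg t \<in> U" using stay by auto
    then show "(1 - eps) * F.N v <= chart_norm c (sg t) v"
     using cmp[of "snd c (sg t)" v] chart_inv_left[OF c, of "sg t"] unfolding U_def N by simp
   qed (use eps stay in \<open>auto simp: U_def\<close>)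
   then have "(1 - eps) * F.N (snd c (sg s) - snd c x) <= l"
    unfolding l(1) sg0 using l(2) eps by (simp add: F.N_nonneg)
   then have "F.N (snd c (sg s) - snd c x) <= l / (1 - eps)" using eps by (simp add: field_simps)
   then show ?thesis using stay[of s] s by (auto simp: K_def U_def)
  qed
  have inU: "sg t \<in> U" if "t \<in> {0..1}" for t
  proof (rule ccontr)
   assume "sg t \<notin> U"
   define E where "E = {0..1} \<inter> sg -` (- U)"
   have E: "compact E" "E ~= {}"
   proof -
    have "closed E" unfolding E_def by (rule continuous_closed_preimage[OF cont]) (use oU in auto)
    then show "compact E" unfolding E_def by (simp add: compact_eq_bounded_closed bounded_Int)
    show "E ~= {}" using that \<open>sg t \<notin> U\<close> by (auto simp: E_def)
   qed
   \<comment> \<open>The first exit time.\<close>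
   from compact_attains_inf[OF E] obtain e where e: "e \<in> E" "\<And>t. t \<in> E ==> e <= t" by auto
   have xU: "x \<in> U" using x R unfolding U_def N by auto
   have e0: "0 < e" using e(1) xU sg0 by (cases "e = 0") (auto simp: E_def)
   have before: "sg t \<in> U" if "0 <= t" "t < e" for t using e that by (force simp: E_def)
   have "sg t \<in> chart_inv c ` K" if t: "t \<in> {0..<e}" for t
   proof -
    have st: "sg t \<in> fst c & snd c (sg t) \<in> K" using t before e(1) by (intro step) (auto simp: E_def)
    then have "sg t = chart_inv c (snd c (sg t))" using chart_inv_left[OF c, of "sg t"] by simp
    then show ?thesis using st by blast
   qed
   then have "sg ` {0..<e} \<subseteq> chart_inv c ` K" by blast
   moreover have "sg e \<in> closure (sg ` {0..<e})"
   proof -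
    have "continuous_on (closure {0..<e}) sg" using e(1) e0 by (intro continuous_on_subset[OF cont]) (auto simp: E_def)
    from image_closure_subset[OF this closed_closure closure_subset] e0 show ?thesis by auto
   qed
   ultimately have "sg e \<in> chart_inv c ` K" using clZ closure_minimal by blast
   then show False using ZU e(1) by (auto simp: E_def)
  qed
  have fin: "sg 1 \<in> U" using inU by simp
  have "snd c (sg 1) \<in> K" using step[of 1] inU by auto
  then have "(1 - eps) * F.N (snd c (sg 1) - snd c x) <= l" using eps by (simp add: K_def field_simps)
  then show ?thesis using fin unfolding l(1) U_def by (auto intro: ennreal_leI)
 qed
 have "\<exists>sg. piecewise_C1_curve \<A> sg & sg 0 = x & sg 1 = y & curve_length \<A> g sg < ennreal ((1 - eps) * (R / 2))"
  using y unfolding rdist_def INF_less_iff by auto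
 then obtain sg S where sg: "regular_off S sg" "sg 0 = x" "sg 1 = y" "curve_length \<A> g sg < ennreal ((1 - eps) * (R / 2))"
  by (auto simp: piecewise_regular)
 from key[OF sg(1,2,4)] sg(3) show "y \<in> fst c" "chart_norm c p0 (snd c y - snd c p0) < R" unfolding N by auto
 show "ennreal ((1 - eps) * chart_norm c p0 (snd c y - snd c x)) <= rdist \<A> g x y"
  unfolding rdist_def N
 proof (rule INF_greatest)
  fix sg' assume "sg' \<in> {sg. piecewise_C1_curve \<A> sg & sg 0 = x & sg 1 = y}"
  then obtain S' where sg': "regular_off S' sg'" "sg' 0 = x" "sg' 1 = y" by (auto simp: piecewise_regular)
  show "ennreal ((1 - eps) * F.N (snd c y - snd c x)) <= curve_length \<A> g sg'"
  proof (cases "curve_length \<A> g sg' < ennreal ((1 - eps) * (R / 2))")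
   case True
   then show ?thesis using key[OF sg'(1,2)] sg'(3) by auto
  next
   case False
   from key[OF sg(1,2,4)] sg(3) have "ennreal ((1 - eps) * F.N (snd c y - snd c x)) <= curve_length \<A> g sg" by auto
   then show ?thesis using False sg(4) by (meson le_less_trans less_imp_le not_le)
  qed
 qed
qed

lemma segment_regular:
 assumes c: "c \<in> \<A>" and seg: "\<And>t. t \<in> {0..1} ==> a + t *\<^sub>R w \<in> snd c ` fst c"
 shows "regular_off {} (%t. chart_inv c (a + t *\<^sub>R w))"
  "t \<in> {0<..<1} ==> vector_derivative (snd c \<circ> (%t. chart_inv c (a + t *\<^sub>R w))) (at t) = w"
proof -
 define p where "p t = a + t *\<^sub>R w" for t :: real
 define sg where "sg t = chart_inv c (p t)" for t
 have cp: "continuous_on T p" for T unfolding p_def by (intro continuous_intros)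
 have dp: "(p has_derivative (%h. h *\<^sub>R w)) (at t)" for t unfolding p_def by (auto intro!: derivative_eq_intros)
 have pin: "p t \<in> snd c ` fst c" if "t \<in> {0..1}" for t unfolding p_def by (rule seg[OF that])
 have cont: "continuous_on {0..1} sg" unfolding sg_def
  using pin by (intro continuous_on_compose2[OF chart_cont(2)[OF c] cp]) auto
 have C1: "(snd c' \<circ> sg) C1_differentiable_on {t \<in> {0<..<1} - {}. sg t \<in> fst c'}" if c': "c' \<in> \<A>" for c'
 proof (rule C1_differentiable_onI)
  let ?\<Psi> = "snd c' \<circ> chart_inv c"
  have in_dom: "p t \<in> snd c ` (fst c \<inter> fst c')" if "t \<in> {t \<in> {0<..<1} - {}. sg t \<in> fst c'}" for t
  proof -
   have pz: "p t \<in> snd c ` fst c" by (rule pin) (use that in simp)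
   have "sg t \<in> fst c" "p t = snd c (sg t)"
    unfolding sg_def using chart_inv_in[OF c pz] chart_inv_right[OF c pz] by simp_all
   moreover have "sg t \<in> fst c'" using that by simp
   ultimately show ?thesis by blast
  qed
  show "continuous_on {t \<in> {0<..<1} - {}. sg t \<in> fst c'} (%t. frechet_derivative ?\<Psi> (at (p t)) w)"
   by (rule continuous_on_compose2[OF smooth_on_deriv_continuous[OF transition_smooth[OF c c']] cp]) (rule image_subsetI, erule in_dom)
  fix t assume t: "t \<in> {t \<in> {0<..<1} - {}. sg t \<in> fst c'}"
  have d2: "(?\<Psi> has_derivative frechet_derivative ?\<Psi> (at (p t))) (at (p t))"
   by (rule smooth_onD[OF transition_smooth[OF c c'] in_dom[OF t]])
  interpret bounded_linear "frechet_derivative ?\<Psi> (at (p t))" using d2 by (rule has_derivative_bounded_linear)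
  have "((?\<Psi> \<circ> p) has_derivative (frechet_derivative ?\<Psi> (at (p t)) \<circ> (%h. h *\<^sub>R w))) (at t)"
   by (rule diff_chain_at[OF dp d2])
  moreover have "(frechet_derivative ?\<Psi> (at (p t)) \<circ> (%h. h *\<^sub>R w)) = (%h. h *\<^sub>R frechet_derivative ?\<Psi> (at (p t)) w)"
   by (simp add: fun_eq_iff scaleR)
  moreover have "?\<Psi> \<circ> p = snd c' \<circ> sg" by (simp add: fun_eq_iff sg_def)
  ultimately show "((snd c' \<circ> sg) has_vector_derivative frechet_derivative ?\<Psi> (at (p t)) w) (at t)"
   by (simp add: has_vector_derivative_def)
 qed
 have "regular_off {} sg" unfolding regular_off_def by (intro conjI finite.emptyI cont ballI C1)
 then show "regular_off {} (%t. chart_inv c (a + t *\<^sub>R w))" by (simp only: sg_def[abs_def] p_def)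
 assume t: "t \<in> {0<..<1}"
 have "((snd c \<circ> sg) has_vector_derivative w) (at t)"
  unfolding has_vector_derivative_def
 proof (rule has_derivative_transform_within_open[OF dp])
  show "open {0<..<1::real}" "t \<in> {0<..<1}" using t by auto
  fix s :: real assume "s \<in> {0<..<1}"
  then have "p s \<in> snd c ` fst c" by (intro pin) simp
  from chart_inv_right[OF c this] show "p s = (snd c \<circ> sg) s" by (simp add: sg_def)
 qed
 then show "vector_derivative (snd c \<circ> (%t. chart_inv c (a + t *\<^sub>R w))) (at t) = w"
  unfolding sg_def p_def by (rule vector_derivative_at)
qed

text \<open>The coordinate segment stays in the frozen ball, which is convex.\<close>

lemma rdist_upper:
 assumes fb: "frozen_ball c p0 eps R"
  and x: "x \<in> fst c" "chart_norm c p0 (snd c x - snd c p0) < R" and y: "y \<in> fst c" "chart_norm c p0 (snd c y - snd c p0) < R"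
 shows "rdist \<A> g x y <= ennreal ((1 + eps) * chart_norm c p0 (snd c y - snd c x))"
proof -
 note c = frozen_ballD(1)[OF fb] and p0 = frozen_ballD(2)[OF fb] and eps = frozen_ballD(3,4)[OF fb] and R = frozen_ballD(5)[OF fb]
  and good = frozen_ballD(6)[OF fb] and cmp = frozen_ballD(8)[OF fb]
 interpret F: inner_form "g c p0" by (rule metric_form[OF c p0])
 have N: "chart_norm c p0 = F.N" by (rule chart_norm_N[OF c p0])
 define a where "a = snd c x"
 define w where "w = snd c y - snd c x"
 have inball: "F.N (a + t *\<^sub>R w - snd c p0) < R" if "t \<in> {0..1}" for t
 proof -
  have "a + t *\<^sub>R w - snd c p0 = (1 - t) *\<^sub>R (snd c x - snd c p0) + t *\<^sub>R (snd c y - snd c p0)"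
   by (simp add: a_def w_def algebra_simps)
  then have "F.N (a + t *\<^sub>R w - snd c p0) <= (1 - t) * F.N (snd c x - snd c p0) + t * F.N (snd c y - snd c p0)"
   using F.N_triangle[of "(1 - t) *\<^sub>R (snd c x - snd c p0)" "t *\<^sub>R (snd c y - snd c p0)"] that by (simp add: F.N_scale)
  also have "... < R"
  proof (cases "t = 0")
   case False
   have "(1 - t) * F.N (snd c x - snd c p0) <= (1 - t) * R" using x(2) that unfolding N by (intro mult_left_mono) auto
   moreover have "t * F.N (snd c y - snd c p0) < t * R" using y(2) that False unfolding N by (intro mult_strict_left_mono) auto
   ultimately show ?thesis by (simp add: algebra_simps)
  qed (use x(2) in \<open>simp add: N\<close>)
  finally show ?thesis .
 qed
 let ?sg = "%t. chart_inv c (a + t *\<^sub>R w)"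
 have seg: "a + t *\<^sub>R w \<in> snd c ` fst c" if "t \<in> {0..1}" for t using good inball[OF that] unfolding N by blast
 note reg = segment_regular(1)[OF c seg] and der = segment_regular(2)[OF c seg]
 have ends: "?sg 0 = x" "?sg 1 = y" using x(1) y(1) by (simp_all add: a_def w_def chart_inv_left[OF c])
 have "rdist \<A> g x y <= curve_length \<A> g ?sg"
  unfolding rdist_def by (rule INF_lower) (use reg ends in \<open>auto simp: piecewise_regular\<close>)
 also have "... = (\<integral>\<^sup>+ t. ennreal (speed \<A> g ?sg t) * indicator ({0<..<1} - {}) t \<partial>lborel)"
  by (rule regular_length[OF reg]) auto
 also have "... <= (\<integral>\<^sup>+ t. ennreal ((1 + eps) * F.N w) * indicator {0<..<1::real} t \<partial>lborel)"
 proof (rule nn_integral_mono)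
  fix t :: real
  show "ennreal (speed \<A> g ?sg t) * indicator ({0<..<1} - {}) t <= ennreal ((1 + eps) * F.N w) * indicator {0<..<1} t"
  proof (cases "t \<in> {0<..<1}")
   case True
   then have t: "t \<in> {0<..<1} - {}" "t \<in> {0..1}" by auto
   have "?sg t \<in> fst c" by (rule chart_inv_in[OF c seg[OF t(2)]])
   then have "speed \<A> g ?sg t = chart_norm c (?sg t) w" using speed_chart[OF reg c t(1)] der True by simp
   also have "... <= (1 + eps) * F.N w" using cmp inball[OF t(2)] unfolding N by blast
   finally show ?thesis using True by (simp add: ennreal_leI)
  qed simp
 qed
 also have "... = ennreal ((1 + eps) * F.N w)" by (simp add: nn_integral_cmult_indicator)
 finally show ?thesis by (simp add: w_def N)
qed

end

section \<open>The Riemannian distance as a metric\<close>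

context riemannian begin

context
 fixes S sg T \<nu> and a b t :: real
 assumes reg: "regular_off S sg" and T: "open T" "t \<in> T"
  and eq: "\<And>s. s \<in> T ==> a + b * s \<in> {0<..<1} - S & \<nu> s = sg (a + b * s)"
begin

lemma reparametrised_derivative:
 assumes c: "c \<in> \<A>" "\<nu> t \<in> fst c"
 shows "((snd c \<circ> \<nu>) has_vector_derivative b *\<^sub>R vector_derivative (snd c \<circ> sg) (at (a + b * t))) (at t)"
proof -
 let ?V = "vector_derivative (snd c \<circ> sg) (at (a + b * t))"
 have d: "((snd c \<circ> sg) has_derivative (%h. h *\<^sub>R ?V)) (at (a + b * t))"
  using vel_derivative[OF reg c(1), of "a + b * t"] eq[OF T(2)] c(2) by (simp add: has_vector_derivative_def)
 have "((%s. a + b * s) has_derivative (%h. b * h)) (at t)" by (auto intro!: derivative_eq_intros)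
 from diff_chain_at[OF this d]
 have "((snd c \<circ> sg \<circ> (%s. a + b * s)) has_derivative (%h. h *\<^sub>R (b *\<^sub>R ?V))) (at t)"
  by (simp add: o_def mult.commute)
 from has_derivative_transform_within_open[OF this T, of "snd c \<circ> \<nu>"] eq
 show ?thesis by (simp add: has_vector_derivative_def)
qed

lemma reparametrised_speed: "speed \<A> g \<nu> t = \<bar>b\<bar> * speed \<A> g sg (a + b * t)"
proof -
 let ?p = "a + b * t"
 have p: "\<nu> t = sg ?p" "?p \<in> {0<..<1} - S" using eq[OF T(2)] by auto
 define c where "c = (SOME c. c \<in> \<A> & sg ?p \<in> fst c)"
 have c: "c \<in> \<A>" "sg ?p \<in> fst c" unfolding c_def using someI_ex[of "%c. c \<in> \<A> & sg ?p \<in> fst c"] chart_at[of "sg ?p"] by blast+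
 interpret F: inner_form "g c (sg ?p)" by (rule metric_form[OF c])
 have "vector_derivative (snd c \<circ> \<nu>) (at t) = b *\<^sub>R vector_derivative (snd c \<circ> sg) (at ?p)"
  by (rule vector_derivative_at[OF reparametrised_derivative[OF c(1)]]) (use c(2) p in simp)
 then show ?thesis unfolding speed_def Let_def p(1) c_def[symmetric]
  using F.N_scale[of b "vector_derivative (snd c \<circ> sg) (at ?p)"] by (simp add: F.N_def)
qed

end

text \<open>Regularity is local in time: away from finitely many instants the curve is an affine reparametrisation of known regular curves.\<close>

lemma regular_from_pieces:
 assumes fin: "finite S'" and cont: "continuous_on {0..1} \<nu>"
  and pieces: "\<And>t. t \<in> {0<..<1} - S' ==> \<exists>T a b sg S. open T & t \<in> T & regular_off S sg &
   (\<forall>s\<in>T. a + b * s \<in> {0<..<1} - S & \<nu> s = sg (a + b * s))"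
 shows "regular_off S' \<nu>"
 unfolding regular_off_def
proof (intro conjI fin cont ballI)
 fix c assume c: "c \<in> \<A>"
 define X where "X = {t \<in> {0<..<1} - S'. \<nu> t \<in> fst c}"
 have o: "open ({0<..<1} - S')" using fin by (intro open_Diff finite_imp_closed) auto
 have "continuous_on ({0<..<1} - S') \<nu>" by (rule continuous_on_subset[OF cont]) auto
 from continuous_open_preimage[OF this o chart_open(1)[OF c]]
 have X: "open X" by (simp add: X_def Int_def vimage_def)
 have loc: "\<exists>T. open T & t \<in> T & (\<forall>s\<in>T \<inter> X. (snd c \<circ> \<nu>) differentiable at s) &
   continuous_on (T \<inter> X) (%s. vector_derivative (snd c \<circ> \<nu>) (at s))" if t: "t \<in> X" for t
 proof -
  obtain T a b sg S where T: "open T" "t \<in> T" and reg: "regular_off S sg"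
   and eq: "\<And>s. s \<in> T ==> a + b * s \<in> {0<..<1} - S & \<nu> s = sg (a + b * s)"
   using pieces[of t] t by (auto simp: X_def) metis
  have d: "((snd c \<circ> \<nu>) has_vector_derivative b *\<^sub>R vector_derivative (snd c \<circ> sg) (at (a + b * s))) (at s)"
   if "s \<in> T \<inter> X" for s
   by (rule reparametrised_derivative[OF reg T(1) _ eq c]) (use that in \<open>auto simp: X_def\<close>)
  have "continuous_on (T \<inter> X) (%s. b *\<^sub>R vector_derivative (snd c \<circ> sg) (at (a + b * s)))"
   by (intro continuous_intros continuous_on_compose2[OF vel_continuous[OF reg c]])
    (use eq in \<open>force simp: X_def\<close>)
  then have "continuous_on (T \<inter> X) (%s. vector_derivative (snd c \<circ> \<nu>) (at s))"
   by (rule continuous_on_eq) (simp add: vector_derivative_at[OF d])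
  then show ?thesis using T d unfolding differentiable_def has_vector_derivative_def by blast
 qed
 then obtain T where T: "\<And>t. t \<in> X ==> open (T t) & t \<in> T t & (\<forall>s\<in>T t \<inter> X. (snd c \<circ> \<nu>) differentiable at s) &
   continuous_on (T t \<inter> X) (%s. vector_derivative (snd c \<circ> \<nu>) (at s))" by metis
 have "continuous_on (\<Union>t\<in>X. T t \<inter> X) (%s. vector_derivative (snd c \<circ> \<nu>) (at s))"
  by (rule continuous_on_open_UN) (use T X in auto)
 moreover have "(\<Union>t\<in>X. T t \<inter> X) = X" using T by auto
 ultimately show "(snd c \<circ> \<nu>) C1_differentiable_on {t \<in> {0<..<1} - S'. \<nu> t \<in> fst c}"
  unfolding C1_differentiable_on_eq X_def[symmetric] using T by auto
qed

lemma affine_length: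
 fixes a b :: real
 assumes reg: "regular_off S sg" and b: "b ~= 0"
 defines "F \<equiv> %t. ennreal (\<bar>b\<bar> * speed \<A> g sg (a + b * t)) * indicator ({0<..<1} - S) (a + b * t)"
 shows "F \<in> borel_measurable borel" "curve_length \<A> g sg = (\<integral>\<^sup>+ t. F t \<partial>lborel)"
proof -
 let ?H = "%t. ennreal (speed \<A> g sg t) * indicator ({0<..<1} - S) t"
 have fin: "finite S" using reg by (simp add: regular_off_def)
 have o: "open ({0<..<1} - S)" using fin by (intro open_Diff finite_imp_closed) auto
 have H [measurable]: "?H \<in> borel_measurable borel" by (rule regular_speed_measurable[OF reg o]) simp
 have F: "F = (%t. ennreal \<bar>b\<bar> * ?H (a + b * t))" by (auto simp: F_def fun_eq_iff ennreal_mult' indicator_def)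
 show "F \<in> borel_measurable borel" unfolding F by measurable
 show "curve_length \<A> g sg = (\<integral>\<^sup>+ t. F t \<partial>lborel)"
  unfolding regular_length[OF reg fin order_refl] F by (subst nn_integral_real_affine[OF H b, of a]) (simp add: nn_integral_cmult)
qed

lemma rdist_le: "regular_off S sg ==> rdist \<A> g (sg 0) (sg 1) <= curve_length \<A> g sg"
 unfolding rdist_def by (rule INF_lower) (auto simp: piecewise_regular)

lemma rdist_curve: "rdist \<A> g x y < l ==> \<exists>S sg. regular_off S sg & sg 0 = x & sg 1 = y & curve_length \<A> g sg < l"
 unfolding rdist_def INF_less_iff by (auto simp: piecewise_regular)

lemma rdist_refl: "rdist \<A> g x x = 0"
proof -
 obtain c where c: "c \<in> \<A>" "x \<in> fst c" using chart_at by blast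
 have seg: "snd c x + t *\<^sub>R 0 \<in> snd c ` fst c" for t using c by simp
 note reg = segment_regular(1)[OF c(1) seg] and der = segment_regular(2)[OF c(1) seg]
 let ?sg = "%t::real. chart_inv c (snd c x + t *\<^sub>R 0)"
 have sg: "?sg t = x" for t using chart_inv_left[OF c] by simp
 interpret F: inner_form "g c x" by (rule metric_form[OF c])
 have "speed \<A> g ?sg t = 0" if "t \<in> {0<..<1}" for t
  using speed_chart[OF reg c(1), of t] der[OF that] that sg[of t] c(2) by (simp add: chart_norm_def F.B_simps)
 then have "curve_length \<A> g ?sg = 0"
  unfolding curve_length_def by (intro nn_integral_zero') (auto simp: indicator_def)
 then show ?thesis using rdist_le[OF reg] unfolding sg by simp
qed

lemma rdist_sym_le: "rdist \<A> g y x <= rdist \<A> g x y"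
 unfolding rdist_def[of \<A> g x y]
proof (rule INF_greatest)
 fix sg assume "sg \<in> {sg. piecewise_C1_curve \<A> sg & sg 0 = x & sg 1 = y}"
 then obtain S where reg: "regular_off S sg" and e: "sg 0 = x" "sg 1 = y" by (auto simp: piecewise_regular)
 let ?\<nu> = "%t. sg (1 + (-1) * t)" and ?S' = "(%s. 1 - s) ` S"
 have fin: "finite S" and cont: "continuous_on {0..1} sg" using reg by (auto simp: regular_off_def)
 have "continuous_on {0..1} ?\<nu>" by (rule continuous_on_compose2[OF cont]) (auto intro!: continuous_intros)
 have o: "open ({0<..<1} - ?S')" using fin by (intro open_Diff finite_imp_closed) auto
 have eq: "1 + (-1) * s \<in> {0<..<1} - S & ?\<nu> s = sg (1 + (-1) * s)" if "s \<in> {0<..<1} - ?S'" for s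
  using that by (auto simp: image_iff)
 have reg': "regular_off ?S' ?\<nu>"
  by (rule regular_from_pieces[OF finite_imageI[OF fin] \<open>continuous_on {0..1} ?\<nu>\<close>]) (use o reg eq in blast)
 have "rdist \<A> g y x <= curve_length \<A> g ?\<nu>" using rdist_le[OF reg'] e by simp
 also have "... = (\<integral>\<^sup>+ t. ennreal (speed \<A> g ?\<nu> t) * indicator ({0<..<1} - ?S') t \<partial>lborel)"
  by (rule regular_length[OF reg']) (use fin in auto)
 also have "... <= (\<integral>\<^sup>+ t. ennreal (\<bar>-1\<bar> * speed \<A> g sg (1 + (-1) * t)) * indicator ({0<..<1} - S) (1 + (-1) * t) \<partial>lborel)"
 proof (rule nn_integral_mono)
  fix t show "ennreal (speed \<A> g ?\<nu> t) * indicator ({0<..<1} - ?S') t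
   <= ennreal (\<bar>-1\<bar> * speed \<A> g sg (1 + (-1) * t)) * indicator ({0<..<1} - S) (1 + (-1) * t)"
  proof (cases "t \<in> {0<..<1} - ?S'")
   case True
   show ?thesis using reparametrised_speed[OF reg o True eq] eq[OF True] by (simp add: indicator_def)
  qed simp
 qed
 also have "... = curve_length \<A> g sg" by (rule affine_length(2)[OF reg, symmetric]) simp
 finally show "rdist \<A> g y x <= curve_length \<A> g sg" .
qed

lemma rdist_sym: "rdist \<A> g x y = rdist \<A> g y x"
 by (intro antisym rdist_sym_le)

lemma rdist_triangle: "rdist \<A> g x z <= rdist \<A> g x y + rdist \<A> g y z"
proof -
 have concat: "rdist \<A> g x z <= curve_length \<A> g sg1 + curve_length \<A> g sg2"
  if reg1: "regular_off S1 sg1" and e1: "sg1 0 = x" "sg1 1 = y"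
   and reg2: "regular_off S2 sg2" and e2: "sg2 0 = y" "sg2 1 = z" for S1 sg1 S2 sg2
 proof -
  define \<nu> where "\<nu> t = (if t <= 1/2 then sg1 (0 + 2 * t) else sg2 (-1 + 2 * t))" for t :: real
  define S' where "S' = insert (1/2) ((%s. s / 2) ` S1 \<union> (%s. (1 + s) / 2) ` S2)"
  have fin: "finite S1" "finite S2" and cont: "continuous_on {0..1} sg1" "continuous_on {0..1} sg2"
   using reg1 reg2 by (auto simp: regular_off_def)
  have fS': "finite S'" using fin by (simp add: S'_def)
  have "continuous_on ({0..1/2} \<union> {1/2..1}) \<nu>" unfolding \<nu>_def
  proof (rule continuous_on_cases)
   show "continuous_on {0..1/2} (%t. sg1 (0 + 2 * t))" "continuous_on {1/2..1} (%t. sg2 (-1 + 2 * t))"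
    by (rule continuous_on_compose2[OF cont(1)] continuous_on_compose2[OF cont(2)], auto intro!: continuous_intros)+
   show "\<forall>t. t \<in> {0..1/2} & \<not> t <= 1/2 \<or> t \<in> {1/2..1} & t <= 1/2 --> sg1 (0 + 2 * t) = sg2 (-1 + 2 * t)"
   proof (intro allI impI)
    fix t :: real assume "t \<in> {0..1/2} & \<not> t <= 1/2 \<or> t \<in> {1/2..1} & t <= 1/2"
    then have "0 + 2 * t = 1" "-1 + 2 * t = 0" by auto
    then show "sg1 (0 + 2 * t) = sg2 (-1 + 2 * t)" by (simp only: e1 e2)
   qed
  qed auto
  moreover have "{0..1/2} \<union> {1/2..1} = {0..1::real}" by auto
  ultimately have c\<nu>: "continuous_on {0..1} \<nu>" by simp
  let ?T1 = "{0<..<1/2} - (%s. s / 2) ` S1" and ?T2 = "{1/2<..<1} - (%s. (1 + s) / 2) ` S2"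
  have o: "open ?T1" "open ?T2" using fin by (intro open_Diff finite_imp_closed; simp)+
  have eq1: "0 + 2 * s \<in> {0<..<1} - S1 & \<nu> s = sg1 (0 + 2 * s)" if "s \<in> ?T1" for s
  proof -
   have "0 + 2 * s \<notin> S1"
   proof
    assume "0 + 2 * s \<in> S1"
    then have "(0 + 2 * s) / 2 \<in> (%s. s / 2) ` S1" by (rule imageI)
    then show False using that by simp
   qed
   then show ?thesis using that by (simp add: \<nu>_def)
  qed
  have eq2: "-1 + 2 * s \<in> {0<..<1} - S2 & \<nu> s = sg2 (-1 + 2 * s)" if "s \<in> ?T2" for s
  proof -
   have "-1 + 2 * s \<notin> S2"
   proof
    assume "-1 + 2 * s \<in> S2"
    then have "(1 + (-1 + 2 * s)) / 2 \<in> (%s. (1 + s) / 2) ` S2" by (rule imageI)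
    then show False using that by simp
   qed
   then show ?thesis using that by (simp add: \<nu>_def)
  qed
  have cover: "t \<in> ?T1 \<or> t \<in> ?T2" if "t \<in> {0<..<1} - S'" for t
   using that by (cases "t < 1/2") (auto simp: S'_def)
  have reg: "regular_off S' \<nu>"
  proof (rule regular_from_pieces[OF fS' c\<nu>])
   fix t assume "t \<in> {0<..<1} - S'"
   from cover[OF this] show "\<exists>T a b sg S. open T & t \<in> T & regular_off S sg &
    (\<forall>s\<in>T. a + b * s \<in> {0<..<1} - S & \<nu> s = sg (a + b * s))"
   proof
    assume "t \<in> ?T1" then show ?thesis using o(1) reg1 eq1 by blast
   next
    assume "t \<in> ?T2" then show ?thesis using o(2) reg2 eq2 by blast
   qed
  qed
  let ?F1 = "%t. ennreal (\<bar>2\<bar> * speed \<A> g sg1 (0 + 2 * t)) * indicator ({0<..<1} - S1) (0 + 2 * t)"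
  let ?F2 = "%t. ennreal (\<bar>2\<bar> * speed \<A> g sg2 (-1 + 2 * t)) * indicator ({0<..<1} - S2) (-1 + 2 * t)"
  have two: "(2::real) ~= 0" by simp
  have "rdist \<A> g x z <= curve_length \<A> g \<nu>" using rdist_le[OF reg] e1 e2 by (simp add: \<nu>_def)
  also have "... = (\<integral>\<^sup>+ t. ennreal (speed \<A> g \<nu> t) * indicator ({0<..<1} - S') t \<partial>lborel)"
   by (rule regular_length[OF reg fS' order_refl])
  also have "... <= (\<integral>\<^sup>+ t. ?F1 t + ?F2 t \<partial>lborel)"
  proof (rule nn_integral_mono)
   fix t
   show "ennreal (speed \<A> g \<nu> t) * indicator ({0<..<1} - S') t <= ?F1 t + ?F2 t"
   proof (cases "t \<in> {0<..<1} - S'")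
    case True
    from cover[OF True] show ?thesis
    proof
     assume t: "t \<in> ?T1"
     show ?thesis using reparametrised_speed[OF reg1 o(1) t eq1] eq1[OF t] by (simp add: indicator_def)
    next
     assume t: "t \<in> ?T2"
     show ?thesis using reparametrised_speed[OF reg2 o(2) t eq2] eq2[OF t] by (simp add: indicator_def)
    qed
   qed simp
  qed
  also have "... = (\<integral>\<^sup>+ t. ?F1 t \<partial>lborel) + (\<integral>\<^sup>+ t. ?F2 t \<partial>lborel)"
   using affine_length(1)[OF reg1 two, of 0] affine_length(1)[OF reg2 two, of "-1"] by (intro nn_integral_add) simp_all
  also have "... = curve_length \<A> g sg1 + curve_length \<A> g sg2"
   by (simp only: affine_length(2)[OF reg1 two, of 0] affine_length(2)[OF reg2 two, of "-1"])
  finally show ?thesis .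
 qed
 show ?thesis
 proof (cases "rdist \<A> g x y = \<infinity> \<or> rdist \<A> g y z = \<infinity>")
  case False
  show ?thesis
  proof (rule ennreal_le_epsilon)
   fix e :: real assume e: "0 < e"
   have less: "u < u + ennreal (e / 2)" if "u ~= \<infinity>" for u :: ennreal
    using that e by (cases u) (auto simp: ennreal_less_iff simp flip: ennreal_plus)
   obtain S1 sg1 where 1: "regular_off S1 sg1" "sg1 0 = x" "sg1 1 = y"
    and l1: "curve_length \<A> g sg1 < rdist \<A> g x y + ennreal (e / 2)"
    using rdist_curve[OF less, of x y] False by blast
   obtain S2 sg2 where 2: "regular_off S2 sg2" "sg2 0 = y" "sg2 1 = z"
    and l2: "curve_length \<A> g sg2 < rdist \<A> g y z + ennreal (e / 2)"
    using rdist_curve[OF less, of y z] False by blast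
   from concat[OF 1 2]
   have "rdist \<A> g x z <= curve_length \<A> g sg1 + curve_length \<A> g sg2" .
   also have "... <= (rdist \<A> g x y + ennreal (e / 2)) + (rdist \<A> g y z + ennreal (e / 2))"
    using l1 l2 by (intro add_mono) auto
   also have "... = rdist \<A> g x y + rdist \<A> g y z + (ennreal (e / 2) + ennreal (e / 2))" by (simp add: ac_simps)
   also have "ennreal (e / 2) + ennreal (e / 2) = ennreal e" using e by (simp flip: ennreal_plus)
   finally show "rdist \<A> g x z <= rdist \<A> g x y + rdist \<A> g y z + ennreal e" .
  qed
 qed auto
qed

text \<open>Truncation makes the distance finite between components; it changes no small ball.\<close>

definition D :: "'a => 'a => real" where
 "D x y = enn2real (min 1 (rdist \<A> g x y))"

lemma ennreal_D: "ennreal (D x y) = min 1 (rdist \<A> g x y)"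
 unfolding D_def by (rule ennreal_enn2real) (simp add: min_less_iff_disj)

lemma D_nonneg: "0 <= D x y" and D_le_1: "D x y <= 1" and D_refl: "D x x = 0" and D_sym: "D x y = D y x"
proof -
 show "0 <= D x y" by (simp add: D_def)
 have "ennreal (D x y) <= ennreal 1" by (simp add: ennreal_D)
 then show "D x y <= 1" by simp
qed (simp_all add: D_def rdist_refl rdist_sym[of x y])

lemma D_triangle: "D x z <= D x y + D y z"
proof -
 have "ennreal (D x z) <= ennreal (D x y + D y z)"
 proof (cases "D x y = 1 \<or> D y z = 1")
  case True
  have "ennreal (D x z) <= ennreal 1" using D_le_1 by (intro ennreal_leI)
  also have "... <= ennreal (D x y + D y z)" using True D_nonneg[of x y] D_nonneg[of y z] by (intro ennreal_leI) auto
  finally show ?thesis .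
 next
  case False
  have small: "rdist \<A> g u v = ennreal (D u v)" if "D u v ~= 1" for u v
  proof -
   have "min 1 (rdist \<A> g u v) ~= 1" using that ennreal_D[of u v] by (metis D_nonneg ennreal_1 ennreal_inj zero_le_one)
   then show ?thesis unfolding ennreal_D by (auto simp: min_def split: if_splits)
  qed
  have "ennreal (D x z) <= rdist \<A> g x z" unfolding ennreal_D by simp
  also have "... <= rdist \<A> g x y + rdist \<A> g y z" by (rule rdist_triangle)
  also have "... = ennreal (D x y + D y z)" using False small[of x y] small[of y z] by (simp add: D_nonneg)
  finally show ?thesis .
 qed
 then show ?thesis by (subst (asm) ennreal_le_iff) (simp_all add: D_nonneg)
qed

lemma D_less_iff: "rho <= 1 ==> D x y < rho \<longleftrightarrow> rdist \<A> g x y < ennreal rho"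
proof -
 assume rho: "rho <= 1"
 have "D x y < rho \<longleftrightarrow> ennreal (D x y) < ennreal rho" by (simp add: ennreal_less_iff D_nonneg)
 also have "... \<longleftrightarrow> rdist \<A> g x y < ennreal rho"
 proof -
  have "\<not> 1 < ennreal rho" using rho by (metis ennreal_1 ennreal_leI not_le)
  then show ?thesis by (simp add: ennreal_D min_less_iff_disj)
 qed
 finally show ?thesis .
qed

lemma D_le_rdist: "ennreal (D x y) <= rdist \<A> g x y"
 by (simp add: ennreal_D)

text \<open>Together with \<open>D_ball_in_open\<close> this says that the Riemannian distance induces the topology of the manifold.\<close>

lemma D_near: "0 < e ==> \<exists>U. open U & p \<in> U & (\<forall>q\<in>U. D p q < e)"
proof -
 assume e: "0 < e"
 obtain c where c: "c \<in> \<A>" "p \<in> fst c" using chart_at by blast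
 obtain R where fb: "frozen_ball c p (1/2) R" using frozen_ball_exists[OF c, of "1/2"] by auto
 then have R: "0 < R" by (simp add: frozen_ball_def)
 interpret F: inner_form "g c p" by (rule metric_form[OF c])
 have N: "chart_norm c p = F.N" by (rule chart_norm_N[OF c])
 define s where "s = min R (e / 2)"
 have s: "0 < s" "s <= R" "s <= e / 2" using R e by (auto simp: s_def)
 define U where "U = {q \<in> fst c. snd c q \<in> {z. F.N (z - snd c p) < s}}"
 have "continuous_on UNIV (%z. F.N (z - snd c p))" by (intro F.continuous_N continuous_intros)
 then have "open {z. F.N (z - snd c p) < s}" by (intro open_Collect_less continuous_intros) auto
 then have "open U" unfolding U_def by (rule chart_inv_image_open[OF c(1)])
 moreover have "p \<in> U" using c s by (simp add: U_def F.N_zero)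
 moreover have "D p q < e" if q: "q \<in> U" for q
 proof -
  have "rdist \<A> g p q <= ennreal ((1 + 1/2) * F.N (snd c q - snd c p))"
   using rdist_upper[OF fb c(2) _ , of q] q s R unfolding N by (simp add: U_def F.N_zero)
  then have "ennreal (D p q) <= ennreal ((1 + 1/2) * F.N (snd c q - snd c p))" using D_le_rdist order_trans by blast
  then have "D p q <= (1 + 1/2) * F.N (snd c q - snd c p)" by (subst (asm) ennreal_le_iff) (simp_all add: F.N_nonneg)
  moreover have "F.N (snd c q - snd c p) < e / 2" using q s by (simp add: U_def)
  moreover have "(1 + 1/2) * F.N (snd c q - snd c p) = F.N (snd c q - snd c p) + F.N (snd c q - snd c p) / 2" by simp
  ultimately show ?thesis using e by linarith
 qed
 ultimately show ?thesis by blast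
qed

lemma D_ball_in_open: "open U ==> p \<in> U ==> \<exists>e>0. \<forall>q. D p q < e --> q \<in> U"
proof -
 assume U: "open U" "p \<in> U"
 obtain c where c: "c \<in> \<A>" "p \<in> fst c" using chart_at by blast
 obtain R where fb: "frozen_ball c p (1/2) R" using frozen_ball_exists[OF c, of "1/2"] by auto
 then have R: "0 < R" by (simp add: frozen_ball_def)
 interpret F: inner_form "g c p" by (rule metric_form[OF c])
 have N: "chart_norm c p = F.N" by (rule chart_norm_N[OF c])
 obtain a where a: "0 < a" "\<And>v. a * norm v <= F.N v" using F.equivalent by blast
 have "open (snd c ` (U \<inter> fst c))" using U chart_open(1)[OF c(1)] by (intro chart_image_open[OF c(1)]) auto
 moreover have "snd c p \<in> snd c ` (U \<inter> fst c)" using U c by blast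
 ultimately obtain r where r: "0 < r" "\<And>z. dist z (snd c p) < r ==> z \<in> snd c ` (U \<inter> fst c)"
  unfolding open_dist by blast
 define e where "e = min 1 (min (R / 4) (a * r / 2))"
 have e: "0 < e" "e <= 1" "e <= R / 4" "e <= a * r / 2" using R a r by (auto simp: e_def)
 have "q \<in> U" if q: "D p q < e" for q
 proof -
  have rq: "rdist \<A> g p q < ennreal e" using q e D_less_iff by blast
  also have "... <= ennreal ((1 - 1/2) * (R / 2))" using e by (intro ennreal_leI) simp
  finally have small: "rdist \<A> g p q < ennreal ((1 - 1/2) * (R / 2))" .
  have x: "chart_norm c p (snd c p - snd c p) < R / 2" using R by (simp add: N F.N_zero)
  note low = rdist_lower[OF fb c(2) x small]
  have "ennreal ((1 - 1/2) * F.N (snd c q - snd c p)) < ennreal e" using low(3) rq unfolding N by (rule le_less_trans)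
  then have "(1 - 1/2) * F.N (snd c q - snd c p) < e" by (subst (asm) ennreal_less_iff) (simp_all add: F.N_nonneg)
  then have "F.N (snd c q - snd c p) < 2 * e" by simp
  then have "a * norm (snd c q - snd c p) < a * r" using a(2)[of "snd c q - snd c p"] e(4) by linarith
  then have "dist (snd c q) (snd c p) < r" using a(1) by (simp add: dist_norm)
  then obtain u where "u \<in> U \<inter> fst c" "snd c q = snd c u" using r(2) by blast
  then show "q \<in> U" using chart_inj[OF c(1) low(1), of u] by auto
 qed
 then show ?thesis using e(1) by blast
qed

lemma D_uniform_imp_continuous:
 fixes h :: "'a => real"
 assumes "\<And>e p. 0 < e ==> \<exists>delta>0. \<forall>q. D p q < delta --> \<bar>h p - h q\<bar> < e"
 shows "continuous_on UNIV h"
proof -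
 have "isCont h p" for p
  unfolding isCont_def
 proof (rule tendstoI)
  fix e :: real assume "0 < e"
  then obtain delta where delta: "0 < delta" "\<And>q. D p q < delta ==> \<bar>h p - h q\<bar> < e" using assms[of e p] by blast
  obtain U where "open U" "p \<in> U" "\<And>q. q \<in> U ==> D p q < delta" using D_near[OF delta(1), of p] by blast
  then show "\<forall>\<^sub>F q in at p. dist (h q) (h p) < e" using delta(2)
   by (auto simp: eventually_at_topological dist_real_def abs_minus_commute)
 qed
 then show ?thesis by (simp add: continuous_on_eq_continuous_at)
qed

lemma D_continuous: "continuous_on UNIV (%z. D (fst z) (snd z))"
proof -
 have "isCont (%z. D (fst z) (snd z)) (p, q)" for p q
  unfolding isCont_def
 proof (rule tendstoI)
  fix e :: real assume "0 < e"
  then have e: "0 < e / 2" by simp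
  obtain U where U: "open U" "p \<in> U" "\<And>x. x \<in> U ==> D p x < e / 2" using D_near[OF e, of p] by blast
  obtain V where V: "open V" "q \<in> V" "\<And>x. x \<in> V ==> D q x < e / 2" using D_near[OF e, of q] by blast
  have "dist (D (fst z) (snd z)) (D p q) < e" if z: "z \<in> U \<times> V" for z
  proof -
   have "D p (fst z) < e / 2" "D q (snd z) < e / 2" using z U V by auto
   then show ?thesis
    using D_triangle[of "fst z" "snd z" p] D_triangle[of p "snd z" q] D_triangle[of p q "fst z"] D_triangle[of "fst z" q "snd z"]
    by (simp add: dist_real_def D_sym[of "fst z" p] D_sym[of "snd z" q])
  qed
  moreover have "open (U \<times> V)" "(p, q) \<in> U \<times> V" using U V by (auto intro: open_Times)
  ultimately show "\<forall>\<^sub>F z in at (p, q). dist (D (fst z) (snd z)) (D (fst (p, q)) (snd (p, q))) < e"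
   unfolding eventually_at_topological by (metis fst_conv snd_conv)
 qed
 then show ?thesis by (simp add: continuous_on_eq_continuous_at split_paired_all)
qed

lemma D_measurable:
 assumes "sets \<mu> = sets borel"
 shows "(%z. D (fst z) (snd z)) \<in> borel_measurable (\<mu> \<Otimes>\<^sub>M \<mu>)"
proof -
 have "sets (\<mu> \<Otimes>\<^sub>M \<mu>) = sets (borel :: ('a \<times> 'a) measure)"
  unfolding borel_prod[symmetric] by (rule sets_pair_measure_cong[OF assms assms])
 then show ?thesis using borel_measurable_continuous_onI[OF D_continuous] by (simp cong: measurable_cong_sets)
qed

end

section \<open>Smooth maps are Lipschitz\<close>

lemma smooth_on_locally_Lipschitz:
 fixes F :: "real ^ 'n => 'b::real_normed_vector"
 assumes F: "smooth_on S F" and K: "cball z r \<subseteq> S"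
 shows "\<exists>B\<ge>0. \<forall>x\<in>cball z r. \<forall>y\<in>cball z r. norm (F x - F y) <= B * norm (x - y)"
proof -
 define K where "K x = (\<Sum>i\<in>UNIV. norm (frechet_derivative F (at x) (axis i 1)))" for x :: "real ^ 'n"
 have "continuous_on (cball z r) K" unfolding K_def
  by (intro continuous_on_sum continuous_on_norm continuous_on_subset[OF smooth_on_deriv_continuous[OF F] K])
 then have "compact (K ` cball z r)" by (rule compact_continuous_image) (rule compact_cball)
 then have "bounded (K ` cball z r)" by (rule compact_imp_bounded)
 then obtain B where "\<forall>x\<in>K ` cball z r. norm x <= B" unfolding bounded_iff by blast
 then have B: "norm (K x) <= B" if "x \<in> cball z r" for x using that by blast
 have on: "onorm (frechet_derivative F (at x)) <= max 0 B" if x: "x \<in> cball z r" for x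
 proof (rule onorm_le)
  fix v :: "real ^ 'n"
  interpret bounded_linear "frechet_derivative F (at x)"
   using smooth_onD[OF F subsetD[OF K x]] by (rule has_derivative_bounded_linear)
  have "v = (\<Sum>i\<in>UNIV. v $ i *\<^sub>R axis i 1)" using basis_expansion[of v] by (simp add: scalar_mult_eq_scaleR)
  then have "frechet_derivative F (at x) v = frechet_derivative F (at x) (\<Sum>i\<in>UNIV. v $ i *\<^sub>R axis i 1)"
   by (rule arg_cong)
  also have "... = (\<Sum>i\<in>UNIV. v $ i *\<^sub>R frechet_derivative F (at x) (axis i 1))" by (simp only: sum scaleR)
  finally have "norm (frechet_derivative F (at x) v) <= (\<Sum>i\<in>UNIV. norm (v $ i *\<^sub>R frechet_derivative F (at x) (axis i 1)))"
   by (simp only: norm_sum)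
  also have "... <= (\<Sum>i\<in>UNIV. norm v * norm (frechet_derivative F (at x) (axis i 1)))"
   unfolding norm_scaleR by (intro sum_mono mult_right_mono) (simp_all add: component_le_norm_cart)
  also have "... = K x * norm v" by (simp add: K_def sum_distrib_left mult.commute)
  also have "... <= max 0 B * norm v" using B[OF x] by (intro mult_right_mono) auto
  finally show "norm (frechet_derivative F (at x) v) <= max 0 B * norm v" .
 qed
 have "norm (F x - F y) <= max 0 B * norm (x - y)" if "x \<in> cball z r" "y \<in> cball z r" for x y
  by (rule differentiable_bound[OF convex_cball _ on that])
   (rule has_derivative_at_withinI[OF smooth_onD[OF F subsetD[OF K]]])
 then show ?thesis by (intro exI[of _ "max 0 B"]) auto
qed

context riemannian begin

lemma small_D_eq_rdist: "D x y < 1 ==> rdist \<A> g x y = ennreal (D x y)"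
proof -
 assume "D x y < 1"
 then have "min 1 (rdist \<A> g x y) < 1" unfolding ennreal_D[symmetric] by (metis D_nonneg ennreal_1 ennreal_less_iff)
 then show ?thesis unfolding ennreal_D by (simp add: min_def split: if_splits)
qed

text \<open>In charts the map is continuously differentiable, hence Lipschitz on a small closed ball, and there both distances are equivalent to coordinate norms.\<close>

lemma Lipschitz_near:
 assumes f: "smooth_map \<A> f"
 shows "\<exists>U e L. open U & p \<in> U & 0 < e & 0 <= L & (\<forall>x\<in>U. \<forall>y. D x y < e --> D (f x) (f y) <= L * D x y)"
proof -
 obtain c where c: "c \<in> \<A>" "p \<in> fst c" using chart_at by blast
 obtain c' where c': "c' \<in> \<A>" "f p \<in> fst c'" using chart_at by blast
 obtain R where fb: "frozen_ball c p (1/2) R" using frozen_ball_exists[OF c, of "1/2"] by auto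
 obtain R' where fb': "frozen_ball c' (f p) (1/2) R'" using frozen_ball_exists[OF c', of "1/2"] by auto
 note R = frozen_ballD(5)[OF fb] and R' = frozen_ballD(5)[OF fb']
 interpret F: inner_form "g c p" by (rule metric_form[OF c])
 interpret F': inner_form "g c' (f p)" by (rule metric_form[OF c'])
 have N: "chart_norm c p = F.N" by (rule chart_norm_N[OF c])
 have N': "chart_norm c' (f p) = F'.N" by (rule chart_norm_N[OF c'])
 obtain a where a: "0 < a" "\<And>v. a * norm v <= F.N v" using F.equivalent by blast
 obtain b where b: "0 < b" "\<And>v. F'.N v <= b * norm v" using F'.equivalent by blast
 define W where "W = snd c ` (fst c \<inter> f -` fst c')"
 define \<Psi> where "\<Psi> = snd c' \<circ> f \<circ> chart_inv c"
 have sm: "smooth_on W \<Psi>" using f c(1) c'(1) unfolding smooth_map_def W_def \<Psi>_def by blast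
 have fc: "continuous_on UNIV f" using f by (simp add: smooth_map_def)
 have "open (fst c \<inter> f -` fst c')"
  using continuous_open_preimage[OF fc open_UNIV chart_open(1)[OF c'(1)]] chart_open(1)[OF c(1)] by (intro open_Int) simp_all
 then have W: "open W" unfolding W_def by (intro chart_image_open[OF c(1)]) auto
 define z0 where "z0 = snd c p"
 have z0: "z0 \<in> W" using c c' by (auto simp: W_def z0_def)
 have \<Psi>0: "\<Psi> z0 = snd c' (f p)" by (simp add: \<Psi>_def z0_def chart_inv_left[OF c])
 have "continuous_on W (%z. F'.N (\<Psi> z - snd c' (f p)))"
  by (intro F'.continuous_N continuous_intros smooth_on_continuous[OF sm])
 from continuous_open_preimage[OF this W open_lessThan[of R']]
 have "open (W \<inter> (%z. F'.N (\<Psi> z - snd c' (f p))) -` {..<R'})" .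
 moreover have "z0 \<in> W \<inter> (%z. F'.N (\<Psi> z - snd c' (f p))) -` {..<R'}" using z0 R' by (simp add: \<Psi>0 F'.N_zero)
 ultimately obtain r where r: "0 < r" "cball z0 r \<subseteq> W \<inter> (%z. F'.N (\<Psi> z - snd c' (f p))) -` {..<R'}"
  unfolding open_contains_cball by blast
 have rW: "cball z0 r \<subseteq> W" and rR: "\<And>z. z \<in> cball z0 r ==> F'.N (\<Psi> z - snd c' (f p)) < R'" using r(2) by auto
 from smooth_on_locally_Lipschitz[OF sm rW] obtain B where B0: "0 <= B"
  and B1: "\<forall>x\<in>cball z0 r. \<forall>y\<in>cball z0 r. norm (\<Psi> x - \<Psi> y) <= B * norm (x - y)" by (elim exE conjE) (rule that)
 note B = B0 B1[rule_format]
 define s where "s = min (R / 2) (a * r / 2)"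
 define e where "e = min 1 (min (R / 4) (a * r / 4))"
 define L where "L = 3 * b * B / a"
 have s: "0 < s" "s <= R / 2" "s <= a * r / 2" using R a r by (auto simp: s_def)
 have e: "0 < e" "e <= 1" "e <= R / 4" "e <= a * r / 4" using R a r by (auto simp: e_def)
 define U where "U = {q \<in> fst c. snd c q \<in> {z. F.N (z - snd c p) < s}}"
 have "continuous_on UNIV (%z. F.N (z - snd c p))" by (intro F.continuous_N continuous_intros)
 then have "open {z. F.N (z - snd c p) < s}" by (intro open_Collect_less continuous_intros) auto
 then have U: "open U" unfolding U_def by (rule chart_inv_image_open[OF c(1)])
 have image: "f q \<in> fst c' & \<Psi> (snd c q) = snd c' (f q)" if q: "q \<in> fst c" "snd c q \<in> cball z0 r" for q
 proof -
  have "snd c q \<in> W" using rW q(2) by (rule subsetD)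
  then have "\<exists>u. u \<in> fst c & f u \<in> fst c' & snd c q = snd c u"
   unfolding W_def image_iff Bex_def Int_iff vimage_eq by (elim exE conjE) (intro exI conjI)
  then obtain u where u: "u \<in> fst c" "f u \<in> fst c'" "snd c q = snd c u" by (elim exE conjE) (rule that)
  then have "u = q" using chart_inj[OF c(1) u(1) q(1)] by simp
  then show ?thesis using u(2) by (simp add: \<Psi>_def chart_inv_left[OF c(1) q(1)])
 qed
 have main: "D (f x) (f y) <= L * D x y" if x: "x \<in> U" and xy: "D x y < e" for x y
 proof -
  have xc: "x \<in> fst c" "F.N (snd c x - snd c p) < s" using x by (auto simp: U_def)
  have rd: "rdist \<A> g x y = ennreal (D x y)" using xy e(2) by (intro small_D_eq_rdist) simp
  have small: "rdist \<A> g x y < ennreal ((1 - 1/2) * (R / 2))"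
   unfolding rd using xy e(3) D_nonneg[of x y] by (subst ennreal_less_iff) simp_all
  have xR: "chart_norm c p (snd c x - snd c p) < R / 2" using xc s(2) by (simp add: N)
  note low = rdist_lower[OF fb xc(1) xR small]
  have "(1 - 1/2) * F.N (snd c y - snd c x) <= D x y" using low(3) unfolding rd N by (simp add: D_nonneg)
  then have Nxy: "F.N (snd c y - snd c x) <= 2 * D x y" by simp
  have nxy: "norm (snd c y - snd c x) <= 2 * D x y / a"
   using a(2)[of "snd c y - snd c x"] Nxy by (subst pos_le_divide_eq[OF a(1)]) (simp add: mult.commute)
  have "a * norm (snd c x - z0) < a * (r / 2)" using a(2)[of "snd c x - z0"] xc(2) s(3) by (simp add: z0_def)
  then have nx: "norm (snd c x - z0) < r / 2" using a(1) by simp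
  have "2 * D x y / a <= r / 2" using xy e(4) a(1) by (subst pos_divide_le_eq[OF a(1)]) (simp add: mult.commute)
  then have ny: "norm (snd c y - z0) <= r"
   using nx nxy norm_triangle_ineq[of "snd c y - snd c x" "snd c x - z0"] by simp
  have zx: "snd c x \<in> cball z0 r" and zy: "snd c y \<in> cball z0 r"
   using nx ny r(1) by (simp_all add: dist_norm norm_minus_commute)
  note ix = image[OF xc(1) zx] and iy = image[OF low(1) zy]
  have "rdist \<A> g (f x) (f y) <= ennreal ((1 + 1/2) * chart_norm c' (f p) (snd c' (f y) - snd c' (f x)))"
   by (rule rdist_upper[OF fb']) (use ix iy rR[OF zx] rR[OF zy] in \<open>simp_all add: N'\<close>)
  then have "ennreal (D (f x) (f y)) <= ennreal ((1 + 1/2) * F'.N (snd c' (f y) - snd c' (f x)))"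
   unfolding N' by (rule order_trans[OF D_le_rdist])
  then have d1: "D (f x) (f y) <= (1 + 1/2) * F'.N (snd c' (f y) - snd c' (f x))"
   by (subst (asm) ennreal_le_iff) (simp_all add: F'.N_nonneg)
  have d2: "F'.N (snd c' (f y) - snd c' (f x)) <= b * (B * (2 * D x y / a))"
  proof -
   have "norm (snd c' (f y) - snd c' (f x)) <= B * norm (snd c y - snd c x)" using B(2)[OF zy zx] ix iy by simp
   also have "... <= B * (2 * D x y / a)" using nxy B(1) by (rule mult_left_mono)
   finally have "norm (snd c' (f y) - snd c' (f x)) <= B * (2 * D x y / a)" .
   then have "b * norm (snd c' (f y) - snd c' (f x)) <= b * (B * (2 * D x y / a))" using b(1) by (intro mult_left_mono) auto
   then show ?thesis by (rule order_trans[OF b(2)])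
  qed
  have d3: "L * D x y = (3/2) * (b * (B * (2 * D x y / a)))" by (simp add: L_def)
  have combine: "d <= (1 + 1/2) * n ==> n <= X ==> d <= (3/2) * X" for d n X :: real by simp
  show ?thesis unfolding d3 by (rule combine[OF d1 d2])
 qed
 have "p \<in> U" using c s by (simp add: U_def F.N_zero)
 moreover have "0 <= L" using a(1) b(1) B0 by (simp add: L_def)
 ultimately show ?thesis using U e(1) main by (intro exI[of _ U] exI[of _ e] exI[of _ L]) simp
qed

lemma D_ball_open: "open {q. D p q < e}"
proof -
 have "continuous_on UNIV (%q. D (fst (p, q)) (snd (p, q)))"
  by (rule continuous_on_compose2[OF D_continuous]) (auto intro!: continuous_intros)
 then show ?thesis by (intro open_Collect_less continuous_intros) simp
qed

text \<open>A Lebesgue number for the distance \<open>D\<close>.\<close>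

lemma Lebesgue_number:
 assumes M: "compact (UNIV :: 'a set)" and U: "\<And>p. open (U p) & p \<in> U p"
 shows "\<exists>P delta. finite P & 0 < delta & (\<forall>x. \<exists>p\<in>P. \<forall>y. D x y < delta --> y \<in> U p)"
proof -
 have "\<exists>e>0. \<forall>q. D p q < 2 * e --> q \<in> U p" for p
 proof -
  obtain e' where "e' > 0" "\<forall>q. D p q < e' --> q \<in> U p" using D_ball_in_open U by blast
  then show ?thesis by (intro exI[of _ "e' / 2"]) auto
 qed
 then obtain e where e: "\<And>p. 0 < e p" "\<And>p q. D p q < 2 * e p ==> q \<in> U p" by metis
 have cover: "(UNIV :: 'a set) \<subseteq> (\<Union>p\<in>UNIV. {q. D p q < e p})" using e(1) D_refl by auto
 obtain P where P: "finite P" "(UNIV :: 'a set) \<subseteq> (\<Union>p\<in>P. {q. D p q < e p})"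
  using compactE_image[OF M, of UNIV "%p. {q. D p q < e p}", OF D_ball_open cover] by metis
 define delta where "delta = Min (insert 1 (e ` P))"
 have "0 < delta" unfolding delta_def using P(1) e(1) by simp
 moreover have "\<exists>p\<in>P. \<forall>y. D x y < delta --> y \<in> U p" for x
 proof -
  obtain p where p: "p \<in> P" "D p x < e p" using P(2) by blast
  have "delta <= e p" unfolding delta_def using P(1) p(1) by simp
  then have "y \<in> U p" if "D x y < delta" for y using e(2)[of p y] D_triangle[of p y x] p(2) that by linarith
  then show ?thesis using p(1) by blast
 qed
 ultimately show ?thesis using P(1) by blast
qed

text \<open>Finitely many local Lipschitz constants suffice by compactness. Pairs of points at a definite distance are covered by the bound \<open>D \<le> 1\<close>.\<close>

lemma smooth_map_Lipschitz:
 assumes M: "compact (UNIV :: 'a set)" and f: "smooth_map \<A> f"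
 shows "\<exists>\<Lambda>\<ge>1. \<forall>x y. D (f x) (f y) <= \<Lambda> * D x y"
proof -
 obtain U e L where UeL: "\<And>p. open (U p) & p \<in> U p & 0 < e p & 0 <= L p &
  (\<forall>x\<in>U p. \<forall>y. D x y < e p --> D (f x) (f y) <= L p * D x y)"
  using Lipschitz_near[OF f] by metis
 obtain P delta where P: "finite P" "0 < delta" "\<And>x. \<exists>p\<in>P. \<forall>y. D x y < delta --> y \<in> U p"
  using Lebesgue_number[OF M, of U] UeL by metis
 define \<Lambda> where "\<Lambda> = 1 + (\<Sum>p\<in>P. L p + 1 / e p)"
 have nn: "0 <= L p + 1 / e p" for p using UeL[of p] by simp
 have "D (f x) (f y) <= \<Lambda> * D x y" for x y
 proof -
  obtain p where p: "p \<in> P" "\<And>y. D x y < delta ==> y \<in> U p" using P(3)[of x] by blast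
  have xU: "x \<in> U p" using p(2)[of x] P(2) by (simp add: D_refl)
  have "L p + 1 / e p <= (\<Sum>p\<in>P. L p + 1 / e p)" using P(1) p(1) nn by (intro member_le_sum) auto
  moreover have "0 <= L p" "0 <= 1 / e p" using UeL[of p] by simp_all
  ultimately have \<Lambda>: "L p <= \<Lambda>" "1 / e p <= \<Lambda>" unfolding \<Lambda>_def by linarith+
  show ?thesis
  proof (cases "D x y < e p")
   case True
   then have "D (f x) (f y) <= L p * D x y" using UeL[of p] xU by blast
   also have "... <= \<Lambda> * D x y" using \<Lambda>(1) D_nonneg by (rule mult_right_mono)
   finally show ?thesis .
  next
   case False
   have "D (f x) (f y) <= 1" by (rule D_le_1)
   also have "1 <= 1 / e p * D x y" using False UeL[of p] by (simp add: field_simps)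
   also have "... <= \<Lambda> * D x y" using \<Lambda>(2) D_nonneg by (rule mult_right_mono)
   finally show ?thesis .
  qed
 qed
 moreover have "1 <= \<Lambda>" unfolding \<Lambda>_def using nn by (simp add: sum_nonneg)
 ultimately show ?thesis by blast
qed

end

section \<open>Volumes of small balls\<close>

lemma inner_form_det_nonzero:
 fixes B :: "real ^ 'n => real ^ 'n => real"
 assumes "inner_form B"
 shows "det (\<chi> i j. B (axis i 1) (axis j 1)) ~= 0"
proof
 interpret inner_form B by fact
 let ?M = "(\<chi> i j. B (axis i 1) (axis j 1)) :: real ^ 'n ^ 'n"
 assume "det ?M = 0"
 then have "\<not> (\<forall>x. ?M *v x = 0 --> x = 0)"
  using invertible_det_nz[of ?M] invertible_left_inverse[of ?M] matrix_left_invertible_ker[of ?M] by blast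
 then obtain v where v: "?M *v v = 0" "v ~= 0" by blast
 have "B v v = (\<Sum>i\<in>UNIV. v $ i * (?M *v v) $ i)"
  unfolding bilinear_expand[OF bilin, of v v] by (simp add: matrix_vector_mult_def sum_distrib_left mult_ac)
 then show False using v pos[OF v(2)] by simp
qed

text \<open>The determinant does not vanish along the segment of inner products from the Euclidean one, where it is one.\<close>

lemma inner_form_det_pos:
 fixes B :: "real ^ 'n => real ^ 'n => real"
 assumes B: "inner_form B"
 shows "0 < det (\<chi> i j. B (axis i 1) (axis j 1))"
proof (rule ccontr)
 interpret inner_form B by fact
 define C where "C t v w = (1 - t) * (v \<bullet> w) + t * B v w" for t v w
 define \<phi> where "\<phi> t = det (\<chi> i j. C t (axis i 1) (axis j 1) :: real ^ 'n ^ 'n)" for t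
 have C: "inner_form (C t)" if t: "0 <= t" "t <= 1" for t
 proof
  show "bilinear (C t)" unfolding bilinear_def linear_iff C_def
   by (simp add: B_simps inner_add_left inner_add_right algebra_simps)
  show "C t v w = C t w v" for v w by (simp add: C_def sym[of v w] inner_commute)
  show "0 < C t v v" if "v ~= 0" for v
  proof (cases "t = 0")
   case False
   then show ?thesis using t pos[OF that] by (auto simp: C_def intro!: add_nonneg_pos)
  qed (simp add: C_def that)
 qed
 assume "\<not> 0 < det (\<chi> i j. B (axis i 1) (axis j 1))"
 then have "\<phi> 1 <= 0" by (simp add: \<phi>_def C_def not_less)
 moreover have "0 <= \<phi> 0"
 proof -
  have "(\<chi> i j. C 0 (axis i 1) (axis j 1)) = (mat 1 :: real ^ 'n ^ 'n)"
   by (simp add: C_def mat_def inner_axis_axis vec_eq_iff)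
  then show ?thesis by (simp add: \<phi>_def)
 qed
 moreover have "continuous_on {0..1} \<phi>"
  unfolding \<phi>_def det_def C_def by (simp, intro continuous_intros)
 ultimately obtain t where "0 <= t" "t <= 1" "\<phi> t = 0" using IVT2'[of \<phi> 1 0 0] by auto
 then show False using inner_form_det_nonzero[OF C] by (simp add: \<phi>_def)
qed

context inner_form begin

definition unit_ball_volume :: real where "unit_ball_volume = measure lborel {v. N v < 1}"

lemma ball_open: "open {z. N (z - a) < t}"
 by (intro open_Collect_less continuous_N continuous_intros)

lemma unit_ball_finite: "emeasure lborel {v. N v < 1} = ennreal unit_ball_volume" "0 < unit_ball_volume"
proof -
 let ?E = "{v. N v < 1}"
 have o: "open ?E" using ball_open[of 0 1] by simp
 obtain a where a: "0 < a" "\<And>v. a * norm v <= N v" using equivalent by blast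
 have "bounded ?E"
 proof (rule boundedI)
  fix v assume "v \<in> ?E"
  then have "a * norm v <= 1" using a(2)[of v] by simp
  then show "norm v <= 1 / a" by (subst pos_le_divide_eq[OF a(1)]) (simp add: mult.commute)
 qed
 then have fin: "emeasure lborel ?E < \<infinity>" by (rule emeasure_bounded_finite)
 then show e: "emeasure lborel ?E = ennreal unit_ball_volume"
  unfolding unit_ball_volume_def by (intro emeasure_eq_ennreal_measure) auto
 have "0 \<in> ?E" by (simp add: N_zero)
 then have "\<not> negligible ?E" using open_not_negligible[OF o] by blast
 moreover have "negligible ?E" if "emeasure lborel ?E = 0"
 proof -
  have "?E \<in> null_sets lborel" using that o by (intro null_setsI) auto
  then have "?E \<in> null_sets lebesgue" by (rule null_sets_completionI)
  then show ?thesis by (simp add: negligible_iff_null_sets)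
 qed
 ultimately have "unit_ball_volume ~= 0" using e by auto
 then show "0 < unit_ball_volume" by (simp add: unit_ball_volume_def less_le)
qed

lemma ball_volume:
 assumes t: "0 < t"
 shows "emeasure lborel {z. N (z - a) < t} = ennreal (unit_ball_volume * t ^ CARD('n))"
proof -
 have eq: "{z. N (z - a) < t} = (%x. t *\<^sub>R x + a) ` {v. N v < 1}"
 proof (intro set_eqI iffI)
  fix z assume "z \<in> {z. N (z - a) < t}"
  then have "N ((1 / t) *\<^sub>R (z - a)) < 1" using t by (simp add: N_scale)
  moreover have "z = t *\<^sub>R ((1 / t) *\<^sub>R (z - a)) + a" using t by simp
  ultimately show "z \<in> (%x. t *\<^sub>R x + a) ` {v. N v < 1}" by blast
 qed (use t in \<open>auto simp: N_scale\<close>)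
 have leb: "emeasure lborel S = emeasure lebesgue S" if "open S" for S :: "(real ^ 'n) set"
  using that by simp
 have "emeasure lborel {z. N (z - a) < t} = emeasure lebesgue ((%x. t *\<^sub>R x + a) ` {v. N v < 1})"
  unfolding eq[symmetric] by (rule leb[OF ball_open])
 also have "... = ennreal (\<bar>t\<bar> ^ DIM(real ^ 'n)) * emeasure lebesgue {v. N v < 1}"
  using emeasure_lebesgue_affine[of t a "{v. N v < 1}"] by simp
 also have "emeasure lebesgue {v. N v < 1} = ennreal unit_ball_volume"
  using leb[OF ball_open[of 0 1]] unit_ball_finite(1) by simp
 also have "ennreal (\<bar>t\<bar> ^ DIM(real ^ 'n)) * ennreal unit_ball_volume = ennreal (unit_ball_volume * t ^ CARD('n))"
  using t unit_ball_finite(2) by (simp add: ennreal_mult mult.commute less_imp_le)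
 finally show ?thesis .
qed

end

locale riemannian_volume = riemannian \<A> g
 for \<A> :: "('a::{t2_space, second_countable_topology}, 'n::finite) chart set" and g :: "('a, 'n) metric" +
 fixes V :: "'a measure" and h :: "'a => real" and \<mu> :: "'a measure"
 assumes vol: "is_riemannian_volume \<A> g V" and h_smooth: "smooth_fun \<A> h" and h_pos: "\<And>x. 0 < h x"
  and \<mu>: "\<mu> = density V (%x. ennreal (h x))" and prob: "prob_space \<mu>" and compact_M: "compact (UNIV :: 'a set)"
begin

sublocale prob_space \<mu> by (rule prob)

lemma sets_V: "sets V = sets borel" and sets_\<mu>: "sets \<mu> = sets borel"
 using vol by (simp_all add: is_riemannian_volume_def \<mu>)

lemma h_cont: "continuous_on UNIV h"
proof -
 have "continuous_on (fst c) h" if c: "c \<in> \<A>" for c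
 proof -
  have "smooth_on (snd c ` fst c) (h \<circ> chart_inv c)" using h_smooth c by (simp add: smooth_fun_def)
  from continuous_on_compose2[OF smooth_on_continuous[OF this] chart_cont(1)[OF c]]
  have "continuous_on (fst c) (%p. (h \<circ> chart_inv c) (snd c p))" by simp
  then show ?thesis by (rule continuous_on_eq) (simp add: chart_inv_left[OF c])
 qed
 then have "continuous_on (\<Union>c\<in>\<A>. fst c) h" by (intro continuous_on_open_UN chart_open(1))
 moreover have "(\<Union>c\<in>\<A>. fst c) = UNIV" using chart_at by blast
 ultimately show ?thesis by simp
qed

definition vol_density :: "('a, 'n) chart => 'a => real" where "vol_density c p = sqrt (gram_det g c p)"

lemma vol_density_pos: "c \<in> \<A> ==> p \<in> fst c ==> 0 < vol_density c p"
 using inner_form_det_pos[OF metric_form, of c p] by (simp add: vol_density_def gram_det_def)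

lemma vol_density_cont: "c \<in> \<A> ==> continuous_on (fst c) (vol_density c)"
 unfolding vol_density_def gram_det_def det_def
 by (simp, intro continuous_on_real_sqrt continuous_on_sum continuous_on_mult continuous_on_const continuous_on_prod metric_entry_continuous)

text \<open>Near \<open>p0\<close> the measure is almost a constant multiple of Lebesgue measure in coordinates. Comparing measures of open sets avoids identifying the restriction of the volume to a chart domain as an image measure.\<close>

lemma measure_near:
 assumes c: "c \<in> \<A>" "p0 \<in> fst c" and eps: "0 < eps" "eps < 1"
 defines "k0 \<equiv> h p0 * vol_density c p0"
 shows "\<exists>U. open U & p0 \<in> U & U \<subseteq> fst c & (\<forall>B. open B & B \<subseteq> U -->
  ennreal ((1 - eps)\<^sup>2 * k0) * emeasure lborel (snd c ` B) <= emeasure \<mu> B &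
  emeasure \<mu> B <= ennreal ((1 + eps)\<^sup>2 * k0) * emeasure lborel (snd c ` B))"
proof -
 let ?s = "vol_density c"
 have pos: "0 < ?s p0" "0 < h p0" using vol_density_pos[OF c] h_pos by auto
 let ?I = "%t. {(1 - eps) * t <..< (1 + eps) * t}"
 define U where "U = (fst c \<inter> ?s -` ?I (?s p0)) \<inter> (fst c \<inter> h -` ?I (h p0))"
 have oU: "open U" unfolding U_def
  by (rule open_Int[OF continuous_open_preimage[OF vol_density_cont[OF c(1)] chart_open(1)[OF c(1)] open_greaterThanLessThan]
   continuous_open_preimage[OF continuous_on_subset[OF h_cont subset_UNIV] chart_open(1)[OF c(1)] open_greaterThanLessThan]])
 have pU: "p0 \<in> U" using c pos eps by (simp add: U_def algebra_simps)
 have Uc: "U \<subseteq> fst c" by (auto simp: U_def)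
 have bd: "ennreal ((1 - eps)\<^sup>2 * k0) * emeasure lborel (snd c ` B) <= emeasure \<mu> B &
  emeasure \<mu> B <= ennreal ((1 + eps)\<^sup>2 * k0) * emeasure lborel (snd c ` B)" if B: "open B" "B \<subseteq> U" for B
 proof -
  have BV: "B \<in> sets V" and Bb: "B \<in> sets borel" using B(1) by (simp_all add: sets_V)
  have Bc: "B \<subseteq> fst c" using B(2) by (auto simp: U_def)
  have iB: "snd c ` B \<in> sets lborel" using chart_image_open[OF c(1) B(1) Bc] by simp
  have VB: "emeasure V B = (\<integral>\<^sup>+ z. ennreal (?s (chart_inv c z)) * indicator (snd c ` B) z \<partial>lborel)"
   using vol c(1) Bb Bc by (simp add: is_riemannian_volume_def vol_density_def)
  have sB: "(1 - eps) * ?s p0 <= ?s (chart_inv c z) & ?s (chart_inv c z) <= (1 + eps) * ?s p0" if zB: "z \<in> snd c ` B" for z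
  proof -
   from zB obtain q where q: "z = snd c q" "q \<in> B" by (rule imageE)
   then have "chart_inv c z = q" using chart_inv_left[OF c(1) subsetD[OF Bc q(2)]] by simp
   moreover have "q \<in> U" using B(2) q(2) by (rule subsetD)
   ultimately show ?thesis by (simp add: U_def less_imp_le)
  qed
  have hB: "(1 - eps) * h p0 <= h q & h q <= (1 + eps) * h p0" if "q \<in> B" for q
   using that B(2) by (auto simp: U_def intro: less_imp_le)
  have V1: "ennreal ((1 - eps) * ?s p0) * emeasure lborel (snd c ` B) <= emeasure V B"
   unfolding VB nn_integral_cmult_indicator[OF iB, symmetric]
   by (intro nn_integral_mono) (use sB in \<open>auto simp: indicator_def intro!: ennreal_leI\<close>)
  have V2: "emeasure V B <= ennreal ((1 + eps) * ?s p0) * emeasure lborel (snd c ` B)"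
   unfolding VB nn_integral_cmult_indicator[OF iB, symmetric]
   by (intro nn_integral_mono) (use sB in \<open>auto simp: indicator_def intro!: ennreal_leI\<close>)
  have "h \<in> borel_measurable borel" by (rule borel_measurable_continuous_onI[OF h_cont])
  then have "h \<in> borel_measurable V" using sets_V by (simp cong: measurable_cong_sets)
  then have \<mu>B: "emeasure \<mu> B = (\<integral>\<^sup>+ x. ennreal (h x) * indicator B x \<partial>V)"
   unfolding \<mu> using BV by (intro emeasure_density) auto
  have M1: "ennreal ((1 - eps) * h p0) * emeasure V B <= emeasure \<mu> B"
   unfolding \<mu>B nn_integral_cmult_indicator[OF BV, symmetric]
   by (intro nn_integral_mono) (use hB in \<open>auto simp: indicator_def intro!: ennreal_leI\<close>)
  have M2: "emeasure \<mu> B <= ennreal ((1 + eps) * h p0) * emeasure V B"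
   unfolding \<mu>B nn_integral_cmult_indicator[OF BV, symmetric]
   by (intro nn_integral_mono) (use hB in \<open>auto simp: indicator_def intro!: ennreal_leI\<close>)
  have k1: "ennreal ((1 - eps)\<^sup>2 * k0) = ennreal ((1 - eps) * h p0) * ennreal ((1 - eps) * ?s p0)"
   using pos eps by (simp add: k0_def power2_eq_square mult_ac flip: ennreal_mult)
  have k2: "ennreal ((1 + eps)\<^sup>2 * k0) = ennreal ((1 + eps) * h p0) * ennreal ((1 + eps) * ?s p0)"
   using pos eps by (simp add: k0_def power2_eq_square mult_ac flip: ennreal_mult)
  have L1: "ennreal ((1 - eps)\<^sup>2 * k0) * emeasure lborel (snd c ` B) <= ennreal ((1 - eps) * h p0) * emeasure V B"
   unfolding k1 mult.assoc by (rule mult_left_mono[OF V1]) simp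
  have L2: "ennreal ((1 + eps) * h p0) * emeasure V B <= ennreal ((1 + eps)\<^sup>2 * k0) * emeasure lborel (snd c ` B)"
   unfolding k2 mult.assoc by (rule mult_left_mono[OF V2]) simp
  show ?thesis by (intro conjI order_trans[OF L1 M1] order_trans[OF M2 L2])
 qed
 show ?thesis
 proof (intro exI[of _ U] conjI[OF oU] conjI[OF pU] conjI[OF Uc] allI impI)
  fix B assume "open B & B \<subseteq> U"
  then show "ennreal ((1 - eps)\<^sup>2 * k0) * emeasure lborel (snd c ` B) <= emeasure \<mu> B &
   emeasure \<mu> B <= ennreal ((1 + eps)\<^sup>2 * k0) * emeasure lborel (snd c ` B)" by (elim conjE) (rule bd)
 qed
qed

text \<open>Small balls lie between two coordinate balls of the norm frozen at \<open>p0\<close>, so their measure is asymptotically that of a ball of this norm, locally uniformly in the centre.\<close>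

lemma local_volume:
 "\<exists>\<gamma>0>0. \<forall>eta>0. \<exists>U r0. open U & p0 \<in> U & 0 < r0 & (\<forall>x\<in>U. \<forall>rho. 0 < rho & rho < r0 -->
   \<bar>measure \<mu> {y. D x y < rho} - \<gamma>0 * rho ^ CARD('n)\<bar> <= eta * rho ^ CARD('n))"
proof -
 obtain c where c: "c \<in> \<A>" "p0 \<in> fst c" using chart_at by blast
 interpret F: inner_form "g c p0" by (rule metric_form[OF c])
 have N: "chart_norm c p0 = F.N" by (rule chart_norm_N[OF c])
 define k0 where "k0 = h p0 * vol_density c p0"
 let ?\<omega> = "F.unit_ball_volume" and ?d = "CARD('n)"
 define \<gamma>0 where "\<gamma>0 = k0 * ?\<omega>"
 have k0: "0 < k0" using vol_density_pos[OF c] h_pos by (simp add: k0_def)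
 have \<gamma>0: "0 < \<gamma>0" using k0 F.unit_ball_finite(2) by (simp add: \<gamma>0_def)
 show ?thesis
 proof (intro exI[of _ \<gamma>0] conjI \<gamma>0 allI impI)
  fix eta :: real assume eta: "0 < eta"
  let ?up = "%eps. (1 + eps)\<^sup>2 / (1 - eps) ^ ?d * \<gamma>0" and ?lo = "%eps. (1 - eps)\<^sup>2 / (1 + eps) ^ ?d * \<gamma>0"
  have "(?up \<longlongrightarrow> \<gamma>0) (at_right 0)" "(?lo \<longlongrightarrow> \<gamma>0) (at_right 0)" by (auto intro!: tendsto_eq_intros)
  then have "\<forall>\<^sub>F eps in at_right 0. ?up eps < \<gamma>0 + eta" "\<forall>\<^sub>F eps in at_right 0. \<gamma>0 - eta < ?lo eps"
   using order_tendstoD(2)[of ?up \<gamma>0 "at_right 0" "\<gamma>0 + eta"] order_tendstoD(1)[of ?lo \<gamma>0 "at_right 0" "\<gamma>0 - eta"] eta by simp_all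
  moreover have "\<forall>\<^sub>F eps in at_right (0::real). 0 < eps & eps < 1"
   unfolding eventually_at_right_field by (intro exI[of _ 1]) auto
  ultimately have "\<forall>\<^sub>F eps in at_right 0. ?up eps < \<gamma>0 + eta & \<gamma>0 - eta < ?lo eps & 0 < eps & eps < 1"
   by eventually_elim simp
  then obtain eps where up: "?up eps < \<gamma>0 + eta" and lo: "\<gamma>0 - eta < ?lo eps" and eps: "0 < eps" "eps < 1"
   using eventually_happens'[OF trivial_limit_at_right_real] by blast
  obtain R where fb: "frozen_ball c p0 eps R" using frozen_ball_exists[OF c eps] by blast
  have R: "0 < R" by (rule frozen_ballD(5)[OF fb])
  from measure_near[OF c eps, folded k0_def] obtain U1 where U1: "open U1" "p0 \<in> U1" "U1 \<subseteq> fst c"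
   and "\<forall>B. open B & B \<subseteq> U1 -->
    ennreal ((1 - eps)\<^sup>2 * k0) * emeasure lborel (snd c ` B) <= emeasure \<mu> B &
    emeasure \<mu> B <= ennreal ((1 + eps)\<^sup>2 * k0) * emeasure lborel (snd c ` B)"
   by (elim exE conjE) (rule that)
  note meas = this(4)[rule_format, OF conjI]
  from D_ball_in_open[OF U1(1,2)] obtain e1 where "0 < e1" "\<forall>q. D p0 q < e1 --> q \<in> U1" by (elim exE conjE) (rule that)
  note e1 = this(1) this(2)[rule_format]
  define U where "U = {p \<in> fst c. snd c p \<in> {z. F.N (z - snd c p0) < R / 2}} \<inter> {q. D p0 q < e1 / 2}"
  define r0 where "r0 = min 1 (min (e1 / 2) ((1 - eps) * (R / 2)))"
  have r0: "0 < r0" "r0 <= 1" "r0 <= e1 / 2" "r0 <= (1 - eps) * (R / 2)" using e1 eps R by (auto simp: r0_def)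
  have "open U" unfolding U_def by (intro open_Int chart_inv_image_open[OF c(1)] F.ball_open D_ball_open)
  moreover have "p0 \<in> U" using c R e1 by (simp add: U_def F.N_zero D_refl)
  moreover have "\<bar>measure \<mu> {y. D x y < rho} - \<gamma>0 * rho ^ ?d\<bar> <= eta * rho ^ ?d" if x: "x \<in> U" and rho: "0 < rho" "rho < r0" for x rho
  proof -
   let ?B = "{y. D x y < rho}"
   have xc: "x \<in> fst c" "F.N (snd c x - snd c p0) < R / 2" "D p0 x < e1 / 2" using x by (auto simp: U_def)
   have BU: "?B \<subseteq> U1"
   proof
    fix y assume "y \<in> ?B"
    then show "y \<in> U1" using D_triangle[of p0 y x] xc(3) rho r0(3) by (intro e1(2)) simp
   qed
   have xR: "chart_norm c p0 (snd c x - snd c p0) < R / 2" using xc(2) by (simp add: N)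
   then have xR': "chart_norm c p0 (snd c x - snd c p0) < R" using R by simp
   have upper: "snd c ` ?B \<subseteq> {z. F.N (z - snd c x) < rho / (1 - eps)}"
   proof (rule image_subsetI)
    fix y assume y: "y \<in> ?B"
    then have rd: "rdist \<A> g x y = ennreal (D x y)" using rho r0(2) by (intro small_D_eq_rdist) simp
    have "rdist \<A> g x y < ennreal ((1 - eps) * (R / 2))"
     unfolding rd using y rho r0(4) D_nonneg[of x y] by (subst ennreal_less_iff) simp_all
    note low = rdist_lower[OF fb xc(1) xR this]
    have "(1 - eps) * F.N (snd c y - snd c x) <= D x y" using low(3) unfolding rd N by (simp add: D_nonneg)
    then have "(1 - eps) * F.N (snd c y - snd c x) < rho" using y by simp
    then show "snd c y \<in> {z. F.N (z - snd c x) < rho / (1 - eps)}" using eps(2) by (simp add: pos_less_divide_eq mult.commute)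
   qed
   have lower: "{z. F.N (z - snd c x) < rho / (1 + eps)} \<subseteq> snd c ` ?B"
   proof
    fix z assume "z \<in> {z. F.N (z - snd c x) < rho / (1 + eps)}"
    then have z: "(1 + eps) * F.N (z - snd c x) < rho" using eps(1) by (simp add: pos_less_divide_eq mult.commute)
    have "F.N (z - snd c x) <= (1 + eps) * F.N (z - snd c x)" using eps(1) F.N_nonneg[of "z - snd c x"] by (simp add: algebra_simps)
    also note z
    also have "rho < R / 2"
    proof -
     have "(1 - eps) * (R / 2) <= 1 * (R / 2)" using eps R by (intro mult_right_mono) auto
     then show ?thesis using rho(2) r0(4) by linarith
    qed
    finally have "F.N (z - snd c p0) < R"
     using F.N_triangle[of "z - snd c x" "snd c x - snd c p0"] xc(2) by simp
    then have zR: "chart_norm c p0 (z - snd c p0) < R" by (simp add: N)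
    have zi: "z \<in> snd c ` fst c" by (rule frozen_ballD(6)[OF fb zR])
    note y = chart_inv_in[OF c(1) zi] and ry = chart_inv_right[OF c(1) zi]
    have "rdist \<A> g x (chart_inv c z) <= ennreal ((1 + eps) * chart_norm c p0 (snd c (chart_inv c z) - snd c x))"
     by (rule rdist_upper[OF fb xc(1) xR' y]) (simp add: ry zR)
    also have "... < ennreal rho" using z rho unfolding ry N by (intro ennreal_lessI) auto
    finally have "D x (chart_inv c z) < rho" using rho r0(2) by (subst D_less_iff) auto
    then show "z \<in> snd c ` ?B" using ry by force
   qed
   have oB: "open ?B" by (rule D_ball_open)
   have ib: "snd c ` ?B \<in> sets lborel" using chart_image_open[OF c(1) oB] BU U1(3) by (simp add: subset_trans[OF BU U1(3)])
   have ballm: "{z. F.N (z - snd c x) < t} \<in> sets lborel" for t using F.ball_open by simp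
   have p1: "0 < rho / (1 - eps)" "0 < rho / (1 + eps)" using rho eps by auto
   have "emeasure \<mu> ?B <= ennreal ((1 + eps)\<^sup>2 * k0) * emeasure lborel (snd c ` ?B)" using meas[OF oB BU] by simp
   also have "... <= ennreal ((1 + eps)\<^sup>2 * k0) * emeasure lborel {z. F.N (z - snd c x) < rho / (1 - eps)}"
    by (intro mult_left_mono emeasure_mono upper ballm) simp
   also have "... = ennreal (?up eps * rho ^ ?d)"
    unfolding F.ball_volume[OF p1(1)] using k0 eps rho F.unit_ball_finite(2)
    by (simp add: \<gamma>0_def power_divide mult_ac flip: ennreal_mult)
   finally have "measure \<mu> ?B <= ?up eps * rho ^ ?d"
    unfolding emeasure_eq_measure using \<gamma>0 rho eps by (subst (asm) ennreal_le_iff) auto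
   also have "... <= (\<gamma>0 + eta) * rho ^ ?d" using up rho by (intro mult_right_mono) auto
   finally have A: "measure \<mu> ?B <= (\<gamma>0 + eta) * rho ^ ?d" .
   have "ennreal (?lo eps * rho ^ ?d) = ennreal ((1 - eps)\<^sup>2 * k0) * emeasure lborel {z. F.N (z - snd c x) < rho / (1 + eps)}"
    unfolding F.ball_volume[OF p1(2)] using k0 eps rho F.unit_ball_finite(2)
    by (simp add: \<gamma>0_def power_divide mult_ac flip: ennreal_mult)
   also have "... <= ennreal ((1 - eps)\<^sup>2 * k0) * emeasure lborel (snd c ` ?B)"
    by (intro mult_left_mono emeasure_mono lower ib) simp
   also have "... <= emeasure \<mu> ?B" using meas[OF oB BU] by simp
   finally have "?lo eps * rho ^ ?d <= measure \<mu> ?B"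
    unfolding emeasure_eq_measure by (subst (asm) ennreal_le_iff) auto
   moreover have "(\<gamma>0 - eta) * rho ^ ?d <= ?lo eps * rho ^ ?d" using lo rho by (intro mult_right_mono) auto
   ultimately show ?thesis using A by (simp add: abs_le_iff algebra_simps)
  qed
  ultimately show "\<exists>U r0. open U & p0 \<in> U & 0 < r0 & (\<forall>x\<in>U. \<forall>rho. 0 < rho & rho < r0 -->
    \<bar>measure \<mu> {y. D x y < rho} - \<gamma>0 * rho ^ ?d\<bar> <= eta * rho ^ ?d)" using r0(1) by blast
 qed
qed

abbreviation "\<gamma> \<equiv> local_density \<A> g \<mu>"

lemma local_density_limit:
 "0 < \<gamma> x" "((%rho. measure \<mu> {y. D x y < rho} / rho ^ CARD('n)) \<longlongrightarrow> \<gamma> x) (at_right 0)"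
proof -
 let ?q = "%rho. measure \<mu> {y. D x y < rho} / rho ^ CARD('n)"
 obtain \<gamma>0 where \<gamma>0: "\<gamma>0 > 0" and near: "\<And>eta. eta > 0 ==> \<exists>U r0. open U & x \<in> U & 0 < r0 &
  (\<forall>x\<in>U. \<forall>rho. 0 < rho & rho < r0 --> \<bar>measure \<mu> {y. D x y < rho} - \<gamma>0 * rho ^ CARD('n)\<bar> <= eta * rho ^ CARD('n))"
  using local_volume[of x] by blast
 have lim: "(?q \<longlongrightarrow> \<gamma>0) (at_right 0)"
 proof (rule tendstoI)
  fix e :: real assume e: "0 < e"
  then obtain r0 where r0: "0 < r0" "\<And>rho. 0 < rho ==> rho < r0 ==>
   \<bar>measure \<mu> {y. D x y < rho} - \<gamma>0 * rho ^ CARD('n)\<bar> <= e / 2 * rho ^ CARD('n)"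
   using near[of "e / 2"] by auto
  have "dist (?q rho) \<gamma>0 < e" if rho: "0 < rho" "rho < r0" for rho
  proof -
   have p: "0 < rho ^ CARD('n)" using rho by simp
   have "?q rho - \<gamma>0 = (measure \<mu> {y. D x y < rho} - \<gamma>0 * rho ^ CARD('n)) / rho ^ CARD('n)" using rho by (simp add: diff_divide_distrib)
   then have "\<bar>?q rho - \<gamma>0\<bar> <= e / 2" using r0(2)[OF rho] p by (simp add: abs_divide pos_divide_le_eq)
   then show ?thesis using e by (simp add: dist_real_def)
  qed
  then show "\<forall>\<^sub>F rho in at_right 0. dist (?q rho) \<gamma>0 < e"
   unfolding eventually_at_right_field using r0(1) by blast
 qed
 have "\<forall>\<^sub>F rho in at_right (0::real). rho < 1" unfolding eventually_at_right_field by (intro exI[of _ 1]) auto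
 then have "\<forall>\<^sub>F rho in at_right 0. ?q rho = measure \<mu> (rball \<A> g x rho) / rho ^ CARD('n)"
  by eventually_elim (simp add: rball_def D_less_iff)
 with lim have "((%rho. measure \<mu> (rball \<A> g x rho) / rho ^ CARD('n)) \<longlongrightarrow> \<gamma>0) (at_right 0)"
  by (rule Lim_transform_eventually)
 then have "\<gamma> x = \<gamma>0" unfolding local_density_def by (intro tendsto_Lim) simp_all
 then show "0 < \<gamma> x" "(?q \<longlongrightarrow> \<gamma> x) (at_right 0)" using \<gamma>0 lim by simp_all
qed

text \<open>Local uniformity of the volume asymptotics forces the density to be continuous, and compactness makes both statements uniform.\<close>

lemma uniform_density:
 assumes eta: "eta > 0"
 shows "\<exists>delta r0. 0 < delta & 0 < r0 & (\<forall>x y. D x y < delta --> \<bar>\<gamma> x - \<gamma> y\<bar> < eta) &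
  (\<forall>x rho. 0 < rho & rho < r0 --> \<bar>measure \<mu> {y. D x y < rho} - \<gamma> x * rho ^ CARD('n)\<bar> <= eta * rho ^ CARD('n))"
proof -
 have eta4: "eta / 4 > 0" using eta by simp
 have "\<exists>c0 U r0. open U & p \<in> U & 0 < r0 & (\<forall>x\<in>U. \<forall>rho. 0 < rho & rho < r0 -->
   \<bar>measure \<mu> {y. D x y < rho} - c0 * rho ^ CARD('n)\<bar> <= eta / 4 * rho ^ CARD('n))" for p
  using local_volume[of p] eta4 by blast
 then obtain c0 U r where U: "\<And>p. open (U p) & p \<in> U p" and r: "\<And>p. 0 < r p"
  and est: "\<And>p x rho. x \<in> U p ==> 0 < rho ==> rho < r p ==>
   \<bar>measure \<mu> {y. D x y < rho} - c0 p * rho ^ CARD('n)\<bar> <= eta / 4 * rho ^ CARD('n)" by metis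
 have close: "\<bar>\<gamma> x - c0 p\<bar> <= eta / 4" if x: "x \<in> U p" for x p
 proof (rule tendsto_upperbound)
  show "((%rho. \<bar>measure \<mu> {y. D x y < rho} / rho ^ CARD('n) - c0 p\<bar>) \<longlongrightarrow> \<bar>\<gamma> x - c0 p\<bar>) (at_right 0)"
   by (intro tendsto_intros local_density_limit(2))
  have "\<bar>measure \<mu> {y. D x y < rho} / rho ^ CARD('n) - c0 p\<bar> <= eta / 4" if rho: "0 < rho" "rho < r p" for rho
  proof -
   have p: "0 < rho ^ CARD('n)" using rho by simp
   have "measure \<mu> {y. D x y < rho} / rho ^ CARD('n) - c0 p = (measure \<mu> {y. D x y < rho} - c0 p * rho ^ CARD('n)) / rho ^ CARD('n)"
    using rho by (simp add: diff_divide_distrib)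
   then show ?thesis using est[OF x rho] p by (simp add: abs_divide pos_divide_le_eq)
  qed
  then show "\<forall>\<^sub>F rho in at_right 0. \<bar>measure \<mu> {y. D x y < rho} / rho ^ CARD('n) - c0 p\<bar> <= eta / 4"
   unfolding eventually_at_right_field using r[of p] by blast
 qed simp
 obtain P delta where P: "finite P" "0 < delta" "\<And>x. \<exists>p\<in>P. \<forall>y. D x y < delta --> y \<in> U p"
  using Lebesgue_number[OF compact_M, of U] U by metis
 define r0 where "r0 = Min (insert 1 (r ` P))"
 have "0 < r0" unfolding r0_def using P(1) r by simp
 moreover have "\<bar>\<gamma> x - \<gamma> y\<bar> < eta" if xy: "D x y < delta" for x y
 proof -
  obtain p where p: "\<And>y. D x y < delta ==> y \<in> U p" using P(3)[of x] by blast
  have "\<bar>\<gamma> x - c0 p\<bar> <= eta / 4" "\<bar>\<gamma> y - c0 p\<bar> <= eta / 4"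
   using close p[of x] p[OF xy] P(2) by (auto simp: D_refl)
  then show ?thesis using eta by linarith
 qed
 moreover have "\<bar>measure \<mu> {y. D x y < rho} - \<gamma> x * rho ^ CARD('n)\<bar> <= eta * rho ^ CARD('n)" if rho: "0 < rho" "rho < r0" for x rho
 proof -
  obtain p where p: "p \<in> P" "\<And>y. D x y < delta ==> y \<in> U p" using P(3)[of x] by blast
  have xU: "x \<in> U p" using p(2)[of x] P(2) by (simp add: D_refl)
  have "r0 <= r p" unfolding r0_def using P(1) p(1) by simp
  then have 1: "\<bar>measure \<mu> {y. D x y < rho} - c0 p * rho ^ CARD('n)\<bar> <= eta / 4 * rho ^ CARD('n)" using est[OF xU, of rho] rho by simp
  have "\<bar>\<gamma> x - c0 p\<bar> * rho ^ CARD('n) <= eta / 4 * rho ^ CARD('n)" using close[OF xU] rho by (intro mult_right_mono) auto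
  moreover have "\<bar>\<gamma> x - c0 p\<bar> * rho ^ CARD('n) = \<bar>\<gamma> x * rho ^ CARD('n) - c0 p * rho ^ CARD('n)\<bar>"
   using rho by (simp add: abs_mult flip: left_diff_distrib)
  moreover have "eta / 4 * rho ^ CARD('n) + eta / 4 * rho ^ CARD('n) <= eta * rho ^ CARD('n)" using eta rho by simp
  ultimately show ?thesis using 1 by linarith
 qed
 ultimately show ?thesis using P(2) by blast
qed

lemma density_bounds: "\<exists>c G. 0 < c & (\<forall>x. c <= \<gamma> x & \<gamma> x <= G)"
proof -
 have cont: "continuous_on UNIV \<gamma>"
 proof (rule D_uniform_imp_continuous)
  fix e :: real and p assume "0 < e"
  from uniform_density[OF this] obtain delta where "0 < delta" "\<forall>x y. D x y < delta --> \<bar>\<gamma> x - \<gamma> y\<bar> < e"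
   by (elim exE conjE) (rule that)
  then show "\<exists>delta>0. \<forall>q. D p q < delta --> \<bar>\<gamma> p - \<gamma> q\<bar> < e" by (intro exI[of _ delta]) simp
 qed
 from continuous_attains_inf[OF compact_M UNIV_not_empty cont] obtain a where a: "\<forall>x. \<gamma> a <= \<gamma> x" by auto
 from continuous_attains_sup[OF compact_M UNIV_not_empty cont] obtain b where b: "\<forall>x. \<gamma> x <= \<gamma> b" by auto
 have "0 < \<gamma> a & (\<forall>x. \<gamma> a <= \<gamma> x & \<gamma> x <= \<gamma> b)" using local_density_limit(1)[of a] a b by simp
 then show ?thesis by (intro exI)
qed

end

section \<open>Poisson limit laws for exponentially mixing diffeomorphisms\<close>

context riemannian begin

lemma rdist_measurable: "rdist \<A> g x \<in> borel_measurable borel"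
proof (rule borel_measurableI_less)
 fix t
 have "open {y. rdist \<A> g x y < t}"
  unfolding open_subopen[of "{y. rdist \<A> g x y < t}"]
 proof
  fix y assume "y \<in> {y. rdist \<A> g x y < t}"
  then obtain u where u: "rdist \<A> g x y < u" "u < t" using dense[of "rdist \<A> g x y" t] by auto
  obtain v where v: "u = ennreal v" "0 <= v" using u(2) by (cases u) auto
  obtain r where r: "rdist \<A> g x y = ennreal r" "0 <= r" using u(1) by (cases "rdist \<A> g x y") auto
  have rv: "r < v" using u(1) r v by (simp add: ennreal_less_iff)
  define e where "e = min (v - r) (1/2)"
  have e: "0 < e" "e <= 1" "r + e <= v" using rv by (auto simp: e_def)
  obtain U where U: "open U" "y \<in> U" "\<And>q. q \<in> U ==> D y q < e" using D_near[OF e(1), of y] by blast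
  have "rdist \<A> g x q < t" if "q \<in> U" for q
  proof -
   have "rdist \<A> g y q < ennreal e" using U(3)[OF that] D_less_iff[OF e(2)] by blast
   have "rdist \<A> g x q <= ennreal r + rdist \<A> g y q" using rdist_triangle[of x q y] r(1) by simp
   also have "... <= ennreal r + ennreal e" using \<open>rdist \<A> g y q < ennreal e\<close> by (intro add_left_mono) simp
   also have "... = ennreal (r + e)" using r(2) e(1) by simp
   also have "... <= u" unfolding v(1) using e(3) by (rule ennreal_leI)
   finally show ?thesis using u(2) by (rule le_less_trans)
  qed
  then show "\<exists>T. open T & y \<in> T & T \<subseteq> {y. rdist \<A> g x y < t}" using U by blast
 qed
 then show "{y \<in> space borel. rdist \<A> g x y < t} \<in> sets borel" by simp
qed

text \<open>An observable that is Lipschitz for the sum of the distances \<open>D\<close> is Lipschitz for the maximum distance with a constant larger by the number of variables. A rate of zero is replaced by one half, so that its logarithm is available.\<close>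

lemma mixing_for_D:
 assumes r: "2 <= r" and mix: "exponentially_mixing (rdist \<A> g) \<mu> f r"
 shows "\<exists>C>0. \<exists>theta. 0 < theta & theta < 1 & (\<forall>A L m k.
    A \<in> borel_measurable (\<Pi>\<^sub>M j\<in>{..<r}. \<mu>) & (\<forall>X. 0 <= A X & A X <= 1) & 0 <= L &
    (\<forall>X Y. \<bar>A X - A Y\<bar> <= L * (\<Sum>j<r. D (X j) (Y j))) &
    k 0 = 0 & (\<forall>j. Suc j < r --> k j + m <= k (Suc j)) -->
    \<bar>(LINT x|\<mu>. A (\<lambda>j\<in>{..<r}. (f ^^ k j) x)) - (\<integral>X. A X \<partial>(\<Pi>\<^sub>M j\<in>{..<r}. \<mu>))\<bar> <= C * theta ^ m * (1 + L))"
proof -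
 obtain C theta where C: "0 < C" and theta: "0 <= theta" "theta < 1"
  and bound: "\<And>A m k. \<exists>L. lipschitz_const (rdist \<A> g) r A L ==> k 0 = 0 & (\<forall>j. Suc j < r --> k j + m <= k (Suc j)) ==>
   \<bar>(LINT x|\<mu>. A (\<lambda>j\<in>{..<r}. (f ^^ k j) x)) - (\<integral>X. A X \<partial>(\<Pi>\<^sub>M j\<in>{..<r}. \<mu>))\<bar> <= C * theta ^ m * lipschitz_norm (rdist \<A> g) r A"
  using mix unfolding exponentially_mixing_def by metis
 define theta' where "theta' = max theta (1/2)"
 have theta': "0 < theta'" "theta' < 1" "theta <= theta'" using theta by (auto simp: theta'_def)
 have main: "\<bar>(LINT x|\<mu>. A (\<lambda>j\<in>{..<r}. (f ^^ k j) x)) - (\<integral>X. A X \<partial>(\<Pi>\<^sub>M j\<in>{..<r}. \<mu>))\<bar> <= (C * real r) * theta' ^ m * (1 + L)"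
  if A01: "\<forall>X. 0 <= A X & A X <= 1" and L: "0 <= L" and Lip: "\<forall>X Y. \<bar>A X - A Y\<bar> <= L * (\<Sum>j<r. D (X j) (Y j))"
   and k: "k 0 = 0 & (\<forall>j. Suc j < r --> k j + m <= k (Suc j))" for A L m k
 proof -
  have lc: "lipschitz_const (rdist \<A> g) r A (real r * L)"
   unfolding lipschitz_const_def
  proof (intro conjI ballI)
   show "0 <= real r * L" using L by simp
   fix X Y :: "nat => 'a"
   let ?S = "SUP j\<in>{..<r}. rdist \<A> g (X j) (Y j)"
   have "ennreal \<bar>A X - A Y\<bar> <= ennreal (L * (\<Sum>j<r. D (X j) (Y j)))" using Lip by (intro ennreal_leI) blast
   also have "... = ennreal L * (\<Sum>j<r. ennreal (D (X j) (Y j)))"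
    using L by (simp add: ennreal_mult' sum_nonneg D_nonneg flip: sum_ennreal)
   also have "... <= ennreal L * (\<Sum>j<r. ?S)"
    by (intro mult_left_mono sum_mono order_trans[OF D_le_rdist] SUP_upper) auto
   also have "... = ennreal (real r * L) * ?S"
    using L by (simp add: ennreal_mult' ennreal_of_nat_eq_real_of_nat mult_ac)
   finally show "ennreal \<bar>A X - A Y\<bar> <= ennreal (real r * L) * ?S" .
  qed
  have "lipschitz_norm (rdist \<A> g) r A <= 1 + real r * L"
   unfolding lipschitz_norm_def
  proof (rule add_mono)
   have "({..<r} \<rightarrow>\<^sub>E (UNIV :: 'a set)) ~= {}" by (simp add: PiE_eq_empty_iff)
   then show "(SUP X\<in>{..<r} \<rightarrow>\<^sub>E UNIV. \<bar>A X\<bar>) <= 1" by (rule cSUP_least) (use A01 in auto)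
   show "Inf {L. lipschitz_const (rdist \<A> g) r A L} <= real r * L"
    by (rule cInf_lower) (use lc in \<open>auto simp: lipschitz_const_def intro!: bdd_belowI[of _ 0]\<close>)
  qed
  also have "... <= real r * (1 + L)" using r by (simp add: algebra_simps)
  finally have norm: "lipschitz_norm (rdist \<A> g) r A <= real r * (1 + L)" .
  have "\<bar>(LINT x|\<mu>. A (\<lambda>j\<in>{..<r}. (f ^^ k j) x)) - (\<integral>X. A X \<partial>(\<Pi>\<^sub>M j\<in>{..<r}. \<mu>))\<bar> <= C * theta ^ m * lipschitz_norm (rdist \<A> g) r A"
   by (rule bound[OF _ k]) (use lc in blast)
  also have "... <= C * theta ^ m * (real r * (1 + L))" using norm C theta by (intro mult_left_mono) auto
  also have "... <= C * theta' ^ m * (real r * (1 + L))"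
   using C theta theta' L by (intro mult_right_mono mult_left_mono power_mono) auto
  finally show ?thesis by (simp add: mult_ac)
 qed
 show ?thesis
  by (rule exI[of _ "C * real r"], intro conjI exI[of _ theta'] allI impI) (use C r theta' main in auto)
qed

end

context riemannian_volume begin

theorem mixing_metric_space:
 assumes f: "smooth_diffeo \<A> f" and inv: "distr \<mu> \<mu> f = \<mu>"
  and mix: "\<forall>r\<ge>2. exponentially_mixing (rdist \<A> g) \<mu> f r"
 shows "\<exists>\<Lambda> c G. mixing_metric_space \<mu> D f \<Lambda> CARD('n) \<gamma> c G"
proof -
 have sm: "smooth_map \<A> f" using f by (simp add: smooth_diffeo_def)
 obtain \<Lambda> where \<Lambda>: "1 <= \<Lambda>" "\<And>x y. D (f x) (f y) <= \<Lambda> * D x y" using smooth_map_Lipschitz[OF compact_M sm] by blast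
 from density_bounds obtain c G where "0 < c" and cG': "\<forall>x. c <= \<gamma> x & \<gamma> x <= G" by (elim exE conjE) (rule that)
 note cG = this(1) cG'[rule_format, THEN conjunct1] cG'[rule_format, THEN conjunct2]
 have "f \<in> borel_measurable borel" using sm by (intro borel_measurable_continuous_onI) (simp add: smooth_map_def)
 then have fm: "f \<in> \<mu> \<rightarrow>\<^sub>M \<mu>" using sets_\<mu> by (simp cong: measurable_cong_sets)
 have cm: "h \<in> borel_measurable \<mu>" if "\<And>eps. eps > 0 ==> \<exists>delta>0. \<forall>x y. D x y < delta --> \<bar>h x - h y\<bar> < eps" for h :: "'a => real"
 proof -
  have "continuous_on UNIV h" by (rule D_uniform_imp_continuous) (use that in blast)
  then have "h \<in> borel_measurable borel" by (rule borel_measurable_continuous_onI)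
  then show ?thesis using sets_\<mu> by (simp cong: measurable_cong_sets)
 qed
 have "mixing_metric_space \<mu> D f \<Lambda> CARD('n) \<gamma> c G"
 proof (intro mixing_metric_space.intro mixing_metric_system.intro mixing_metric_system_axioms.intro mixing_metric_space_axioms.intro)
  show "prob_space \<mu>" by (rule prob)
  show "sets \<mu> = sets borel" by (rule sets_\<mu>)
  show "(%z. D (fst z) (snd z)) \<in> borel_measurable (\<mu> \<Otimes>\<^sub>M \<mu>)" by (rule D_measurable[OF sets_\<mu>])
  show "0 <= D x y" "D x y <= 1" "D x x = 0" "D x y = D y x" "D x z <= D x y + D y z" for x y z
   by (fact D_nonneg D_le_1 D_refl D_sym D_triangle)+
  show "f \<in> \<mu> \<rightarrow>\<^sub>M \<mu>" "distr \<mu> \<mu> f = \<mu>" "1 <= \<Lambda>" by (fact fm inv \<Lambda>(1))+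
  show "D (f x) (f y) <= \<Lambda> * D x y" for x y by (rule \<Lambda>(2))
  show "\<exists>C>0. \<exists>theta. 0 < theta & theta < 1 & (\<forall>A L m k.
    A \<in> borel_measurable (\<Pi>\<^sub>M j\<in>{..<r}. \<mu>) & (\<forall>X. 0 <= A X & A X <= 1) & 0 <= L &
    (\<forall>X Y. \<bar>A X - A Y\<bar> <= L * (\<Sum>j<r. D (X j) (Y j))) &
    k 0 = 0 & (\<forall>j. Suc j < r --> k j + m <= k (Suc j)) -->
    \<bar>(LINT x|\<mu>. A (\<lambda>j\<in>{..<r}. (f ^^ k j) x)) - (\<integral>X. A X \<partial>(\<Pi>\<^sub>M j\<in>{..<r}. \<mu>))\<bar> <= C * theta ^ m * (1 + L))"
   if "2 <= r" for r by (rule mixing_for_D[OF that]) (use mix that in blast)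
  show "1 <= CARD('n)" by (simp add: Suc_le_eq)
  show "0 < c" "c <= \<gamma> x" "\<gamma> x <= G" for x by (rule cG)+
  show "\<exists>r0>0. \<forall>x rho. 0 < rho & rho < r0 --> \<bar>measure \<mu> {y. D x y < rho} - \<gamma> x * rho ^ CARD('n)\<bar> <= eps * rho ^ CARD('n)"
   "\<exists>delta>0. \<forall>x y. D x y < delta --> \<bar>\<gamma> x - \<gamma> y\<bar> < eps" if "eps > 0" for eps
  proof -
   from uniform_density[OF that] obtain delta r0 where 1: "0 < delta" "\<forall>x y. D x y < delta --> \<bar>\<gamma> x - \<gamma> y\<bar> < eps"
    and 2: "0 < r0" "\<forall>x rho. 0 < rho & rho < r0 --> \<bar>measure \<mu> {y. D x y < rho} - \<gamma> x * rho ^ CARD('n)\<bar> <= eps * rho ^ CARD('n)"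
    by (elim exE conjE) (rule that)
   show "\<exists>r0>0. \<forall>x rho. 0 < rho & rho < r0 --> \<bar>measure \<mu> {y. D x y < rho} - \<gamma> x * rho ^ CARD('n)\<bar> <= eps * rho ^ CARD('n)"
    by (intro exI[of _ r0] conjI 2)
   show "\<exists>delta>0. \<forall>x y. D x y < delta --> \<bar>\<gamma> x - \<gamma> y\<bar> < eps" by (intro exI[of _ delta] conjI 1)
  qed
  show "h \<in> borel_measurable \<mu>" if "\<And>eps. eps > 0 ==> \<exists>delta>0. \<forall>x y. D x y < delta --> \<bar>h x - h y\<bar> < eps" for h :: "'a => real"
   by (rule cm[OF that])
 qed
 then show ?thesis by blast
qed

end

theorem theorem5p1:
  fixes \<A> :: "('a::{t2_space, second_countable_topology}, 'n::finite) chart set"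
    and g :: "('a, 'n) metric"
    and f :: "'a \<Rightarrow> 'a" and \<mu> :: "'a measure" and \<tau> :: real
  defines "d \<equiv> CARD('n)"
    and "N \<equiv> \<lambda>\<rho>::real. nat \<lfloor>\<tau> / \<rho> ^ CARD('n)\<rfloor>"
    and "\<gamma> \<equiv> local_density \<A> g \<mu>"
  assumes manifold: "compact (UNIV :: 'a set)" "smooth_atlas \<A>" "riemannian_metric \<A> g"
    and diffeo: "smooth_diffeo \<A> f"
    and measure: "prob_space \<mu>" "smooth_measure \<A> g \<mu>"
    and preserving: "distr \<mu> \<mu> f = \<mu>"
    and mixing: "\<forall>r\<ge>2. exponentially_mixing (rdist \<A> g) \<mu> f r"
    and tau: "\<tau> > 0"
  shows
    "(AE x in \<mu>.
        converges_in_law \<mu> (\<lambda>\<rho> y. visits f (N \<rho>) (rball \<A> g x \<rho>) y)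
          (measure_pmf (poisson_pmf (\<tau> * \<gamma> x))) (at_right 0) \<and>
        (\<forall>(P :: 'w measure) T.
           poisson_process P T
             (density lborel (\<lambda>t. ennreal (\<gamma> x * \<tau> * real d * t ^ (d - 1)) * indicator {0<..} t)) \<longrightarrow>
           converges_in_law \<mu>
             (\<lambda>\<rho> y. \<lambda>i. nth_closest (rdist \<A> g) f (N \<rho>) (Suc i) x y / ennreal \<rho>)
             (distr P borel (\<lambda>\<omega> i. ennreal (T i \<omega>))) (at_right 0))) \<and>
     converges_in_law \<mu>
       (\<lambda>\<rho> x. visits f (N \<rho>) (rball \<A> g x (\<rho> / \<gamma> x powr (1 / real d))) x)
       (measure_pmf (poisson_pmf \<tau>)) (at_right 0)"
proof -
 from measure(2)[unfolded smooth_measure_def]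
 obtain V h where V: "is_riemannian_volume \<A> g V" "smooth_fun \<A> h" "\<forall>x. 0 < h x" "\<mu> = density V (%x. ennreal (h x))"
  by (elim exE conjE) (rule that)
 interpret R: riemannian_volume \<A> g V h \<mu>
  by (intro riemannian_volume.intro riemannian.intro riemannian_volume_axioms.intro manifold measure(1) V(1,2,4) V(3)[rule_format])
 from R.mixing_metric_space[OF diffeo preserving mixing, folded d_def \<gamma>_def]
 obtain \<Lambda> c G where "mixing_metric_space \<mu> R.D f \<Lambda> d \<gamma> c G" by (elim exE) (rule that)
 then interpret M: mixing_metric_space \<mu> R.D f \<Lambda> d \<gamma> c G .
 have N: "N rho = horizon \<tau> d rho" for rho by (simp add: N_def d_def horizon_def)
 have visits: "visits f n (rball \<A> g x rho) y = card {k \<in> {1..n}. R.D x ((f ^^ k) y) < rho}" if "rho <= 1" for n x rho y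
  using that by (simp add: visits_def rball_def R.D_less_iff)
 have small: "\<forall>\<^sub>F rho in at_right (0::real). 0 < rho & rho < s" if "0 < s" for s
  unfolding eventually_at_right_field using that by blast
 from M.slow_recurrence obtain eta where eta: "0 < eta" and slow: "AE x in \<mu>. \<exists>s0>0. \<forall>s. 0 < s & s < s0 -->
   (\<forall>g\<ge>1. real g <= s powr (- eta) --> Sigma_Algebra.measure \<mu> {y. R.D x y < s & R.D x ((f ^^ g) y) < s} <= s ^ d * s powr eta)"
  by (elim exE conjE) (rule that)
 show ?thesis
 proof (rule conjI)
  from slow show "AE x in \<mu>.
    converges_in_law \<mu> (%rho y. visits f (N rho) (rball \<A> g x rho) y)
     (measure_pmf (poisson_pmf (\<tau> * \<gamma> x))) (at_right 0) &
    (\<forall>(P :: 'w measure) T.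
      poisson_process P T
       (density lborel (%t. ennreal (\<gamma> x * \<tau> * real d * t ^ (d - 1)) * indicator {0<..} t)) -->
      converges_in_law \<mu>
       (%rho y. %i. nth_closest (rdist \<A> g) f (N rho) (Suc i) x y / ennreal rho)
       (distr P borel (%\<omega> i. ennreal (T i \<omega>))) (at_right 0))"
  proof eventually_elim
   case (elim x)
   then obtain s0 where s0: "0 < s0" and sl: "\<forall>s. 0 < s & s < s0 -->
    (\<forall>g\<ge>1. real g <= s powr (- eta) --> Sigma_Algebra.measure \<mu> {y. R.D x y < s & R.D x ((f ^^ g) y) < s} <= s ^ d * s powr eta)"
    by (elim exE conjE) (rule that)
   have sl': "Sigma_Algebra.measure \<mu> {y. R.D x y < s & R.D x ((f ^^ g) y) < s} <= s ^ d * s powr eta"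
    if "0 < s" "s < s0" "1 <= g" "real g <= s powr (- eta)" for s g using sl that by simp
   show ?case
   proof (intro conjI allI impI)
    show "converges_in_law \<mu> (%rho y. visits f (N rho) (rball \<A> g x rho) y)
     (measure_pmf (poisson_pmf (\<tau> * \<gamma> x))) (at_right 0)"
     unfolding converges_in_law_def
    proof (intro allI impI)
     fix h :: "nat => real" assume h: "continuous_on UNIV h & bounded (range h)"
     have "\<forall>\<^sub>F rho in at_right 0. (LINT y|\<mu>. h (card {k \<in> {1..horizon \<tau> d rho}. R.D x ((f ^^ k) y) < rho}))
      = (LINT y|\<mu>. h (visits f (N rho) (rball \<A> g x rho) y))"
      using small[of 1] by (rule eventually_mono) (simp_all add: visits N)
     from Lim_transform_eventually[OF M.hitting_law[OF tau eta s0 sl' conjunct2[OF h]] this]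
     show "((%rho. \<integral>y. h (visits f (N rho) (rball \<A> g x rho) y) \<partial>\<mu>)
      \<longlongrightarrow> (\<integral>b. h b \<partial>measure_pmf (poisson_pmf (\<tau> * \<gamma> x)))) (at_right 0)" .
    qed
    fix P :: "'w measure" and T
    assume pp: "poisson_process P T
     (density lborel (%t. ennreal (\<gamma> x * \<tau> * real d * t ^ (d - 1)) * indicator {0<..} t))"
    have "rdist \<A> g x \<in> borel_measurable \<mu>"
     using R.rdist_measurable R.sets_\<mu> by (simp cong: measurable_cong_sets)
    have E: "rdist \<A> g x y < ennreal r \<longleftrightarrow> R.D x y < r" if "r <= 1" for r y using R.D_less_iff[OF that] by simp
    from M.closest_distances_law[where E = "rdist \<A> g" and x = x, OF tau eta s0 sl' E \<open>rdist \<A> g x \<in> borel_measurable \<mu>\<close> pp]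
    show "converges_in_law \<mu> (%rho y. %i. nth_closest (rdist \<A> g) f (N rho) (Suc i) x y / ennreal rho)
       (distr P borel (%\<omega> i. ennreal (T i \<omega>))) (at_right 0)" unfolding N .
   qed
  qed
  show "converges_in_law \<mu> (%rho x. visits f (N rho) (rball \<A> g x (rho / \<gamma> x powr (1 / real d))) x)
    (measure_pmf (poisson_pmf \<tau>)) (at_right 0)"
   unfolding converges_in_law_def
  proof (intro allI impI)
   fix h :: "nat => real" assume h: "continuous_on UNIV h & bounded (range h)"
   have "0 < c powr (1 / real d)" using M.c_pos by simp
   from small[OF this]
   have "\<forall>\<^sub>F rho in at_right 0. (LINT y|\<mu>. h (card {k \<in> {1..horizon \<tau> d rho}. R.D y ((f ^^ k) y) < rho * M.unit_radius y}))
    = (LINT x|\<mu>. h (visits f (N rho) (rball \<A> g x (rho / \<gamma> x powr (1 / real d))) x))"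
   proof eventually_elim
    case (elim rho)
    have eq: "rho / \<gamma> x powr (1 / real d) = rho * M.unit_radius x" for x by (simp add: M.unit_radius_def)
    have le: "rho * M.unit_radius x <= 1" for x
    proof -
     have "rho * M.unit_radius x <= rho * (1 / c powr (1 / real d))"
      using M.unit_radius_bounds(2)[of x] elim by (intro mult_left_mono) auto
     also have "... <= 1" using elim \<open>0 < c powr (1 / real d)\<close> by (simp add: field_simps)
     finally show ?thesis .
    qed
    show ?case unfolding eq N visits[OF le] ..
   qed
   from Lim_transform_eventually[OF M.return_law[OF tau conjunct2[OF h]] this]
   show "((%rho. \<integral>x. h (visits f (N rho) (rball \<A> g x (rho / \<gamma> x powr (1 / real d))) x) \<partial>\<mu>)
    \<longlongrightarrow> (\<integral>b. h b \<partial>measure_pmf (poisson_pmf \<tau>))) (at_right 0)" .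
  qed
 qed
qed

end
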